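(* Let $k,n$ be integers with $n>2k\ge 2$ and let $\theta\in(0,1)$. Let $\Omega\subset\mathbb{R}^n$ be a $C^{2k,\theta}$-smooth bounded domain and let $x_0\in\Omega$. Let $\omega\subset\mathbb{R}^n$ be a $C^{2k,\theta}$-smooth bounded domain containing $0$. Fix $q\in(0,1)$. For $\varepsilon>0$ put $\Omega_\varepsilon:=\Omega\setminus\overline{\{x_0+\varepsilon\omega\}}$, and let $G_{\Omega_\varepsilon}$ be the Green function of $(-\Delta)^k$ in $\Omega_\varepsilon$ with Dirichlet boundary condition. Then for all integers $r$ with $1\le r\le 2k$, $$\sup_{\varepsilon\in\left(0,\,q\,d(x_0,\partial\Omega)/\operatorname{diam}(\omega)\right)}\ \sup_{x,y\in\Omega_\varepsilon,\ x\ne y}|x-y|^{n-2k+r}\,|\nabla_y^rG_{\Omega_\varepsilon}(x,y)|=+\infty.$$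
   Context: For a bounded open set $U\subset\mathbb{R}^n$ with $C^{2k,\theta}$-smooth boundary and exterior unit normal $\nu$, the Green function of $(-\Delta)^k$ in $U$ with Dirichlet boundary condition is the function $G_U:\overline{U}\times\overline{U}\setminus\{(x,x):x\in\overline U\}\to\mathbb{R}$ (understood as usual to be continuous off the diagonal) such that for every $f\in C^{0,\theta}(\overline U)$ the unique solution $u\in C^{2k,\theta}(\overline U)$ of $$(-\Delta)^k u=f\ \text{ in }U,\qquad u=\partial_\nu u=\ldots=\partial_\nu^{(k-1)}u=0\ \text{ on }\partial U$$ is given by $u(x)=\int_U G_U(x,y)f(y)\,dy$. For fixed $x$, $G_U(x,\cdot)$ is $2k$ times continuously differentiable away from $x$. $\nabla_y^r G_U(x,y)=(\partial_y^\gamma G_U(x,y))_{|\gamma|=r}$ denotes the collection of all partial derivatives of order $r$ with respect to $y$, and $|\nabla_y^rG_U(x,y)|$ its Euclidean norm. $d(x_0,\partial\Omega)$ is the Euclidean distance from $x_0$ to $\partial\Omega$ and $\operatorname{diam}(\omega)$ is the Euclidean diameter of $\omega$. *)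

theory Defs
  imports "HOL-Analysis.Analysis"
begin

definition partial :: "'n \<Rightarrow> (real ^ 'n \<Rightarrow> real) \<Rightarrow> real ^ 'n \<Rightarrow> real" where
  "partial i f x = deriv (\<lambda>t. f (x + t *\<^sub>R axis i 1)) 0"

definition partials :: "'n list \<Rightarrow> (real ^ 'n \<Rightarrow> real) \<Rightarrow> real ^ 'n \<Rightarrow> real" where
  "partials js f = foldr partial js f"

(* For a multi-index \<gamma>. The chosen order of differentiation is immaterial for functions
   that are |\<gamma>| times continuously differentiable near the point. *)
definition multi_partial ::
  "('n \<Rightarrow> nat) \<Rightarrow> (real ^ 'n \<Rightarrow> real) \<Rightarrow> real ^ 'n \<Rightarrow> real" where
  "multi_partial \<gamma> f = partials (SOME js. \<forall>i. count_list js i = \<gamma> i) f"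

definition norm_nabla :: "nat \<Rightarrow> (real ^ 'n \<Rightarrow> real) \<Rightarrow> real ^ 'n \<Rightarrow> real" where
  "norm_nabla r f x =
     L2_set (\<lambda>\<gamma>. multi_partial \<gamma> f x) {\<gamma> :: 'n \<Rightarrow> nat. (\<Sum>i\<in>UNIV. \<gamma> i) = r}"

definition neg_laplacian :: "(real ^ 'n \<Rightarrow> real) \<Rightarrow> real ^ 'n \<Rightarrow> real" where
  "neg_laplacian f x = - (\<Sum>i\<in>UNIV. partial i (partial i f) x)"

(* For S open and S \<subseteq> T \<subseteq> closure S: f is m times continuously differentiable in S, it is
   continuous on T, and all its derivatives of order at most m extend continuously from S to T.
   T = S gives C^m(S), and T = closure S gives C^m of the closure of S. *)
definition C_diff :: "nat \<Rightarrow> (real ^ 'n) set \<Rightarrow> (real ^ 'n) set \<Rightarrow> (real ^ 'n \<Rightarrow> real) \<Rightarrow> bool" where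
  "C_diff m S T f \<longleftrightarrow>
     continuous_on T f \<and>
     (\<forall>js i. length js < m \<longrightarrow>
        (\<forall>x\<in>S. (\<lambda>t. partials js f (x + t *\<^sub>R axis i 1)) field_differentiable at 0)) \<and>
     (\<forall>js. length js \<le> m \<longrightarrow>
        (\<exists>g. continuous_on T g \<and> (\<forall>x\<in>S. g x = partials js f x)))"

(* The Hoelder space C^{m,\<theta>} of the closure of the open set S. *)
definition C_holder :: "nat \<Rightarrow> real \<Rightarrow> (real ^ 'n) set \<Rightarrow> (real ^ 'n \<Rightarrow> real) \<Rightarrow> bool" where
  "C_holder m \<theta> S f \<longleftrightarrow>
     C_diff m S (closure S) f \<and>
     (\<forall>js. length js = m \<longrightarrow>
        (\<exists>C. \<forall>x\<in>S. \<forall>y\<in>S. \<bar>partials js f x - partials js f y\<bar> \<le> C * dist x y powr \<theta>))"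

(* Near each boundary point, U is the strict epigraph, in the direction of a unit vector e, of a
   C^{m,\<theta>} function of the coordinates orthogonal to e. Such a function is encoded as a function
   on the whole space that is constant along e; it may be taken global after a cut-off. *)
definition holder_boundary :: "nat \<Rightarrow> real \<Rightarrow> (real ^ 'n) set \<Rightarrow> bool" where
  "holder_boundary m \<theta> U \<longleftrightarrow>
     (\<forall>p\<in>frontier U. \<exists>s>0. \<exists>e \<phi>. norm e = 1 \<and>
        (\<forall>x t. \<phi> (x + t *\<^sub>R e) = \<phi> x) \<and> C_holder m \<theta> UNIV \<phi> \<and>
        U \<inter> ball p s = {x \<in> ball p s. x \<bullet> e > \<phi> x})"

definition holder_domain :: "nat \<Rightarrow> real \<Rightarrow> (real ^ 'n) set \<Rightarrow> bool" where
  "holder_domain m \<theta> U \<longleftrightarrow>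
     open U \<and> connected U \<and> U \<noteq> {} \<and> bounded U \<and> holder_boundary m \<theta> U"

(* The unit vector \<nu> for which all directions v with v \<bullet> \<nu> < 0 point into U and all directions
   with v \<bullet> \<nu> > 0 point out of it, i.e. the exterior normal of the tangent hyperplane at x.
   There is at most one such vector, and exactly one at each boundary point of a C^1 set. *)
definition exterior_normal :: "(real ^ 'n) set \<Rightarrow> real ^ 'n \<Rightarrow> real ^ 'n" where
  "exterior_normal U x = (THE \<nu>. norm \<nu> = 1 \<and>
     (\<forall>v. v \<bullet> \<nu> < 0 \<longrightarrow> (\<forall>\<^sub>F t in at_right 0. x + t *\<^sub>R v \<in> U)) \<and>
     (\<forall>v. v \<bullet> \<nu> > 0 \<longrightarrow> (\<forall>\<^sub>F t in at_right 0. x + t *\<^sub>R v \<notin> closure U)))"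

(* The j-th derivative at t = 0 of t \<mapsto> u (x + t \<nu>) for t \<le> 0: one-sided at t = 0, as u is only
   relevant on the closure of U. *)
definition normal_derivative ::
  "(real ^ 'n) set \<Rightarrow> nat \<Rightarrow> (real ^ 'n \<Rightarrow> real) \<Rightarrow> real ^ 'n \<Rightarrow> real" where
  "normal_derivative U j u x =
     ((\<lambda>h t. vector_derivative h (at t within {..0})) ^^ j)
       (\<lambda>t. u (x + t *\<^sub>R exterior_normal U x)) 0"

definition dirichlet_solution ::
  "nat \<Rightarrow> real \<Rightarrow> (real ^ 'n) set \<Rightarrow> (real ^ 'n \<Rightarrow> real) \<Rightarrow> (real ^ 'n \<Rightarrow> real) \<Rightarrow> bool" where
  "dirichlet_solution k \<theta> U f u \<longleftrightarrow>
     C_holder (2 * k) \<theta> U u \<and>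
     (\<forall>x\<in>U. (neg_laplacian ^^ k) u x = f x) \<and>
     (\<forall>x\<in>frontier U. \<forall>j<k. normal_derivative U j u x = 0)"

(* Functions on the closure of U are represented by functions on the whole space, and everything
   below depends only on their values on the closure. The equivalence in the last clause says that
   the Dirichlet problem has a unique solution on the closure and that it is the integral. *)
definition green_function ::
  "nat \<Rightarrow> real \<Rightarrow> (real ^ 'n) set \<Rightarrow> (real ^ 'n \<Rightarrow> real ^ 'n \<Rightarrow> real) \<Rightarrow> bool" where
  "green_function k \<theta> U G \<longleftrightarrow>
     continuous_on {(x, y). x \<in> closure U \<and> y \<in> closure U \<and> x \<noteq> y} (\<lambda>(x, y). G x y) \<and>
     (\<forall>x\<in>closure U. C_diff (2 * k) (U - {x}) (closure U - {x}) (G x)) \<and>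
     (\<forall>f. C_holder 0 \<theta> U f \<longrightarrow>
        (\<forall>x\<in>closure U. set_integrable lborel U (\<lambda>y. G x y * f y)) \<and>
        (\<forall>u. dirichlet_solution k \<theta> U f u \<longleftrightarrow>
           (\<forall>x\<in>closure U. u x = (LINT y:U|lborel. G x y * f y))))"

definition perforated ::
  "(real ^ 'n) set \<Rightarrow> real ^ 'n \<Rightarrow> (real ^ 'n) set \<Rightarrow> real \<Rightarrow> (real ^ 'n) set" where
  "perforated \<Omega> x0 \<omega> \<epsilon> = \<Omega> - closure ((\<lambda>z. x0 + \<epsilon> *\<^sub>R z) ` \<omega>)"

end

theory Submission
  imports Defs "HOL-Computational_Algebra.Polynomial"
begin

text \<open>
Suppose the supremum is finite. Then for some \<open>B\<close> all partial derivatives of order \<open>r\<close> of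
\<open>G x\<close>, where \<open>G\<close> is the Green function of the perforated domain, are bounded by
\<open>B / |x - y|^(n-2k+r)\<close>, uniformly in \<open>\<epsilon>\<close>. Since \<open>G x\<close> has zero Dirichlet data on the boundary of the hole, such a
bound makes \<open>G x\<close> small around a tiny hole, so small that \<open>G\<close> cannot reproduce the fundamental solution.

Two facts make this precise. The first is an identity. Let \<open>V\<close> be \<open>|z|^(2k-n)\<close>, cut off
smoothly so that it vanishes for \<open>|z| \<le> 1\<close> and is unchanged for \<open>|z| \<ge> sqrt 2\<close>, and let
\<open>W_s y = s^(2k-n) V ((y - x0) / s)\<close>. If the hole lies in the ball of radius \<open>R \<epsilon>\<close> about \<open>x0\<close> and the
ball of radius \<open>2c\<close> lies in \<open>\<Omega>\<close>, then \<open>W_(R \<epsilon>) - W_c\<close> vanishes near the boundary of the perforated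
domain, so it is represented by \<open>G\<close>. Its image under \<open>(-\<Delta>)^k\<close> lives on the two annuli
\<open>s \<le> |y - x0| \<le> sqrt 2 s\<close>, \<open>s = R \<epsilon>\<close> and \<open>s = c\<close>, with total mass bounded on each. Hence
\<open>|x - x0|^(2k-n) \<le> Z (K1 + K2)\<close>, where \<open>K1\<close> and \<open>K2\<close> bound \<open>|G x|\<close> on the inner and on the outer
annulus (test_identity_bound).

The second is that the derivatives of order \<open>r\<close> control \<open>G x\<close> itself:
\<open>K1 \<le> C \<epsilon>^r sup |D^r (G x)|\<close> near the hole (inner_green_bound), and \<open>K2\<close> is at most a constant
(outer_green_bound). With \<open>|x - x0| = \<eta> = M \<epsilon>\<close> the assumed bound turns the former into
\<open>K1 \<le> C' M^(-r) \<eta>^(2k-n)\<close>. As \<open>r \<ge> 1\<close>, a large \<open>M\<close> and then a small \<open>\<eta>\<close> contradict the identity.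

Both estimates of \<open>G x\<close> are cases of one interpolation argument (jets_bound). Up to \<open>O(\<delta>)\<close>, where \<open>\<delta>\<close>
bounds the derivatives of order \<open>r\<close>, the function agrees with a Taylor polynomial of degree
less than \<open>r \<le> 2k\<close>. The function has zero Dirichlet data of order \<open>k\<close> at the boundary, so on every line through
the centre the polynomial has Hermite data \<open>O(\<delta>)\<close> of order \<open>k\<close> at two points, and a polynomial in one variable
of degree less than \<open>2k\<close> is controlled by such data. Around the hole the line passes
through the hole: the polynomial is defined there, although the function is not.

It remains to see that \<open>G x y\<close> has zero Dirichlet data in \<open>y\<close>, while its definition prescribes boundary
values in \<open>x\<close> only. If the derivatives of order less than \<open>m\<close> vanish, \<open>m < k\<close>, then
near a boundary point \<open>p\<close> we have \<open>G x y = A \<rho>^m + o(\<rho>^m)\<close>, where \<open>\<rho>\<close> is a defining function. Testing with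
\<open>w = \<rho>^(2k-1-m) \<psi> ((y - p) / d)\<close>, which has zero Dirichlet data and vanishes at \<open>x\<close>, and letting \<open>d\<close>
tend to \<open>0\<close> gives \<open>A I = 0\<close>, where \<open>I\<close> is an explicit integral over a half-space (blowup_coefficient_zero).
Integration by parts shows \<open>I \<noteq> 0\<close> (half_int_neg_laplacian_nonzero), so \<open>A = 0\<close>.
\<close>

section \<open>Directional derivatives\<close>

text \<open>The derivative in direction \<open>v\<close>, written through the coordinate partials: its iterates then
inherit regularity from the iterated partials by closure under finite sums. Where \<open>f\<close> is
differentiable it is the value of the total derivative at \<open>v\<close>.\<close>

definition ddir :: "real ^ 'n \<Rightarrow> (real ^ 'n \<Rightarrow> real) \<Rightarrow> real ^ 'n \<Rightarrow> real" where
  "ddir v f x = (\<Sum>i\<in>UNIV. v $ i * partial i f x)"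

lemma ddir_axis: "ddir (axis l 1) g y = partial l g y"
  by (simp add: ddir_def axis_def if_distrib[of "\<lambda>z. z * _"] cong: if_cong)

lemma has_derivative_along:
  fixes f :: "real ^ 'n \<Rightarrow> real"
  assumes "(f has_derivative f') (at (a + t *\<^sub>R v))"
  shows "((\<lambda>t. f (a + t *\<^sub>R v)) has_real_derivative f' v) (at t)"
proof -
  have "((\<lambda>t. a + t *\<^sub>R v) has_derivative (\<lambda>s. s *\<^sub>R v)) (at t)"
    by (auto intro!: derivative_eq_intros)
  from has_derivative_compose[OF this assms]
  have "((\<lambda>t. f (a + t *\<^sub>R v)) has_derivative (\<lambda>s. f' (s *\<^sub>R v))) (at t)" .
  moreover have "(\<lambda>s. f' (s *\<^sub>R v)) = (*) (f' v)"
    using linear_cmul[OF has_derivative_linear[OF assms]] by (auto simp: mult.commute)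
  ultimately show ?thesis by (simp add: has_field_derivative_def)
qed

lemma partial_eq_derivative:
  assumes "(f has_derivative f') (at x)"
  shows "partial i f x = f' (axis i 1)"
  using has_derivative_along[of f f' x 0 "axis i 1"] assms
  by (auto simp: partial_def intro: DERIV_imp_deriv)

lemma has_derivative_ddir:
  assumes "f differentiable (at x)"
  shows "(f has_derivative (\<lambda>v. ddir v f x)) (at x)"
proof -
  obtain f' where f': "(f has_derivative f') (at x)"
    using assms by (auto simp: differentiable_def)
  have lin: "linear f'" by (rule has_derivative_linear[OF f'])
  have "f' v = ddir v f x" for v
  proof -
    have "f' v = f' (\<Sum>i\<in>UNIV. v $ i *\<^sub>R axis i 1)"
      by (simp add: basis_expansion flip: scalar_mult_eq_scaleR)
    also have "\<dots> = ddir v f x"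
      by (simp add: linear_sum[OF lin] linear_cmul[OF lin] ddir_def partial_eq_derivative[OF f'])
    finally show ?thesis .
  qed
  then have "f' = (\<lambda>v. ddir v f x)" by auto
  with f' show ?thesis by simp
qed

lemma DERIV_along:
  assumes "f differentiable (at (a + t *\<^sub>R v))"
  shows "((\<lambda>t. f (a + t *\<^sub>R v)) has_real_derivative ddir v f (a + t *\<^sub>R v)) (at t)"
  by (rule has_derivative_along[OF has_derivative_ddir[OF assms]])

lemma partial_cong_open:
  assumes "open S" "x \<in> S" "\<And>y. y \<in> S \<Longrightarrow> f y = g y"
  shows "partial i f x = partial i g x"
proof -
  have c: "((\<lambda>t. x + t *\<^sub>R axis i 1) \<longlongrightarrow> x + 0 *\<^sub>R axis i 1) (nhds (0::real))"
    by (intro tendsto_intros filterlim_ident)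
  have "\<forall>\<^sub>F t in nhds (0::real). x + t *\<^sub>R axis i 1 \<in> S"
    using topological_tendstoD[OF c assms(1)] assms(2) by simp
  then have "\<forall>\<^sub>F t in nhds (0::real). f (x + t *\<^sub>R axis i 1) = g (x + t *\<^sub>R axis i 1)"
    by eventually_elim (rule assms(3))
  then show ?thesis unfolding partial_def by (rule deriv_cong_ev) simp
qed

lemma partials_Cons: "partials (i # js) f = partial i (partials js f)"
  by (simp add: partials_def)

lemma partials_Nil: "partials [] f = f"
  by (simp add: partials_def)

lemma partial_const [simp]: "partial i (\<lambda>_. c) x = 0"
  by (simp add: partial_def)

lemma partial_add:
  assumes "f differentiable (at x)" "g differentiable (at x)"
  shows "partial i (\<lambda>y. f y + g y) x = partial i f x + partial i g x"
  using partial_eq_derivative[OF has_derivative_add[OF has_derivative_ddir[OF assms(1)] has_derivative_ddir[OF assms(2)]]]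
   partial_eq_derivative[OF has_derivative_ddir[OF assms(1)]]
   partial_eq_derivative[OF has_derivative_ddir[OF assms(2)]] by metis

lemma partial_mult:
  assumes "f differentiable (at x)" "g differentiable (at x)"
  shows "partial i (\<lambda>y. f y * g y) x = partial i f x * g x + f x * partial i g x"
  using partial_eq_derivative[OF has_derivative_mult[OF has_derivative_ddir[OF assms(1)] has_derivative_ddir[OF assms(2)]], of i]
   partial_eq_derivative[OF has_derivative_ddir[OF assms(1)], of i]
   partial_eq_derivative[OF has_derivative_ddir[OF assms(2)], of i] by simp

text \<open>The increment from \<open>x\<close> to \<open>x + h\<close> is split into one leg per coordinate, and
the mean value theorem on each leg compares it with the partial derivative at \<open>x\<close>. The
induction runs over the set \<open>I\<close> of coordinates already moved.\<close>

lemma differentiable_of_continuous_partials: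
  fixes f :: "real ^ 'n \<Rightarrow> real"
  assumes S: "open S" "x \<in> S"
    and fd: "\<And>i y. y \<in> S \<Longrightarrow> (\<lambda>t. f (y + t *\<^sub>R axis i 1)) field_differentiable at 0"
    and cont: "\<And>i. continuous_on S (partial i f)"
  shows "f differentiable (at x)"
proof -
  have D: "((\<lambda>t. f (y + t *\<^sub>R axis i 1)) has_real_derivative partial i f (y + t *\<^sub>R axis i 1)) (at t)"
    if "y + t *\<^sub>R axis i 1 \<in> S" for y i t
  proof -
    have "((\<lambda>s. f ((y + t *\<^sub>R axis i 1) + s *\<^sub>R axis i 1)) has_real_derivative partial i f (y + t *\<^sub>R axis i 1)) (at 0)"
      unfolding partial_def using fd[OF that] by (rule field_differentiable_derivI)
    then have "((\<lambda>s. f ((y + t *\<^sub>R axis i 1) + (s - t) *\<^sub>R axis i 1)) has_real_derivative partial i f (y + t *\<^sub>R axis i 1)) (at t)"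
      using DERIV_shift[of "\<lambda>s. f ((y + t *\<^sub>R axis i 1) + s *\<^sub>R axis i 1)" _ t "-t"] by simp
    then show ?thesis by (simp add: algebra_simps)
  qed
  have key: "\<exists>d>0. \<forall>h. norm h < d \<longrightarrow> \<bar>f (x + h) - f x - ddir h f x\<bar> \<le> \<eta> * norm h" if "\<eta> > 0" for \<eta>
  proof -
    define \<eta>' where "\<eta>' = \<eta> / CARD('n)"
    have \<eta>': "\<eta>' > 0" using that by (simp add: \<eta>'_def)
    have "\<forall>i. \<exists>d>0. ball x d \<subseteq> S \<and> (\<forall>y\<in>ball x d. \<bar>partial i f y - partial i f x\<bar> \<le> \<eta>')"
    proof
      fix i
      obtain d1 where d1: "d1 > 0" "ball x d1 \<subseteq> S" using S open_contains_ball by blast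
      have "isCont (partial i f) x" using cont[of i] S by (simp add: continuous_on_eq_continuous_at)
      then obtain d2 where d2: "d2 > 0" "\<forall>y. dist y x < d2 \<longrightarrow> dist (partial i f y) (partial i f x) < \<eta>'"
        using \<eta>' unfolding continuous_at_eps_delta by blast
      show "\<exists>d>0. ball x d \<subseteq> S \<and> (\<forall>y\<in>ball x d. \<bar>partial i f y - partial i f x\<bar> \<le> \<eta>')"
        using d1 d2 by (intro exI[of _ "min d1 d2"]) (fastforce simp: dist_commute dist_real_def subset_iff)
    qed
    then obtain d where d: "\<And>i. d i > 0" "\<And>i. ball x (d i) \<subseteq> S"
      "\<And>i y. y \<in> ball x (d i) \<Longrightarrow> \<bar>partial i f y - partial i f x\<bar> \<le> \<eta>'" by metis
    define d0 where "d0 = Min (range d)"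
    have d0: "d0 > 0" "\<And>i. d0 \<le> d i" using d(1) by (auto simp: d0_def)
    have "\<bar>f (x + h) - f x - ddir h f x\<bar> \<le> \<eta> * norm h" if h: "norm h < d0" for h
    proof -
      have part: "norm (\<Sum>i\<in>I. c i *\<^sub>R axis i (1::real)) \<le> norm h"
        if c: "\<And>i. \<bar>c i\<bar> \<le> \<bar>h $ i\<bar>" for I :: "'n set" and c
      proof (rule norm_le_componentwise_cart)
        fix j
        have "(\<Sum>i\<in>I. c i *\<^sub>R axis i (1::real)) $ j = (if j \<in> I then c j else 0)"
          by (simp add: axis_def if_distrib[of "\<lambda>z. _ * z"] cong: if_cong)
        then show "norm ((\<Sum>i\<in>I. c i *\<^sub>R axis i (1::real)) $ j) \<le> norm (h $ j)" using c by simp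
      qed
      have "\<bar>f (x + (\<Sum>i\<in>I. h $ i *\<^sub>R axis i 1)) - f x - (\<Sum>i\<in>I. h $ i * partial i f x)\<bar> \<le> (\<Sum>i\<in>I. \<eta>' * \<bar>h $ i\<bar>)" for I
        using finite[of I]
      proof (induction I rule: finite_induct)
        case empty then show ?case by simp
      next
        case (insert j I)
        define z where "z = x + (\<Sum>i\<in>I. h $ i *\<^sub>R axis i 1)"
        have inb: "z + t *\<^sub>R axis j 1 \<in> ball x d0" if "\<bar>t\<bar> \<le> \<bar>h $ j\<bar>" for t
        proof -
          have "z + t *\<^sub>R axis j 1 - x = (\<Sum>i\<in>insert j I. (if i = j then t else h $ i) *\<^sub>R axis i 1)"
            using insert.hyps unfolding z_def
            by (simp add: algebra_simps if_distrib cong: if_cong) (rule sum.cong, auto)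
          also have "norm \<dots> \<le> norm h" using that by (intro part) auto
          finally show ?thesis using h by (simp add: dist_norm norm_minus_commute)
        qed
        have "\<exists>c. \<bar>c\<bar> \<le> \<bar>h $ j\<bar> \<and> f (z + h $ j *\<^sub>R axis j 1) - f z = h $ j * partial j f (z + c *\<^sub>R axis j 1)"
        proof -
          have D': "((\<lambda>t. f (z + t *\<^sub>R axis j 1)) has_real_derivative partial j f (z + t *\<^sub>R axis j 1)) (at t)"
            if "\<bar>t\<bar> \<le> \<bar>h $ j\<bar>" for t
            using D inb[OF that] d(2)[of j] d0(2)[of j] by (meson subsetD subset_ball)
          consider "h $ j = 0" | "h $ j > 0" | "h $ j < 0" by linarith
          then show ?thesis
          proof cases
            case 1 then show ?thesis by (intro exI[of _ 0]) simp
          next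
            case 2
            obtain c where "c > 0" "c < h $ j" "f (z + h $ j *\<^sub>R axis j 1) - f (z + 0 *\<^sub>R axis j 1) = (h $ j - 0) * partial j f (z + c *\<^sub>R axis j 1)"
              using MVT2[OF 2, of "\<lambda>t. f (z + t *\<^sub>R axis j 1)" "\<lambda>t. partial j f (z + t *\<^sub>R axis j 1)"] D' by auto
            then show ?thesis by (intro exI[of _ c]) auto
          next
            case 3
            obtain c where "c > h $ j" "c < 0" "f (z + 0 *\<^sub>R axis j 1) - f (z + h $ j *\<^sub>R axis j 1) = (0 - h $ j) * partial j f (z + c *\<^sub>R axis j 1)"
              using MVT2[OF 3, of "\<lambda>t. f (z + t *\<^sub>R axis j 1)" "\<lambda>t. partial j f (z + t *\<^sub>R axis j 1)"] D' by auto
            then show ?thesis by (intro exI[of _ c]) auto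
          qed
        qed
        then obtain c where c: "\<bar>c\<bar> \<le> \<bar>h $ j\<bar>" "f (z + h $ j *\<^sub>R axis j 1) - f z = h $ j * partial j f (z + c *\<^sub>R axis j 1)" by blast
        have "\<bar>partial j f (z + c *\<^sub>R axis j 1) - partial j f x\<bar> \<le> \<eta>'"
          using d(3)[of "z + c *\<^sub>R axis j 1" j] inb[OF c(1)] d0(2)[of j] by auto
        from mult_right_mono[OF this, of "\<bar>h $ j\<bar>"]
        have "\<bar>h $ j * (partial j f (z + c *\<^sub>R axis j 1) - partial j f x)\<bar> \<le> \<eta>' * \<bar>h $ j\<bar>"
          by (simp add: abs_mult mult.commute)
        then have "\<bar>f (z + h $ j *\<^sub>R axis j 1) - f z - h $ j * partial j f x\<bar> \<le> \<eta>' * \<bar>h $ j\<bar>"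
          by (simp add: c(2) algebra_simps)
        moreover have "x + (\<Sum>i\<in>insert j I. h $ i *\<^sub>R axis i 1) = z + h $ j *\<^sub>R axis j 1"
          using insert.hyps by (simp add: z_def algebra_simps)
        moreover have "(\<Sum>i\<in>insert j I. h $ i * partial i f x) = h $ j * partial j f x + (\<Sum>i\<in>I. h $ i * partial i f x)"
          "(\<Sum>i\<in>insert j I. \<eta>' * \<bar>h $ i\<bar>) = \<eta>' * \<bar>h $ j\<bar> + (\<Sum>i\<in>I. \<eta>' * \<bar>h $ i\<bar>)"
          using insert.hyps by simp_all
        ultimately show ?case using insert.IH[folded z_def] by (simp only:)
      qed
      from this[of UNIV] have "\<bar>f (x + h) - f x - ddir h f x\<bar> \<le> (\<Sum>i\<in>(UNIV::'n set). \<eta>' * \<bar>h $ i\<bar>)"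
        by (simp add: ddir_def basis_expansion flip: scalar_mult_eq_scaleR)
      also have "\<dots> \<le> (\<Sum>i\<in>(UNIV::'n set). \<eta>' * norm h)"
        using \<eta>' by (intro sum_mono mult_left_mono component_le_norm_cart) auto
      also have "\<dots> = \<eta> * norm h" by (simp add: \<eta>'_def)
      finally show ?thesis .
    qed
    with d0(1) show ?thesis by blast
  qed
  have "bounded_linear (\<lambda>h. ddir h f x)"
    by (intro linear_conv_bounded_linear[THEN iffD1] linearI)
       (simp_all add: ddir_def algebra_simps sum.distrib sum_distrib_left)
  moreover have "\<exists>d>0. \<forall>y. norm (y - x) < d \<longrightarrow> norm (f y - f x - ddir (y - x) f x) \<le> e * norm (y - x)" if "e > 0" for e
    using key[OF that] by (metis add.commute diff_add_cancel real_norm_def)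
  ultimately have "(f has_derivative (\<lambda>h. ddir h f x)) (at x)"
    unfolding has_derivative_at_alt by blast
  then show ?thesis by (auto simp: differentiable_def)
qed

section \<open>Classes of differentiable functions\<close>

text \<open>One recursion serves three classes: functions with continuous partials up to order \<open>m\<close>,
functions whose partials are in addition locally Hoelder continuous, and families depending continuously
on a parameter. \<open>B\<close> is the property demanded of the function and of every iterated partial,
and \<open>A\<close> is the parameter range, which is a singleton when there is no parameter.\<close>

primrec reg :: "(('p \<Rightarrow> real ^ 'n \<Rightarrow> real) \<Rightarrow> bool) \<Rightarrow> 'p set \<Rightarrow> (real ^ 'n) set \<Rightarrow> nat
    \<Rightarrow> ('p \<Rightarrow> real ^ 'n \<Rightarrow> real) \<Rightarrow> bool" where
  "reg B A S 0 f \<longleftrightarrow> B f"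
| "reg B A S (Suc m) f \<longleftrightarrow> B f \<and> (\<forall>a\<in>A. \<forall>x\<in>S. f a differentiable (at x)) \<and>
     (\<forall>i. reg B A S m (\<lambda>a. partial i (f a)))"

text \<open>What \<open>B\<close> must satisfy for the class to be an algebra of functions containing the
coordinates. Everything else about the classes, down to iterated Laplacians, follows from this by
induction on the order.\<close>

definition reg_base :: "(('p \<Rightarrow> real ^ 'n \<Rightarrow> real) \<Rightarrow> bool) \<Rightarrow> 'p set \<Rightarrow> (real ^ 'n) set \<Rightarrow> bool" where
  "reg_base B A S \<longleftrightarrow> open S \<and>
     (\<forall>f g. (\<forall>a\<in>A. \<forall>x\<in>S. f a x = g a x) \<longrightarrow> B f \<longrightarrow> B g) \<and>
     (\<forall>f g. B f \<longrightarrow> B g \<longrightarrow> B (\<lambda>a x. f a x + g a x)) \<and>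
     (\<forall>f g. B f \<longrightarrow> B g \<longrightarrow> B (\<lambda>a x. f a x * g a x)) \<and>
     (\<forall>c. B (\<lambda>a x. c)) \<and> (\<forall>i. B (\<lambda>a x. x $ i))"

lemma reg_imp_base: "reg B A S m f \<Longrightarrow> B f"
  by (cases m) auto

lemma reg_SucD: "reg B A S (Suc m) f \<Longrightarrow> reg B A S m f"
  by (induction m arbitrary: f) auto

lemma reg_mono: "m \<le> m' \<Longrightarrow> reg B A S m' f \<Longrightarrow> reg B A S m f"
  by (induction m' rule: dec_induct) (blast dest: reg_SucD)+

lemma reg_mono_base: "(\<And>f. B f \<Longrightarrow> B' f) \<Longrightarrow> reg B A S m f \<Longrightarrow> reg B' A S m f"
  by (induction m arbitrary: f) auto

lemma differentiable_cong_open: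
  assumes "open S" "x \<in> S" "\<And>y. y \<in> S \<Longrightarrow> f y = g y" "f differentiable (at x)"
  shows "g differentiable (at x)"
  using assms has_derivative_transform_within_open[of f _ x UNIV S g]
  unfolding differentiable_def by metis

lemma reg_cong:
  assumes "reg_base B A S"
  shows "\<lbrakk>\<And>a x. a \<in> A \<Longrightarrow> x \<in> S \<Longrightarrow> f a x = g a x; reg B A S m f\<rbrakk> \<Longrightarrow> reg B A S m g"
proof (induction m arbitrary: f g)
  case 0
  then show ?case using assms unfolding reg_base_def by (metis reg.simps(1))
next
  case (Suc m)
  have o: "open S" using assms by (simp add: reg_base_def)
  have 1: "B g" using assms Suc.prems unfolding reg_base_def by (metis reg.simps(2))
  have 2: "g a differentiable (at x)" if "a \<in> A" "x \<in> S" for a x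
    using differentiable_cong_open[OF o that(2), of "f a" "g a"] Suc.prems that by auto
  have 3: "reg B A S m (\<lambda>a. partial i (g a))" for i
  proof (rule Suc.IH)
    show "reg B A S m (\<lambda>a. partial i (f a))" using Suc.prems(2) by simp
    show "partial i (f a) x = partial i (g a) x" if "a \<in> A" "x \<in> S" for a x
      by (rule partial_cong_open[OF o that(2)]) (rule Suc.prems(1)[OF that(1)])
  qed
  show ?case using 1 2 3 by simp
qed

lemma reg_const:
  assumes "reg_base B A S" shows "reg B A S m (\<lambda>a x. c)"
proof (induction m arbitrary: c)
  case 0 then show ?case using assms by (simp add: reg_base_def)
next
  case (Suc m) 
  have "reg B A S m (\<lambda>a. partial i (\<lambda>x. c))" for i
    by (rule reg_cong[OF assms _ Suc.IH[of 0]]) simp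
  then show ?case using assms by (simp add: reg_base_def)
qed

lemma partial_component: "partial i (\<lambda>x. x $ j) x = (if i = j then 1 else 0)"
proof -
  have "((\<lambda>x. x $ j) has_derivative (\<lambda>x. x $ j)) (at x)"
    by (rule bounded_linear_imp_has_derivative[OF bounded_linear_vec_nth])
  from partial_eq_derivative[OF this] show ?thesis by (simp add: axis_def)
qed

lemma reg_component:
  fixes S :: "(real ^ 'a) set"
  assumes "reg_base B A S" shows "reg B A S m (\<lambda>a x. x $ i)"
proof (cases m)
  case 0 then show ?thesis using assms by (simp add: reg_base_def)
next
  case (Suc l)
  have "reg B A S l (\<lambda>a. partial j (\<lambda>x. x $ i))" for j
    by (rule reg_cong[OF assms _ reg_const[OF assms]]) (rule partial_component[symmetric])
  moreover have "(\<lambda>x. x $ i) differentiable (at (x :: real ^ 'a))" for x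
    using bounded_linear_imp_differentiable[OF bounded_linear_vec_nth] by blast
  ultimately show ?thesis using assms by (simp add: reg_base_def Suc)
qed

lemma reg_add:
  assumes "reg_base B A S"
  shows "reg B A S m f \<Longrightarrow> reg B A S m g \<Longrightarrow> reg B A S m (\<lambda>a x. f a x + g a x)"
proof (induction m arbitrary: f g)
  case 0 then show ?case using assms by (simp add: reg_base_def)
next
  case (Suc m)
  have "reg B A S m (\<lambda>a. partial i (\<lambda>x. f a x + g a x))" for i
  proof (rule reg_cong[OF assms])
    show "reg B A S m (\<lambda>a x. partial i (f a) x + partial i (g a) x)"
      using Suc.prems by (intro Suc.IH) auto
    show "partial i (f a) x + partial i (g a) x = partial i (\<lambda>x. f a x + g a x) x" if "a \<in> A" "x \<in> S" for a x
      using Suc.prems that by (simp add: partial_add)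
  qed
  then show ?case using Suc.prems assms by (auto simp: reg_base_def)
qed

lemma reg_mult:
  assumes "reg_base B A S"
  shows "reg B A S m f \<Longrightarrow> reg B A S m g \<Longrightarrow> reg B A S m (\<lambda>a x. f a x * g a x)"
proof (induction m arbitrary: f g)
  case 0 then show ?case using assms by (simp add: reg_base_def)
next
  case (Suc m)
  have "reg B A S m (\<lambda>a. partial i (\<lambda>x. f a x * g a x))" for i
  proof (rule reg_cong[OF assms])
    show "reg B A S m (\<lambda>a x. partial i (f a) x * g a x + f a x * partial i (g a) x)"
      using Suc.prems reg_SucD[OF Suc.prems(1)] reg_SucD[OF Suc.prems(2)]
      by (intro reg_add[OF assms] Suc.IH) auto
    show "partial i (f a) x * g a x + f a x * partial i (g a) x = partial i (\<lambda>x. f a x * g a x) x" if "a \<in> A" "x \<in> S" for a x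
      using Suc.prems that by (simp add: partial_mult)
  qed
  then show ?case using Suc.prems assms by (auto simp: reg_base_def)
qed

lemma reg_sum:
  assumes "reg_base B A S" "finite I" "\<And>i. i \<in> I \<Longrightarrow> reg B A S m (f i)"
  shows "reg B A S m (\<lambda>a x. \<Sum>i\<in>I. f i a x)"
  using assms(2,3)
proof (induction I rule: finite_induct)
  case empty then show ?case by (simp add: reg_const[OF assms(1)])
next
  case (insert i I)
  then show ?case using reg_add[OF assms(1), of m "f i"] by simp
qed

lemma reg_power:
  assumes "reg_base B A S" "reg B A S m f"
  shows "reg B A S m (\<lambda>a x. f a x ^ b)"
  by (induction b) (auto intro: reg_const[OF assms(1)] reg_mult[OF assms(1) assms(2)])

lemma reg_partial: "reg B A S (Suc m) f \<Longrightarrow> reg B A S m (\<lambda>a. partial i (f a))"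
  by simp

lemma reg_partials: "reg B A S (length js + m) f \<Longrightarrow> reg B A S m (\<lambda>a. partials js (f a))"
proof (induction js arbitrary: m)
  case Nil then show ?case by (simp add: partials_Nil)
next
  case (Cons i js)
  then have "reg B A S (length js + Suc m) f" by simp
  from Cons.IH[OF this] show ?case unfolding partials_Cons by (rule reg_partial)
qed

lemma reg_ddir:
  assumes "reg_base B A S" "reg B A S (Suc m) f"
  shows "reg B A S m (\<lambda>a. ddir v (f a))"
  unfolding ddir_def[abs_def] using assms(2)
  by (intro reg_sum[OF assms(1)] reg_mult[OF assms(1)] reg_const[OF assms(1)]) auto

definition Cm :: "nat \<Rightarrow> (real ^ 'n) set \<Rightarrow> (real ^ 'n \<Rightarrow> real) \<Rightarrow> bool" where
  "Cm m S f \<longleftrightarrow> reg (\<lambda>F. continuous_on S (F ())) {()} S m (\<lambda>_. f)"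

text \<open>The functions of class \<open>C^m\<close> on the whole space whose partials of every order at most
\<open>m\<close> are Hoelder continuous on each compact set. Asking for this at all orders, and not only
at the top one, makes membership a \<open>reg\<close> condition; it restricts to \<open>C_holder\<close>
on bounded sets.\<close>

definition Hm :: "real \<Rightarrow> nat \<Rightarrow> (real ^ 'n \<Rightarrow> real) \<Rightarrow> bool" where
  "Hm \<theta> m f \<longleftrightarrow> reg (\<lambda>F. continuous_on UNIV (F ()) \<and>
      (\<forall>K. compact K \<longrightarrow> (\<exists>C. \<forall>x\<in>K. \<forall>y\<in>K. \<bar>F () x - F () y\<bar> \<le> C * dist x y powr \<theta>)))
    {()} UNIV m (\<lambda>_. f)"

lemma Cm_base:
  fixes S :: "(real ^ 'n) set"
  assumes "open S"
  shows "reg_base (\<lambda>F. continuous_on S (F ())) {()} S"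
proof -
  have 1: "continuous_on S f \<longleftrightarrow> continuous_on S g" if "\<forall>x\<in>S. f x = g x" for f g :: "real ^ 'n \<Rightarrow> real"
    using that by (intro continuous_on_cong) auto
  show ?thesis using assms unfolding reg_base_def
    by (auto intro!: continuous_intros simp: 1)
qed

text \<open>On bounded sets Lipschitz functions are Hoelder continuous.\<close>

lemma dist_le_dist_powr:
  fixes x y :: "'a :: metric_space"
  assumes "0 < \<theta>" "\<theta> \<le> 1" "dist x y \<le> d"
  shows "dist x y \<le> (1 + \<bar>d\<bar>) powr (1 - \<theta>) * dist x y powr \<theta>"
proof -
  have "dist x y = dist x y powr (1 - \<theta>) * dist x y powr \<theta>"
    by (cases "dist x y = 0") (auto simp flip: powr_add)
  also have "\<dots> \<le> (1 + \<bar>d\<bar>) powr (1 - \<theta>) * dist x y powr \<theta>"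
    using assms by (intro mult_right_mono powr_mono2) auto
  finally show ?thesis .
qed

lemma Hm_base:
  assumes "0 < \<theta>" "\<theta> \<le> 1"
  shows "reg_base (\<lambda>F. continuous_on UNIV (F ()) \<and>
      (\<forall>K. compact K \<longrightarrow> (\<exists>C. \<forall>x\<in>K. \<forall>y\<in>K. \<bar>F () x - F () (y :: real ^ 'n)\<bar> \<le> C * dist x y powr \<theta>)))
    {()} UNIV"
proof -
  define H where "H f K \<longleftrightarrow> (\<exists>C. \<forall>x\<in>K. \<forall>y\<in>K. \<bar>f x - f y\<bar> \<le> C * dist x y powr \<theta>)"
    for f :: "real ^ 'n \<Rightarrow> real" and K
  have cong: "f = g" if "\<forall>x. f x = g x" for f g :: "real ^ 'n \<Rightarrow> real" using that by auto
  have add: "H (\<lambda>x. f x + g x) K" if H: "H f K" "H g K" for f g K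
  proof -
    obtain C D where "\<forall>x\<in>K. \<forall>y\<in>K. \<bar>f x - f y\<bar> \<le> C * dist x y powr \<theta>"
      "\<forall>x\<in>K. \<forall>y\<in>K. \<bar>g x - g y\<bar> \<le> D * dist x y powr \<theta>" using H unfolding H_def by blast
    then have "\<bar>f x + g x - (f y + g y)\<bar> \<le> (C + D) * dist x y powr \<theta>" if "x \<in> K" "y \<in> K" for x y
      using that by (smt (verit, ccfv_threshold) distrib_right)
    then show ?thesis unfolding H_def by blast
  qed
  have mult: "H (\<lambda>x. f x * g x) K" if H: "H f K" "H g K" and K: "compact K" "continuous_on UNIV f" "continuous_on UNIV g" for f g K
  proof -
    obtain C D where CD: "\<forall>x\<in>K. \<forall>y\<in>K. \<bar>f x - f y\<bar> \<le> C * dist x y powr \<theta>"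
      "\<forall>x\<in>K. \<forall>y\<in>K. \<bar>g x - g y\<bar> \<le> D * dist x y powr \<theta>" using H unfolding H_def by blast
    have "bounded (f ` K)" "bounded (g ` K)"
      using K by (auto intro!: compact_imp_bounded compact_continuous_image intro: continuous_on_subset)
    then obtain M N where "\<forall>x\<in>K. \<bar>f x\<bar> \<le> M" "\<forall>x\<in>K. \<bar>g x\<bar> \<le> N"
      unfolding bounded_real by (metis imageI)
    then have MN: "\<forall>x\<in>K. \<bar>f x\<bar> \<le> \<bar>M\<bar>" "\<forall>x\<in>K. \<bar>g x\<bar> \<le> \<bar>N\<bar>" by force+
    have "\<bar>f x * g x - f y * g y\<bar> \<le> (\<bar>M\<bar> * \<bar>D\<bar> + \<bar>N\<bar> * \<bar>C\<bar>) * dist x y powr \<theta>" if "x \<in> K" "y \<in> K" for x y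
    proof -
      have "f x * g x - f y * g y = f x * (g x - g y) + (f x - f y) * g y" by (simp add: algebra_simps)
      then have "\<bar>f x * g x - f y * g y\<bar> \<le> \<bar>f x\<bar> * \<bar>g x - g y\<bar> + \<bar>f x - f y\<bar> * \<bar>g y\<bar>"
        by (metis abs_mult abs_triangle_ineq)
      also have "\<dots> \<le> \<bar>M\<bar> * (\<bar>D\<bar> * dist x y powr \<theta>) + (\<bar>C\<bar> * dist x y powr \<theta>) * \<bar>N\<bar>"
      proof (intro add_mono mult_mono)
        show "\<bar>g x - g y\<bar> \<le> \<bar>D\<bar> * dist x y powr \<theta>"
          using CD(2) that by (meson abs_ge_self mult_right_mono order_trans powr_ge_zero)
        show "\<bar>f x - f y\<bar> \<le> \<bar>C\<bar> * dist x y powr \<theta>"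
          using CD(1) that by (meson abs_ge_self mult_right_mono order_trans powr_ge_zero)
      qed (use MN that in auto)
      finally show ?thesis by (simp add: algebra_simps)
    qed
    then show ?thesis unfolding H_def by blast
  qed
  have const: "H (\<lambda>x. c) K" for c K unfolding H_def by (intro exI[of _ 0]) simp
  have comp: "H (\<lambda>x. x $ i) K" if K: "compact K" for i K
  proof -
    obtain d where d: "\<forall>x\<in>K. \<forall>y\<in>K. dist x y \<le> d"
      using compact_imp_bounded[OF K] by (auto simp: bounded_two_points)
    have "\<bar>x $ i - y $ i\<bar> \<le> (1 + \<bar>d\<bar>) powr (1 - \<theta>) * dist x y powr \<theta>" if "x \<in> K" "y \<in> K" for x y
    proof -
      have "\<bar>x $ i - y $ i\<bar> \<le> dist x y" 
        using component_le_norm_cart[of "x - y" i] by (simp add: dist_norm)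
      also have "\<dots> \<le> (1 + \<bar>d\<bar>) powr (1 - \<theta>) * dist x y powr \<theta>"
        by (rule dist_le_dist_powr[OF assms]) (use d that in blast)
      finally show ?thesis .
    qed
    then show ?thesis unfolding H_def by blast
  qed
  define B where "B F \<longleftrightarrow> continuous_on UNIV (F ()) \<and> (\<forall>K. compact K \<longrightarrow> H (F ()) K)"
    for F :: "unit \<Rightarrow> real ^ 'n \<Rightarrow> real"
  have "B g" if "\<forall>a\<in>{()}. \<forall>x\<in>UNIV. f a x = g a x" "B f" for f g
    using cong[of "f ()" "g ()"] that by (simp add: B_def)
  moreover have "B (\<lambda>a x. f a x + g a x)" if "B f" "B g" for f g
    using that add unfolding B_def by (auto intro!: continuous_on_add)
  moreover have "B (\<lambda>a x. f a x * g a x)" if "B f" "B g" for f g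
    using that mult unfolding B_def by (auto intro!: continuous_on_mult)
  moreover have "B (\<lambda>a x. c)" for c
    using const unfolding B_def by simp
  moreover have "B (\<lambda>a x. x $ i)" for i
    using comp unfolding B_def by (auto intro!: continuous_intros)
  ultimately have "reg_base B {()} UNIV"
    unfolding reg_base_def by blast
  then show ?thesis unfolding B_def[abs_def] H_def .
qed

lemma Cm_0: "Cm 0 S f \<longleftrightarrow> continuous_on S f" by (simp add: Cm_def)

lemma Cm_Suc: "Cm (Suc m) S f \<longleftrightarrow> continuous_on S f \<and> (\<forall>x\<in>S. f differentiable (at x)) \<and> (\<forall>i. Cm m S (partial i f))"
  by (simp add: Cm_def)

lemma Cm_mono: "m \<le> m' \<Longrightarrow> Cm m' S f \<Longrightarrow> Cm m S f"
  unfolding Cm_def by (rule reg_mono)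

lemma Cm_continuous: "Cm m S f \<Longrightarrow> continuous_on S f"
  unfolding Cm_def by (drule reg_imp_base)

lemma Cm_differentiable: "Cm m S f \<Longrightarrow> m > 0 \<Longrightarrow> x \<in> S \<Longrightarrow> f differentiable (at x)"
  by (cases m) (auto simp: Cm_Suc)

lemma Cm_subset: "Cm m S f \<Longrightarrow> T \<subseteq> S \<Longrightarrow> Cm m T f"
  by (induction m arbitrary: f) (auto simp: Cm_0 Cm_Suc intro: continuous_on_subset)

lemma Cm_cong: "open S \<Longrightarrow> (\<And>x. x \<in> S \<Longrightarrow> f x = g x) \<Longrightarrow> Cm m S f \<Longrightarrow> Cm m S g"
  unfolding Cm_def by (rule reg_cong[OF Cm_base]) auto

lemma Cm_const: "open S \<Longrightarrow> Cm m S (\<lambda>x. c)"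
  unfolding Cm_def by (rule reg_const[OF Cm_base])

lemma Cm_component: "open S \<Longrightarrow> Cm m S (\<lambda>x. x $ i)"
  unfolding Cm_def by (rule reg_component[OF Cm_base])

lemma Cm_add: "open S \<Longrightarrow> Cm m S f \<Longrightarrow> Cm m S g \<Longrightarrow> Cm m S (\<lambda>x. f x + g x)"
  unfolding Cm_def by (rule reg_add[OF Cm_base])

lemma Cm_mult: "open S \<Longrightarrow> Cm m S f \<Longrightarrow> Cm m S g \<Longrightarrow> Cm m S (\<lambda>x. f x * g x)"
  unfolding Cm_def by (rule reg_mult[OF Cm_base])

lemma Cm_cmult: "open S \<Longrightarrow> Cm m S f \<Longrightarrow> Cm m S (\<lambda>x. c * f x)"
  by (intro Cm_mult Cm_const)

lemma Cm_diff: "open S \<Longrightarrow> Cm m S f \<Longrightarrow> Cm m S g \<Longrightarrow> Cm m S (\<lambda>x. f x - g x)"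
  using Cm_add[of S m f "\<lambda>x. -1 * g x"] Cm_cmult[of S m g "-1"] by simp

lemma Cm_sum: "open S \<Longrightarrow> finite I \<Longrightarrow> (\<And>i. i \<in> I \<Longrightarrow> Cm m S (f i)) \<Longrightarrow> Cm m S (\<lambda>x. \<Sum>i\<in>I. f i x)"
  unfolding Cm_def by (rule reg_sum[OF Cm_base])

lemma Cm_power: "open S \<Longrightarrow> Cm m S f \<Longrightarrow> Cm m S (\<lambda>x. f x ^ b)"
  unfolding Cm_def by (rule reg_power[OF Cm_base])

lemma Cm_partial: "Cm (Suc m) S f \<Longrightarrow> Cm m S (partial i f)"
  by (simp add: Cm_Suc)

lemma Cm_partials: "Cm (length js + m) S f \<Longrightarrow> Cm m S (partials js f)"
  unfolding Cm_def by (rule reg_partials)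

lemma Cm_ddir: "open S \<Longrightarrow> Cm (Suc m) S f \<Longrightarrow> Cm m S (ddir v f)"
  unfolding Cm_def by (rule reg_ddir[OF Cm_base])

text \<open>The outer function is \<open>Q 0\<close> and \<open>Q j\<close> is its \<open>j\<close>-th derivative.
Supplying the whole sequence suits truncated and real powers, whose derivatives are known in closed form
but hold only on a set \<open>T\<close>.\<close>

lemma Cm_compose:
  fixes Q :: "nat \<Rightarrow> real \<Rightarrow> real"
  assumes S: "open S"
  shows "\<lbrakk>Cm m S f; \<And>x. x \<in> S \<Longrightarrow> f x \<in> T; continuous_on T (Q m);
    \<And>j t. j < m \<Longrightarrow> t \<in> T \<Longrightarrow> (Q j has_real_derivative Q (Suc j) t) (at t)\<rbrakk>
   \<Longrightarrow> Cm m S (\<lambda>x. Q 0 (f x))"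
proof (induction m arbitrary: Q)
  case 0
  then show ?case by (auto simp: Cm_0 intro!: continuous_on_compose2[of T "Q 0" S f])
next
  case (Suc m)
  have D: "((\<lambda>x. Q 0 (f x)) has_derivative (\<lambda>v. Q 1 (f x) * ddir v f x)) (at x)" if "x \<in> S" for x
  proof -
    have "(Q 0 has_derivative (*) (Q 1 (f x))) (at (f x))"
      using Suc.prems(2,4) that by (auto simp: has_field_derivative_def)
    moreover have "f differentiable (at x)" using Suc.prems(1) that by (simp add: Cm_Suc)
    ultimately show ?thesis using has_derivative_compose[of f "\<lambda>v. ddir v f x" x UNIV "Q 0" "\<lambda>z. Q 1 (f x) * z"]
      by (simp add: has_derivative_ddir)
  qed
  have p: "partial i (\<lambda>x. Q 0 (f x)) x = Q 1 (f x) * partial i f x" if "x \<in> S" for x i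
    using partial_eq_derivative[OF D[OF that], of i] partial_eq_derivative[OF has_derivative_ddir, of f x i]
      Suc.prems(1) that by (simp add: Cm_Suc)
  have "Cm m S (\<lambda>x. Q (Suc 0) (f x))"
    using Suc.prems by (intro Suc.IH[of "\<lambda>j. Q (Suc j)"]) (auto intro: Cm_mono[of m "Suc m"])
  then have cmul: "Cm m S (\<lambda>x. Q 1 (f x) * partial i f x)" for i
    using Suc.prems(1) by (intro Cm_mult[OF S]) (auto simp: Cm_Suc)
  have "Cm m S (partial i (\<lambda>x. Q 0 (f x)))" for i
    by (rule Cm_cong[OF S _ cmul[of i]]) (simp add: p)
  moreover have "continuous_on S (\<lambda>x. Q 0 (f x))"
    using D by (meson differentiableI differentiable_at_imp_differentiable_on differentiable_imp_continuous_on)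
  ultimately show ?case using D by (auto simp: Cm_Suc differentiable_def)
qed

text \<open>The mixed second difference over a square of side \<open>t\<close> is symmetric in the two directions.
Two applications of the mean value theorem, in either order, express it as \<open>t^2\<close> times a
mixed partial at a nearby point; then \<open>t\<close> tends to \<open>0\<close>.\<close>

lemma partial_partial_commute:
  assumes "Cm 2 S f" "open S" "x \<in> S"
  shows "partial i (partial j f) x = partial j (partial i f) x"
proof -
  have c1: "Cm 1 S (partial l f)" and df: "\<And>y. y \<in> S \<Longrightarrow> f differentiable (at y)" for l
    using assms(1) by (simp_all add: numeral_2_eq_2 Cm_Suc)
  have dp: "partial l f differentiable (at y)" if "y \<in> S" for l y
    using c1[of l] that by (simp add: Cm_Suc)
  have cp: "continuous_on S (partial l (partial l' f))" for l l'
    using c1[of l'] by (simp add: Cm_Suc Cm_0)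
  obtain d where d: "d > 0" "ball x d \<subseteq> S" using assms openE by blast
  have q: "\<exists>y. dist y x \<le> 2 * t \<and> f (x + t *\<^sub>R axis l 1 + t *\<^sub>R axis l' 1) - f (x + t *\<^sub>R axis l 1) - f (x + t *\<^sub>R axis l' 1) + f x
      = t * (t * partial l' (partial l f) y)" if t: "0 < t" "2 * t < d" for t l l'
  proof -
    have inS: "x + a *\<^sub>R axis l 1 + b *\<^sub>R axis l' 1 \<in> S" "dist (x + a *\<^sub>R axis l 1 + b *\<^sub>R axis l' 1) x \<le> 2 * t"
      if "0 \<le> a" "a \<le> t" "0 \<le> b" "b \<le> t" for a b
    proof -
      have "norm (a *\<^sub>R axis l (1::real) + b *\<^sub>R axis l' 1) \<le> a + b"
        using norm_triangle_ineq[of "a *\<^sub>R axis l (1::real)" "b *\<^sub>R axis l' 1"] that by simp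
      then show "dist (x + a *\<^sub>R axis l 1 + b *\<^sub>R axis l' 1) x \<le> 2 * t"
        using that by (simp add: dist_norm add.assoc)
      then have "x + a *\<^sub>R axis l 1 + b *\<^sub>R axis l' 1 \<in> ball x d" using t by (simp add: dist_commute)
      then show "x + a *\<^sub>R axis l 1 + b *\<^sub>R axis l' 1 \<in> S" using d by blast
    qed
    define h where "h a = f (x + t *\<^sub>R axis l' 1 + a *\<^sub>R axis l 1) - f (x + a *\<^sub>R axis l 1)" for a
    have pe: "partial l g y = ddir (axis l 1) g y" for g :: "real ^ 'n \<Rightarrow> real" and l y
      by (simp add: ddir_axis)
    have "(h has_real_derivative partial l f (x + t *\<^sub>R axis l' 1 + a *\<^sub>R axis l 1) - partial l f (x + a *\<^sub>R axis l 1)) (at a)"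
      if "0 \<le> a" "a \<le> t" for a
      unfolding h_def pe using inS(1)[of a t] inS(1)[of a 0] that t
      by (intro DERIV_diff DERIV_along df) (auto simp: algebra_simps)
    from MVT2[OF t(1) this] obtain a where a: "0 < a" "a < t"
      "h t - h 0 = t * (partial l f (x + t *\<^sub>R axis l' 1 + a *\<^sub>R axis l 1) - partial l f (x + a *\<^sub>R axis l 1))" by auto
    have "((\<lambda>b. partial l f ((x + a *\<^sub>R axis l 1) + b *\<^sub>R axis l' 1)) has_real_derivative partial l' (partial l f) ((x + a *\<^sub>R axis l 1) + b *\<^sub>R axis l' 1)) (at b)"
      if "0 \<le> b" "b \<le> t" for b
      unfolding pe[of l'] using inS(1)[of a b] that a by (intro DERIV_along dp) auto
    from MVT2[OF t(1) this] obtain b where b: "0 < b" "b < t"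
      "partial l f ((x + a *\<^sub>R axis l 1) + t *\<^sub>R axis l' 1) - partial l f ((x + a *\<^sub>R axis l 1) + 0 *\<^sub>R axis l' 1) = t * partial l' (partial l f) ((x + a *\<^sub>R axis l 1) + b *\<^sub>R axis l' 1)" by auto
    have "h t - h 0 = t * (t * partial l' (partial l f) ((x + a *\<^sub>R axis l 1) + b *\<^sub>R axis l' 1))"
      unfolding a(3) b(3)[symmetric] by (simp add: algebra_simps)
    then show ?thesis using inS(2)[of a b] a b
      by (intro exI[of _ "x + a *\<^sub>R axis l 1 + b *\<^sub>R axis l' 1"]) (simp add: h_def algebra_simps)
  qed
  define t where "t n = d / 3 * inverse (real (Suc n))" for n
  have t: "0 < t n" "2 * t n < d" for n
    using d(1) by (auto simp: t_def field_simps intro: add_pos_nonneg)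
  have t0: "t \<longlonglongrightarrow> 0" unfolding t_def by (intro tendsto_mult_right_zero LIMSEQ_inverse_real_of_nat)
  have lim: "\<exists>y. y \<longlonglongrightarrow> x \<and> (\<forall>n. f (x + t n *\<^sub>R axis l 1 + t n *\<^sub>R axis l' 1) - f (x + t n *\<^sub>R axis l 1) - f (x + t n *\<^sub>R axis l' 1) + f x
      = t n * (t n * partial l' (partial l f) (y n)))" for l l'
  proof -
    obtain y where y: "\<And>n. dist (y n) x \<le> 2 * t n" "\<forall>n. f (x + t n *\<^sub>R axis l 1 + t n *\<^sub>R axis l' 1) - f (x + t n *\<^sub>R axis l 1) - f (x + t n *\<^sub>R axis l' 1) + f x
      = t n * (t n * partial l' (partial l f) (y n))" using q[OF t, of _ l l'] by metis
    have "(\<lambda>n. 2 * t n) \<longlonglongrightarrow> 0" using tendsto_mult_left[OF t0, of 2] by simp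
    then have "(\<lambda>n. dist (y n) x) \<longlonglongrightarrow> 0"
      by (rule tendsto_sandwich[where f = "\<lambda>_. 0", rotated 3]) (auto simp: y(1))
    then have "y \<longlonglongrightarrow> x" unfolding tendsto_dist_iff[of y] .
    then show ?thesis using y(2) by blast
  qed
  obtain y where y: "y \<longlonglongrightarrow> x" "\<And>n. f (x + t n *\<^sub>R axis i 1 + t n *\<^sub>R axis j 1) - f (x + t n *\<^sub>R axis i 1) - f (x + t n *\<^sub>R axis j 1) + f x
      = t n * (t n * partial j (partial i f) (y n))" using lim[of i j] by blast
  obtain z where z: "z \<longlonglongrightarrow> x" "\<And>n. f (x + t n *\<^sub>R axis j 1 + t n *\<^sub>R axis i 1) - f (x + t n *\<^sub>R axis j 1) - f (x + t n *\<^sub>R axis i 1) + f x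
      = t n * (t n * partial i (partial j f) (z n))" using lim[of j i] by blast
  have eq: "partial i (partial j f) (z n) = partial j (partial i f) (y n)" for n
  proof -
    have "t n * (t n * partial j (partial i f) (y n)) = t n * (t n * partial i (partial j f) (z n))"
      unfolding y(2)[symmetric] z(2)[symmetric] by (simp add: algebra_simps)
    then show ?thesis using t(1)[of n] by simp
  qed
  have "(\<lambda>n. partial i (partial j f) (z n)) \<longlonglongrightarrow> partial i (partial j f) x"
    using cp[of i j] assms z(1) by (metis continuous_on_eq_continuous_at isCont_tendsto_compose)
  moreover have "(\<lambda>n. partial j (partial i f) (y n)) \<longlonglongrightarrow> partial j (partial i f) x"
    using cp[of j i] assms y(1) by (metis continuous_on_eq_continuous_at isCont_tendsto_compose)
  ultimately show ?thesis unfolding eq by (rule LIMSEQ_unique)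
qed

section \<open>Partial derivatives of higher order\<close>

lemma partials_move_front:
  assumes "open S" "Cm (length xs + length ys + 1) S f" "x \<in> S"
  shows "partials (xs @ i # ys) f x = partials (i # xs @ ys) f x"
  using assms(2,3)
proof (induction xs arbitrary: x)
  case Nil then show ?case by simp
next
  case (Cons a xs)
  have c: "Cm (length xs + length ys + 1) S f" by (rule Cm_mono[OF _ Cons.prems(1)]) simp
  have "partials ((a # xs) @ i # ys) f x = partial a (partials (i # xs @ ys) f) x"
    unfolding append_Cons partials_Cons[of a]
    by (rule partial_cong_open[OF assms(1) Cons.prems(2)]) (rule Cons.IH[OF c])
  also have "\<dots> = partial a (partial i (partials (xs @ ys) f)) x" by (simp only: partials_Cons)
  also have "\<dots> = partial i (partial a (partials (xs @ ys) f)) x"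
  proof (rule partial_partial_commute[OF _ assms(1) Cons.prems(2)])
    show "Cm 2 S (partials (xs @ ys) f)"
      by (rule Cm_partials) (rule Cm_mono[OF _ Cons.prems(1)], simp)
  qed
  finally show ?case by (simp add: partials_Cons)
qed

text \<open>By this symmetry the order of differentiation chosen in \<open>multi_partial\<close> is immaterial, and
Taylor coefficients are symmetric in their indices.\<close>

lemma partials_mset_eq:
  assumes "open S"
  shows "\<lbrakk>mset js = mset js'; Cm (length js) S f; x \<in> S\<rbrakk> \<Longrightarrow> partials js f x = partials js' f x"
proof (induction js arbitrary: js' x)
  case Nil then show ?case by simp
next
  case (Cons i js)
  then have "i \<in> set js'" by (metis list.set_intros(1) set_mset_mset)
  then obtain xs ys where js': "js' = xs @ i # ys" by (meson split_list)
  have m: "mset js = mset (xs @ ys)" using Cons.prems(1) by (simp add: js')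
  then have len: "length js = length xs + length ys" by (metis length_append size_mset)
  have "partials (i # js) f x = partial i (partials (xs @ ys) f) x"
    unfolding partials_Cons
    by (rule partial_cong_open[OF assms Cons.prems(3)]) (rule Cons.IH[OF m Cm_mono[OF _ Cons.prems(2)]], auto)
  also have "\<dots> = partials js' f x"
    unfolding js' partials_Cons[symmetric]
    by (rule partials_move_front[symmetric, OF assms _ Cons.prems(3)]) (use Cons.prems(2) len in simp)
  finally show ?case .
qed

lemma finite_multi_indices: "finite {\<gamma> :: 'n::finite \<Rightarrow> nat. (\<Sum>i\<in>UNIV. \<gamma> i) = r}"
proof (rule finite_subset)
  show "{\<gamma> :: 'n \<Rightarrow> nat. (\<Sum>i\<in>UNIV. \<gamma> i) = r} \<subseteq> PiE UNIV (\<lambda>_. {..r})"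
    by (auto simp: PiE_UNIV_domain intro: member_le_sum)
  show "finite (PiE (UNIV :: 'n set) (\<lambda>_. {..r}))" by (rule finite_PiE) auto
qed

text \<open>After reordering, every iterated partial is one of the components of which \<open>norm_nabla\<close> is
the Euclidean norm.\<close>

lemma partials_le_norm_nabla:
  fixes f :: "real ^ 'n \<Rightarrow> real"
  assumes "open S" "Cm r S f" "x \<in> S" "length js = r"
  shows "\<bar>partials js f x\<bar> \<le> norm_nabla r f x"
proof -
  define \<gamma> where "\<gamma> = count_list js"
  define js' where "js' = (SOME js'. \<forall>i. count_list js' i = \<gamma> i)"
  have "\<forall>i. count_list js' i = \<gamma> i"
    unfolding js'_def by (rule someI[of _ js]) (simp add: \<gamma>_def)
  then have "mset js = mset js'" by (intro multiset_eqI) (simp add: \<gamma>_def count_mset)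
  then have eq: "partials js f x = multi_partial \<gamma> f x"
    unfolding multi_partial_def js'_def[symmetric]
    using assms by (intro partials_mset_eq[OF assms(1)]) auto
  have "(\<Sum>i\<in>UNIV. \<gamma> i) = r"
    using sum_count_set[of js UNIV] assms(4) by (simp add: \<gamma>_def)
  then have "\<bar>multi_partial \<gamma> f x\<bar> \<le> norm_nabla r f x"
    unfolding norm_nabla_def
    using member_le_L2_set[OF finite_multi_indices, of \<gamma> r "\<lambda>\<gamma>. \<bar>multi_partial \<gamma> f x\<bar>"]
    by (simp add: L2_set_def)
  then show ?thesis by (simp add: eq)
qed

lemma differentiable_affine:
  fixes f :: "real ^ 'n \<Rightarrow> real"
  assumes "f differentiable (at (p + \<delta> *\<^sub>R z))"
  shows "((\<lambda>z. f (p + \<delta> *\<^sub>R z)) has_derivative (\<lambda>v. ddir (\<delta> *\<^sub>R v) f (p + \<delta> *\<^sub>R z))) (at z)"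
proof -
  have "((\<lambda>z. p + \<delta> *\<^sub>R z) has_derivative (\<lambda>v. \<delta> *\<^sub>R v)) (at z)"
    by (auto intro!: derivative_eq_intros)
  from has_derivative_compose[OF this has_derivative_ddir[OF assms]] show ?thesis .
qed

lemma ddir_scaleR: "ddir (c *\<^sub>R v) f x = c * ddir v f x"
  by (simp add: ddir_def sum_distrib_left mult.assoc)

lemma partial_affine:
  assumes "f differentiable (at (p + \<delta> *\<^sub>R z))"
  shows "partial i (\<lambda>z. f (p + \<delta> *\<^sub>R z)) z = \<delta> * partial i f (p + \<delta> *\<^sub>R z)"
  using partial_eq_derivative[OF differentiable_affine[OF assms], of i]
  by (simp add: ddir_scaleR ddir_axis)

lemma open_affine_vimage: "open S \<Longrightarrow> open {z :: real ^ 'n. p + \<delta> *\<^sub>R z \<in> S}"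
proof -
  assume "open S"
  moreover have "continuous_on UNIV (\<lambda>z :: real ^ 'n. p + \<delta> *\<^sub>R z)" by (intro continuous_intros)
  ultimately have "open ((\<lambda>z. p + \<delta> *\<^sub>R z) -` S)" by (rule open_vimage)
  then show ?thesis by (simp add: vimage_def)
qed

lemma Cm_affine:
  assumes "open S"
  shows "Cm m S f \<Longrightarrow> Cm m {z. p + \<delta> *\<^sub>R z \<in> S} (\<lambda>z. f (p + \<delta> *\<^sub>R z))"
proof (induction m arbitrary: f)
  case 0
  then show ?case unfolding Cm_0 by (rule continuous_on_compose2) (auto intro!: continuous_intros)
next
  case (Suc m)
  let ?S = "{z. p + \<delta> *\<^sub>R z \<in> S}"
  have o: "open ?S" by (rule open_affine_vimage[OF assms])
  have d: "f differentiable (at (p + \<delta> *\<^sub>R z))" if "z \<in> ?S" for z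
    using Suc.prems that by (simp add: Cm_Suc)
  have "Cm m ?S (\<lambda>z. \<delta> * partial i f (p + \<delta> *\<^sub>R z))" for i
    using Suc.prems by (intro Cm_cmult[OF o] Suc.IH) (simp add: Cm_Suc)
  then have "Cm m ?S (partial i (\<lambda>z. f (p + \<delta> *\<^sub>R z)))" for i
    using Cm_cong[OF o, of "\<lambda>z. \<delta> * partial i f (p + \<delta> *\<^sub>R z)"] partial_affine[OF d] by simp
  moreover have "continuous_on ?S (\<lambda>z. f (p + \<delta> *\<^sub>R z))"
    using Cm_continuous[OF Suc.prems] by (rule continuous_on_compose2) (auto intro!: continuous_intros)
  ultimately show ?case using differentiable_affine[OF d] unfolding Cm_Suc differentiable_def by blast
qed

lemma partial_cmult:
  assumes "f differentiable (at x)"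
  shows "partial i (\<lambda>y. c * f y) x = c * partial i f x"
  using partial_mult[of "\<lambda>_. c" x f i] assms by simp

lemma partials_affine:
  assumes "open S"
  shows "\<lbrakk>Cm (length js) S f; p + \<delta> *\<^sub>R z \<in> S\<rbrakk> \<Longrightarrow>
     partials js (\<lambda>z. f (p + \<delta> *\<^sub>R z)) z = \<delta> ^ length js * partials js f (p + \<delta> *\<^sub>R z)"
proof (induction js arbitrary: z)
  case Nil then show ?case by (simp add: partials_Nil)
next
  case (Cons i js)
  let ?S = "{z. p + \<delta> *\<^sub>R z \<in> S}"
  have o: "open ?S" by (rule open_affine_vimage[OF assms])
  have c: "Cm (length js) S f" by (rule Cm_mono[OF _ Cons.prems(1)]) simp
  have d: "partials js f differentiable (at (p + \<delta> *\<^sub>R z))"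
    using Cm_partials[of js 1 S f] Cons.prems by (intro Cm_differentiable[of 1 S]) auto
  have "partials (i # js) (\<lambda>z. f (p + \<delta> *\<^sub>R z)) z = partial i (\<lambda>z. \<delta> ^ length js * partials js f (p + \<delta> *\<^sub>R z)) z"
    unfolding partials_Cons using Cons.prems
    by (intro partial_cong_open[OF o]) (auto intro: Cons.IH[OF c])
  also have "\<dots> = \<delta> ^ length js * (\<delta> * partial i (partials js f) (p + \<delta> *\<^sub>R z))"
    using differentiable_affine[OF d] by (subst partial_cmult) (auto simp: partial_affine[OF d] differentiable_def)
  finally show ?case by (simp add: partials_Cons)
qed

text \<open>The factor \<open>CARD('n)\<close> comes from bounding the derivative along the segment by the sum of
its coordinate contributions.\<close>

lemma mean_value_partials:
  fixes f :: "real ^ 'n \<Rightarrow> real" and \<kappa> :: real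
  assumes "\<And>z. z \<in> closed_segment a b \<Longrightarrow> f differentiable (at z)"
    and "\<And>z i. z \<in> closed_segment a b \<Longrightarrow> \<bar>partial i f z\<bar> \<le> \<kappa>"
  shows "\<bar>f b - f a\<bar> \<le> CARD('n) * \<kappa> * dist a b"
proof -
  have seg: "a + t *\<^sub>R (b - a) \<in> closed_segment a b" if "0 \<le> t" "t \<le> 1" for t
    using that by (auto simp: in_segment algebra_simps intro!: exI[of _ t])
  have "((\<lambda>t. f (a + t *\<^sub>R (b - a))) has_real_derivative ddir (b - a) f (a + t *\<^sub>R (b - a))) (at t)"
    if "0 \<le> t" "t \<le> 1" for t
    by (rule DERIV_along[OF assms(1)[OF seg[OF that]]])
  from MVT2[OF zero_less_one this] obtain t where t: "0 < t" "t < 1"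
    "f b - f a = ddir (b - a) f (a + t *\<^sub>R (b - a))" by auto
  have "\<bar>ddir (b - a) f (a + t *\<^sub>R (b - a))\<bar> \<le> (\<Sum>i\<in>(UNIV::'n set). dist a b * \<kappa>)"
    unfolding ddir_def
  proof (rule order_trans[OF sum_abs sum_mono])
    fix i
    show "\<bar>(b - a) $ i * partial i f (a + t *\<^sub>R (b - a))\<bar> \<le> dist a b * \<kappa>"
      unfolding abs_mult using component_le_norm_cart[of "b - a" i] assms(2)[OF seg, of t i] t
      by (intro mult_mono) (auto simp: dist_norm norm_minus_commute)
  qed
  also have "\<dots> = CARD('n) * \<kappa> * dist a b" by simp
  finally show ?thesis by (simp add: t(3))
qed

text \<open>\<open>C_diff\<close> only asserts derivatives along the coordinate axes and continuous iterated
partials; at each order these two together give total differentiability.\<close>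

lemma C_diff_imp_Cm:
  assumes "C_diff m S T f" "open S" "S \<subseteq> T"
  shows "Cm m S f"
proof -
  have "Cm l S (partials js f)" if "length js + l \<le> m" for l js
    using that
  proof (induction l arbitrary: js)
    case 0
    then obtain g where "continuous_on T g" "\<forall>x\<in>S. g x = partials js f x"
      using assms(1) unfolding C_diff_def by auto
    then show ?case unfolding Cm_0 using assms(3) 
      by (metis (no_types, lifting) continuous_on_cong continuous_on_subset)
  next
    case (Suc l)
    have p: "Cm l S (partial i (partials js f))" for i
      using Suc.IH[of "i # js"] Suc.prems by (simp add: partials_Cons)
    have "(\<lambda>t. partials js f (x + t *\<^sub>R axis i 1)) field_differentiable at 0" if "x \<in> S" for x i
      using assms(1) Suc.prems that unfolding C_diff_def by auto
    then have d: "partials js f differentiable (at x)" if "x \<in> S" for x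
      using p that by (intro differentiable_of_continuous_partials[OF assms(2)]) (auto dest: Cm_continuous)
    have "continuous_on S (partials js f)"
      using d by (metis differentiable_at_imp_differentiable_on differentiable_imp_continuous_on)
    then show ?case using p d by (simp add: Cm_Suc)
  qed
  from this[of "[]" m] show ?thesis by (simp add: partials_Nil)
qed

lemma Cm_imp_C_diff:
  assumes "Cm m UNIV f"
  shows "C_diff m U T f"
proof -
  have "(\<lambda>t. partials js f (x + t *\<^sub>R axis i 1)) field_differentiable at 0" if "length js < m" for js x i
  proof -
    have "Cm 1 UNIV (partials js f)"
      using that by (intro Cm_partials Cm_mono[OF _ assms]) auto
    then have "partials js f differentiable (at (x + 0 *\<^sub>R axis i 1))" by (simp add: Cm_Suc)
    from DERIV_along[OF this] show ?thesis by (auto simp: field_differentiable_def)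
  qed
  moreover have "continuous_on T (partials js f)" if "length js \<le> m" for js
  proof -
    have "Cm 0 UNIV (partials js f)"
      using that by (intro Cm_partials Cm_mono[OF _ assms]) auto
    then show ?thesis by (auto simp: Cm_0 intro: continuous_on_subset)
  qed
  moreover have "continuous_on T f" using Cm_continuous[OF assms] by (auto intro: continuous_on_subset)
  ultimately show ?thesis unfolding C_diff_def by blast
qed

lemma Hm_0: "Hm \<theta> 0 f \<longleftrightarrow> continuous_on UNIV f \<and>
   (\<forall>K. compact K \<longrightarrow> (\<exists>C. \<forall>x\<in>K. \<forall>y\<in>K. \<bar>f x - f y\<bar> \<le> C * dist x y powr \<theta>))"
  by (simp add: Hm_def)

lemma Hm_Suc: "Hm \<theta> (Suc m) f \<longleftrightarrow> Hm \<theta> 0 f \<and> (\<forall>x. f differentiable (at x)) \<and> (\<forall>i. Hm \<theta> m (partial i f))"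
  by (simp add: Hm_def)

lemma Hm_imp_Cm: "Hm \<theta> m f \<Longrightarrow> Cm m UNIV f"
  unfolding Hm_def Cm_def
  by (rule reg_mono_base[where B = "\<lambda>F. continuous_on UNIV (F ()) \<and> P F" for P]) auto

lemma Hm_mult: "0 < \<theta> \<Longrightarrow> \<theta> \<le> 1 \<Longrightarrow> Hm \<theta> m f \<Longrightarrow> Hm \<theta> m g \<Longrightarrow> Hm \<theta> m (\<lambda>x. f x * g x)"
  unfolding Hm_def by (rule reg_mult[OF Hm_base])

lemma Hm_power: "0 < \<theta> \<Longrightarrow> \<theta> \<le> 1 \<Longrightarrow> Hm \<theta> m f \<Longrightarrow> Hm \<theta> m (\<lambda>x. f x ^ b)"
  unfolding Hm_def by (rule reg_power[OF Hm_base])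

lemma Hm_add: "0 < \<theta> \<Longrightarrow> \<theta> \<le> 1 \<Longrightarrow> Hm \<theta> m f \<Longrightarrow> Hm \<theta> m g \<Longrightarrow> Hm \<theta> m (\<lambda>x. f x + g x)"
  unfolding Hm_def by (rule reg_add[OF Hm_base])

lemma Hm_cmult: "0 < \<theta> \<Longrightarrow> \<theta> \<le> 1 \<Longrightarrow> Hm \<theta> m f \<Longrightarrow> Hm \<theta> m (\<lambda>x. c * f x)"
  unfolding Hm_def by (rule reg_mult[OF Hm_base reg_const[OF Hm_base]])

lemma Hm_partials: "Hm \<theta> (length js + m) f \<Longrightarrow> Hm \<theta> m (partials js f)"
  unfolding Hm_def by (rule reg_partials)

text \<open>On a ball containing the compact set the partials are bounded, so the function is Lipschitz there.\<close>

lemma C1_imp_Hm_0: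
  fixes f :: "real ^ 'n \<Rightarrow> real"
  assumes "0 < \<theta>" "\<theta> \<le> 1" "Cm 1 UNIV f"
  shows "Hm \<theta> 0 f"
  unfolding Hm_0
proof (intro conjI allI impI)
  show "continuous_on UNIV f" using Cm_continuous[OF assms(3)] .
  fix K :: "(real ^ 'n) set" assume "compact K"
  then obtain R where R: "K \<subseteq> cball 0 R"
    using bounded_subset_ballD[OF compact_imp_bounded, of K 0] ball_subset_cball by blast
  have "\<exists>M. \<forall>z\<in>cball 0 R. \<bar>partial i f z\<bar> \<le> M" for i
  proof -
    have "continuous_on (cball 0 R) (partial i f)"
      using Cm_continuous[OF Cm_partial, of 0 UNIV f i] assms(3) continuous_on_subset by (metis One_nat_def subset_UNIV)
    then have "bounded (partial i f ` cball 0 R)" by (intro compact_imp_bounded compact_continuous_image) auto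
    then show ?thesis unfolding bounded_real by blast
  qed
  then obtain M where M: "\<And>i z. z \<in> cball 0 R \<Longrightarrow> \<bar>partial i f z\<bar> \<le> M i" by metis
  define \<kappa> where "\<kappa> = (\<Sum>i\<in>UNIV. \<bar>M i\<bar>)"
  have \<kappa>: "\<bar>partial i f z\<bar> \<le> \<kappa>" if "z \<in> cball 0 R" for i z
  proof -
    have "\<bar>M i\<bar> \<le> \<kappa>" unfolding \<kappa>_def by (rule member_le_sum) auto
    then show ?thesis using M[OF that, of i] by linarith
  qed
  have \<kappa>0: "\<kappa> \<ge> 0" unfolding \<kappa>_def by (rule sum_nonneg) auto
  have "\<bar>f x - f y\<bar> \<le> (CARD('n) * \<kappa> * (1 + \<bar>2 * R\<bar>) powr (1 - \<theta>)) * dist x y powr \<theta>" if xy: "x \<in> K" "y \<in> K" for x y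
  proof -
    have "closed_segment y x \<subseteq> cball 0 R"
      using R xy by (intro closed_segment_subset) auto
    then have "\<bar>f x - f y\<bar> \<le> CARD('n) * \<kappa> * dist y x"
      using assms(3) \<kappa> by (intro mean_value_partials[of y x f \<kappa>]) (auto simp: Cm_Suc)
    also have "\<dots> \<le> CARD('n) * \<kappa> * ((1 + \<bar>2 * R\<bar>) powr (1 - \<theta>) * dist x y powr \<theta>)"
    proof (rule mult_left_mono)
      have "norm x \<le> R" "norm y \<le> R" using R xy by auto
      then have "dist x y \<le> 2 * R" unfolding dist_norm using norm_triangle_ineq4[of x y] by linarith
      then show "dist y x \<le> (1 + \<bar>2 * R\<bar>) powr (1 - \<theta>) * dist x y powr \<theta>"
        using dist_le_dist_powr[OF assms(1,2)] by (metis dist_commute)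
    qed (use \<kappa>0 in simp)
    finally show ?thesis by (simp add: mult.assoc)
  qed
  then show "\<exists>C. \<forall>x\<in>K. \<forall>y\<in>K. \<bar>f x - f y\<bar> \<le> C * dist x y powr \<theta>" by blast
qed

lemma Cm_imp_Hm:
  assumes "0 < \<theta>" "\<theta> \<le> 1"
  shows "Cm (Suc m) UNIV f \<Longrightarrow> Hm \<theta> m f"
proof (induction m arbitrary: f)
  case 0 then show ?case using C1_imp_Hm_0[OF assms] by simp
next
  case (Suc m)
  have "Cm 1 UNIV f" by (rule Cm_mono[OF _ Suc.prems]) simp
  then show ?case unfolding Hm_Suc using C1_imp_Hm_0[OF assms] Suc by (auto simp: Cm_Suc)
qed

lemma C_holder_UNIV_imp_Hm:
  assumes "0 < \<theta>" "\<theta> \<le> 1" "C_holder m \<theta> UNIV f"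
  shows "Hm \<theta> m f"
proof -
  have C: "Cm m UNIV f"
    using assms(3) by (intro C_diff_imp_Cm[of m UNIV "closure UNIV"]) (auto simp: C_holder_def)
  have "Hm \<theta> l (partials js f)" if "length js + l = m" for l js
    using that
  proof (induction l arbitrary: js)
    case 0
    have "Cm 0 UNIV (partials js f)" using C 0 by (intro Cm_partials) simp
    then show ?case using assms(3) 0 unfolding Hm_0 C_holder_def Cm_0 by (metis UNIV_I add.right_neutral)
  next
    case (Suc l)
    have "Cm 1 UNIV (partials js f)" using Suc.prems by (intro Cm_partials Cm_mono[OF _ C]) simp
    moreover have "Hm \<theta> l (partial i (partials js f))" for i
      using Suc.IH[of "i # js"] Suc.prems by (simp add: partials_Cons)
    ultimately show ?case unfolding Hm_Suc using C1_imp_Hm_0[OF assms(1,2)] by (auto simp: Cm_Suc)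
  qed
  from this[of "[]" m] show ?thesis by (simp add: partials_Nil)
qed

lemma Hm_imp_C_holder:
  assumes "Hm \<theta> m f" "bounded U"
  shows "C_holder m \<theta> U f"
  unfolding C_holder_def
proof (intro conjI allI impI)
  show "C_diff m U (closure U) f" by (rule Cm_imp_C_diff[OF Hm_imp_Cm[OF assms(1)]])
  fix js :: "'a list" assume "length js = m"
  then have "Hm \<theta> 0 (partials js f)" using assms(1) by (intro Hm_partials) simp
  moreover have "compact (closure U)" using assms(2) by (simp add: compact_closure)
  ultimately obtain C where "\<forall>x\<in>closure U. \<forall>y\<in>closure U. \<bar>partials js f x - partials js f y\<bar> \<le> C * dist x y powr \<theta>"
    unfolding Hm_0 by blast
  then show "\<exists>C. \<forall>x\<in>U. \<forall>y\<in>U. \<bar>partials js f x - partials js f y\<bar> \<le> C * dist x y powr \<theta>"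
    using closure_subset by blast
qed

section \<open>Iterated directional derivatives and iterated Laplacians\<close>

lemma ddir_cong_open:
  assumes "open S" "x \<in> S" "\<And>y. y \<in> S \<Longrightarrow> f y = g y"
  shows "ddir v f x = ddir v g x"
  unfolding ddir_def using partial_cong_open[OF assms(1,2), of f g] assms(3) by simp

lemma ddir_pow_cong_open:
  assumes "open S" "\<And>y. y \<in> S \<Longrightarrow> f y = g y"
  shows "x \<in> S \<Longrightarrow> (ddir v ^^ j) f x = (ddir v ^^ j) g x"
proof (induction j arbitrary: x)
  case 0 then show ?case by (simp add: assms)
next
  case (Suc j)
  show ?case by (simp, rule ddir_cong_open[OF assms(1) Suc.prems], rule Suc.IH)
qed

lemma Cm_ddir_pow:
  assumes "open S"
  shows "Cm (j + m) S f \<Longrightarrow> Cm m S ((ddir v ^^ j) f)"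
proof (induction j arbitrary: m)
  case 0 then show ?case by simp
next
  case (Suc j)
  then show ?case using Suc.IH[of "Suc m"] by (simp add: Cm_ddir[OF assms])
qed

lemma DERIV_ddir_pow:
  assumes "open S" "Cm m S f" "j < m" "a + t *\<^sub>R v \<in> S"
  shows "((\<lambda>t. (ddir v ^^ j) f (a + t *\<^sub>R v)) has_real_derivative (ddir v ^^ Suc j) f (a + t *\<^sub>R v)) (at t)"
proof -
  have "Cm 1 S ((ddir v ^^ j) f)"
    using assms(3) by (intro Cm_ddir_pow[OF assms(1)] Cm_mono[OF _ assms(2)]) simp
  then have "(ddir v ^^ j) f differentiable (at (a + t *\<^sub>R v))" using assms(4) by (simp add: Cm_Suc)
  from DERIV_along[OF this] show ?thesis by simp
qed

lemma ddir_add: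
  assumes "f differentiable (at x)" "g differentiable (at x)"
  shows "ddir v (\<lambda>y. f y + g y) x = ddir v f x + ddir v g x"
  unfolding ddir_def using assms by (simp add: partial_add algebra_simps sum.distrib)

lemma ddir_mult:
  assumes "f differentiable (at x)" "g differentiable (at x)"
  shows "ddir v (\<lambda>y. f y * g y) x = ddir v f x * g x + f x * ddir v g x"
  unfolding ddir_def using assms
  by (simp add: partial_mult algebra_simps sum.distrib sum_distrib_left)

lemma ddir_cmult:
  assumes "f differentiable (at x)"
  shows "ddir v (\<lambda>y. c * f y) x = c * ddir v f x"
  unfolding ddir_def using assms by (simp add: partial_cmult sum_distrib_left algebra_simps)

lemma ddir_pow_add:
  assumes "open S"
  shows "\<lbrakk>Cm j S f; Cm j S g; x \<in> S\<rbrakk> \<Longrightarrow>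
    (ddir v ^^ j) (\<lambda>y. f y + g y) x = (ddir v ^^ j) f x + (ddir v ^^ j) g x"
proof (induction j arbitrary: x)
  case 0 then show ?case by simp
next
  case (Suc j)
  have c: "Cm j S f" "Cm j S g" using Suc.prems Cm_mono[of j "Suc j"] by auto
  have d: "(ddir v ^^ j) f differentiable (at x)" "(ddir v ^^ j) g differentiable (at x)"
    by (rule Cm_differentiable[of 1 S], rule Cm_ddir_pow[OF assms]; use Suc.prems in simp)+
  have "(ddir v ^^ Suc j) (\<lambda>y. f y + g y) x = ddir v (\<lambda>y. (ddir v ^^ j) f y + (ddir v ^^ j) g y) x"
    by (simp, rule ddir_cong_open[OF assms Suc.prems(3)], rule Suc.IH[OF c])
  also have "\<dots> = (ddir v ^^ Suc j) f x + (ddir v ^^ Suc j) g x"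
    by (simp add: ddir_add d)
  finally show ?case .
qed

lemma ddir_pow_cmult:
  assumes "open S"
  shows "\<lbrakk>Cm j S f; x \<in> S\<rbrakk> \<Longrightarrow> (ddir v ^^ j) (\<lambda>y. c * f y) x = c * (ddir v ^^ j) f x"
proof (induction j arbitrary: x)
  case 0 then show ?case by simp
next
  case (Suc j)
  have c: "Cm j S f" using Suc.prems Cm_mono[of j "Suc j"] by auto
  have d: "(ddir v ^^ j) f differentiable (at x)"
    by (rule Cm_differentiable[of 1 S], rule Cm_ddir_pow[OF assms]; use Suc.prems in simp)+
  have "(ddir v ^^ Suc j) (\<lambda>y. c * f y) x = ddir v (\<lambda>y. c * (ddir v ^^ j) f y) x"
    by (simp, rule ddir_cong_open[OF assms Suc.prems(2)], rule Suc.IH[OF c])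
  also have "\<dots> = c * (ddir v ^^ Suc j) f x"
    by (simp add: ddir_cmult d)
  finally show ?case .
qed

lemma ddir_pow_zero: "(ddir v ^^ j) (\<lambda>_ :: real ^ 'n. 0) = (\<lambda>_. 0)"
proof -
  have "ddir v (\<lambda>_. 0) = (\<lambda>_ :: real ^ 'n. 0)" by (simp add: ddir_def fun_eq_iff)
  then show ?thesis by (induction j) auto
qed

lemma ddir_pow_eq_0:
  assumes "open S" "\<And>y. y \<in> S \<Longrightarrow> f y = 0" "x \<in> S"
  shows "(ddir v ^^ j) f x = 0"
proof -
  have "(ddir v ^^ j) f x = (ddir v ^^ j) (\<lambda>_. 0) x"
    by (rule ddir_pow_cong_open[OF assms(1) _ assms(3)]) (rule assms(2))
  then show ?thesis by (simp add: ddir_pow_zero)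
qed

lemma ddir_pow_sum:
  assumes "open S" "finite I" "\<And>i. i \<in> I \<Longrightarrow> Cm j S (F i)" "x \<in> S"
  shows "(ddir v ^^ j) (\<lambda>y. \<Sum>i\<in>I. c i * F i y) x = (\<Sum>i\<in>I. c i * (ddir v ^^ j) (F i) x)"
  using assms(2,3)
proof (induction I rule: finite_induct)
  case empty
  show ?case by (simp add: ddir_pow_zero)
next
  case (insert i I)
  have "(ddir v ^^ j) (\<lambda>y. c i * F i y + (\<Sum>i\<in>I. c i * F i y)) x
      = (ddir v ^^ j) (\<lambda>y. c i * F i y) x + (ddir v ^^ j) (\<lambda>y. \<Sum>i\<in>I. c i * F i y) x"
    using insert.prems insert.hyps
    by (intro ddir_pow_add[OF assms(1) _ _ assms(4)] Cm_cmult[OF assms(1)] Cm_sum[OF assms(1)]) auto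
  then show ?case using insert ddir_pow_cmult[OF assms(1) _ assms(4), of j "F i"] by simp
qed

text \<open>Peeling off the innermost derivative turns the \<open>(j+1)\<close>-st directional derivative of a
partial into a combination of \<open>j\<close>-th ones of further partials; the list \<open>js0\<close>
records the partials taken so far.\<close>

lemma ddir_pow_bound:
  fixes f :: "real ^ 'n \<Rightarrow> real"
  assumes "open S" "x \<in> S" "\<And>i. \<bar>v $ i\<bar> \<le> 1"
  shows "\<lbrakk>Cm (j + length js0) S f; \<And>js. length js = j \<Longrightarrow> \<bar>partials (js @ js0) f x\<bar> \<le> \<kappa>\<rbrakk> \<Longrightarrow>
     \<bar>(ddir v ^^ j) (partials js0 f) x\<bar> \<le> real CARD('n) ^ j * \<kappa>"
proof (induction j arbitrary: js0)
  case 0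
  then show ?case using "0.prems"(2)[of "[]"] by simp
next
  case (Suc j)
  have "(ddir v ^^ Suc j) (partials js0 f) x
     = (ddir v ^^ j) (\<lambda>y. \<Sum>i\<in>UNIV. v $ i * partials (i # js0) f y) x"
    unfolding funpow_Suc_right by (simp add: ddir_def[abs_def] partials_Cons)
  also have "\<dots> = (\<Sum>i\<in>UNIV. v $ i * (ddir v ^^ j) (partials (i # js0) f) x)"
    using Suc.prems(1) by (intro ddir_pow_sum[OF assms(1) finite _ assms(2)] Cm_partials) (simp add: add.commute)
  finally have "\<bar>(ddir v ^^ Suc j) (partials js0 f) x\<bar> \<le> (\<Sum>i\<in>UNIV. \<bar>v $ i * (ddir v ^^ j) (partials (i # js0) f) x\<bar>)"
    by (simp add: sum_abs)
  also have "\<dots> \<le> (\<Sum>i\<in>(UNIV::'n set). 1 * (real CARD('n) ^ j * \<kappa>))"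
    unfolding abs_mult
  proof (intro sum_mono mult_mono Suc.IH assms(3))
    fix i and js :: "'n list" assume "length js = j"
    then show "\<bar>partials (js @ i # js0) f x\<bar> \<le> \<kappa>"
      using Suc.prems(2)[of "js @ [i]"] by simp
  qed (use Suc.prems(1) in auto)
  also have "\<dots> = real CARD('n) ^ Suc j * \<kappa>" by simp
  finally show ?case .
qed

lemma ddir_pow_extends:
  fixes f :: "real ^ 'n \<Rightarrow> real"
  assumes "open S" "\<And>js. length js = j + length js0 \<Longrightarrow> \<exists>g. continuous_on T g \<and> (\<forall>x\<in>S. g x = partials js f x)"
    and "Cm (j + length js0) S f"
  shows "\<exists>g. continuous_on T g \<and> (\<forall>x\<in>S. g x = (ddir v ^^ j) (partials js0 f) x)"
  using assms(2,3)
proof (induction j arbitrary: js0)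
  case 0 then show ?case by simp
next
  case (Suc j)
  have eq: "(ddir v ^^ Suc j) (partials js0 f) x
     = (\<Sum>i\<in>UNIV. v $ i * (ddir v ^^ j) (partials (i # js0) f) x)" if "x \<in> S" for x
  proof -
    have "(ddir v ^^ Suc j) (partials js0 f) x
     = (ddir v ^^ j) (\<lambda>y. \<Sum>i\<in>UNIV. v $ i * partials (i # js0) f y) x"
      unfolding funpow_Suc_right by (simp add: ddir_def[abs_def] partials_Cons)
    also have "\<dots> = (\<Sum>i\<in>UNIV. v $ i * (ddir v ^^ j) (partials (i # js0) f) x)"
      using Suc.prems(2) by (intro ddir_pow_sum[OF assms(1) finite _ that] Cm_partials) (simp add: add.commute)
    finally show ?thesis .
  qed
  have "\<forall>i. \<exists>g. continuous_on T g \<and> (\<forall>x\<in>S. g x = (ddir v ^^ j) (partials (i # js0) f) x)"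
  proof
    fix i
    show "\<exists>g. continuous_on T g \<and> (\<forall>x\<in>S. g x = (ddir v ^^ j) (partials (i # js0) f) x)"
      by (rule Suc.IH) (use Suc.prems in auto)
  qed
  then obtain g where g: "\<And>i. continuous_on T (g i)" "\<And>i x. x \<in> S \<Longrightarrow> g i x = (ddir v ^^ j) (partials (i # js0) f) x"
    by metis
  show ?case
    by (rule exI[of _ "\<lambda>x. \<Sum>i\<in>UNIV. v $ i * g i x"]) (use g eq in \<open>auto intro!: continuous_intros\<close>)
qed

text \<open>Each derivative lowers the exponent of \<open>\<rho>\<close> by at most one. Hence \<open>\<rho>^a
\<psi>\<close> with \<open>a \<ge> k\<close> has zero Dirichlet data of order \<open>k\<close> on the
zero set of \<open>\<rho>\<close>.\<close>

lemma ddir_pow_vanish: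
  fixes \<rho> \<psi> :: "real ^ 'n \<Rightarrow> real"
  assumes "Cm m UNIV \<rho>" "Cm m UNIV \<psi>" "j \<le> a" "j \<le> m"
  shows "\<exists>c. Cm (m - j) UNIV c \<and> (ddir v ^^ j) (\<lambda>x. \<rho> x ^ a * \<psi> x) = (\<lambda>x. \<rho> x ^ (a - j) * c x)"
  using assms(3,4)
proof (induction j)
  case 0 then show ?case using assms(2) by auto
next
  case (Suc j)
  then obtain c where c: "Cm (m - j) UNIV c"
    "(ddir v ^^ j) (\<lambda>x. \<rho> x ^ a * \<psi> x) = (\<lambda>x. \<rho> x ^ (a - j) * c x)" by auto
  define b where "b = a - Suc j"
  have b: "a - j = Suc b" using Suc.prems by (simp add: b_def)
  have mj: "m - j = Suc (m - Suc j)" using Suc.prems by simp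
  have \<rho>': "Cm (Suc (m - Suc j)) UNIV \<rho>" using assms(1) Suc.prems Cm_mono by (metis Suc_diff_Suc Suc_le_lessD diff_le_self)
  have c': "Cm (Suc (m - Suc j)) UNIV c" using c(1) mj by simp
  have d: "\<rho> differentiable (at x)" "c differentiable (at x)" for x
    using \<rho>' c' by (auto simp: Cm_Suc)
  have pw: "(\<lambda>y. \<rho> y ^ l) differentiable (at x)" for l x
    using d(1) by (rule differentiable_power)
  have dp: "ddir v (\<lambda>y. \<rho> y ^ Suc l) x = real (Suc l) * \<rho> x ^ l * ddir v \<rho> x" for l x
  proof (induction l)
    case (Suc l)
    have "ddir v (\<lambda>y. \<rho> y ^ Suc (Suc l)) x = ddir v (\<lambda>y. \<rho> y * \<rho> y ^ Suc l) x" by simp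
    also have "\<dots> = ddir v \<rho> x * \<rho> x ^ Suc l + \<rho> x * ddir v (\<lambda>y. \<rho> y ^ Suc l) x"
      by (rule ddir_mult[OF d(1) pw])
    finally show ?case unfolding Suc.IH by (simp add: algebra_simps)
  qed simp
  define c2 where "c2 x = real (Suc b) * (ddir v \<rho> x * c x) + \<rho> x * ddir v c x" for x
  have "Cm (m - Suc j) UNIV c2" unfolding c2_def
    using \<rho>' c' Cm_mono[OF _ \<rho>', of "m - Suc j"] Cm_mono[OF _ c', of "m - Suc j"]
    by (intro Cm_add Cm_cmult Cm_mult Cm_ddir) auto
  moreover have "(ddir v ^^ Suc j) (\<lambda>x. \<rho> x ^ a * \<psi> x) x = \<rho> x ^ b * c2 x" for x
  proof -
    have "(ddir v ^^ Suc j) (\<lambda>x. \<rho> x ^ a * \<psi> x) x = ddir v (\<lambda>y. \<rho> y ^ Suc b * c y) x"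
      using c(2) b by simp
    also have "\<dots> = ddir v (\<lambda>y. \<rho> y ^ Suc b) x * c x + \<rho> x ^ Suc b * ddir v c x"
      by (rule ddir_mult[OF pw d(2)])
    finally show ?thesis unfolding dp c2_def by (simp add: algebra_simps)
  qed
  ultimately show ?case unfolding b_def by blast
qed

text \<open>For a function that is smooth across the boundary, the nested one-sided derivatives are ordinary
directional derivatives. The argument holds for any direction, so it does not depend on what
\<open>exterior_normal\<close> is.\<close>

lemma normal_derivative_eq_ddir_pow:
  assumes "Cm m UNIV u" "j \<le> m"
  shows "normal_derivative U j u x = (ddir (exterior_normal U x) ^^ j) u x"
proof -
  define v where "v = exterior_normal U x"
  have "((\<lambda>h t. vector_derivative h (at t within {..0})) ^^ j) (\<lambda>t. u (x + t *\<^sub>R v)) t = (ddir v ^^ j) u (x + t *\<^sub>R v)"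
    if "t \<le> 0" for t
    using that assms(2)
  proof (induction j arbitrary: t)
    case 0 then show ?case by simp
  next
    case (Suc j)
    have "((\<lambda>t. (ddir v ^^ j) u (x + t *\<^sub>R v)) has_vector_derivative (ddir v ^^ Suc j) u (x + t *\<^sub>R v)) (at t within {..0})"
      using DERIV_ddir_pow[OF open_UNIV assms(1), of j x t v] Suc.prems
      by (metis Suc_le_lessD UNIV_I has_real_derivative_iff_has_vector_derivative has_vector_derivative_at_within)
    then have "(((\<lambda>h t. vector_derivative h (at t within {..0})) ^^ j) (\<lambda>t. u (x + t *\<^sub>R v)) has_vector_derivative (ddir v ^^ Suc j) u (x + t *\<^sub>R v)) (at t within {..0})"
      by (rule has_vector_derivative_transform[rotated 2]) (use Suc in auto)
    moreover have "at t within {..0} \<noteq> bot"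
    proof -
      have "t islimpt {..0}" using islimpt_Icc[of "t - 1" t t] Suc.prems by (auto intro: islimpt_subset[of t "{t-1..t}"])
      then show ?thesis by (simp add: trivial_limit_within)
    qed
    ultimately show ?case by (simp add: vector_derivative_within)
  qed
  from this[of 0] show ?thesis by (simp add: normal_derivative_def v_def)
qed

lemma reg_neg_laplacian:
  assumes "reg_base B A S" "reg B A S (Suc (Suc m)) f"
  shows "reg B A S m (\<lambda>a. neg_laplacian (f a))"
proof -
  have "reg B A S m (\<lambda>a x. -1 * (\<Sum>i\<in>UNIV. partial i (partial i (f a)) x))"
    using assms(2) by (intro reg_mult[OF assms(1)] reg_const[OF assms(1)] reg_sum[OF assms(1)]) auto
  then show ?thesis by (simp add: neg_laplacian_def[abs_def])
qed

lemma reg_neg_laplacian_pow: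
  assumes "reg_base B A S"
  shows "reg B A S (2 * k + m) f \<Longrightarrow> reg B A S m (\<lambda>a. (neg_laplacian ^^ k) (f a))"
proof (induction k arbitrary: m)
  case 0 then show ?case by simp
next
  case (Suc k)
  have "reg B A S (2 * k + Suc (Suc m)) f" using Suc.prems by simp
  from Suc.IH[OF this] show ?case using reg_neg_laplacian[OF assms] by simp
qed

lemma Cm_neg_laplacian_pow: "open S \<Longrightarrow> Cm (2 * k + m) S f \<Longrightarrow> Cm m S ((neg_laplacian ^^ k) f)"
  unfolding Cm_def by (rule reg_neg_laplacian_pow[OF Cm_base])

lemma Hm_neg_laplacian_pow: "0 < \<theta> \<Longrightarrow> \<theta> \<le> 1 \<Longrightarrow> Hm \<theta> (2 * k + m) f \<Longrightarrow> Hm \<theta> m ((neg_laplacian ^^ k) f)"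
  unfolding Hm_def by (rule reg_neg_laplacian_pow[OF Hm_base])

lemma neg_laplacian_cong_open:
  assumes "open S" "x \<in> S" "\<And>y. y \<in> S \<Longrightarrow> f y = g y"
  shows "neg_laplacian f x = neg_laplacian g x"
proof -
  have "partial i (partial i f) x = partial i (partial i g) x" for i
    by (intro partial_cong_open[OF assms(1,2)] partial_cong_open[OF assms(1)] assms(3))
  then show ?thesis by (simp add: neg_laplacian_def)
qed

lemma neg_laplacian_pow_cong_open:
  assumes "open S" "\<And>y. y \<in> S \<Longrightarrow> f y = g y" "x \<in> S"
  shows "(neg_laplacian ^^ k) f x = (neg_laplacian ^^ k) g x"
  using assms(3)
proof (induction k arbitrary: x)
  case 0 then show ?case by (simp add: assms)
next
  case (Suc k)
  show ?case by (simp, rule neg_laplacian_cong_open[OF assms(1) Suc.prems], rule Suc.IH)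
qed

lemma neg_laplacian_zero: "(neg_laplacian ^^ k) (\<lambda>_ :: real ^ 'n. 0) = (\<lambda>_. 0)"
proof -
  have "partial i (\<lambda>_ :: real ^ 'n. 0) = (\<lambda>_. 0)" for i by (simp add: fun_eq_iff)
  then have "neg_laplacian (\<lambda>_ :: real ^ 'n. 0) = (\<lambda>_. 0)" by (intro ext) (simp add: neg_laplacian_def)
  then show ?thesis by (induction k) auto
qed

lemma neg_laplacian_pow_eq_0:
  assumes "open S" "\<And>y. y \<in> S \<Longrightarrow> f y = 0" "x \<in> S"
  shows "(neg_laplacian ^^ k) f x = 0"
proof -
  have "(neg_laplacian ^^ k) f x = (neg_laplacian ^^ k) (\<lambda>_. 0) x"
    by (rule neg_laplacian_pow_cong_open[OF assms(1) _ assms(3)]) (rule assms(2))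
  then show ?thesis by (simp add: neg_laplacian_zero)
qed

lemma neg_laplacian_affine:
  assumes "Cm 2 S f" "open S" "p + \<delta> *\<^sub>R z \<in> S"
  shows "neg_laplacian (\<lambda>z. f (p + \<delta> *\<^sub>R z)) z = \<delta>\<^sup>2 * neg_laplacian f (p + \<delta> *\<^sub>R z)"
proof -
  have "partials [i, i] (\<lambda>z. f (p + \<delta> *\<^sub>R z)) z = \<delta> ^ 2 * partials [i, i] f (p + \<delta> *\<^sub>R z)" for i
  proof -
    have "Cm (length [i, i]) S f" using assms(1) unfolding numeral_2_eq_2 by simp
    from partials_affine[OF assms(2) this assms(3)] show ?thesis unfolding numeral_2_eq_2 by simp
  qed
  then show ?thesis
    by (simp add: neg_laplacian_def partials_Cons partials_Nil sum_distrib_left)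
qed

lemma neg_laplacian_cmult:
  assumes "Cm 2 S f" "open S" "x \<in> S"
  shows "neg_laplacian (\<lambda>y. c * f y) x = c * neg_laplacian f x"
proof -
  have d: "f differentiable (at y)" "partial i f differentiable (at y)" if "y \<in> S" for y i
    using assms that unfolding numeral_2_eq_2 by (auto simp: Cm_Suc)
  have "partial i (partial i (\<lambda>y. c * f y)) x = c * partial i (partial i f) x" for i
  proof -
    have "partial i (partial i (\<lambda>y. c * f y)) x = partial i (\<lambda>y. c * partial i f y) x"
      by (rule partial_cong_open[OF assms(2,3)]) (rule partial_cmult[OF d(1)])
    also have "\<dots> = c * partial i (partial i f) x" by (rule partial_cmult[OF d(2)[OF assms(3)]])
    finally show ?thesis .
  qed
  then show ?thesis by (simp add: neg_laplacian_def sum_distrib_left)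
qed

lemma neg_laplacian_add:
  assumes "Cm 2 S f" "Cm 2 S g" "open S" "x \<in> S"
  shows "neg_laplacian (\<lambda>y. f y + g y) x = neg_laplacian f x + neg_laplacian g x"
proof -
  have d: "f differentiable (at y)" "partial i f differentiable (at y)"
     "g differentiable (at y)" "partial i g differentiable (at y)" if "y \<in> S" for y i
    using assms that unfolding numeral_2_eq_2 by (auto simp: Cm_Suc)
  have "partial i (partial i (\<lambda>y. f y + g y)) x = partial i (partial i f) x + partial i (partial i g) x" for i
  proof -
    have "partial i (partial i (\<lambda>y. f y + g y)) x = partial i (\<lambda>y. partial i f y + partial i g y) x"
      by (rule partial_cong_open[OF assms(3,4)]) (rule partial_add[OF d(1,3)])
    also have "\<dots> = partial i (partial i f) x + partial i (partial i g) x"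
      by (rule partial_add[OF d(2,4)[OF assms(4)]])
    finally show ?thesis .
  qed
  then show ?thesis by (simp add: neg_laplacian_def sum.distrib)
qed

lemma neg_laplacian_pow_affine:
  assumes "open S"
  shows "\<lbrakk>Cm (2 * k) S f; p + \<delta> *\<^sub>R z \<in> S\<rbrakk> \<Longrightarrow>
     (neg_laplacian ^^ k) (\<lambda>z. f (p + \<delta> *\<^sub>R z)) z = \<delta> ^ (2 * k) * (neg_laplacian ^^ k) f (p + \<delta> *\<^sub>R z)"
proof (induction k arbitrary: z)
  case 0 then show ?case by simp
next
  case (Suc k)
  let ?S = "{z. p + \<delta> *\<^sub>R z \<in> S}"
  have o: "open ?S" by (rule open_affine_vimage[OF assms])
  have c: "Cm (2 * k) S f" by (rule Cm_mono[OF _ Suc.prems(1)]) simp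
  have c2: "Cm 2 S ((neg_laplacian ^^ k) f)"
    by (rule Cm_neg_laplacian_pow[OF assms]) (use Suc.prems(1) in simp)
  have "(neg_laplacian ^^ Suc k) (\<lambda>z. f (p + \<delta> *\<^sub>R z)) z
     = neg_laplacian (\<lambda>z. \<delta> ^ (2 * k) * (neg_laplacian ^^ k) f (p + \<delta> *\<^sub>R z)) z"
    by (simp, rule neg_laplacian_cong_open[OF o]) (use Suc.prems(2) Suc.IH[OF c] in auto)
  also have "\<dots> = \<delta> ^ (2 * k) * (\<delta>\<^sup>2 * neg_laplacian ((neg_laplacian ^^ k) f) (p + \<delta> *\<^sub>R z))"
    using Suc.prems(2) by (simp add: neg_laplacian_cmult[OF Cm_affine[OF assms c2] o] neg_laplacian_affine[OF c2 assms])
  finally show ?case by (simp add: power2_eq_square)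
qed

lemma neg_laplacian_pow_add:
  assumes "open S"
  shows "\<lbrakk>Cm (2 * k) S f; Cm (2 * k) S g; x \<in> S\<rbrakk> \<Longrightarrow>
     (neg_laplacian ^^ k) (\<lambda>y. f y + g y) x = (neg_laplacian ^^ k) f x + (neg_laplacian ^^ k) g x"
proof (induction k arbitrary: x)
  case 0 then show ?case by simp
next
  case (Suc k)
  have c: "Cm (2 * k) S f" "Cm (2 * k) S g" using Suc.prems(1,2) by (auto intro: Cm_mono[of "2 * k" "2 * Suc k"])
  have c2: "Cm 2 S ((neg_laplacian ^^ k) f)" "Cm 2 S ((neg_laplacian ^^ k) g)"
    by (rule Cm_neg_laplacian_pow[OF assms], use Suc.prems(1,2) in simp)+
  have "(neg_laplacian ^^ Suc k) (\<lambda>y. f y + g y) x = neg_laplacian (\<lambda>y. (neg_laplacian ^^ k) f y + (neg_laplacian ^^ k) g y) x"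
    by (simp, rule neg_laplacian_cong_open[OF assms Suc.prems(3)], rule Suc.IH[OF c])
  then show ?case using neg_laplacian_add[OF c2 assms Suc.prems(3)] by simp
qed

lemma neg_laplacian_pow_cmult:
  assumes "open S"
  shows "\<lbrakk>Cm (2 * k) S f; x \<in> S\<rbrakk> \<Longrightarrow>
     (neg_laplacian ^^ k) (\<lambda>y. c * f y) x = c * (neg_laplacian ^^ k) f x"
proof (induction k arbitrary: x)
  case 0 then show ?case by simp
next
  case (Suc k)
  have c: "Cm (2 * k) S f" using Suc.prems(1) by (auto intro: Cm_mono[of "2 * k" "2 * Suc k"])
  have c2: "Cm 2 S ((neg_laplacian ^^ k) f)"
    by (rule Cm_neg_laplacian_pow[OF assms]) (use Suc.prems(1) in simp)
  have "(neg_laplacian ^^ Suc k) (\<lambda>y. c * f y) x = neg_laplacian (\<lambda>y. c * (neg_laplacian ^^ k) f y) x"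
    by (simp, rule neg_laplacian_cong_open[OF assms Suc.prems(2)], rule Suc.IH[OF c])
  then show ?case using neg_laplacian_cmult[OF c2 assms Suc.prems(2)] by simp
qed

text \<open>A function on the whole space whose directional derivatives of order less than \<open>k\<close> all
vanish on the frontier is the Dirichlet solution for its own image under \<open>(-\<Delta>)^k\<close>,
so the Green function reproduces it. This is the only way in which the integral representation is used.\<close>

lemma green_function_test:
  fixes u :: "real ^ 'n \<Rightarrow> real"
  assumes G: "green_function k \<theta> U G" and \<theta>: "0 < \<theta>" "\<theta> \<le> 1" and U: "bounded U"
    and u: "Hm \<theta> (2 * k) u"
    and bc: "\<And>x v j. x \<in> frontier U \<Longrightarrow> j < k \<Longrightarrow> (ddir v ^^ j) u x = 0"
    and x: "x \<in> closure U"
  shows "set_integrable lborel U (\<lambda>y. G x y * (neg_laplacian ^^ k) u y)"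
    "u x = (LINT y:U|lborel. G x y * (neg_laplacian ^^ k) u y)"
proof -
  let ?f = "(neg_laplacian ^^ k) u"
  have f: "C_holder 0 \<theta> U ?f"
    using u by (intro Hm_imp_C_holder[OF _ U] Hm_neg_laplacian_pow[OF \<theta>]) simp
  have "dirichlet_solution k \<theta> U ?f u"
    unfolding dirichlet_solution_def
    using Hm_imp_C_holder[OF u U] bc normal_derivative_eq_ddir_pow[OF Hm_imp_Cm[OF u]] by auto
  with f G x show "set_integrable lborel U (\<lambda>y. G x y * (neg_laplacian ^^ k) u y)"
    "u x = (LINT y:U|lborel. G x y * (neg_laplacian ^^ k) u y)"
    unfolding green_function_def by blast+
qed

section \<open>Integration by parts on a half-space\<close>

text \<open>The truncated power; for \<open>m = 0\<close> it is the indicator function of the open half-line, not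
the constant \<open>1\<close>.\<close>

definition pos_pow :: "nat \<Rightarrow> real \<Rightarrow> real" where
  "pos_pow m s = (if s > 0 then s ^ m else 0)"

text \<open>The integral of \<open>(z \<bullet> \<nu>)^m F\<close> over the half-space \<open>z \<bullet> \<nu> >
0\<close>.\<close>

definition half_int :: "real ^ 'n \<Rightarrow> nat \<Rightarrow> (real ^ 'n \<Rightarrow> real) \<Rightarrow> real" where
  "half_int \<nu> m F = (LINT z|lborel. pos_pow m (z \<bullet> \<nu>) * F z)"

lemma pos_pow_measurable [measurable]: "pos_pow m \<in> borel_measurable borel"
  unfolding pos_pow_def[abs_def] by measurable

lemma pos_pow_bound: "\<bar>s\<bar> \<le> L \<Longrightarrow> \<bar>pos_pow m s\<bar> \<le> (1 + L) ^ m"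
  by (auto simp: pos_pow_def intro!: power_mono)

lemma integrable_indicator_cball:
  "integrable lborel (\<lambda>z :: real ^ 'n. indicator (cball 0 R) z * (K :: real))"
proof -
  have "emeasure lborel (cball (0 :: real ^ 'n) R) < \<infinity>" by (rule emeasure_bounded_finite) simp
  then show ?thesis by (intro integrable_mult_left integrable_real_indicator) simp_all
qed

lemma integrable_bounded_support:
  fixes g :: "real ^ 'n \<Rightarrow> real"
  assumes "g \<in> borel_measurable borel" "\<And>z. z \<notin> cball 0 R \<Longrightarrow> g z = 0" "\<And>z. z \<in> cball 0 R \<Longrightarrow> \<bar>g z\<bar> \<le> K"
  shows "integrable lborel g"
proof (rule Bochner_Integration.integrable_bound)
  show "integrable lborel (\<lambda>z :: real ^ 'n. indicator (cball 0 R) z * K)"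
    by (rule integrable_indicator_cball)
  show "g \<in> borel_measurable lborel" using assms(1) by simp
  show "AE z in lborel. norm (g z) \<le> norm (indicator (cball 0 R) z * K)"
  proof (rule AE_I2)
    fix z show "norm (g z) \<le> norm (indicator (cball 0 R) z * K)"
      using assms(2,3)[of z] by (cases "z \<in> cball 0 R") auto
  qed
qed

lemma continuous_bounded_cball:
  fixes F :: "real ^ 'n \<Rightarrow> real"
  assumes "continuous_on UNIV F"
  obtains K where "K \<ge> 0" "\<And>z. z \<in> cball 0 R \<Longrightarrow> \<bar>F z\<bar> \<le> K"
proof -
  have "bounded (F ` cball 0 R)"
    using assms by (intro compact_imp_bounded compact_continuous_image) (auto intro: continuous_on_subset)
  then obtain K where "\<forall>z\<in>cball 0 R. \<bar>F z\<bar> \<le> K" unfolding bounded_real by blast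
  then show ?thesis using that[of "\<bar>K\<bar>"] by force
qed

lemma half_int_integrable:
  fixes F :: "real ^ 'n \<Rightarrow> real"
  assumes "continuous_on UNIV F" "\<And>z. z \<notin> cball 0 R \<Longrightarrow> F z = 0"
  shows "integrable lborel (\<lambda>z. pos_pow m (z \<bullet> \<nu>) * F z)"
proof -
  obtain K where K: "K \<ge> 0" "\<And>z. z \<in> cball 0 R \<Longrightarrow> \<bar>F z\<bar> \<le> K"
    using continuous_bounded_cball[OF assms(1)] by blast
  have [measurable]: "F \<in> borel_measurable borel" using assms(1) by (rule borel_measurable_continuous_onI)
  show ?thesis
  proof (rule integrable_bounded_support[where R = R and K = "(1 + R * norm \<nu>) ^ m * K"])
    show "(\<lambda>z. pos_pow m (z \<bullet> \<nu>) * F z) \<in> borel_measurable borel" by measurable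
    fix z :: "real ^ 'n" assume z: "z \<in> cball 0 R"
    have "\<bar>z \<bullet> \<nu>\<bar> \<le> R * norm \<nu>"
      using Cauchy_Schwarz_ineq2[of z \<nu>] z by (smt (verit) mem_cball_0 mult_right_mono norm_ge_zero)
    then show "\<bar>pos_pow m (z \<bullet> \<nu>) * F z\<bar> \<le> (1 + R * norm \<nu>) ^ m * K"
      unfolding abs_mult using K z pos_pow_bound by (intro mult_mono) auto
  qed (use assms in auto)
qed

lemma half_int_add:
  assumes "continuous_on UNIV F" "\<And>z. z \<notin> cball 0 R \<Longrightarrow> F z = 0"
    and "continuous_on UNIV G" "\<And>z. z \<notin> cball 0 R \<Longrightarrow> G z = 0"
  shows "half_int \<nu> m (\<lambda>z. F z + G z) = half_int \<nu> m F + half_int \<nu> m G"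
  unfolding half_int_def using half_int_integrable[OF assms(1,2)] half_int_integrable[OF assms(3,4)]
  by (simp add: distrib_left)

lemma half_int_cmult: "half_int \<nu> m (\<lambda>z. c * F z) = c * half_int \<nu> m F"
  unfolding half_int_def by (simp add: mult.left_commute)

lemma half_int_sum:
  assumes "finite I" "\<And>i. i \<in> I \<Longrightarrow> continuous_on UNIV (F i)" "\<And>i z. i \<in> I \<Longrightarrow> z \<notin> cball 0 R \<Longrightarrow> F i z = 0"
  shows "half_int \<nu> m (\<lambda>z. \<Sum>i\<in>I. c i * F i z) = (\<Sum>i\<in>I. c i * half_int \<nu> m (F i))"
proof -
  have "integrable lborel (\<lambda>z. c i * (pos_pow m (z \<bullet> \<nu>) * F i z))" if "i \<in> I" for i
    by (intro integrable_mult_right half_int_integrable) (use assms that in auto)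
  then show ?thesis unfolding half_int_def
    by (simp add: sum_distrib_left mult.left_commute[of "pos_pow m _"] Bochner_Integration.integral_sum)
qed

lemma half_int_mult_linear: "half_int \<nu> m (\<lambda>z. (z \<bullet> \<nu>) * F z) = half_int \<nu> (Suc m) F"
  unfolding half_int_def pos_pow_def by (intro Bochner_Integration.integral_cong) auto

lemma AE_off_hyperplane:
  assumes "\<nu> \<noteq> (0 :: real ^ 'n)"
  shows "AE z in lborel. z \<bullet> \<nu> \<noteq> 0"
proof (rule AE_I')
  have "closed {z. \<nu> \<bullet> z = 0}" by (rule closed_hyperplane)
  moreover have "negligible {z. \<nu> \<bullet> z = 0}" using assms by (intro negligible_hyperplane) auto
  ultimately show "{z. \<nu> \<bullet> z = 0} \<in> null_sets lborel"
    by (simp add: negligible_iff_null_sets null_sets_completion_iff)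
qed (auto simp: inner_commute)

lemma DERIV_pos_pow:
  assumes "s \<noteq> 0"
  shows "(pos_pow m has_real_derivative (real m * pos_pow (m - 1) s)) (at s)"
proof (cases "s > 0")
  case True
  have "((\<lambda>t. t ^ m) has_real_derivative real m * s ^ (m - 1)) (at s)"
    using DERIV_pow[of m s UNIV] by simp
  moreover have "\<forall>\<^sub>F t in nhds s. pos_pow m t = t ^ m"
    using eventually_nhds_in_open[of "{0<..}" s] True by (auto elim!: eventually_mono simp: pos_pow_def)
  ultimately show ?thesis using True by (subst DERIV_cong_ev) (auto simp: pos_pow_def)
next
  case False
  have "\<forall>\<^sub>F t in nhds s. pos_pow m t = 0"
    using eventually_nhds_in_open[of "{..<0}" s] False assms by (auto elim!: eventually_mono simp: pos_pow_def)
  then show ?thesis using False by (subst DERIV_cong_ev) (auto simp: pos_pow_def)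
qed

lemma pos_pow_lipschitz:
  assumes "m \<ge> 1" "\<bar>s\<bar> \<le> L" "\<bar>t\<bar> \<le> L"
  shows "\<bar>pos_pow m s - pos_pow m t\<bar> \<le> real m * L ^ (m - 1) * \<bar>s - t\<bar>"
proof -
  have e: "pos_pow m s = max 0 s ^ m" for s using assms(1) by (auto simp: pos_pow_def max_def power_0_left)
  define a where "a = max 0 s"
  define b where "b = max 0 t"
  have ab: "0 \<le> a" "a \<le> L" "0 \<le> b" "b \<le> L" "\<bar>a - b\<bar> \<le> \<bar>s - t\<bar>" using assms by (auto simp: a_def b_def)
  have "\<bar>a ^ m - b ^ m\<bar> = \<bar>a - b\<bar> * \<bar>\<Sum>i<m. b ^ (m - Suc i) * a ^ i\<bar>"
    by (simp add: power_diff_sumr2 abs_mult)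
  also have "\<bar>\<Sum>i<m. b ^ (m - Suc i) * a ^ i\<bar> \<le> (\<Sum>i<m. L ^ (m - 1))"
  proof (rule order_trans[OF sum_abs sum_mono])
    fix i assume i: "i \<in> {..<m}"
    have "\<bar>b ^ (m - Suc i) * a ^ i\<bar> \<le> L ^ (m - Suc i) * L ^ i"
      unfolding abs_mult using ab by (intro mult_mono) (auto simp: power_mono)
    also have "\<dots> = L ^ (m - 1)" using i by (simp flip: power_add)
    finally show "\<bar>b ^ (m - Suc i) * a ^ i\<bar> \<le> L ^ (m - 1)" .
  qed
  finally have "\<bar>a ^ m - b ^ m\<bar> \<le> \<bar>a - b\<bar> * (real m * L ^ (m - 1))"
    by (simp add: mult_left_mono)
  also have "\<dots> \<le> \<bar>s - t\<bar> * (real m * L ^ (m - 1))"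
    using ab by (intro mult_right_mono) auto
  finally show ?thesis by (simp add: e a_def b_def algebra_simps)
qed

lemma lborel_integral_shift:
  fixes g :: "real ^ 'n \<Rightarrow> real"
  assumes [measurable]: "g \<in> borel_measurable borel"
  shows "(LINT z|lborel. g (z + a)) = (LINT z|lborel. g z)"
proof -
  have "(LINT z|lborel. g z) = (LINT z|distr lborel borel ((+) a). g z)" by (simp add: lborel_distr_plus)
  also have "\<dots> = (LINT z|lborel. g (a + z))" by (subst integral_distr) auto
  finally show ?thesis by (simp add: add.commute)
qed

text \<open>Integration by parts, by translation invariance: the difference quotient of \<open>F\<close> is moved to
the weight, and dominated convergence applies on both sides. Off the hyperplane the weight is
differentiable; at the hyperplane it is Lipschitz for \<open>m \<ge> 1\<close> but jumps for \<open>m =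
0\<close>, and then only tangential directions are allowed.\<close>

lemma half_int_ddir:
  fixes F :: "real ^ 'n \<Rightarrow> real"
  assumes \<nu>: "\<nu> \<noteq> 0" and F: "Cm 1 UNIV F" and supp: "\<And>z. z \<notin> cball 0 R \<Longrightarrow> F z = 0"
    and mv: "m \<ge> 1 \<or> v \<bullet> \<nu> = 0" and R: "R \<ge> 0"
  shows "half_int \<nu> m (ddir v F) = - (v \<bullet> \<nu>) * real m * half_int \<nu> (m - 1) F"
proof -
  define h where "h j = inverse (real (Suc j))" for j
  have h: "0 < h j" "h j \<le> 1" for j by (auto simp: h_def field_simps)
  have h0: "h \<longlonglongrightarrow> 0" unfolding h_def by (rule LIMSEQ_inverse_real_of_nat)
  have hat: "filterlim h (at 0) sequentially"
    using h0 h(1) by (auto simp: filterlim_at intro!: always_eventually less_imp_neq[symmetric])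
  define c where "c = v \<bullet> \<nu>"
  have contF: "continuous_on UNIV F" by (rule Cm_continuous[OF F])
  have [measurable]: "F \<in> borel_measurable borel" using contF by (rule borel_measurable_continuous_onI)
  have contD: "continuous_on UNIV (ddir v F)"
    using Cm_ddir[OF open_UNIV, of 0 F v] F by (simp add: Cm_0)
  then have [measurable]: "ddir v F \<in> borel_measurable borel" by (rule borel_measurable_continuous_onI)
  have diffF: "F differentiable (at x)" for x using F by (simp add: Cm_Suc)
  define R' where "R' = R + norm v"
  obtain K where K: "K \<ge> 0" "\<And>z. z \<in> cball 0 (R' + norm v) \<Longrightarrow> \<bar>ddir v F z\<bar> \<le> K"
    using continuous_bounded_cball[OF contD] by blast
  obtain KF where KF: "KF \<ge> 0" "\<And>z. z \<in> cball 0 R \<Longrightarrow> \<bar>F z\<bar> \<le> KF"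
    using continuous_bounded_cball[OF contF] by blast
  define A where "A j = (LINT z|lborel. pos_pow m (z \<bullet> \<nu>) * ((F (z + h j *\<^sub>R v) - F z) / h j))" for j
  have inner_bd: "\<bar>z \<bullet> \<nu>\<bar> \<le> r * norm \<nu>" if "z \<in> cball 0 r" for z r
    using Cauchy_Schwarz_ineq2[of z \<nu>] that by (smt (verit) mem_cball_0 mult_right_mono norm_ge_zero)
  have ball_sub: "z \<in> cball 0 R'" if "z + t *\<^sub>R v \<in> cball 0 R" "0 \<le> t" "t \<le> 1" for z t
  proof -
    have "norm z \<le> norm (z + t *\<^sub>R v) + norm (t *\<^sub>R v)" using norm_triangle_ineq4[of "z + t *\<^sub>R v" "t *\<^sub>R v"] by simp
    moreover have "norm (t *\<^sub>R v) \<le> norm v" using that by (simp add: mult_left_le_one_le)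
    ultimately show ?thesis using that by (simp add: R'_def)
  qed
  have lim1: "A \<longlonglongrightarrow> half_int \<nu> m (ddir v F)"
    unfolding A_def half_int_def
  proof (rule integral_dominated_convergence)
    show "integrable lborel (\<lambda>z :: real ^ 'n. indicator (cball 0 R') z * ((1 + R' * norm \<nu>) ^ m * K))"
      by (rule integrable_indicator_cball)
    show "AE z in lborel. (\<lambda>j. pos_pow m (z \<bullet> \<nu>) * ((F (z + h j *\<^sub>R v) - F z) / h j)) \<longlonglongrightarrow> pos_pow m (z \<bullet> \<nu>) * ddir v F z"
    proof (rule AE_I2)
      fix z
      have "((\<lambda>t. F (z + t *\<^sub>R v)) has_real_derivative ddir v F z) (at 0)"
        using DERIV_along[of F z 0 v] diffF by simp
      then have "((\<lambda>t. (F (z + t *\<^sub>R v) - F z) / t) \<longlongrightarrow> ddir v F z) (at 0)"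
        by (simp add: DERIV_def)
      from filterlim_compose[OF this hat]
      show "(\<lambda>j. pos_pow m (z \<bullet> \<nu>) * ((F (z + h j *\<^sub>R v) - F z) / h j)) \<longlonglongrightarrow> pos_pow m (z \<bullet> \<nu>) * ddir v F z"
        by (rule tendsto_mult_left)
    qed
    show "AE z in lborel. norm (pos_pow m (z \<bullet> \<nu>) * ((F (z + h j *\<^sub>R v) - F z) / h j)) \<le> indicator (cball 0 R') z * ((1 + R' * norm \<nu>) ^ m * K)" for j
    proof (rule AE_I2)
      fix z
      show "norm (pos_pow m (z \<bullet> \<nu>) * ((F (z + h j *\<^sub>R v) - F z) / h j)) \<le> indicator (cball 0 R') z * ((1 + R' * norm \<nu>) ^ m * K)"
      proof (cases "z \<in> cball 0 R'")
        case False
        then have "F (z + h j *\<^sub>R v) = 0" using ball_sub[of z "h j"] h[of j] by (intro supp) auto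
        moreover have "F z = 0" using ball_sub[of z 0] False by (intro supp) auto
        ultimately show ?thesis using False by simp
      next
        case True
        obtain t where t: "0 < t" "t < h j" "F (z + h j *\<^sub>R v) - F (z + 0 *\<^sub>R v) = (h j - 0) * ddir v F (z + t *\<^sub>R v)"
          using MVT2[OF h(1)[of j], of "\<lambda>t. F (z + t *\<^sub>R v)" "\<lambda>t. ddir v F (z + t *\<^sub>R v)"] DERIV_along[OF diffF] by blast
        have "norm (z + t *\<^sub>R v) \<le> norm z + norm (t *\<^sub>R v)" by (rule norm_triangle_ineq)
        also have "\<dots> \<le> R' + norm v" using True t h[of j] by (intro add_mono) (auto simp: mult_left_le_one_le)
        finally have "\<bar>ddir v F (z + t *\<^sub>R v)\<bar> \<le> K" by (intro K(2)) simp
        moreover have "(F (z + h j *\<^sub>R v) - F z) / h j = ddir v F (z + t *\<^sub>R v)" using t h(1)[of j] by simp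
        ultimately have "\<bar>pos_pow m (z \<bullet> \<nu>)\<bar> * \<bar>(F (z + h j *\<^sub>R v) - F z) / h j\<bar> \<le> (1 + R' * norm \<nu>) ^ m * K"
          using K(1) inner_bd[OF True] pos_pow_bound by (intro mult_mono) auto
        then show ?thesis using True by (simp add: abs_mult)
      qed
    qed
  qed measurable
  \<comment> \<open>the same quantity after the substitution that shifts \<open>z + h v\<close> back to
     \<open>z\<close>\<close>
  have A_eq: "A j = (LINT z|lborel. ((pos_pow m (z \<bullet> \<nu> - h j * c) - pos_pow m (z \<bullet> \<nu>)) / h j) * F z)" for j
  proof -
    let ?g = "\<lambda>z. pos_pow m (z \<bullet> \<nu> - h j * c) * F z"
    have sh: "?g (z + h j *\<^sub>R v) = pos_pow m (z \<bullet> \<nu>) * F (z + h j *\<^sub>R v)" for z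
      by (simp add: inner_add_left c_def)
    have i1: "integrable lborel (\<lambda>z. pos_pow m (z \<bullet> \<nu>) * F (z + h j *\<^sub>R v))"
    proof (rule half_int_integrable)
      show "continuous_on UNIV (\<lambda>z. F (z + h j *\<^sub>R v))"
        by (rule continuous_on_compose2[OF contF]) (auto intro!: continuous_intros)
      show "F (z + h j *\<^sub>R v) = 0" if "z \<notin> cball 0 R'" for z
        using that ball_sub[of z "h j"] h[of j] by (intro supp) auto
    qed
    have i2: "integrable lborel (\<lambda>z. pos_pow m (z \<bullet> \<nu>) * F z)" by (rule half_int_integrable[OF contF supp])
    have i3: "integrable lborel ?g"
    proof (rule integrable_bounded_support[where R = R and K = "(1 + (R * norm \<nu> + \<bar>c\<bar>)) ^ m * KF"])
      fix z :: "real ^ 'n" assume z: "z \<in> cball 0 R"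
      have "\<bar>h j * c\<bar> \<le> \<bar>c\<bar>" using h[of j] by (simp add: abs_mult mult_left_le_one_le)
      then have "\<bar>z \<bullet> \<nu> - h j * c\<bar> \<le> R * norm \<nu> + \<bar>c\<bar>" using inner_bd[OF z] by linarith
      then show "\<bar>?g z\<bar> \<le> (1 + (R * norm \<nu> + \<bar>c\<bar>)) ^ m * KF"
        unfolding abs_mult using KF z pos_pow_bound R by (intro mult_mono) auto
    qed (use supp in auto)
    have "A j = ((LINT z|lborel. pos_pow m (z \<bullet> \<nu>) * F (z + h j *\<^sub>R v)) - (LINT z|lborel. pos_pow m (z \<bullet> \<nu>) * F z)) / h j"
    proof -
      have "A j = (LINT z|lborel. (pos_pow m (z \<bullet> \<nu>) * F (z + h j *\<^sub>R v) - pos_pow m (z \<bullet> \<nu>) * F z) / h j)"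
        unfolding A_def by (simp only: right_diff_distrib times_divide_eq_right)
      then show ?thesis
        by (simp only: integral_divide_zero Bochner_Integration.integral_diff[OF i1 i2])
    qed
    also have "(LINT z|lborel. pos_pow m (z \<bullet> \<nu>) * F (z + h j *\<^sub>R v)) = (LINT z|lborel. ?g z)"
      using lborel_integral_shift[of ?g "h j *\<^sub>R v"] unfolding sh by simp
    also have "((LINT z|lborel. ?g z) - (LINT z|lborel. pos_pow m (z \<bullet> \<nu>) * F z)) / h j
       = (LINT z|lborel. ((pos_pow m (z \<bullet> \<nu> - h j * c) - pos_pow m (z \<bullet> \<nu>)) / h j) * F z)"
      by (simp only: Bochner_Integration.integral_diff[OF i3 i2, symmetric] integral_divide_zero[symmetric]
            left_diff_distrib times_divide_eq_left)
    finally show ?thesis .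
  qed
  have lim2: "A \<longlonglongrightarrow> (LINT z|lborel. (- c * (real m * pos_pow (m - 1) (z \<bullet> \<nu>))) * F z)"
    unfolding A_eq[abs_def]
  proof (rule integral_dominated_convergence)
    define L where "L = R * norm \<nu> + \<bar>c\<bar>"
    show "integrable lborel (\<lambda>z :: real ^ 'n. indicator (cball 0 R) z * (real m * L ^ (m - 1) * \<bar>c\<bar> * KF))"
      by (rule integrable_indicator_cball)
    show "AE z in lborel. (\<lambda>j. ((pos_pow m (z \<bullet> \<nu> - h j * c) - pos_pow m (z \<bullet> \<nu>)) / h j) * F z) \<longlonglongrightarrow> (- c * (real m * pos_pow (m - 1) (z \<bullet> \<nu>))) * F z"
      using AE_off_hyperplane[OF \<nu>]
    proof eventually_elim
      case (elim z)
      have "((\<lambda>t. pos_pow m (z \<bullet> \<nu> - t * c)) has_real_derivative (real m * pos_pow (m - 1) (z \<bullet> \<nu>)) * (- c)) (at 0)"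
      proof -
        have 1: "(pos_pow m has_real_derivative real m * pos_pow (m - 1) (z \<bullet> \<nu>)) (at (z \<bullet> \<nu> - 0 * c))"
          using DERIV_pos_pow[OF elim, of m] by simp
        have 2: "((\<lambda>t. z \<bullet> \<nu> - t * c) has_real_derivative - c) (at 0)"
          by (auto intro!: derivative_eq_intros)
        show ?thesis by (rule DERIV_chain2[OF 1 2])
      qed
      then have "((\<lambda>t. (pos_pow m (z \<bullet> \<nu> - t * c) - pos_pow m (z \<bullet> \<nu>)) / t) \<longlongrightarrow> (- c * (real m * pos_pow (m - 1) (z \<bullet> \<nu>)))) (at 0)"
        by (simp add: DERIV_def mult.commute)
      from filterlim_compose[OF this hat] show ?case by (rule tendsto_mult_right)
    qed
    show "AE z in lborel. norm (((pos_pow m (z \<bullet> \<nu> - h j * c) - pos_pow m (z \<bullet> \<nu>)) / h j) * F z) \<le> indicator (cball 0 R) z * (real m * L ^ (m - 1) * \<bar>c\<bar> * KF)" for j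
    proof (rule AE_I2)
      fix z
      show "norm (((pos_pow m (z \<bullet> \<nu> - h j * c) - pos_pow m (z \<bullet> \<nu>)) / h j) * F z) \<le> indicator (cball 0 R) z * (real m * L ^ (m - 1) * \<bar>c\<bar> * KF)"
      proof (cases "z \<in> cball 0 R")
        case False then show ?thesis using supp by simp
      next
        case True
        have q: "\<bar>pos_pow m (z \<bullet> \<nu> - h j * c) - pos_pow m (z \<bullet> \<nu>)\<bar> \<le> real m * L ^ (m - 1) * (h j * \<bar>c\<bar>)"
        proof (cases "m \<ge> 1")
          case True
          have "\<bar>h j * c\<bar> \<le> \<bar>c\<bar>" using h[of j] by (simp add: abs_mult mult_left_le_one_le)
          then have "\<bar>z \<bullet> \<nu> - h j * c\<bar> \<le> L" "\<bar>z \<bullet> \<nu>\<bar> \<le> L"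
            using inner_bd[OF \<open>z \<in> cball 0 R\<close>] unfolding L_def by linarith+
          from pos_pow_lipschitz[OF True this] show ?thesis using h(1)[of j] by (simp add: abs_mult)
        next
          case False
          then show ?thesis using mv by (simp add: c_def)
        qed
        have "\<bar>(pos_pow m (z \<bullet> \<nu> - h j * c) - pos_pow m (z \<bullet> \<nu>)) / h j\<bar> \<le> real m * L ^ (m - 1) * \<bar>c\<bar>"
          using q h(1)[of j] by (simp add: abs_divide divide_le_eq algebra_simps)
        then have "\<bar>(pos_pow m (z \<bullet> \<nu> - h j * c) - pos_pow m (z \<bullet> \<nu>)) / h j\<bar> * \<bar>F z\<bar> \<le> real m * L ^ (m - 1) * \<bar>c\<bar> * KF"
          using KF True R by (intro mult_mono) (auto simp: L_def)
        then show ?thesis using True by (simp add: abs_mult)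
      qed
    qed
  qed measurable
  have "half_int \<nu> m (ddir v F) = (LINT z|lborel. (- c * (real m * pos_pow (m - 1) (z \<bullet> \<nu>))) * F z)"
    by (rule LIMSEQ_unique[OF lim1 lim2])
  also have "\<dots> = (LINT z|lborel. (- c * real m) * (pos_pow (m - 1) (z \<bullet> \<nu>) * F z))"
    by (simp only: mult.assoc)
  also have "\<dots> = - c * real m * half_int \<nu> (m - 1) F" unfolding half_int_def by simp
  finally show ?thesis by (simp add: c_def)
qed

section \<open>A non-vanishing polyharmonic integral over a half-space\<close>

lemma partial_sum:
  assumes "open S" "finite I" "\<And>i. i \<in> I \<Longrightarrow> Cm 1 S (F i)" "x \<in> S"
  shows "partial j (\<lambda>y. \<Sum>i\<in>I. c i * F i y) x = (\<Sum>i\<in>I. c i * partial j (F i) x)"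
  using ddir_pow_sum[of S I 1 F x "axis j 1" c] assms by (simp add: ddir_axis)

lemma neg_laplacian_partials: "neg_laplacian F x = (\<Sum>i\<in>UNIV. -1 * partials [i, i] F x)"
  by (simp add: neg_laplacian_def partials_Cons partials_Nil sum_negf)

lemma ddir_neg_laplacian:
  fixes F :: "real ^ 'n \<Rightarrow> real"
  assumes "Cm 3 UNIV F"
  shows "neg_laplacian (ddir \<nu> F) x = ddir \<nu> (neg_laplacian F) x"
proof -
  have C: "Cm (3 - length js) UNIV (partials js F)" if "length js \<le> 3" for js
    by (rule Cm_partials) (use assms that in simp)
  have 1: "partial i (ddir \<nu> F) = (\<lambda>y. \<Sum>j\<in>UNIV. \<nu> $ j * partials [i, j] F y)" for i
  proof
    fix y
    have "partial i (\<lambda>y. \<Sum>j\<in>UNIV. \<nu> $ j * partials [j] F y) y = (\<Sum>j\<in>UNIV. \<nu> $ j * partial i (partials [j] F) y)"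
    proof (rule partial_sum[OF open_UNIV])
      show "Cm 1 UNIV (partials [j] F)" for j by (rule Cm_mono[OF _ C]) auto
    qed auto
    then show "partial i (ddir \<nu> F) y = (\<Sum>j\<in>UNIV. \<nu> $ j * partials [i, j] F y)"
      by (simp add: ddir_def[abs_def] partials_Cons partials_Nil)
  qed
  have 2: "partial i (partial i (ddir \<nu> F)) x = (\<Sum>j\<in>UNIV. \<nu> $ j * partials [i, i, j] F x)" for i
  proof -
    have "partial i (\<lambda>y. \<Sum>j\<in>UNIV. \<nu> $ j * partials [i, j] F y) x = (\<Sum>j\<in>UNIV. \<nu> $ j * partial i (partials [i, j] F) x)"
    proof (rule partial_sum[OF open_UNIV])
      show "Cm 1 UNIV (partials [i, j] F)" for j by (rule Cm_mono[OF _ C]) auto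
    qed auto
    then show ?thesis unfolding 1 by (simp add: partials_Cons)
  qed
  have 3: "partial j (neg_laplacian F) x = (\<Sum>i\<in>UNIV. -1 * partials [j, i, i] F x)" for j
  proof -
    have "partial j (\<lambda>y. \<Sum>i\<in>UNIV. -1 * partials [i, i] F y) x = (\<Sum>i\<in>UNIV. -1 * partial j (partials [i, i] F) x)"
    proof (rule partial_sum[OF open_UNIV])
      show "Cm 1 UNIV (partials [i, i] F)" for i by (rule Cm_mono[OF _ C]) auto
    qed auto
    then show ?thesis unfolding neg_laplacian_partials[abs_def] by (simp add: partials_Cons)
  qed
  have 4: "partials [i, i, j] F x = partials [j, i, i] F x" for i j
    by (rule partials_mset_eq[OF open_UNIV]) (use assms in \<open>auto simp: eval_nat_numeral\<close>)
  have "neg_laplacian (ddir \<nu> F) x = (\<Sum>i\<in>UNIV. \<Sum>j\<in>UNIV. \<nu> $ j * (-1 * partials [i, i, j] F x))"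
    unfolding neg_laplacian_def 2 by (simp add: sum_negf)
  also have "\<dots> = (\<Sum>i\<in>UNIV. \<Sum>j\<in>UNIV. \<nu> $ j * (-1 * partials [j, i, i] F x))"
    by (intro sum.cong refl arg_cong2[where f = "(*)"] 4)
  also have "\<dots> = (\<Sum>j\<in>UNIV. \<Sum>i\<in>UNIV. \<nu> $ j * (-1 * partials [j, i, i] F x))" by (rule sum.swap)
  also have "\<dots> = ddir \<nu> (neg_laplacian F) x"
    unfolding ddir_def 3 by (simp only: sum_distrib_left)
  finally show ?thesis .
qed

lemma Cm_inner: "open S \<Longrightarrow> Cm m S (\<lambda>z. z \<bullet> \<nu>)"
  unfolding inner_vec_def inner_real_def by (intro Cm_sum Cm_mult Cm_component Cm_const) auto

lemma partial_inner: "partial i (\<lambda>z. z \<bullet> \<nu>) x = \<nu> $ i"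
proof -
  have "((\<lambda>z. z \<bullet> \<nu>) has_derivative (\<lambda>z. z \<bullet> \<nu>)) (at x)"
    by (intro bounded_linear_imp_has_derivative bounded_linear_inner_left)
  from partial_eq_derivative[OF this] show ?thesis by (simp add: inner_axis inner_commute)
qed

lemma ddir_inner: "ddir v (\<lambda>z. z \<bullet> \<nu>) x = v \<bullet> \<nu>"
  unfolding ddir_def partial_inner by (simp add: inner_vec_def)

lemma neg_laplacian_inner_mult:
  assumes "Cm 2 UNIV X"
  shows "neg_laplacian (\<lambda>z. (z \<bullet> \<nu>) * X z) x = (x \<bullet> \<nu>) * neg_laplacian X x - 2 * ddir \<nu> X x"
proof -
  have d: "X differentiable (at y)" "partial i X differentiable (at y)" "(\<lambda>z. z \<bullet> \<nu>) differentiable (at y)" for y i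
    using assms Cm_inner[of UNIV 1 \<nu>] unfolding numeral_2_eq_2 by (auto simp: Cm_Suc)
  have 1: "partial i (\<lambda>z. (z \<bullet> \<nu>) * X z) = (\<lambda>y. \<nu> $ i * X y + (y \<bullet> \<nu>) * partial i X y)" for i
    by (rule ext) (simp add: partial_mult d partial_inner)
  have "partial i (partial i (\<lambda>z. (z \<bullet> \<nu>) * X z)) x = 2 * (\<nu> $ i * partial i X x) + (x \<bullet> \<nu>) * partial i (partial i X) x" for i
  proof -
    have "partial i (\<lambda>y. \<nu> $ i * X y + (y \<bullet> \<nu>) * partial i X y) x
      = partial i (\<lambda>y. \<nu> $ i * X y) x + partial i (\<lambda>y. (y \<bullet> \<nu>) * partial i X y) x"
      using d by (intro partial_add differentiable_mult) auto
    also have "\<dots> = \<nu> $ i * partial i X x + (\<nu> $ i * partial i X x + (x \<bullet> \<nu>) * partial i (partial i X) x)"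
      by (simp add: partial_cmult partial_mult d partial_inner)
    finally show ?thesis unfolding 1 by simp
  qed
  then show ?thesis
    by (simp add: neg_laplacian_def ddir_def sum.distrib sum_distrib_left)
qed

text \<open>The commutator of \<open>(-\<Delta>)^(k+1)\<close> with multiplication by the linear function \<open>z
\<bullet> \<nu>\<close>: the linear function has constant gradient \<open>\<nu>\<close> and no second
derivatives, so each Laplacian contributes one term \<open>-2 \<partial>_\<nu>\<close>.\<close>

lemma neg_laplacian_pow_inner_mult:
  fixes X :: "real ^ 'n \<Rightarrow> real"
  assumes "Cm (2 * k + 2) UNIV X"
  shows "(neg_laplacian ^^ Suc k) (\<lambda>z. (z \<bullet> \<nu>) * X z)
      = (\<lambda>x. (x \<bullet> \<nu>) * (neg_laplacian ^^ Suc k) X x - 2 * real (Suc k) * ddir \<nu> ((neg_laplacian ^^ k) X) x)"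
  using assms
proof (induction k)
  case 0
  then have "Cm 2 UNIV X" by (metis add_0 mult_0_right)
  from neg_laplacian_inner_mult[OF this, of \<nu>] show ?case by (intro ext) simp
next
  case (Suc k)
  let ?N = "neg_laplacian"
  have c: "Cm (2 * k + 2) UNIV X" using Suc.prems by (rule Cm_mono[rotated]) simp
  have c2: "Cm 2 UNIV ((?N ^^ Suc k) X)"
    by (rule Cm_neg_laplacian_pow[OF open_UNIV]) (use Suc.prems in simp)
  have c3: "Cm 3 UNIV ((?N ^^ k) X)"
    by (rule Cm_neg_laplacian_pow[OF open_UNIV]) (rule Cm_mono[OF _ Suc.prems], simp)
  have c4: "Cm 2 UNIV (ddir \<nu> ((?N ^^ k) X))"
    using c3 by (intro Cm_ddir) (simp_all add: eval_nat_numeral)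
  show ?case
  proof
    fix x
    have "(?N ^^ Suc (Suc k)) (\<lambda>z. (z \<bullet> \<nu>) * X z) x
      = ?N (\<lambda>x. (x \<bullet> \<nu>) * (?N ^^ Suc k) X x + (- 2 * real (Suc k)) * ddir \<nu> ((?N ^^ k) X) x) x"
    proof -
      have "(?N ^^ Suc k) (\<lambda>z. (z \<bullet> \<nu>) * X z)
        = (\<lambda>x. (x \<bullet> \<nu>) * (?N ^^ Suc k) X x + (- 2 * real (Suc k)) * ddir \<nu> ((?N ^^ k) X) x)"
        unfolding Suc.IH[OF c] by (simp add: fun_eq_iff algebra_simps del: funpow.simps)
      moreover have "(?N ^^ Suc (Suc k)) (\<lambda>z. (z \<bullet> \<nu>) * X z) x = ?N ((?N ^^ Suc k) (\<lambda>z. (z \<bullet> \<nu>) * X z)) x"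
        by simp
      ultimately show ?thesis by (simp only:)
    qed
    also have "\<dots> = ?N (\<lambda>x. (x \<bullet> \<nu>) * (?N ^^ Suc k) X x) x + ?N (\<lambda>x. (- 2 * real (Suc k)) * ddir \<nu> ((?N ^^ k) X) x) x"
      using c2 c4 by (intro neg_laplacian_add[OF _ _ open_UNIV] Cm_mult Cm_cmult Cm_inner) auto
    also have "?N (\<lambda>x. (- 2 * real (Suc k)) * ddir \<nu> ((?N ^^ k) X) x) x = (- 2 * real (Suc k)) * ?N (ddir \<nu> ((?N ^^ k) X)) x"
      by (rule neg_laplacian_cmult[OF c4 open_UNIV]) simp
    also have "?N (ddir \<nu> ((?N ^^ k) X)) x = ddir \<nu> ((?N ^^ Suc k) X) x"
      using ddir_neg_laplacian[OF c3] by simp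
    also have "?N (\<lambda>x. (x \<bullet> \<nu>) * (?N ^^ Suc k) X x) x = (x \<bullet> \<nu>) * (?N ^^ Suc (Suc k)) X x - 2 * ddir \<nu> ((?N ^^ Suc k) X) x"
      using neg_laplacian_inner_mult[OF c2] by simp
    finally show "(?N ^^ Suc (Suc k)) (\<lambda>z. (z \<bullet> \<nu>) * X z) x =
      (x \<bullet> \<nu>) * (?N ^^ Suc (Suc k)) X x - 2 * real (Suc (Suc k)) * ddir \<nu> ((?N ^^ Suc k) X) x"
      by (simp add: algebra_simps del: funpow.simps)
  qed
qed

definition zero_off_ball :: "(real ^ 'n \<Rightarrow> real) \<Rightarrow> bool" where
  "zero_off_ball F \<longleftrightarrow> (\<forall>z. z \<notin> cball 0 1 \<longrightarrow> F z = 0)"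

lemma zero_off_ball_neg_laplacian_pow: "zero_off_ball F \<Longrightarrow> zero_off_ball ((neg_laplacian ^^ k) F)"
  unfolding zero_off_ball_def
  using neg_laplacian_pow_eq_0[of "- cball 0 1" F] by (auto simp: open_Compl)

lemma zero_off_ball_partial:
  fixes F :: "real ^ 'n \<Rightarrow> real"
  shows "zero_off_ball F \<Longrightarrow> zero_off_ball (partial i F)"
  unfolding zero_off_ball_def
proof (intro allI impI)
  fix z :: "real ^ 'n" assume F: "\<forall>z. z \<notin> cball 0 1 \<longrightarrow> F z = 0" and z: "z \<notin> cball 0 1"
  have "partial i F z = partial i (\<lambda>_. 0) z"
    by (rule partial_cong_open[of "- cball 0 1"]) (use F z in \<open>auto simp: open_Compl\<close>)
  then show "partial i F z = 0" by simp
qed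

lemma zero_off_ball_ddir: "zero_off_ball F \<Longrightarrow> zero_off_ball (ddir v F)"
  using zero_off_ball_partial[of F] unfolding zero_off_ball_def ddir_def by simp

lemma zero_off_ball_mult: "zero_off_ball F \<Longrightarrow> zero_off_ball (\<lambda>z. g z * F z)"
  unfolding zero_off_ball_def by simp

lemma zero_off_ballD: "zero_off_ball F \<Longrightarrow> z \<notin> cball 0 1 \<Longrightarrow> F z = 0"
  unfolding zero_off_ball_def by blast

context
  fixes \<nu> :: "real ^ 'n"
  assumes \<nu>: "\<nu> \<noteq> 0"
begin

text \<open>Integration by parts, by translation invariance: the difference quotient of \<open>F\<close> is moved to
the weight, and dominated convergence applies on both sides. Off the hyperplane the weight is
differentiable; at the hyperplane it is Lipschitz for \<open>m \<ge> 1\<close> but jumps for \<open>m =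
0\<close>, and then only tangential directions are allowed.\<close>

lemma half_int_ddir': "\<lbrakk>Cm 1 UNIV F; zero_off_ball F; m \<ge> 1 \<or> v \<bullet> \<nu> = 0\<rbrakk> \<Longrightarrow>
   half_int \<nu> m (ddir v F) = - (v \<bullet> \<nu>) * real m * half_int \<nu> (m - 1) F"
  using half_int_ddir[OF \<nu>, of F 1] by (simp add: zero_off_ball_def)

text \<open>The main term of the commutator has weight \<open>(z \<bullet> \<nu>)^(m+1)\<close>, and one integration
by parts turns its Laplacian into \<open>(m + 1) \<partial>_\<nu>\<close>, which combines with the
commutator term.\<close>

lemma half_int_neg_laplacian_pow_mult:
  assumes "Cm (2 * k + 3) UNIV X" "zero_off_ball X"
  shows "half_int \<nu> m ((neg_laplacian ^^ Suc k) (\<lambda>z. (z \<bullet> \<nu>) * X z))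
     = (real m + 1 - 2 * real (Suc k)) * half_int \<nu> m (ddir \<nu> ((neg_laplacian ^^ k) X))"
proof -
  let ?Y = "(neg_laplacian ^^ k) X"
  have cY: "Cm 3 UNIV ?Y" by (rule Cm_neg_laplacian_pow[OF open_UNIV assms(1)])
  have vY: "zero_off_ball ?Y" by (rule zero_off_ball_neg_laplacian_pow[OF assms(2)])
  have cN: "Cm 1 UNIV (neg_laplacian ?Y)"
    using Cm_neg_laplacian_pow[OF open_UNIV, of 1 1 ?Y] cY by (simp add: numeral_3_eq_3)
  have vN: "zero_off_ball (neg_laplacian ?Y)" using zero_off_ball_neg_laplacian_pow[OF vY, of 1] by simp
  have cd: "Cm 2 UNIV (ddir v ?Y)" for v using cY by (intro Cm_ddir) (simp_all add: eval_nat_numeral)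
  have vd: "zero_off_ball (ddir v ?Y)" for v by (rule zero_off_ball_ddir[OF vY])
  have cp: "Cm 2 UNIV (partial i ?Y)" for i using cY by (intro Cm_partial) (simp add: eval_nat_numeral)
  have e: "(neg_laplacian ^^ Suc k) (\<lambda>z. (z \<bullet> \<nu>) * X z)
     = (\<lambda>x. (x \<bullet> \<nu>) * neg_laplacian ?Y x + (- 2 * real (Suc k)) * ddir \<nu> ?Y x)"
    by (subst neg_laplacian_pow_inner_mult[OF Cm_mono[OF _ assms(1)]]) (simp_all add: fun_eq_iff algebra_simps)
  have "half_int \<nu> m ((neg_laplacian ^^ Suc k) (\<lambda>z. (z \<bullet> \<nu>) * X z))
     = half_int \<nu> m (\<lambda>x. (x \<bullet> \<nu>) * neg_laplacian ?Y x) + half_int \<nu> m (\<lambda>x. (- 2 * real (Suc k)) * ddir \<nu> ?Y x)"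
    unfolding e
  proof (rule half_int_add[where R = 1])
    show "continuous_on UNIV (\<lambda>x. (x \<bullet> \<nu>) * neg_laplacian ?Y x)"
      using Cm_continuous[OF cN] by (intro continuous_intros)
    show "continuous_on UNIV (\<lambda>x. (- 2 * real (Suc k)) * ddir \<nu> ?Y x)"
      using Cm_continuous[OF cd] by (intro continuous_intros)
  qed (use zero_off_ballD[OF vN] zero_off_ballD[OF vd] in auto)
  also have "half_int \<nu> m (\<lambda>x. (x \<bullet> \<nu>) * neg_laplacian ?Y x) = half_int \<nu> (Suc m) (neg_laplacian ?Y)"
    by (rule half_int_mult_linear)
  also have "\<dots> = (\<Sum>i\<in>UNIV. -1 * half_int \<nu> (Suc m) (partial i (partial i ?Y)))"
  proof -
    have eq: "neg_laplacian ?Y = (\<lambda>x. \<Sum>i\<in>UNIV. -1 * partial i (partial i ?Y) x)"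
      by (rule ext) (simp add: neg_laplacian_def sum_negf)
    show ?thesis unfolding eq
    proof (rule half_int_sum[where R = 1])
      show "continuous_on UNIV (partial i (partial i ?Y))" for i
      proof -
        have "Cm (Suc 1) UNIV (partial i ?Y)" using cp by (simp add: eval_nat_numeral)
        from Cm_continuous[OF Cm_partial[OF this]] show ?thesis .
      qed
      show "partial i (partial i ?Y) z = 0" if "z \<notin> cball 0 1" for i z
        using zero_off_ballD[OF zero_off_ball_partial[OF zero_off_ball_partial[OF vY]] that] .
    qed auto
  qed
  also have "\<dots> = (\<Sum>i\<in>UNIV. (real m + 1) * (\<nu> $ i * half_int \<nu> m (partial i ?Y)))"
  proof (rule sum.cong[OF refl])
    fix i
    have "half_int \<nu> (Suc m) (ddir (axis i 1) (partial i ?Y)) = - (axis i 1 \<bullet> \<nu>) * real (Suc m) * half_int \<nu> (Suc m - 1) (partial i ?Y)"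
      by (rule half_int_ddir'[OF Cm_mono[OF _ cp] zero_off_ball_partial[OF vY]]) auto
    then show "-1 * half_int \<nu> (Suc m) (partial i (partial i ?Y)) = (real m + 1) * (\<nu> $ i * half_int \<nu> m (partial i ?Y))"
      by (simp add: ddir_axis[abs_def] inner_axis' algebra_simps)
  qed
  also have "\<dots> = (real m + 1) * half_int \<nu> m (ddir \<nu> ?Y)"
  proof -
    have "half_int \<nu> m (\<lambda>x. \<Sum>i\<in>UNIV. \<nu> $ i * partial i ?Y x) = (\<Sum>i\<in>UNIV. \<nu> $ i * half_int \<nu> m (partial i ?Y))"
      by (rule half_int_sum[where R = 1]) (use Cm_continuous[OF cp] zero_off_ballD[OF zero_off_ball_partial[OF vY]] in auto)
    then show ?thesis by (simp add: ddir_def[abs_def] sum_distrib_left)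
  qed
  also have "half_int \<nu> m (\<lambda>x. (- 2 * real (Suc k)) * ddir \<nu> ?Y x) = (- 2 * real (Suc k)) * half_int \<nu> m (ddir \<nu> ?Y)"
    by (rule half_int_cmult)
  finally show ?thesis by (simp only: algebra_simps)
qed

text \<open>One linear factor and one Laplacian are traded for one power of the weight; for \<open>m \<ge> 1\<close>
the remaining normal derivative can be integrated by parts once more.\<close>

lemma half_int_step_pos:
  assumes "Cm (2 * k + 3) UNIV X" "zero_off_ball X" "m \<ge> 1"
  shows "half_int \<nu> m ((neg_laplacian ^^ Suc k) (\<lambda>z. (z \<bullet> \<nu>) * X z))
     = - ((real m + 1 - 2 * real (Suc k)) * (\<nu> \<bullet> \<nu>) * real m) * half_int \<nu> (m - 1) ((neg_laplacian ^^ k) X)"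
proof -
  have "Cm 1 UNIV ((neg_laplacian ^^ k) X)"
    by (rule Cm_mono[OF _ Cm_neg_laplacian_pow[OF open_UNIV assms(1)]]) simp
  then have "half_int \<nu> m (ddir \<nu> ((neg_laplacian ^^ k) X)) = - (\<nu> \<bullet> \<nu>) * real m * half_int \<nu> (m - 1) ((neg_laplacian ^^ k) X)"
    using assms(3) by (intro half_int_ddir' zero_off_ball_neg_laplacian_pow assms(2)) auto
  moreover have "a * (- b * c * h) = - (a * b * c) * h" for a b c h :: real by simp
  ultimately show ?thesis unfolding half_int_neg_laplacian_pow_mult[OF assms(1,2)] by (simp only:)
qed

text \<open>With weight \<open>1\<close> all tangential derivatives integrate to zero, so the second normal
derivative carries the whole Laplacian.\<close>

lemma half_int_0_ddir_ddir:
  assumes Z: "Cm 3 UNIV Z" "zero_off_ball Z"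
  shows "half_int \<nu> 0 (ddir \<nu> (ddir \<nu> Z)) = - (\<nu> \<bullet> \<nu>) * half_int \<nu> 0 (neg_laplacian Z)"
proof -
  have nn: "\<nu> \<bullet> \<nu> \<noteq> 0" using \<nu> by simp
  have tang: "(\<nu> \<bullet> \<nu>) * half_int \<nu> 0 (partial i W) = \<nu> $ i * half_int \<nu> 0 (ddir \<nu> W)" if W: "Cm 1 UNIV W" "zero_off_ball W" for W i
  proof -
    \<comment> \<open>the tangential part of the coordinate direction, scaled by \<open>\<nu> \<bullet>
       \<nu>\<close>\<close>
    define \<tau> where "\<tau> = (\<nu> \<bullet> \<nu>) *\<^sub>R axis i 1 - \<nu> $ i *\<^sub>R \<nu>"
    have cont: "continuous_on UNIV (ddir v W)" for v using W by (intro Cm_continuous[of 0] Cm_ddir) auto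
    have "\<tau> \<bullet> \<nu> = 0" by (simp add: \<tau>_def inner_diff_left inner_axis')
    then have "half_int \<nu> 0 (ddir \<tau> W) = 0" using half_int_ddir'[OF W, of 0 \<tau>] by simp
    moreover have "ddir \<tau> W = (\<lambda>x. (\<nu> \<bullet> \<nu>) * ddir (axis i 1) W x + (- \<nu> $ i) * ddir \<nu> W x)"
    proof
      fix x
      have "ddir (a - b) W x = ddir a W x - ddir b W x" for a b
        by (simp add: ddir_def left_diff_distrib sum_subtractf)
      then show "ddir \<tau> W x = (\<nu> \<bullet> \<nu>) * ddir (axis i 1) W x + (- \<nu> $ i) * ddir \<nu> W x"
        unfolding \<tau>_def by (simp add: ddir_scaleR)
    qed
    moreover have "half_int \<nu> 0 (\<lambda>x. (\<nu> \<bullet> \<nu>) * ddir (axis i 1) W x + (- \<nu> $ i) * ddir \<nu> W x)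
       = half_int \<nu> 0 (\<lambda>x. (\<nu> \<bullet> \<nu>) * ddir (axis i 1) W x) + half_int \<nu> 0 (\<lambda>x. (- \<nu> $ i) * ddir \<nu> W x)"
      by (rule half_int_add[where R = 1]) (use cont zero_off_ballD[OF zero_off_ball_ddir[OF W(2)]] in \<open>auto intro!: continuous_intros\<close>)
    ultimately show ?thesis by (simp only: half_int_cmult) (simp add: ddir_axis[abs_def])
  qed
  have cp: "Cm 2 UNIV (partial i Z)" for i using Z by (intro Cm_partial) (simp add: eval_nat_numeral)
  have cpp: "continuous_on UNIV (partial i (partial j Z))" for i j
  proof -
    have "Cm (Suc 1) UNIV (partial j Z)" using cp by (simp add: eval_nat_numeral)
    from Cm_continuous[OF Cm_partial[OF this]] show ?thesis .
  qed
  have vpp: "zero_off_ball (partial i (partial j Z))" for i j using Z(2) by (intro zero_off_ball_partial)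
  have d1: "half_int \<nu> 0 (ddir \<nu> W) = (\<Sum>i\<in>UNIV. \<nu> $ i * half_int \<nu> 0 (partial i W))" if "Cm 1 UNIV W" "zero_off_ball W" for W
    unfolding ddir_def[abs_def]
    by (rule half_int_sum[where R = 1]) (use that zero_off_ballD[OF zero_off_ball_partial[OF that(2)]] in \<open>auto intro!: Cm_continuous[of 0] Cm_partial\<close>)
  have comm: "ddir \<nu> (partial i Z) = partial i (ddir \<nu> Z)" for i
  proof
    fix x
    have "partial i (ddir \<nu> Z) x = (\<Sum>j\<in>UNIV. \<nu> $ j * partial i (partial j Z) x)"
      unfolding ddir_def[abs_def] by (rule partial_sum[OF open_UNIV]) (auto intro: Cm_mono[OF _ cp])
    also have "\<dots> = ddir \<nu> (partial i Z) x"
      unfolding ddir_def using partial_partial_commute[OF Cm_mono[OF _ Z(1)] open_UNIV, of x] by simp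
    finally show "ddir \<nu> (partial i Z) x = partial i (ddir \<nu> Z) x" by simp
  qed
  have cdZ: "Cm 2 UNIV (ddir \<nu> Z)" using Z by (intro Cm_ddir) (simp_all add: eval_nat_numeral)
  have "(\<nu> \<bullet> \<nu>) * half_int \<nu> 0 (neg_laplacian Z) = (\<nu> \<bullet> \<nu>) * (\<Sum>i\<in>UNIV. -1 * half_int \<nu> 0 (partial i (partial i Z)))"
  proof -
    have eq: "neg_laplacian Z = (\<lambda>x. \<Sum>i\<in>UNIV. -1 * partial i (partial i Z) x)"
      by (rule ext) (simp add: neg_laplacian_def sum_negf)
    show ?thesis unfolding eq
      by (subst half_int_sum[where R = 1]) (use cpp zero_off_ballD[OF vpp] in auto)
  qed
  also have "\<dots> = (\<Sum>i\<in>UNIV. - (\<nu> $ i * half_int \<nu> 0 (partial i (ddir \<nu> Z))))"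
    unfolding sum_distrib_left
  proof (rule sum.cong[OF refl])
    fix i
    have "(\<nu> \<bullet> \<nu>) * half_int \<nu> 0 (partial i (partial i Z)) = \<nu> $ i * half_int \<nu> 0 (ddir \<nu> (partial i Z))"
      by (rule tang[OF Cm_mono[OF _ cp] zero_off_ball_partial[OF Z(2)]]) simp
    then show "(\<nu> \<bullet> \<nu>) * (-1 * half_int \<nu> 0 (partial i (partial i Z))) = - (\<nu> $ i * half_int \<nu> 0 (partial i (ddir \<nu> Z)))"
      by (simp add: comm)
  qed
  also have "\<dots> = - half_int \<nu> 0 (ddir \<nu> (ddir \<nu> Z))"
    using d1[OF Cm_mono[OF _ cdZ] zero_off_ball_ddir[OF Z(2)]] by (simp add: sum_negf)
  finally show ?thesis by simp
qed

text \<open>With weight \<open>1\<close> a single normal derivative cannot be integrated by parts. Removing two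
linear factors at once leaves a second normal derivative, which the preceding identity turns back into a
Laplacian.\<close>

lemma half_int_step_zero:
  assumes Y: "Cm (2 * k + 5) UNIV Y" "zero_off_ball Y"
  shows "half_int \<nu> 0 ((neg_laplacian ^^ Suc (Suc k)) (\<lambda>z. (z \<bullet> \<nu>) * ((z \<bullet> \<nu>) * Y z)))
    = (1 - 2 * real (Suc (Suc k))) * (2 * real (Suc k) * (\<nu> \<bullet> \<nu>)) * half_int \<nu> 0 ((neg_laplacian ^^ Suc k) Y)"
proof -
  let ?X = "\<lambda>z. (z \<bullet> \<nu>) * Y z"
  let ?W = "(neg_laplacian ^^ Suc k) Y"
  let ?Z = "(neg_laplacian ^^ k) Y"
  have cX: "Cm (2 * Suc k + 3) UNIV ?X" using Y(1) by (intro Cm_mult Cm_inner) (auto simp: add.commute)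
  have cZ: "Cm 5 UNIV ?Z" by (rule Cm_neg_laplacian_pow[OF open_UNIV Y(1)])
  have vZ: "zero_off_ball ?Z" by (rule zero_off_ball_neg_laplacian_pow[OF Y(2)])
  have cW: "Cm 3 UNIV ?W" by (rule Cm_neg_laplacian_pow[OF open_UNIV]) (use Y(1) in \<open>simp add: add.commute\<close>)
  have vW: "zero_off_ball ?W" by (rule zero_off_ball_neg_laplacian_pow[OF Y(2)])
  have cd: "Cm 4 UNIV (ddir \<nu> ?Z)" using cZ by (intro Cm_ddir) (simp_all add: eval_nat_numeral)
  have cdd: "continuous_on UNIV (ddir \<nu> (ddir \<nu> ?Z))"
  proof -
    have "Cm (Suc 3) UNIV (ddir \<nu> ?Z)" using cd by (simp add: eval_nat_numeral)
    from Cm_continuous[OF Cm_ddir[OF open_UNIV this]] show ?thesis .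
  qed
  have cdW: "Cm 2 UNIV (ddir \<nu> ?W)" using cW by (intro Cm_ddir) (simp_all add: eval_nat_numeral)
  have e: "(neg_laplacian ^^ Suc k) ?X = (\<lambda>x. (x \<bullet> \<nu>) * ?W x + (- 2 * real (Suc k)) * ddir \<nu> ?Z x)"
    by (subst neg_laplacian_pow_inner_mult[OF Cm_mono[OF _ Y(1)]]) (simp_all add: fun_eq_iff algebra_simps)
  have lin: "(\<lambda>z. z \<bullet> \<nu>) differentiable (at x)" for x
    using Cm_inner[of UNIV 1 \<nu>] by (simp add: Cm_Suc)
  have dW: "?W differentiable (at x)" for x using Cm_differentiable[OF cW] by simp
  have dZ: "ddir \<nu> ?Z differentiable (at x)" for x using Cm_differentiable[OF cd] by simp
  have "ddir \<nu> ((neg_laplacian ^^ Suc k) ?X)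
     = (\<lambda>x. ((\<nu> \<bullet> \<nu>) * ?W x + (x \<bullet> \<nu>) * ddir \<nu> ?W x) + (- 2 * real (Suc k)) * ddir \<nu> (ddir \<nu> ?Z) x)"
  proof
    fix x
    have "ddir \<nu> (\<lambda>x. (x \<bullet> \<nu>) * ?W x + (- 2 * real (Suc k)) * ddir \<nu> ?Z x) x
      = ddir \<nu> (\<lambda>x. (x \<bullet> \<nu>) * ?W x) x + ddir \<nu> (\<lambda>x. (- 2 * real (Suc k)) * ddir \<nu> ?Z x) x"
      by (rule ddir_add) (intro differentiable_mult differentiable_const lin dW dZ)+
    also have "\<dots> = ((\<nu> \<bullet> \<nu>) * ?W x + (x \<bullet> \<nu>) * ddir \<nu> ?W x) + (- 2 * real (Suc k)) * ddir \<nu> (ddir \<nu> ?Z) x"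
      by (simp only: ddir_mult[OF lin dW] ddir_inner ddir_cmult[OF dZ])
    finally show "ddir \<nu> ((neg_laplacian ^^ Suc k) ?X) x
     = ((\<nu> \<bullet> \<nu>) * ?W x + (x \<bullet> \<nu>) * ddir \<nu> ?W x) + (- 2 * real (Suc k)) * ddir \<nu> (ddir \<nu> ?Z) x" unfolding e .
  qed
  then have "half_int \<nu> 0 (ddir \<nu> ((neg_laplacian ^^ Suc k) ?X))
     = half_int \<nu> 0 (\<lambda>x. ((\<nu> \<bullet> \<nu>) * ?W x + (x \<bullet> \<nu>) * ddir \<nu> ?W x) + (- 2 * real (Suc k)) * ddir \<nu> (ddir \<nu> ?Z) x)"
    by simp
  also have "\<dots> = half_int \<nu> 0 (\<lambda>x. (\<nu> \<bullet> \<nu>) * ?W x + (x \<bullet> \<nu>) * ddir \<nu> ?W x)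
      + half_int \<nu> 0 (\<lambda>x. (- 2 * real (Suc k)) * ddir \<nu> (ddir \<nu> ?Z) x)"
    by (rule half_int_add[where R = 1])
      (use Cm_continuous[OF cW] Cm_continuous[OF cdW] cdd zero_off_ballD[OF vW] zero_off_ballD[OF zero_off_ball_ddir[OF vW]]
          zero_off_ballD[OF zero_off_ball_ddir[OF zero_off_ball_ddir[OF vZ]]] in \<open>auto intro!: continuous_intros simp del: funpow.simps\<close>)
  also have "half_int \<nu> 0 (\<lambda>x. (\<nu> \<bullet> \<nu>) * ?W x + (x \<bullet> \<nu>) * ddir \<nu> ?W x)
     = half_int \<nu> 0 (\<lambda>x. (\<nu> \<bullet> \<nu>) * ?W x) + half_int \<nu> 0 (\<lambda>x. (x \<bullet> \<nu>) * ddir \<nu> ?W x)"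
    by (rule half_int_add[where R = 1])
      (use Cm_continuous[OF cW] Cm_continuous[OF cdW] zero_off_ballD[OF vW] zero_off_ballD[OF zero_off_ball_ddir[OF vW]]
           in \<open>auto intro!: continuous_intros simp del: funpow.simps\<close>)
  also have "half_int \<nu> 0 (\<lambda>x. (x \<bullet> \<nu>) * ddir \<nu> ?W x) = - (\<nu> \<bullet> \<nu>) * half_int \<nu> 0 ?W"
    unfolding half_int_mult_linear using half_int_ddir'[OF Cm_mono[OF _ cW] vW, of 1 \<nu>] by simp
  finally have "half_int \<nu> 0 (ddir \<nu> ((neg_laplacian ^^ Suc k) ?X)) = (- 2 * real (Suc k)) * half_int \<nu> 0 (ddir \<nu> (ddir \<nu> ?Z))"
    by (simp only: half_int_cmult)
  also have "half_int \<nu> 0 (ddir \<nu> (ddir \<nu> ?Z)) = - (\<nu> \<bullet> \<nu>) * half_int \<nu> 0 ?W"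
    using half_int_0_ddir_ddir[OF Cm_mono[OF _ cZ] vZ] by simp
  finally have "half_int \<nu> 0 (ddir \<nu> ((neg_laplacian ^^ Suc k) ?X)) = 2 * real (Suc k) * (\<nu> \<bullet> \<nu>) * half_int \<nu> 0 ?W"
    by (simp add: algebra_simps)
  then show ?thesis
    using half_int_neg_laplacian_pow_mult[OF cX zero_off_ball_mult[OF Y(2)], of 0] by simp
qed

text \<open>This is the integral left over by the blow-up. The two steps reduce it to a non-zero multiple of the
integral of \<open>\<partial>_\<nu> \<psi>\<close>: the first one \<open>m\<close> times until the
weight is \<open>1\<close>, then the second one, which removes the linear factors in pairs. The exponent
\<open>2k - 1 - m\<close> is chosen so that a single linear factor and a single Laplacian remain at the
end. None of the constants vanishes, because \<open>m < k\<close> keeps \<open>m + 1 - 2k\<close>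
negative throughout.\<close>

lemma half_int_neg_laplacian_nonzero:
  assumes "Cm (2 * k + 3) UNIV \<psi>" "zero_off_ball \<psi>" "half_int \<nu> 0 (ddir \<nu> \<psi>) \<noteq> 0" "m < k"
  shows "half_int \<nu> m ((neg_laplacian ^^ k) (\<lambda>z. (z \<bullet> \<nu>) ^ (2 * k - 1 - m) * \<psi> z)) \<noteq> 0"
proof -
  have nn: "\<nu> \<bullet> \<nu> \<noteq> 0" using \<nu> by simp
  have C: "Cm l UNIV (\<lambda>z. (z \<bullet> \<nu>) ^ a * \<psi> z)" if "l \<le> 2 * k + 3" for a l
    by (intro Cm_mult Cm_power Cm_inner open_UNIV Cm_mono[OF that assms(1)])
  have V: "zero_off_ball (\<lambda>z. (z \<bullet> \<nu>) ^ a * \<psi> z)" for a by (rule zero_off_ball_mult[OF assms(2)])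
  have base: "half_int \<nu> 0 ((neg_laplacian ^^ Suc j) (\<lambda>z. (z \<bullet> \<nu>) ^ (2 * j + 1) * \<psi> z)) \<noteq> 0" if "Suc j \<le> k" for j
    using that
  proof (induction j)
    case 0
    have "half_int \<nu> 0 ((neg_laplacian ^^ Suc 0) (\<lambda>z. (z \<bullet> \<nu>) * \<psi> z)) = (real 0 + 1 - 2 * real (Suc 0)) * half_int \<nu> 0 (ddir \<nu> ((neg_laplacian ^^ 0) \<psi>))"
      by (rule half_int_neg_laplacian_pow_mult) (use assms Cm_mono[OF _ assms(1), of 3] in auto)
    then show ?case using assms(3) by simp
  next
    case (Suc j)
    have "half_int \<nu> 0 ((neg_laplacian ^^ Suc (Suc j)) (\<lambda>z. (z \<bullet> \<nu>) * ((z \<bullet> \<nu>) * ((z \<bullet> \<nu>) ^ (2 * j + 1) * \<psi> z)))) \<noteq> 0"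
      using Suc.IH Suc.prems nn by (subst half_int_step_zero[OF C V]) auto
    then show ?case by (simp add: mult.assoc del: funpow.simps)
  qed
  have "half_int \<nu> m ((neg_laplacian ^^ j) (\<lambda>z. (z \<bullet> \<nu>) ^ (2 * j - 1 - m) * \<psi> z)) \<noteq> 0" if "m < j" "j \<le> k" for m j
    using that
  proof (induction m arbitrary: j)
    case 0
    then show ?case using base[of "j - 1"] by (cases j) auto
  next
    case (Suc m)
    then obtain i where j: "j = Suc i" "m < i" "Suc i \<le> k" by (cases j) auto
    have a: "2 * j - 1 - Suc m = Suc (2 * i - 1 - m)" using j by simp
    have r: "real (Suc m) + 1 - 2 * real (Suc i) < 0" using j by simp
    have "half_int \<nu> (Suc m) ((neg_laplacian ^^ Suc i) (\<lambda>z. (z \<bullet> \<nu>) * ((z \<bullet> \<nu>) ^ (2 * i - 1 - m) * \<psi> z))) \<noteq> 0"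
      using Suc.IH[of i] j nn r by (subst half_int_step_pos[OF C V]) auto
    moreover have "(\<lambda>z. (z \<bullet> \<nu>) ^ (2 * j - 1 - Suc m) * \<psi> z) = (\<lambda>z. (z \<bullet> \<nu>) * ((z \<bullet> \<nu>) ^ (2 * i - 1 - m) * \<psi> z))"
      unfolding a by (simp add: mult.assoc)
    ultimately show ?case by (simp only: j(1) not_False_eq_True)
  qed
  from this[OF assms(4)] show ?thesis by simp
qed

end

section \<open>A bump function and the truncated fundamental solution\<close>

lemma continuous_on_pos_pow: "m \<ge> 1 \<Longrightarrow> continuous_on UNIV (pos_pow m)"
proof -
  assume "m \<ge> 1"
  then have "pos_pow m = (\<lambda>s. max 0 s ^ m)" by (auto simp: pos_pow_def max_def power_0_left fun_eq_iff)
  then show ?thesis by (auto intro!: continuous_intros)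
qed

lemma DERIV_pos_pow_everywhere:
  assumes "m \<ge> 2"
  shows "(pos_pow m has_real_derivative (real m * pos_pow (m - 1) s)) (at s)"
proof (cases "s = 0")
  case False then show ?thesis by (rule DERIV_pos_pow)
next
  case True
  have "((\<lambda>h. (pos_pow m (0 + h) - pos_pow m 0) / h) \<longlongrightarrow> pos_pow (m - 1) 0) (at 0)"
  proof (rule Lim_transform_eventually)
    show "(pos_pow (m - 1) \<longlongrightarrow> pos_pow (m - 1) 0) (at 0)"
      using continuous_on_pos_pow[of "m - 1"] assms by (simp add: continuous_on_def)
    show "\<forall>\<^sub>F h in at 0. pos_pow (m - 1) h = (pos_pow m (0 + h) - pos_pow m 0) / h"
      using assms by (intro always_eventually allI) (auto simp: pos_pow_def power_eq_if[of _ m])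
  qed
  then show ?thesis using True by (simp add: DERIV_def pos_pow_def)
qed

lemma Cm_pos_pow:
  assumes "open S" "Cm m S f" "m < N"
  shows "Cm m S (\<lambda>x. pos_pow N (f x))"
proof -
  define Q where "Q j t = fact N / fact (N - j) * pos_pow (N - j) t" for j t
  have "Cm m S (\<lambda>x. Q 0 (f x))"
  proof (rule Cm_compose[OF assms(1,2), where T = UNIV])
    show "continuous_on UNIV (Q m)"
      unfolding Q_def using continuous_on_pos_pow[of "N - m"] assms(3) by (intro continuous_intros) auto
    fix j t assume "j < m"
    then have j: "N - j \<ge> 2" "N - j = Suc (N - Suc j)" using assms(3) by auto
    have "(Q j has_real_derivative fact N / fact (N - j) * (real (N - j) * pos_pow (N - j - 1) t)) (at t)"
      unfolding Q_def by (rule DERIV_cmult[OF DERIV_pos_pow_everywhere[OF j(1)]])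
    also have "fact N / fact (N - j) * (real (N - j) * pos_pow (N - j - 1) t) = Q (Suc j) t"
      unfolding Q_def j(2) by (simp add: divide_simps)
    finally show "(Q j has_real_derivative Q (Suc j) t) (at t)" .
  qed auto
  then show ?thesis by (simp add: Q_def)
qed

lemma Cm_powr:
  assumes "open S" "Cm m S f" "\<And>x. x \<in> S \<Longrightarrow> f x > 0"
  shows "Cm m S (\<lambda>x. f x powr b)"
proof -
  define Q where "Q j t = (\<Prod>i<j. b - real i) * t powr (b - real j)" for j t
  have "Cm m S (\<lambda>x. Q 0 (f x))"
  proof (rule Cm_compose[OF assms(1,2), where T = "{0<..}"])
    show "continuous_on {0<..} (Q m)"
      unfolding Q_def by (auto intro!: continuous_intros)
    fix j and t :: real assume t: "t \<in> {0<..}"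
    have "(Q j has_real_derivative (\<Prod>i<j. b - real i) * ((b - real j) * t powr (b - real j - 1))) (at t)"
      unfolding Q_def using t by (intro DERIV_cmult has_real_derivative_powr) auto
    also have "(\<Prod>i<j. b - real i) * ((b - real j) * t powr (b - real j - 1)) = Q (Suc j) t"
      unfolding Q_def by (simp add: algebra_simps)
    finally show "(Q j has_real_derivative Q (Suc j) t) (at t)" .
  qed (use assms(3) in auto)
  then show ?thesis by (simp add: Q_def)
qed

lemma Cm_inner_self: "open S \<Longrightarrow> Cm m S (\<lambda>z. z \<bullet> z)"
  unfolding inner_vec_def inner_real_def by (intro Cm_sum Cm_mult Cm_component) auto

text \<open>Finite smoothness suffices, and for this choice the sign of the normal derivative on a half-space is
visible.\<close>

definition bump :: "nat \<Rightarrow> real ^ 'n \<Rightarrow> real" where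
  "bump N z = pos_pow N (1 - z \<bullet> z)"

lemma Cm_bump: "m < N \<Longrightarrow> Cm m UNIV (bump N)"
  unfolding bump_def[abs_def] by (intro Cm_pos_pow Cm_diff Cm_const Cm_inner_self) auto

lemma bump_outside: "norm z \<ge> 1 \<Longrightarrow> bump N z = 0"
  using one_le_power[of "norm z" 2] unfolding bump_def pos_pow_def by (simp add: power2_norm_eq_inner)

lemma zero_off_ball_bump: "zero_off_ball (bump N)"
  unfolding zero_off_ball_def by (auto intro: bump_outside)

lemma ddir_bump:
  assumes "N \<ge> 2"
  shows "ddir \<nu> (bump N) z = - (2 * real N * pos_pow (N - 1) (1 - z \<bullet> z)) * (z \<bullet> \<nu>)"
proof -
  have d: "((\<lambda>z. 1 - z \<bullet> z) has_derivative (\<lambda>v. - (z \<bullet> v + v \<bullet> z))) (at z)"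
    by (auto intro!: derivative_eq_intros)
  have "(pos_pow N has_derivative (*) (real N * pos_pow (N - 1) (1 - z \<bullet> z))) (at (1 - z \<bullet> z))"
    using DERIV_pos_pow_everywhere[OF assms] by (simp add: has_field_derivative_def)
  from has_derivative_compose[OF d this]
  have "(bump N has_derivative (\<lambda>v. real N * pos_pow (N - 1) (1 - z \<bullet> z) * - (z \<bullet> v + v \<bullet> z))) (at z)"
    by (simp add: bump_def[abs_def])
  from has_derivative_along[of "bump N" _ z 0 \<nu>] this
  have "((\<lambda>t. bump N (z + t *\<^sub>R \<nu>)) has_real_derivative real N * pos_pow (N - 1) (1 - z \<bullet> z) * - (z \<bullet> \<nu> + \<nu> \<bullet> z)) (at 0)"
    by simp
  moreover have "((\<lambda>t. bump N (z + t *\<^sub>R \<nu>)) has_real_derivative ddir \<nu> (bump N) z) (at 0)"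
    using DERIV_along[of "bump N" z 0 \<nu>] Cm_differentiable[OF Cm_bump[of 1 N], of z] assms by simp
  ultimately have "ddir \<nu> (bump N) z = real N * pos_pow (N - 1) (1 - z \<bullet> z) * - (z \<bullet> \<nu> + \<nu> \<bullet> z)"
    by (rule DERIV_unique[rotated])
  then show ?thesis by (simp add: inner_commute)
qed

text \<open>Integration by parts, by translation invariance: the difference quotient of \<open>F\<close> is moved to
the weight, and dominated convergence applies on both sides. Off the hyperplane the weight is
differentiable; at the hyperplane it is Lipschitz for \<open>m \<ge> 1\<close> but jumps for \<open>m =
0\<close>, and then only tangential directions are allowed.\<close>

text \<open>On the half-space the integrand is at most zero, and it is negative on the open half-ball.\<close>

lemma half_int_ddir_bump:
  fixes \<nu> :: "real ^ 'n"
  assumes "N \<ge> 2" "\<nu> \<noteq> 0"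
  shows "half_int \<nu> 0 (ddir \<nu> (bump N)) \<noteq> 0"
proof
  assume h0: "half_int \<nu> 0 (ddir \<nu> (bump N)) = 0"
  define g where "g z = pos_pow 0 (z \<bullet> \<nu>) * (-1 * ddir \<nu> (bump N) z)" for z
  have C: "continuous_on UNIV (ddir \<nu> (bump N))"
    using Cm_continuous[OF Cm_ddir[OF open_UNIV Cm_bump[of "Suc 0" N]]] assms by simp
  have int: "integrable lborel g"
    unfolding g_def
    by (rule half_int_integrable[where R = 1]) (use C zero_off_ballD[OF zero_off_ball_ddir[OF zero_off_ball_bump]] in \<open>auto intro!: continuous_intros\<close>)
  have g: "g z = 2 * real N * (pos_pow 1 (z \<bullet> \<nu>) * pos_pow (N - 1) (1 - z \<bullet> z))" for z
    unfolding g_def ddir_bump[OF assms(1)] by (simp add: pos_pow_def)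
  have nn: "g z \<ge> 0" for z unfolding g by (simp add: pos_pow_def)
  have "(LINT z|lborel. g z) = 0"
    using h0 half_int_cmult[of \<nu> 0 "-1" "ddir \<nu> (bump N)"] by (simp add: half_int_def g_def)
  then have "AE z in lborel. g z = 0"
    using integral_nonneg_eq_0_iff_AE[OF int] nn by simp
  then obtain M where M: "{z. g z \<noteq> 0} \<subseteq> M" "M \<in> null_sets lborel"
    unfolding eventually_ae_filter by auto
  define W where "W = {z. z \<bullet> \<nu> > 0} \<inter> ball 0 1"
  have "g z \<noteq> 0" if "z \<in> W" for z
  proof -
    have "norm z < 1" "z \<bullet> \<nu> > 0" using that by (auto simp: W_def)
    moreover from this have "1 - z \<bullet> z > 0" by (simp add: power2_norm_eq_inner[symmetric] abs_square_less_1)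
    ultimately show ?thesis unfolding g using assms(1) by (simp add: pos_pow_def)
  qed
  then have "negligible W"
    using M by (metis (mono_tags, lifting) mem_Collect_eq negligible_iff_null_sets negligible_subset null_sets_completionI subsetD subsetI)
  moreover have "open W" unfolding W_def
    using open_halfspace_gt[of 0 \<nu>, unfolded inner_commute[of \<nu>]] by (intro open_Int open_ball)
  moreover have "(1 / (2 * norm \<nu>)) *\<^sub>R \<nu> \<in> W"
    using assms(2) by (simp add: W_def)
  ultimately show False using open_not_negligible by blast
qed

lemma Cm_union:
  assumes "open S" "open T"
  shows "Cm m S f \<Longrightarrow> Cm m T f \<Longrightarrow> Cm m (S \<union> T) f"
proof (induction m arbitrary: f)
  case 0 then show ?case using assms by (simp add: Cm_0 continuous_on_open_Un)
next
  case (Suc m) then show ?case using assms by (auto simp: Cm_Suc continuous_on_open_Un)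
qed

text \<open>Written with \<open>z \<bullet> z\<close> instead of the norm, the function is a real power of a
polynomial, and each derivative is a coordinate times a function of the same kind.\<close>

lemma neg_laplacian_radial_powr:
  fixes z :: "real ^ 'n"
  assumes "z \<noteq> 0"
  shows "neg_laplacian (\<lambda>z. (z \<bullet> z) powr b) z = - (2 * b * (real CARD('n) + 2 * b - 2)) * (z \<bullet> z) powr (b - 1)"
proof -
  let ?S = "- {0 :: real ^ 'n}"
  have o: "open ?S" by auto
  have d: "(\<lambda>z. (z \<bullet> z) powr b) differentiable (at x)" and
    p: "partial i (\<lambda>z. (z \<bullet> z) powr b) x = 2 * b * (x $ i * (x \<bullet> x) powr (b - 1))" if "x \<in> ?S" for b x i
  proof -
    have D: "((\<lambda>z. z \<bullet> z) has_derivative (\<lambda>v. x \<bullet> v + v \<bullet> x)) (at x)"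
      by (intro has_derivative_inner has_derivative_ident)
    have pos: "x \<bullet> x > 0" using that by simp
    have "((\<lambda>t. t powr b) has_derivative (*) (b * (x \<bullet> x) powr (b - 1))) (at (x \<bullet> x))"
      using has_real_derivative_powr[OF pos, of b] by (simp add: has_field_derivative_def)
    from has_derivative_compose[OF D this]
    have X: "((\<lambda>z. (z \<bullet> z) powr b) has_derivative (\<lambda>v. b * (x \<bullet> x) powr (b - 1) * (x \<bullet> v + v \<bullet> x))) (at x)" .
    then show "(\<lambda>z. (z \<bullet> z) powr b) differentiable (at x)" by (auto simp: differentiable_def)
    from partial_eq_derivative[OF X] show "partial i (\<lambda>z. (z \<bullet> z) powr b) x = 2 * b * (x $ i * (x \<bullet> x) powr (b - 1))"
      by (simp add: inner_axis inner_axis')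
  qed
  have z: "z \<in> ?S" using assms by simp
  have dc: "(\<lambda>x. x $ i) differentiable (at (x :: real ^ 'n))" for i x
    using bounded_linear_imp_differentiable[OF bounded_linear_vec_nth] by blast
  have "partial i (partial i (\<lambda>z. (z \<bullet> z) powr b)) z
     = 2 * b * ((z \<bullet> z) powr (b - 1) + 2 * (b - 1) * ((z $ i)\<^sup>2 * (z \<bullet> z) powr (b - 2)))" for i
  proof -
    have "partial i (partial i (\<lambda>z. (z \<bullet> z) powr b)) z = partial i (\<lambda>x. 2 * b * (x $ i * (x \<bullet> x) powr (b - 1))) z"
      by (rule partial_cong_open[OF o z]) (rule p)
    also have "\<dots> = 2 * b * (partial i (\<lambda>x. x $ i) z * (z \<bullet> z) powr (b - 1) + z $ i * partial i (\<lambda>x. (x \<bullet> x) powr (b - 1)) z)"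
      by (simp only: partial_cmult[OF differentiable_mult[OF dc d[OF z]]] partial_mult[OF dc d[OF z]])
    finally show ?thesis unfolding p[OF z] partial_component by (simp add: power2_eq_square algebra_simps)
  qed
  then have "neg_laplacian (\<lambda>z. (z \<bullet> z) powr b) z = - (\<Sum>i\<in>UNIV. 2 * b * ((z \<bullet> z) powr (b - 1) + 2 * (b - 1) * ((z $ i)\<^sup>2 * (z \<bullet> z) powr (b - 2))))"
    by (simp add: neg_laplacian_def)
  also have "\<dots> = - (2 * b * (real CARD('n) * (z \<bullet> z) powr (b - 1) + 2 * (b - 1) * ((\<Sum>i\<in>UNIV. (z $ i)\<^sup>2) * (z \<bullet> z) powr (b - 2))))"
    by (simp add: sum.distrib flip: sum_distrib_left sum_distrib_right)
  also have "(\<Sum>i\<in>UNIV. (z $ i)\<^sup>2) = z \<bullet> z" by (simp add: inner_vec_def power2_eq_square)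
  also have "(z \<bullet> z) * (z \<bullet> z) powr (b - 2) = (z \<bullet> z) powr (b - 1)"
    using assms powr_add[of "z \<bullet> z" 1 "b - 2"] by simp
  finally show ?thesis by (simp add: algebra_simps)
qed

text \<open>Each Laplacian lowers the exponent of \<open>z \<bullet> z\<close> by one and multiplies by a factor
that is zero at exponent \<open>1 - n/2\<close>. This exponent is reached at the \<open>k\<close>-th
application.\<close>

lemma polyharmonic_powr:
  fixes z :: "real ^ 'n"
  assumes "z \<noteq> 0" "k \<ge> 1"
  shows "(neg_laplacian ^^ k) (\<lambda>z. (z \<bullet> z) powr ((2 * real k - real CARD('n)) / 2)) z = 0"
proof -
  define b where "b = (2 * real k - real CARD('n)) / 2"
  let ?S = "- {0 :: real ^ 'n}"
  have o: "open ?S" by auto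
  define c where "c j = (\<Prod>i<j. - (2 * (b - real i) * (real CARD('n) + 2 * (b - real i) - 2)))" for j
  have "(neg_laplacian ^^ j) (\<lambda>z. (z \<bullet> z) powr b) z = c j * (z \<bullet> z) powr (b - real j)" if "z \<in> ?S" for j z
    using that
  proof (induction j arbitrary: z)
    case 0 then show ?case by (simp add: c_def)
  next
    case (Suc j)
    have "(neg_laplacian ^^ Suc j) (\<lambda>z. (z \<bullet> z) powr b) z = neg_laplacian (\<lambda>z. c j * (z \<bullet> z) powr (b - real j)) z"
      by (simp, rule neg_laplacian_cong_open[OF o Suc.prems], rule Suc.IH)
    also have "\<dots> = c j * neg_laplacian (\<lambda>z. (z \<bullet> z) powr (b - real j)) z"
      by (rule neg_laplacian_cmult[OF _ o Suc.prems]) (intro Cm_powr Cm_inner_self o, simp)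
    also have "neg_laplacian (\<lambda>z. (z \<bullet> z) powr (b - real j)) z
       = - (2 * (b - real j) * (real CARD('n) + 2 * (b - real j) - 2)) * (z \<bullet> z) powr (b - real j - 1)"
      using Suc.prems by (intro neg_laplacian_radial_powr) auto
    finally show ?case by (simp add: c_def algebra_simps)
  qed
  moreover have "c k = 0"
  proof -
    have "real CARD('n) + 2 * (b - real (k - 1)) - 2 = 0" using assms(2) by (simp add: b_def of_nat_diff field_simps)
    then show ?thesis unfolding c_def using assms(2) by (intro prod_zero) (auto intro!: bexI[of _ "k - 1"])
  qed
  ultimately show ?thesis using assms(1) by (simp add: b_def)
qed

text \<open>The singularity is removed by a radial cut-off, and outside the transition annulus \<open>V\<close> is
zero or polyharmonic.\<close>

lemma truncated_fundamental_solution: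
  assumes "k \<ge> 1"
  obtains V :: "real ^ 'n \<Rightarrow> real" where "Cm m UNIV V" "\<And>z. norm z \<le> 1 \<Longrightarrow> V z = 0"
    "\<And>z. norm z \<ge> sqrt 2 \<Longrightarrow> V z = norm z powr (2 * real k - real CARD('n))"
    "\<And>z. norm z < 1 \<or> norm z > sqrt 2 \<Longrightarrow> (neg_laplacian ^^ k) V z = 0"
proof -
  define b where "b = (2 * real k - real CARD('n)) / 2"
  \<comment> \<open>the step function \<open>a / (a + b)\<close> with \<open>a = (|z|^2 - 1)_+^(m+1)\<close> and
     \<open>b = (2 - |z|^2)_+^(m+1)\<close>, never both zero\<close>
  define \<sigma> where "\<sigma> z = pos_pow (Suc m) (z \<bullet> z - 1) * (pos_pow (Suc m) (z \<bullet> z - 1) + pos_pow (Suc m) (2 - z \<bullet> z)) powr (-1)" for z :: "real ^ 'n"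
  define V where "V z = \<sigma> z * (z \<bullet> z) powr b" for z
  have ss: "z \<bullet> z = (norm z)\<^sup>2" for z :: "real ^ 'n" by (simp add: power2_norm_eq_inner)
  have pos: "pos_pow (Suc m) (z \<bullet> z - 1) + pos_pow (Suc m) (2 - z \<bullet> z) > 0" for z :: "real ^ 'n"
    by (auto simp: pos_pow_def intro: add_pos_pos)
  have C\<sigma>: "Cm m UNIV \<sigma>" unfolding \<sigma>_def[abs_def]
    by (intro Cm_mult Cm_powr Cm_add Cm_pos_pow Cm_diff Cm_const Cm_inner_self pos) auto
  have V0: "V z = 0" if "norm z \<le> 1" for z
  proof -
    have "z \<bullet> z \<le> 1" using that by (simp add: ss power_le_one)
    then show ?thesis by (simp add: V_def \<sigma>_def pos_pow_def)
  qed
  have Vout: "V z = (z \<bullet> z) powr b" if "norm z \<ge> sqrt 2" for z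
  proof -
    have "z \<bullet> z \<ge> 2" unfolding ss using that real_sqrt_le_iff by (metis real_sqrt_abs real_sqrt_le_iff abs_norm_cancel)
    then have "pos_pow (Suc m) (2 - z \<bullet> z) = 0" "pos_pow (Suc m) (z \<bullet> z - 1) > 0" by (auto simp: pos_pow_def)
    then have "\<sigma> z = 1" unfolding \<sigma>_def by (simp add: powr_minus)
    then show ?thesis by (simp add: V_def)
  qed
  have o: "open (- {0 :: real ^ 'n})" by auto
  have "Cm m (- {0}) V" unfolding V_def[abs_def]
    by (intro Cm_mult Cm_powr Cm_inner_self o Cm_subset[OF C\<sigma>]) auto
  moreover have "Cm m (ball 0 1) V"
    by (rule Cm_cong[OF open_ball _ Cm_const[OF open_ball, of _ _ _ 0]]) (use V0 in auto)
  ultimately have "Cm m (- {0} \<union> ball 0 1) V" by (intro Cm_union o open_ball)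
  moreover have "- {0} \<union> ball 0 1 = (UNIV :: (real ^ 'n) set)" by auto
  ultimately have CV: "Cm m UNIV V" by simp
  have N: "(neg_laplacian ^^ k) V z = 0" if "norm z < 1 \<or> norm z > sqrt 2" for z
  proof (cases "norm z < 1")
    case True
    then show ?thesis using V0 by (intro neg_laplacian_pow_eq_0[of "ball 0 1"]) auto
  next
    case False
    then have z: "z \<in> - cball 0 (sqrt 2)" using that by auto
    have "(neg_laplacian ^^ k) V z = (neg_laplacian ^^ k) (\<lambda>z. (z \<bullet> z) powr b) z"
      by (rule neg_laplacian_pow_cong_open[OF _ _ z]) (auto intro!: Vout)
    also have "\<dots> = 0" unfolding b_def using z assms by (intro polyharmonic_powr) auto
    finally show ?thesis .
  qed
  have Vout': "V z = norm z powr (2 * real k - real CARD('n))" if "norm z \<ge> sqrt 2" for z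
  proof -
    have "norm z > 0" using that by (smt (verit) real_sqrt_gt_zero)
    then have "z \<bullet> z = norm z powr 2" by (simp add: ss)
    then have "(z \<bullet> z) powr b = norm z powr (2 * b)"
      by (simp only: powr_powr)
    moreover have "2 * b = 2 * real k - real CARD('n)" by (simp add: b_def)
    ultimately show ?thesis using Vout[OF that] by (simp only:)
  qed
  show ?thesis using that[OF CV V0 Vout' N] .
qed

section \<open>Blow-up at a boundary point\<close>

text \<open>Families of \<open>C^m\<close> functions indexed by \<open>[0, 1]\<close> whose partials are continuous
in the parameter and the variable jointly. Limits and uniform bounds as the parameter tends to
\<open>0\<close> are then immediate, also after applying iterated Laplacians.\<close>

definition joint_Cm :: "nat \<Rightarrow> (real \<Rightarrow> real ^ 'n \<Rightarrow> real) \<Rightarrow> bool" where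
  "joint_Cm m F \<longleftrightarrow> reg (\<lambda>F. continuous_on ({0..1} \<times> UNIV) (\<lambda>(a, x). F a x)) {0..1} UNIV m F"

lemma joint_Cm_base: "reg_base (\<lambda>F :: real \<Rightarrow> real ^ 'n \<Rightarrow> real. continuous_on ({0..1} \<times> UNIV) (\<lambda>(a, x). F a x)) {0..1} UNIV"
proof -
  define B where "B F \<longleftrightarrow> continuous_on ({0..1} \<times> UNIV) (\<lambda>(a, x). F a x)" for F :: "real \<Rightarrow> real ^ 'n \<Rightarrow> real"
  have "B g" if "\<forall>a\<in>{0..1}. \<forall>x\<in>UNIV. f a x = g a x" "B f" for f g
    using that(2) unfolding B_def by (rule continuous_on_eq) (use that(1) in auto)
  moreover have "B (\<lambda>a x. f a x + g a x)" if "B f" "B g" for f g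
    using continuous_on_add[OF that[unfolded B_def]] by (simp add: B_def case_prod_unfold)
  moreover have "B (\<lambda>a x. f a x * g a x)" if "B f" "B g" for f g
    using continuous_on_mult[OF that[unfolded B_def]] by (simp add: B_def case_prod_unfold)
  moreover have "B (\<lambda>a x. c)" for c unfolding B_def by (simp add: case_prod_unfold)
  moreover have "B (\<lambda>a x. x $ i)" for i unfolding B_def
    by (auto simp: case_prod_unfold intro!: continuous_intros)
  ultimately have "reg_base B {0..1} UNIV" unfolding reg_base_def by blast
  then show ?thesis unfolding B_def[abs_def] .
qed

lemma joint_Cm_0: "joint_Cm 0 F \<longleftrightarrow> continuous_on ({0..1} \<times> UNIV) (\<lambda>(a, x). F a x)"
  by (simp add: joint_Cm_def)

lemma joint_Cm_Suc: "joint_Cm (Suc m) F \<longleftrightarrow> joint_Cm 0 F \<and> (\<forall>a\<in>{0..1}. \<forall>x. F a differentiable (at x)) \<and> (\<forall>i. joint_Cm m (\<lambda>a. partial i (F a)))"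
  by (simp add: joint_Cm_def)

lemma joint_Cm_mult: "joint_Cm m F \<Longrightarrow> joint_Cm m G \<Longrightarrow> joint_Cm m (\<lambda>a x. F a x * G a x)"
  unfolding joint_Cm_def by (rule reg_mult[OF joint_Cm_base])

lemma joint_Cm_power: "joint_Cm m F \<Longrightarrow> joint_Cm m (\<lambda>a x. F a x ^ b)"
  unfolding joint_Cm_def by (rule reg_power[OF joint_Cm_base])

lemma joint_Cm_cong: "(\<And>a x. a \<in> {0..1} \<Longrightarrow> F a x = G a x) \<Longrightarrow> joint_Cm m F \<Longrightarrow> joint_Cm m G"
  unfolding joint_Cm_def by (rule reg_cong[OF joint_Cm_base]) auto

lemma joint_Cm_neg_laplacian_pow: "joint_Cm (2 * k + m) F \<Longrightarrow> joint_Cm m (\<lambda>a. (neg_laplacian ^^ k) (F a))"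
  unfolding joint_Cm_def by (rule reg_neg_laplacian_pow[OF joint_Cm_base])

lemma joint_Cm_const: "Cm m UNIV f \<Longrightarrow> joint_Cm m (\<lambda>a. f)"
proof (induction m arbitrary: f)
  case 0
  then show ?case unfolding joint_Cm_0 Cm_0 case_prod_unfold
    by (rule continuous_on_compose2) (auto intro!: continuous_intros)
next
  case (Suc m)
  have "joint_Cm 0 (\<lambda>a. f)" unfolding joint_Cm_0 case_prod_unfold
    by (rule continuous_on_compose2[OF Cm_continuous[OF Suc.prems]]) (auto intro!: continuous_intros)
  then show ?case using Suc by (simp add: joint_Cm_Suc Cm_Suc)
qed

lemma joint_Cm_param:
  assumes "continuous_on {0..1} \<phi>" shows "joint_Cm m (\<lambda>a (x :: real ^ 'n). \<phi> a)"
proof -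
  have J0: "joint_Cm 0 (\<lambda>a (x :: real ^ 'n). \<phi> a)" unfolding joint_Cm_0 case_prod_unfold
    by (rule continuous_on_compose2[OF assms]) (auto intro!: continuous_intros)
  show ?thesis
  proof (cases m)
    case 0 then show ?thesis using J0 by simp
  next
    case (Suc l)
    have "joint_Cm l (\<lambda>a x. 0)" by (rule joint_Cm_const) (rule Cm_const, simp)
    then have "joint_Cm l (\<lambda>a. partial i (\<lambda>x :: real ^ 'n. \<phi> a))" for i
      by (rule joint_Cm_cong[rotated]) simp
    then show ?thesis using J0 by (simp add: Suc joint_Cm_Suc)
  qed
qed

lemma joint_Cm_scaled: "Cm m UNIV h \<Longrightarrow> joint_Cm m (\<lambda>a z. h (p + (a * c) *\<^sub>R z))"
proof (induction m arbitrary: h)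
  case 0
  then show ?case unfolding joint_Cm_0 Cm_0 case_prod_unfold
    by (rule continuous_on_compose2) (auto intro!: continuous_intros)
next
  case (Suc m)
  have J0: "joint_Cm 0 (\<lambda>a z. h (p + (a * c) *\<^sub>R z))" unfolding joint_Cm_0 case_prod_unfold
    by (rule continuous_on_compose2[OF Cm_continuous[OF Suc.prems]]) (auto intro!: continuous_intros)
  have d: "h differentiable (at x)" for x using Suc.prems by (simp add: Cm_Suc)
  have "joint_Cm m (\<lambda>a. partial i (\<lambda>z. h (p + (a * c) *\<^sub>R z)))" for i
  proof (rule joint_Cm_cong)
    show "joint_Cm m (\<lambda>a z. (a * c) * partial i h (p + (a * c) *\<^sub>R z))"
      using Suc.prems by (intro joint_Cm_mult joint_Cm_param Suc.IH) (auto simp: Cm_Suc intro!: continuous_intros)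
  qed (simp add: partial_affine[OF d])
  moreover have "(\<lambda>z. h (p + (a * c) *\<^sub>R z)) differentiable (at x)" for a x
    using differentiable_affine[OF d] by (auto simp: differentiable_def)
  ultimately show ?case using J0 by (simp add: joint_Cm_Suc)
qed

lemma linear_ddir: "linear (\<lambda>v. ddir v f x)"
  by (rule linearI) (simp_all add: ddir_def algebra_simps sum.distrib sum_distrib_left)

text \<open>The rescaled functions \<open>\<rho> (p + a c z) / (a c)\<close> with the derivative of
\<open>\<rho>\<close> at \<open>p\<close> as their limit at \<open>a = 0\<close>. In the partials the
division cancels, so only joint continuity of the family itself needs an argument: \<open>\<rho> (p + w)
= D\<rho>(p) w + |w| E w\<close> with \<open>E\<close> continuous and \<open>E 0 = 0\<close>.\<close>

lemma joint_Cm_blowup: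
  fixes \<rho> :: "real ^ 'n \<Rightarrow> real"
  assumes \<rho>: "Cm (Suc m) UNIV \<rho>" and p: "\<rho> p = 0" and c: "c > 0"
  shows "joint_Cm (Suc m) (\<lambda>a z. if a = 0 then ddir z \<rho> p else \<rho> (p + (a * c) *\<^sub>R z) / (a * c))"
    (is "joint_Cm (Suc m) ?F")
proof -
  have d: "\<rho> differentiable (at x)" for x using \<rho> by (simp add: Cm_Suc)
  define E where "E w = (if w = 0 then 0 else (\<rho> (p + w) - ddir w \<rho> p) / norm w)" for w
  have contE: "continuous_on UNIV E"
    unfolding continuous_on_eq_continuous_at[OF open_UNIV]
  proof
    fix w :: "real ^ 'n"
    show "isCont E w"
    proof (cases "w = 0")
      case True
      have "((\<lambda>h. norm (\<rho> (p + h) - \<rho> p - ddir h \<rho> p) / norm h) \<longlongrightarrow> 0) (at 0)"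
        using has_derivative_ddir[OF d, of p] by (simp add: has_derivative_at)
      then have "((\<lambda>h. \<bar>E h\<bar>) \<longlongrightarrow> 0) (at 0)"
        by (rule Lim_transform_eventually) (auto simp: eventually_at_filter E_def p)
      then have "(E \<longlongrightarrow> 0) (at 0)" by (simp only: tendsto_rabs_zero_iff)
      moreover have "E 0 = 0" by (simp add: E_def)
      ultimately show ?thesis using True by (simp add: isCont_def)
    next
      case False
      have cl: "isCont (\<lambda>w. ddir w \<rho> p) w" 
        by (rule linear_continuous_at[OF linear_ddir[unfolded linear_conv_bounded_linear]])
      have "isCont \<rho> (p + w)" using d by (rule differentiable_imp_continuous_within)
      then have "isCont (\<lambda>w. \<rho> (p + w)) w" by (rule isCont_o2[rotated]) (intro continuous_intros)
      then have cq: "isCont (\<lambda>w. (\<rho> (p + w) - ddir w \<rho> p) / norm w) w"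
        using False cl by (intro continuous_intros) auto
      have "\<forall>\<^sub>F v in nhds w. E v = (\<rho> (p + v) - ddir v \<rho> p) / norm v"
        using eventually_nhds_in_open[of "- {0}" w] False by (auto elim!: eventually_mono simp: E_def)
      from isCont_cong[OF this] cq show ?thesis by simp
    qed
  qed
  have rep: "?F a z = ddir z \<rho> p + norm z * E ((a * c) *\<^sub>R z)" if "a \<in> {0..1}" for a z
  proof (cases "a = 0 \<or> z = 0")
    case True
    then show ?thesis using p by (auto simp: E_def linear_0[OF linear_ddir])
  next
    case False
    then have "a * c > 0" using that c by simp
    then show ?thesis using False c by (simp add: E_def ddir_scaleR field_simps)
  qed
  have J0: "joint_Cm 0 ?F"
  proof (rule joint_Cm_cong[OF rep[symmetric]])
    show "joint_Cm 0 (\<lambda>a z. ddir z \<rho> p + norm z * E ((a * c) *\<^sub>R z))"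
    proof -
      let ?D = "{0..1 :: real} \<times> (UNIV :: (real ^ 'n) set)"
      have 1: "continuous_on ?D (\<lambda>x. ddir (snd x) \<rho> p)"
        by (rule continuous_on_compose2[OF linear_continuous_on[OF linear_ddir[unfolded linear_conv_bounded_linear], of UNIV]])
           (auto intro!: continuous_intros)
      have 2: "continuous_on ?D (\<lambda>x. E ((fst x * c) *\<^sub>R snd x))"
        by (rule continuous_on_compose2[OF contE]) (auto intro!: continuous_intros)
      show ?thesis unfolding joint_Cm_0 case_prod_unfold
        by (intro continuous_on_add continuous_on_mult continuous_on_norm continuous_on_snd continuous_on_id 1 2)
    qed
  qed auto
  have D: "?F a differentiable (at z)" and P: "partial i (?F a) z = partial i \<rho> (p + (a * c) *\<^sub>R z)" if "a \<in> {0..1}" for a z i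
  proof -
    have "?F a differentiable (at z) \<and> partial i (?F a) z = partial i \<rho> (p + (a * c) *\<^sub>R z)"
    proof (cases "a = 0")
      case True
      have "((\<lambda>w. ddir w \<rho> p) has_derivative (\<lambda>w. ddir w \<rho> p)) (at z)"
        by (intro bounded_linear_imp_has_derivative) (rule linear_ddir[unfolded linear_conv_bounded_linear])
      from this partial_eq_derivative[OF this, of i] show ?thesis using True
        by (auto simp: differentiable_def ddir_axis)
    next
      case False
      then have ac: "a * c > 0" using that c by simp
      have A: "(\<lambda>z. \<rho> (p + (a * c) *\<^sub>R z)) differentiable (at z)"
        using differentiable_affine[OF d] by (auto simp: differentiable_def)
      have e: "?F a = (\<lambda>z. inverse (a * c) * \<rho> (p + (a * c) *\<^sub>R z))" using False by (simp add: divide_inverse mult.commute)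
      have "inverse (a * c) * (a * c * X) = X" for X
        using ac by (metis left_inverse less_irrefl mult.assoc mult_1)
      then show ?thesis unfolding e partial_cmult[OF A] partial_affine[OF d]
        using differentiable_mult[OF differentiable_const A] by blast
    qed
    then show "?F a differentiable (at z)" "partial i (?F a) z = partial i \<rho> (p + (a * c) *\<^sub>R z)" by auto
  qed
  have "joint_Cm m (\<lambda>a. partial i (?F a))" for i
  proof (rule joint_Cm_cong)
    show "joint_Cm m (\<lambda>a z. partial i \<rho> (p + (a * c) *\<^sub>R z))"
      by (rule joint_Cm_scaled[OF Cm_partial[OF \<rho>]])
  qed (rule P[symmetric])
  then show ?thesis using J0 D unfolding joint_Cm_Suc[of m] by blast
qed

lemma lborel_integral_affine:
  fixes f :: "real ^ 'n \<Rightarrow> real"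
  assumes [measurable]: "f \<in> borel_measurable borel" and "c > 0"
  shows "(LINT y|lborel. f y) = c ^ CARD('n) * (LINT z|lborel. f (p + c *\<^sub>R z))"
proof -
  have "(LINT y|lborel. f y) = (LINT y|density (distr lborel borel (\<lambda>x. p + c *\<^sub>R x)) (\<lambda>_. ennreal (\<bar>c\<bar> ^ CARD('n))). f y)"
    using lborel_affine[of c p] assms(2) by simp
  also have "\<dots> = (LINT y|distr lborel borel (\<lambda>x. p + c *\<^sub>R x). c ^ CARD('n) * f y)"
    using assms(2) by (subst integral_density) auto
  also have "\<dots> = (LINT z|lborel. c ^ CARD('n) * f (p + c *\<^sub>R z))"
    by (subst integral_distr) auto
  finally show ?thesis by simp
qed

text \<open>The function \<open>g\<close> behaves like \<open>A \<rho>^m\<close> at \<open>p\<close> and is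
orthogonal to the images under \<open>(-\<Delta>)^k\<close> of test functions concentrated at
\<open>p\<close>. Rescaling by \<open>y = p + \<delta> z\<close> and letting \<open>\<delta>\<close>
tend to \<open>0\<close>, the domain becomes the half-space \<open>z \<bullet> \<nu> > 0\<close>,
\<open>\<rho> / \<delta>\<close> becomes \<open>z \<bullet> \<nu>\<close>, and the orthogonality becomes
\<open>A\<close> times a half-space integral that is not zero. The exponent of the bump makes it smooth
enough for that integral.\<close>

lemma blowup_coefficient_zero:
  fixes \<rho> g :: "real ^ 'n \<Rightarrow> real"
  assumes U: "open U" and s: "s > 0" and \<rho>: "Cm (2 * k) UNIV \<rho>" and p: "\<rho> p = 0"
    and \<nu>: "\<And>z. ddir z \<rho> p = z \<bullet> \<nu>" "\<nu> \<noteq> 0"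
    and chart: "\<And>x. x \<in> ball p s \<Longrightarrow> x \<in> U \<longleftrightarrow> \<rho> x > 0"
    and m: "m < k"
    and A: "\<And>\<eta>. \<eta> > 0 \<Longrightarrow> \<exists>d>0. \<forall>y\<in>U \<inter> ball p d. \<bar>g y - A * \<rho> y ^ m\<bar> \<le> \<eta> * \<rho> y ^ m"
    and test: "\<And>\<delta>. 0 < \<delta> \<Longrightarrow> \<delta> < s \<Longrightarrow>
       set_integrable lborel U (\<lambda>y. g y * (neg_laplacian ^^ k) (\<lambda>y. \<rho> y ^ (2 * k - 1 - m) * bump (2 * k + 4) ((1 / \<delta>) *\<^sub>R (y - p))) y) \<and>
       (LINT y:U|lborel. g y * (neg_laplacian ^^ k) (\<lambda>y. \<rho> y ^ (2 * k - 1 - m) * bump (2 * k + 4) ((1 / \<delta>) *\<^sub>R (y - p))) y) = 0"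
  shows "A = 0"
proof -
  define \<alpha> where "\<alpha> = 2 * k - 1 - m"
  define \<psi> where "\<psi> = (bump (2 * k + 4) :: real ^ 'n \<Rightarrow> real)"
  define c where "c = s / 2"
  have c: "0 < c" "c < s" using s by (auto simp: c_def)
  define R where "R a z = (if a = 0 then ddir z \<rho> p else \<rho> (p + (a * c) *\<^sub>R z) / (a * c))" for a z
  define H where "H a = (neg_laplacian ^^ k) (\<lambda>z. R a z ^ \<alpha> * \<psi> z)" for a
  have k: "2 * k = Suc (2 * k - 1)" using m by simp
  have JR: "joint_Cm (2 * k) R" unfolding R_def[abs_def]
    using joint_Cm_blowup[of "2 * k - 1" \<rho> p c] \<rho> p c k by simp
  have C\<psi>: "Cm (2 * k + 3) UNIV \<psi>" unfolding \<psi>_def by (rule Cm_bump) simp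
  have JH: "joint_Cm 0 H" unfolding H_def
    by (rule joint_Cm_neg_laplacian_pow) (use JR in \<open>auto intro!: joint_Cm_mult joint_Cm_power joint_Cm_const Cm_mono[OF _ C\<psi>]\<close>)
  have JR0: "joint_Cm 0 R" using JR k by (metis joint_Cm_Suc)
  have comp: "compact ({0..1 :: real} \<times> cball (0 :: real ^ 'n) 1)" by (intro compact_Times) auto
  have "bounded ((\<lambda>(a, z). H a z) ` ({0..1} \<times> cball 0 1))"
    by (intro compact_imp_bounded compact_continuous_image comp)
       (rule continuous_on_subset[OF JH[unfolded joint_Cm_0]], auto)
  then obtain KH where KH: "\<And>a z. a \<in> {0..1} \<Longrightarrow> z \<in> cball 0 1 \<Longrightarrow> \<bar>H a z\<bar> \<le> KH"
    unfolding bounded_real by fastforce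
  have "bounded ((\<lambda>(a, z). R a z) ` ({0..1} \<times> cball 0 1))"
    by (intro compact_imp_bounded compact_continuous_image comp)
       (rule continuous_on_subset[OF JR0[unfolded joint_Cm_0]], auto)
  then obtain KR where KR: "\<And>a z. a \<in> {0..1} \<Longrightarrow> z \<in> cball 0 1 \<Longrightarrow> \<bar>R a z\<bar> \<le> KR"
    unfolding bounded_real by fastforce
  have KH0: "KH \<ge> 0" using KH[of 0 0] by simp
  have KR0: "KR \<ge> 0" using KR[of 0 0] by simp
  have Hout: "H a z = 0" if "z \<notin> cball 0 1" for a z
    using zero_off_ballD[OF zero_off_ball_neg_laplacian_pow[OF zero_off_ball_mult[OF zero_off_ball_bump]] that]
    by (simp add: H_def \<psi>_def)
  define a where "a j = inverse (real (Suc j))" for j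
  have a: "0 < a j" "a j \<le> 1" for j by (auto simp: a_def field_simps)
  have a0: "a \<longlonglongrightarrow> 0" unfolding a_def by (rule LIMSEQ_inverse_real_of_nat)
  \<comment> \<open>the rescaled integrand, divided by the powers of \<open>\<delta> = a j * c\<close> that make
     it converge\<close>
  define f where "f j z = indicator U (p + (a j * c) *\<^sub>R z) * g (p + (a j * c) *\<^sub>R z) / (a j * c) ^ m * H (a j) z" for j z
  have f: "f j \<in> borel_measurable borel \<and> (LINT z|lborel. f j z) = 0" for j
  proof -
    define \<delta> where "\<delta> = a j * c"
    have \<delta>: "0 < \<delta>" "\<delta> < s"
      using a[of j] c by (auto simp: \<delta>_def intro: le_less_trans[OF mult_right_mono[of "a j" 1 c]])
    define w where "w y = \<rho> y ^ \<alpha> * \<psi> ((1 / \<delta>) *\<^sub>R (y - p))" for y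
    have Cw: "Cm (2 * k) UNIV w"
    proof -
      have "Cm (2 * k) UNIV (\<lambda>y. \<psi> ((- (1 / \<delta>)) *\<^sub>R p + (1 / \<delta>) *\<^sub>R y))"
        using Cm_affine[OF open_UNIV, of "2 * k" \<psi> "(- (1 / \<delta>)) *\<^sub>R p" "1 / \<delta>"] Cm_mono[OF _ C\<psi>, of "2 * k"] by simp
      moreover have "w = (\<lambda>y. \<rho> y ^ \<alpha> * \<psi> ((- (1 / \<delta>)) *\<^sub>R p + (1 / \<delta>) *\<^sub>R y))"
        unfolding w_def by (simp add: algebra_simps)
      ultimately show ?thesis using \<rho> by (auto intro!: Cm_mult Cm_power)
    qed
    have wz: "(\<lambda>z. w (p + \<delta> *\<^sub>R z)) = (\<lambda>z. \<delta> ^ \<alpha> * (R (a j) z ^ \<alpha> * \<psi> z))"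
      using a(1)[of j] c \<delta> by (auto simp: w_def R_def \<delta>_def[symmetric] power_divide)
    have CR: "Cm (2 * k) UNIV (\<lambda>z. R (a j) z ^ \<alpha> * \<psi> z)"
    proof -
      have "Cm (2 * k) UNIV (\<lambda>z. w (p + \<delta> *\<^sub>R z))" using Cm_affine[OF open_UNIV Cw, of p \<delta>] by simp
      then have "Cm (2 * k) UNIV (\<lambda>z. inverse (\<delta> ^ \<alpha>) * (\<delta> ^ \<alpha> * (R (a j) z ^ \<alpha> * \<psi> z)))"
        unfolding wz by (rule Cm_cmult[OF open_UNIV])
      moreover have "inverse (\<delta> ^ \<alpha>) * (\<delta> ^ \<alpha> * X) = X" for X using \<delta> by simp
      ultimately show ?thesis by (simp only:)
    qed
    have NL: "\<delta> ^ (2 * k) * (neg_laplacian ^^ k) w (p + \<delta> *\<^sub>R z) = \<delta> ^ \<alpha> * H (a j) z" for z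
    proof -
      have "\<delta> ^ (2 * k) * (neg_laplacian ^^ k) w (p + \<delta> *\<^sub>R z) = (neg_laplacian ^^ k) (\<lambda>z. w (p + \<delta> *\<^sub>R z)) z"
        using neg_laplacian_pow_affine[OF open_UNIV Cw, of p \<delta> z] by simp
      also have "\<dots> = \<delta> ^ \<alpha> * H (a j) z"
        unfolding wz H_def by (rule neg_laplacian_pow_cmult[OF open_UNIV CR]) simp
      finally show ?thesis .
    qed
    let ?h = "\<lambda>y. indicator U y * (g y * (neg_laplacian ^^ k) w y)"
    have T: "set_integrable lborel U (\<lambda>y. g y * (neg_laplacian ^^ k) w y)"
       "(LINT y:U|lborel. g y * (neg_laplacian ^^ k) w y) = 0"
      using test[OF \<delta>] unfolding w_def[abs_def] \<alpha>_def \<psi>_def by auto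
    have hm: "?h \<in> borel_measurable borel"
      using T(1) unfolding set_integrable_def by (auto dest: borel_measurable_integrable)
    have h0: "(LINT z|lborel. ?h (p + \<delta> *\<^sub>R z)) = 0"
      using lborel_integral_affine[OF hm \<delta>(1), of p] T(2) \<delta> by (simp add: set_lebesgue_integral_def)
    have fh: "f j z = \<delta> ^ (2 * k) / (\<delta> ^ \<alpha> * \<delta> ^ m) * ?h (p + \<delta> *\<^sub>R z)" for z
    proof -
      have "H (a j) z = \<delta> ^ (2 * k) / \<delta> ^ \<alpha> * (neg_laplacian ^^ k) w (p + \<delta> *\<^sub>R z)"
        using NL[of z] \<delta> by (simp add: field_simps)
      then show ?thesis unfolding f_def \<delta>_def[symmetric] by (simp add: mult_ac)
    qed
    have "(\<lambda>z. ?h (p + \<delta> *\<^sub>R z)) \<in> borel_measurable borel"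
      by (rule measurable_compose[OF _ hm]) simp
    then have "f j \<in> borel_measurable borel" unfolding fh[abs_def] by (rule borel_measurable_times[OF borel_measurable_const])
    moreover have "(LINT z|lborel. f j z) = 0" unfolding fh using h0 by simp
    ultimately show ?thesis by simp
  qed
  have "(\<lambda>j. LINT z|lborel. f j z) \<longlonglongrightarrow> (LINT z|lborel. A * (pos_pow m (z \<bullet> \<nu>) * H 0 z))"
  proof -
    obtain d where d: "d > 0" "\<forall>y\<in>U \<inter> ball p d. \<bar>g y - A * \<rho> y ^ m\<bar> \<le> 1 * \<rho> y ^ m" using A[of 1] by auto
    have inb: "p + (a j * c) *\<^sub>R z \<in> ball p e" if "z \<in> cball 0 1" "a j * c < e" for j z e
    proof -
      have "norm ((a j * c) *\<^sub>R z) \<le> a j * c" using that(1) a[of j] c by (simp add: mult_left_le)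
      then show ?thesis using that(2) by (simp add: dist_norm)
    qed
    have acs: "a j * c < s" for j
      using a[of j] c by (auto intro: le_less_trans[OF mult_right_mono[of "a j" 1 c]])
    have Rpos: "p + (a j * c) *\<^sub>R z \<in> U \<longleftrightarrow> R (a j) z > 0" if "z \<in> cball 0 1" for j z
      using chart[OF inb[OF that acs]] a[of j] mult_pos_pos[OF a(1)[of j] c(1)]
      by (auto simp add: R_def zero_less_divide_iff)
    have \<rho>R: "\<rho> (p + (a j * c) *\<^sub>R z) ^ m = (a j * c) ^ m * R (a j) z ^ m" for j z
      using a[of j] c by (simp add: R_def power_divide)
    \<comment> \<open>both the dominating function and the pointwise limit come from this estimate\<close>
    have est: "\<bar>f j z - A * (pos_pow m (R (a j) z)) * H (a j) z\<bar> \<le> \<eta> * KR ^ m * KH"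
      if z: "z \<in> cball 0 1" and e: "a j * c < e" "\<forall>y\<in>U \<inter> ball p e. \<bar>g y - A * \<rho> y ^ m\<bar> \<le> \<eta> * \<rho> y ^ m" and \<eta>: "\<eta> \<ge> 0" for j z e \<eta>
    proof (cases "R (a j) z > 0")
      case False
      then show ?thesis using Rpos[OF z, of j] \<eta> KR0 KH0 by (simp add: f_def pos_pow_def)
    next
      case True
      then have iU: "p + (a j * c) *\<^sub>R z \<in> U" using Rpos[OF z] by simp
      have ac: "(a j * c) ^ m > 0" using a[of j] c by simp
      have "\<bar>g (p + (a j * c) *\<^sub>R z) - A * ((a j * c) ^ m * R (a j) z ^ m)\<bar> \<le> \<eta> * ((a j * c) ^ m * R (a j) z ^ m)"
        using e(2) iU inb[OF z e(1)] by (simp add: \<rho>R[symmetric])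
      then have "\<bar>g (p + (a j * c) *\<^sub>R z) - A * ((a j * c) ^ m * R (a j) z ^ m)\<bar> / (a j * c) ^ m \<le> \<eta> * R (a j) z ^ m"
        using ac by (simp add: pos_divide_le_eq mult_ac)
      moreover have "\<bar>g (p + (a j * c) *\<^sub>R z) - A * ((a j * c) ^ m * R (a j) z ^ m)\<bar> / (a j * c) ^ m
         = \<bar>g (p + (a j * c) *\<^sub>R z) / (a j * c) ^ m - A * R (a j) z ^ m\<bar>"
      proof -
        have "\<bar>X - A * (q * r)\<bar> / q = \<bar>X / q - A * r\<bar>" if "q > 0" for X q r
        proof -
          have "\<bar>X / q - A * r\<bar> = \<bar>(X - A * (q * r)) / q\<bar>" using that by (simp add: field_simps)
          then show ?thesis using that by (simp add: abs_divide)
        qed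
        from this[OF ac] show ?thesis .
      qed
      ultimately have "\<bar>g (p + (a j * c) *\<^sub>R z) / (a j * c) ^ m - A * R (a j) z ^ m\<bar> \<le> \<eta> * R (a j) z ^ m" by simp
      also have "\<dots> \<le> \<eta> * KR ^ m"
        using KR[OF _ z, of "a j"] a[of j] True \<eta> by (intro mult_left_mono power_mono) auto
      finally have 1: "\<bar>g (p + (a j * c) *\<^sub>R z) / (a j * c) ^ m - A * R (a j) z ^ m\<bar> \<le> \<eta> * KR ^ m" .
      have "f j z - A * (pos_pow m (R (a j) z)) * H (a j) z
          = (g (p + (a j * c) *\<^sub>R z) / (a j * c) ^ m - A * R (a j) z ^ m) * H (a j) z"
        using iU True by (simp add: f_def pos_pow_def left_diff_distrib)
      then show ?thesis unfolding abs_mult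
        using KH[OF _ z, of "a j"] a[of j] 1 by (simp add: abs_mult mult_mono)
    qed
    obtain J where J: "\<And>j. j \<ge> J \<Longrightarrow> a j * c < d"
    proof -
      have "(\<lambda>j. a j * c) \<longlonglongrightarrow> 0 * c" by (intro tendsto_intros a0)
      then have "\<forall>\<^sub>F j in sequentially. a j * c < d" using d(1) by (intro order_tendstoD) auto
      then show ?thesis using that unfolding eventually_sequentially by blast
    qed
    define M where "M = (\<bar>A\<bar> * (1 + KR) ^ m + KR ^ m) * KH"
    show ?thesis
    proof (rule LIMSEQ_offset[of _ J], rule integral_dominated_convergence[where w = "\<lambda>z. indicator (cball 0 1) z * M"])
      show "f (j + J) \<in> borel_measurable lborel" for j using f by simp
      have pc: "continuous_on UNIV (\<lambda>z :: real ^ 'n. (0 :: real, z))" by (intro continuous_intros)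
      have "continuous_on UNIV (H 0)"
      proof -
        have "range (\<lambda>z :: real ^ 'n. (0 :: real, z)) \<subseteq> {0..1} \<times> UNIV" by auto
        from continuous_on_compose2[OF JH[unfolded joint_Cm_0] pc this] show ?thesis by simp
      qed
      then have [measurable]: "H 0 \<in> borel_measurable borel" by (rule borel_measurable_continuous_onI)
      show "(\<lambda>z. A * (pos_pow m (z \<bullet> \<nu>) * H 0 z)) \<in> borel_measurable lborel" by measurable
      show "integrable lborel (\<lambda>z :: real ^ 'n. indicator (cball 0 1) z * M)" by (rule integrable_indicator_cball)
      show "AE z in lborel. norm (f (j + J) z) \<le> indicator (cball 0 1) z * M" for j
      proof (rule AE_I2)
        fix z
        show "norm (f (j + J) z) \<le> indicator (cball 0 1) z * M"
        proof (cases "z \<in> cball 0 1")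
          case False then show ?thesis using Hout by (simp add: f_def)
        next
          case True
          let ?j = "j + J"
          have "\<bar>f ?j z - A * (pos_pow m (R (a ?j) z)) * H (a ?j) z\<bar> \<le> 1 * KR ^ m * KH"
            by (rule est[OF True J d(2)]) auto
          moreover have "\<bar>A * (pos_pow m (R (a ?j) z)) * H (a ?j) z\<bar> \<le> \<bar>A\<bar> * (1 + KR) ^ m * KH"
            unfolding abs_mult using KH[OF _ True, of "a ?j"] KR[OF _ True, of "a ?j"] a[of ?j] KR0
            by (intro mult_mono pos_pow_bound) auto
          ultimately have "\<bar>f ?j z\<bar> \<le> M" unfolding M_def by (simp add: distrib_right)
          then show ?thesis using True by simp
        qed
      qed
      show "AE z in lborel. (\<lambda>j. f (j + J) z) \<longlonglongrightarrow> A * (pos_pow m (z \<bullet> \<nu>) * H 0 z)"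
        using AE_off_hyperplane[OF \<nu>(2)]
      proof eventually_elim
        case (elim z)
        show ?case
        proof (cases "z \<in> cball 0 1")
          case False then show ?thesis using Hout by (simp add: f_def)
        next
          case True
          have lim: "(\<lambda>j. F (a j) z) \<longlonglongrightarrow> F 0 z" if "joint_Cm 0 F" for F
          proof -
            have "continuous_on {0..1} (\<lambda>t. F t z)"
            proof -
              have pc: "continuous_on {0..1} (\<lambda>t :: real. (t, z))" by (intro continuous_intros)
              have "(\<lambda>t :: real. (t, z)) ` {0..1} \<subseteq> {0..1} \<times> UNIV" by auto
              from continuous_on_compose2[OF that[unfolded joint_Cm_0] pc this] show ?thesis by simp
            qed
            then show ?thesis using a0 a
              by (intro continuous_on_tendsto_compose[of "{0..1}" "\<lambda>t. F t z" a 0]) (auto intro!: always_eventually less_imp_le)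
          qed
          have "R 0 z = z \<bullet> \<nu>" by (simp add: R_def \<nu>(1))
          then have "(\<lambda>j. pos_pow m (R (a j) z)) \<longlonglongrightarrow> pos_pow m (z \<bullet> \<nu>)"
            using lim[OF JR0] DERIV_isCont[OF DERIV_pos_pow[OF elim, of m]] by (intro isCont_tendsto_compose[of _ "pos_pow m"]) auto
          then have L: "(\<lambda>j. A * pos_pow m (R (a j) z) * H (a j) z) \<longlonglongrightarrow> A * pos_pow m (z \<bullet> \<nu>) * H 0 z"
            by (intro tendsto_intros lim[OF JH])
          have "(\<lambda>j. f j z - A * pos_pow m (R (a j) z) * H (a j) z) \<longlonglongrightarrow> 0"
          proof (rule LIMSEQ_I)
            fix r :: real assume r: "r > 0"
            define \<eta> where "\<eta> = r / (2 * (KR ^ m * KH + 1))"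
            have KK: "KR ^ m * KH + 1 > 0" using KR0 KH0 by (simp add: add_nonneg_pos)
            then have \<eta>: "\<eta> > 0" using r by (simp add: \<eta>_def)
            obtain e where e: "e > 0" "\<forall>y\<in>U \<inter> ball p e. \<bar>g y - A * \<rho> y ^ m\<bar> \<le> \<eta> * \<rho> y ^ m" using A[OF \<eta>] by auto
            have "(\<lambda>j. a j * c) \<longlonglongrightarrow> 0 * c" by (intro tendsto_intros a0)
            then have "\<forall>\<^sub>F j in sequentially. a j * c < e" using e(1) by (intro order_tendstoD) auto
            then obtain j0 where j0: "\<And>j. j \<ge> j0 \<Longrightarrow> a j * c < e" unfolding eventually_sequentially by blast
            have "\<bar>f j z - A * pos_pow m (R (a j) z) * H (a j) z\<bar> < r" if "j \<ge> j0" for j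
            proof -
              have "\<bar>f j z - A * pos_pow m (R (a j) z) * H (a j) z\<bar> \<le> \<eta> * KR ^ m * KH"
                using \<eta> by (intro est[OF True j0[OF that] e(2)]) simp
              also have "\<dots> \<le> \<eta> * (KR ^ m * KH + 1)" using \<eta> by (simp add: algebra_simps)
              also have "\<dots> = r / 2"
              proof -
                have "r / (2 * K) * K = r / 2" if "K > 0" for K using that by simp
                from this[OF KK] show ?thesis by (simp only: \<eta>_def)
              qed
              finally show ?thesis using r by linarith
            qed
            then show "\<exists>no. \<forall>n\<ge>no. norm (f n z - A * pos_pow m (R (a n) z) * H (a n) z - 0) < r" by auto
          qed
          from tendsto_add[OF this L] have "(\<lambda>j. f j z) \<longlonglongrightarrow> A * (pos_pow m (z \<bullet> \<nu>) * H 0 z)" by (simp add: mult.assoc)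
          then show ?thesis by (rule LIMSEQ_ignore_initial_segment)
        qed
      qed
    qed
  qed
  then have "(\<lambda>j. 0) \<longlonglongrightarrow> (LINT z|lborel. A * (pos_pow m (z \<bullet> \<nu>) * H 0 z))"
    using f by (simp only:)
  from LIMSEQ_unique[OF tendsto_const this] have "(LINT z|lborel. A * (pos_pow m (z \<bullet> \<nu>) * H 0 z)) = 0" by simp
  then have "A * half_int \<nu> m (H 0) = 0" by (simp add: half_int_def)
  moreover have "half_int \<nu> m (H 0) \<noteq> 0"
  proof -
    have "H 0 = (neg_laplacian ^^ k) (\<lambda>z. (z \<bullet> \<nu>) ^ (2 * k - 1 - m) * \<psi> z)"
      unfolding H_def R_def \<alpha>_def by (simp add: \<nu>(1))
    then show ?thesis
      using half_int_neg_laplacian_nonzero[OF \<nu>(2) C\<psi> _ _ m] half_int_ddir_bump[OF _ \<nu>(2), of "2 * k + 4"]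
      by (simp add: \<psi>_def zero_off_ball_bump)
  qed
  ultimately show "A = 0" by simp
qed

section \<open>Boundary decay of the Green function in its second argument\<close>

lemma Hm_affine:
  assumes "0 < \<theta>" "\<theta> \<le> 1"
  shows "Hm \<theta> m f \<Longrightarrow> Hm \<theta> m (\<lambda>z. f (p + \<delta> *\<^sub>R z))"
proof (induction m arbitrary: f)
  case 0
  show ?case unfolding Hm_0
  proof (intro conjI allI impI)
    have "continuous_on UNIV f" using 0 unfolding Hm_0 by blast
    then show "continuous_on UNIV (\<lambda>z. f (p + \<delta> *\<^sub>R z))"
      by (rule continuous_on_compose2) (auto intro!: continuous_intros)
    fix K :: "(real ^ 'a) set" assume "compact K"
    then have "compact ((\<lambda>z. p + \<delta> *\<^sub>R z) ` K)"
      by (intro compact_continuous_image) (auto intro!: continuous_intros)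
    then obtain C where C: "\<forall>x\<in>(\<lambda>z. p + \<delta> *\<^sub>R z) ` K. \<forall>y\<in>(\<lambda>z. p + \<delta> *\<^sub>R z) ` K. \<bar>f x - f y\<bar> \<le> C * dist x y powr \<theta>"
      using 0 unfolding Hm_0 by blast
    have "\<bar>f (p + \<delta> *\<^sub>R x) - f (p + \<delta> *\<^sub>R y)\<bar> \<le> (C * \<bar>\<delta>\<bar> powr \<theta>) * dist x y powr \<theta>" if "x \<in> K" "y \<in> K" for x y
    proof -
      have "dist (p + \<delta> *\<^sub>R x) (p + \<delta> *\<^sub>R y) = \<bar>\<delta>\<bar> * dist x y"
        by (simp add: dist_norm flip: scaleR_diff_right)
      then have "dist (p + \<delta> *\<^sub>R x) (p + \<delta> *\<^sub>R y) powr \<theta> = \<bar>\<delta>\<bar> powr \<theta> * dist x y powr \<theta>"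
        by (simp add: powr_mult)
      moreover have "\<bar>f (p + \<delta> *\<^sub>R x) - f (p + \<delta> *\<^sub>R y)\<bar> \<le> C * dist (p + \<delta> *\<^sub>R x) (p + \<delta> *\<^sub>R y) powr \<theta>"
        using C that by blast
      ultimately show ?thesis by (simp only: mult.assoc)
    qed
    then show "\<exists>C. \<forall>x\<in>K. \<forall>y\<in>K. \<bar>f (p + \<delta> *\<^sub>R x) - f (p + \<delta> *\<^sub>R y)\<bar> \<le> C * dist x y powr \<theta>" by blast
  qed
next
  case (Suc m)
  have d: "f differentiable (at x)" for x using Suc.prems by (simp add: Hm_Suc)
  have "Hm \<theta> 0 (\<lambda>z. f (p + \<delta> *\<^sub>R z))"
  proof (rule C1_imp_Hm_0[OF assms])
    have "Cm 1 UNIV f" by (rule Cm_mono[OF _ Hm_imp_Cm[OF Suc.prems]]) simp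
    from Cm_affine[OF open_UNIV this] show "Cm 1 UNIV (\<lambda>z. f (p + \<delta> *\<^sub>R z))" by simp
  qed
  moreover have "Hm \<theta> m (partial i (\<lambda>z. f (p + \<delta> *\<^sub>R z)))" for i
  proof -
    have "partial i (\<lambda>z. f (p + \<delta> *\<^sub>R z)) = (\<lambda>z. \<delta> * partial i f (p + \<delta> *\<^sub>R z))"
      by (rule ext) (rule partial_affine[OF d])
    moreover have "Hm \<theta> m (\<lambda>z. \<delta> * partial i f (p + \<delta> *\<^sub>R z))"
      using Suc.prems by (intro Hm_cmult[OF assms] Suc.IH) (simp add: Hm_Suc)
    ultimately show ?thesis by simp
  qed
  ultimately show ?case using differentiable_affine[OF d] unfolding Hm_Suc differentiable_def by blast
qed

text \<open>Here \<open>T i\<close> is the \<open>i\<close>-th derivative on the open interval, extended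
continuously to \<open>0\<close>. At the end point no derivative is assumed, so the bound on \<open>T
m\<close> is integrated up through monotonicity.\<close>

lemma taylor_at_zero:
  fixes T :: "nat \<Rightarrow> real \<Rightarrow> real"
  assumes "R > 0"
  shows "\<lbrakk>\<And>i. i \<le> m \<Longrightarrow> continuous_on {0..R} (T i);
    \<And>i t. i < m \<Longrightarrow> 0 < t \<Longrightarrow> t < R \<Longrightarrow> (T i has_real_derivative T (Suc i) t) (at t);
    \<And>i. i < m \<Longrightarrow> T i 0 = 0; \<And>t. 0 < t \<Longrightarrow> t \<le> R \<Longrightarrow> \<bar>T m t - B\<bar> \<le> \<eta>; 0 < t; t \<le> R\<rbrakk>
   \<Longrightarrow> \<bar>T 0 t - B * t ^ m / fact m\<bar> \<le> \<eta> * t ^ m / fact m"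
proof (induction m arbitrary: T t)
  case 0 then show ?case by simp
next
  case (Suc m)
  have IH: "\<bar>T 1 u - B * u ^ m / fact m\<bar> \<le> \<eta> * u ^ m / fact m" if "0 < u" "u \<le> R" for u
    using Suc.IH[of "\<lambda>i. T (Suc i)" u] Suc.prems that by auto
  have cont: "continuous_on {0..t} (T 0)"
    using Suc.prems(1)[of 0] Suc.prems(6) by (auto intro: continuous_on_subset)
  have dpow: "((\<lambda>u. c * u ^ Suc m / fact (Suc m)) has_real_derivative c * u ^ m / fact m) (at u)" for c u
  proof -
    have "((\<lambda>u. u ^ Suc m) has_real_derivative real (Suc m) * u ^ m) (at u)"
      using DERIV_pow[of "Suc m" u UNIV] by simp
    from DERIV_cdivide[OF DERIV_cmult[OF this, of c], of "fact (Suc m)"]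
    have "((\<lambda>u. c * u ^ Suc m / fact (Suc m)) has_real_derivative c * (real (Suc m) * u ^ m) / fact (Suc m)) (at u)" .
    moreover have "c * (real (Suc m) * u ^ m) / fact (Suc m) = c * u ^ m / fact m"
      by (simp add: fact_Suc del: of_nat_Suc)
    ultimately show ?thesis by simp
  qed
  have dT: "(T 0 has_real_derivative T 1 u) (at u)" if "0 < u" "u < t" for u
    using Suc.prems(2)[of 0 u] that Suc.prems(6) by simp
  have "(\<lambda>u. T 0 u - (B - \<eta>) * u ^ Suc m / fact (Suc m)) 0 \<le> (\<lambda>u. T 0 u - (B - \<eta>) * u ^ Suc m / fact (Suc m)) t"
  proof (rule DERIV_nonneg_imp_increasing_open[where f = "\<lambda>u. T 0 u - (B - \<eta>) * u ^ Suc m / fact (Suc m)"])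
    fix u assume u: "0 < u" "u < t"
    have "((\<lambda>u. T 0 u - (B - \<eta>) * u ^ Suc m / fact (Suc m)) has_real_derivative T 1 u - (B - \<eta>) * u ^ m / fact m) (at u)"
      by (rule DERIV_diff[OF dT[OF u] dpow])
    moreover have "0 \<le> T 1 u - (B - \<eta>) * u ^ m / fact m"
      using IH[of u] u Suc.prems(6) by (auto simp: left_diff_distrib diff_divide_distrib abs_le_iff)
    ultimately show "\<exists>y. ((\<lambda>u. T 0 u - (B - \<eta>) * u ^ Suc m / fact (Suc m)) has_real_derivative y) (at u) \<and> 0 \<le> y" by blast
  qed (use Suc.prems(5) cont in \<open>auto intro!: continuous_intros\<close>)
  moreover have "(\<lambda>u. (B + \<eta>) * u ^ Suc m / fact (Suc m) - T 0 u) 0 \<le> (\<lambda>u. (B + \<eta>) * u ^ Suc m / fact (Suc m) - T 0 u) t"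
  proof (rule DERIV_nonneg_imp_increasing_open[where f = "\<lambda>u. (B + \<eta>) * u ^ Suc m / fact (Suc m) - T 0 u"])
    fix u assume u: "0 < u" "u < t"
    have "((\<lambda>u. (B + \<eta>) * u ^ Suc m / fact (Suc m) - T 0 u) has_real_derivative (B + \<eta>) * u ^ m / fact m - T 1 u) (at u)"
      by (rule DERIV_diff[OF dpow dT[OF u]])
    moreover have "0 \<le> (B + \<eta>) * u ^ m / fact m - T 1 u"
      using IH[of u] u Suc.prems(6) by (auto simp: distrib_right add_divide_distrib abs_le_iff)
    ultimately show "\<exists>y. ((\<lambda>u. (B + \<eta>) * u ^ Suc m / fact (Suc m) - T 0 u) has_real_derivative y) (at u) \<and> 0 \<le> y" by blast
  qed (use Suc.prems(5) cont in \<open>auto intro!: continuous_intros\<close>)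
  moreover have "T 0 0 = 0" using Suc.prems(3) by simp
  ultimately show ?case
    by (simp add: abs_le_iff distrib_right left_diff_distrib diff_divide_distrib add_divide_distrib del: power_Suc fact_Suc)
qed

text \<open>If \<open>T j 0\<close> were the first non-zero value, then \<open>T 0\<close> would be of exact order
\<open>t^j\<close>, against the decay of order \<open>t^k\<close>.\<close>

lemma jets_vanish_of_decay:
  fixes T :: "nat \<Rightarrow> real \<Rightarrow> real"
  assumes "R > 0" "\<And>i. i < k \<Longrightarrow> continuous_on {0..R} (T i)"
    "\<And>i t. Suc i < k \<Longrightarrow> 0 < t \<Longrightarrow> t < R \<Longrightarrow> (T i has_real_derivative T (Suc i) t) (at t)"
    "\<And>t. 0 < t \<Longrightarrow> t \<le> R \<Longrightarrow> \<bar>T 0 t\<bar> \<le> C * t ^ k" "j < k"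
  shows "T j 0 = 0"
  using assms(5)
proof (induction j rule: less_induct)
  case (less j)
  define B where "B = T j 0"
  have small: "\<bar>B\<bar> \<le> \<eta>" if \<eta>: "\<eta> > 0" for \<eta>
  proof -
    have "continuous (at 0 within {0..R}) (T j)"
      using assms(1,2) less.prems by (simp add: continuous_on_eq_continuous_within)
    then obtain d where d: "d > 0" "\<forall>t\<in>{0..R}. dist t 0 < d \<longrightarrow> dist (T j t) B < \<eta> / 2"
      using \<eta> unfolding continuous_within_eps_delta B_def by (metis half_gt_zero)
    define r where "r = min R (d / 2)"
    have r: "0 < r" "r \<le> R" "r < d" using d(1) assms(1) by (auto simp: r_def)
    have T: "\<bar>T 0 t - B * t ^ j / fact j\<bar> \<le> (\<eta> / 2) * t ^ j / fact j" if t: "0 < t" "t \<le> r" for t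
    proof (rule taylor_at_zero[OF r(1)])
      show "continuous_on {0..r} (T i)" if "i \<le> j" for i
        using assms(2)[of i] less.prems that r by (auto intro: continuous_on_subset)
      show "(T i has_real_derivative T (Suc i) t) (at t)" if "i < j" "0 < t" "t < r" for i t
        using assms(3)[of i t] less.prems that r by auto
      show "T i 0 = 0" if "i < j" for i using less that by auto
      show "\<bar>T j t - B\<bar> \<le> \<eta> / 2" if "0 < t" "t \<le> r" for t
        using d(2) that r by (auto simp: dist_real_def less_imp_le)
    qed (use t in auto)
    have bd: "\<bar>B\<bar> \<le> \<eta> / 2 + \<bar>C\<bar> * fact j * t" if t: "0 < t" "t \<le> min r 1" for t
    proof -
      have 1: "\<bar>B\<bar> * t ^ j / fact j \<le> (\<eta> / 2) * t ^ j / fact j + \<bar>C\<bar> * (t * t ^ j)"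
      proof -
        have "\<bar>T 0 t\<bar> \<le> C * t ^ k" using assms(4)[of t] t r by simp
        also have "\<dots> \<le> \<bar>C\<bar> * (t * t ^ j)"
        proof (intro mult_mono)
          have "t ^ k \<le> t ^ Suc j" using less.prems t by (intro power_decreasing) auto
          then show "t ^ k \<le> t * t ^ j" by simp
        qed (use t in auto)
        finally have "\<bar>T 0 t\<bar> \<le> \<bar>C\<bar> * (t * t ^ j)" .
        moreover have "\<bar>B * t ^ j / fact j\<bar> = \<bar>B\<bar> * t ^ j / fact j" using t by (simp add: abs_mult)
        ultimately show ?thesis using T[of t] t by linarith
      qed
      have tj: "t ^ j > 0" using t by simp
      have "\<bar>B\<bar> * t ^ j \<le> (\<eta> / 2) * t ^ j + \<bar>C\<bar> * (t * t ^ j) * fact j"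
        using mult_right_mono[OF 1, of "fact j"] by (simp add: distrib_right)
      also have "\<dots> = (\<eta> / 2 + \<bar>C\<bar> * fact j * t) * t ^ j" by (simp add: algebra_simps)
      finally show ?thesis using tj by simp
    qed
    define t where "t = min (min r 1) (\<eta> / (2 * (\<bar>C\<bar> * fact j + 1)))"
    have t: "0 < t" "t \<le> min r 1" "t \<le> \<eta> / (2 * (\<bar>C\<bar> * fact j + 1))"
      using r \<eta> by (auto simp: t_def intro!: divide_pos_pos add_nonneg_pos mult_nonneg_nonneg)
    have "(\<bar>C\<bar> * fact j) * t \<le> (\<bar>C\<bar> * fact j + 1) * t" using t by simp
    also have "\<dots> \<le> (\<bar>C\<bar> * fact j + 1) * (\<eta> / (2 * (\<bar>C\<bar> * fact j + 1)))"
      using t(3) by (intro mult_left_mono) auto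
    also have "\<dots> = \<eta> / 2"
    proof -
      have g: "K * (\<eta> / (2 * K)) = \<eta> / 2" if "K > 0" for K using that by simp
      show ?thesis by (rule g) (simp add: add_nonneg_pos)
    qed
    finally show ?thesis using bd[OF t(1,2)] by linarith
  qed
  have "\<bar>B\<bar> \<le> 0"
  proof (rule field_le_epsilon)
    fix \<eta> :: real assume "\<eta> > 0"
    from small[OF this] show "\<bar>B\<bar> \<le> 0 + \<eta>" by simp
  qed
  then show ?case by (simp add: B_def)
qed

text \<open>A defining function \<open>\<rho>\<close> of \<open>U\<close> near \<open>p\<close> with unit speed
along \<open>e\<close>: moving back by \<open>\<rho> y\<close> in direction \<open>e\<close> leads from
\<open>y\<close> to the boundary. The epigraph of \<open>\<phi>\<close> corresponds to \<open>\<rho> y =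
y \<bullet> e - \<phi> y\<close>, and the outside of a hole to \<open>-\<rho>\<close>.\<close>

definition chart :: "nat \<Rightarrow> real \<Rightarrow> (real ^ 'n) set \<Rightarrow> real ^ 'n \<Rightarrow> real \<Rightarrow> real ^ 'n \<Rightarrow> (real ^ 'n \<Rightarrow> real) \<Rightarrow> bool" where
  "chart m \<theta> U p s e \<rho> \<longleftrightarrow> s > 0 \<and> norm e = 1 \<and> (\<forall>y t. \<rho> (y + t *\<^sub>R e) = \<rho> y + t) \<and> Hm \<theta> m \<rho> \<and>
     (\<forall>y\<in>ball p s. y \<in> U \<longleftrightarrow> \<rho> y > 0)"

lemma chart_frontier:
  assumes "chart m \<theta> U p s e \<rho>" "open U" "y \<in> ball p s"
  shows "y \<in> frontier U \<longleftrightarrow> \<rho> y = 0" "y \<in> closure U \<longleftrightarrow> \<rho> y \<ge> 0"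
proof -
  have \<rho>: "s > 0" "norm e = 1" "\<And>y t. \<rho> (y + t *\<^sub>R e) = \<rho> y + t" "\<And>y. y \<in> ball p s \<Longrightarrow> y \<in> U \<longleftrightarrow> \<rho> y > 0"
    and H: "Hm \<theta> m \<rho>"
    using assms(1) unfolding chart_def by auto
  have cont: "isCont \<rho> y"
    using Cm_continuous[OF Hm_imp_Cm[OF H]] by (simp add: continuous_on_eq_continuous_at)
  have ge: "\<rho> y \<ge> 0" if "y \<in> closure U"
  proof (rule ccontr)
    assume "\<not> \<rho> y \<ge> 0"
    then have "\<rho> y < 0" by simp
    then have "\<forall>\<^sub>F z in nhds y. \<rho> z < 0" using cont by (metis order_tendstoD(2) isCont_def tendsto_at_iff_tendsto_nhds)
    moreover have "\<forall>\<^sub>F z in nhds y. z \<in> ball p s" using assms(3) by (intro eventually_nhds_in_open) auto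
    ultimately have "\<forall>\<^sub>F z in nhds y. z \<notin> U" by eventually_elim (use \<rho>(4) in auto)
    then obtain W where "open W" "y \<in> W" "\<forall>z\<in>W. z \<notin> U" unfolding eventually_nhds by blast
    then show False using that by (auto simp: closure_iff_nhds_not_empty)
  qed
  have cl: "y \<in> closure U" if "\<rho> y \<ge> 0"
    unfolding closure_approachable
  proof (intro allI impI)
    fix r :: real assume r: "r > 0"
    define t where "t = min (r / 2) ((s - dist p y) / 2)"
    have t: "0 < t" "t < r" "t < s - dist p y"
    proof -
      have "t \<le> (s - dist p y) / 2" unfolding t_def by (rule min.cobounded2)
      then show "t < s - dist p y" using assms(3) by simp
    qed (use r assms(3) in \<open>auto simp: t_def\<close>)
    have "dist p (y + t *\<^sub>R e) \<le> dist p y + t"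
      using dist_triangle[of p "y + t *\<^sub>R e" y] t \<rho>(2) by (simp add: dist_norm)
    then have "y + t *\<^sub>R e \<in> ball p s" using t by simp
    moreover have "\<rho> (y + t *\<^sub>R e) > 0" using \<rho>(3) t that by simp
    ultimately have "y + t *\<^sub>R e \<in> U" using \<rho>(4) by blast
    moreover have "dist (y + t *\<^sub>R e) y < r" using t \<rho>(2) by (simp add: dist_norm)
    ultimately show "\<exists>x\<in>U. dist x y < r" by blast
  qed
  show "y \<in> closure U \<longleftrightarrow> \<rho> y \<ge> 0" using ge cl by blast
  then show "y \<in> frontier U \<longleftrightarrow> \<rho> y = 0"
    using \<rho>(4)[OF assms(3)] assms(2) by (auto simp: frontier_def interior_open)
qed

lemma green_partials_extend:
  assumes G: "green_function k \<theta> U G" and U: "open U" "x \<in> U"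
  shows "Cm (2 * k) (U - {x}) (G x)"
    and "j \<le> 2 * k \<Longrightarrow> \<exists>E. continuous_on (closure U - {x}) E \<and> (\<forall>y\<in>U - {x}. E y = (ddir v ^^ j) (G x) y)"
proof -
  have C: "C_diff (2 * k) (U - {x}) (closure U - {x}) (G x)"
    using G U closure_subset[of U] unfolding green_function_def by blast
  have o: "open (U - {x})" using U by auto
  show Cm: "Cm (2 * k) (U - {x}) (G x)"
    by (rule C_diff_imp_Cm[OF C o]) (use closure_subset in auto)
  assume j: "j \<le> 2 * k"
  have "\<exists>E. continuous_on (closure U - {x}) E \<and> (\<forall>y\<in>U - {x}. E y = (ddir v ^^ j) (partials [] (G x)) y)"
    by (rule ddir_pow_extends[OF o]) (use C j Cm_mono[OF _ Cm, of j] in \<open>auto simp: C_diff_def\<close>)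
  then show "\<exists>E. continuous_on (closure U - {x}) E \<and> (\<forall>y\<in>U - {x}. E y = (ddir v ^^ j) (G x) y)"
    by (simp add: partials_Nil)
qed

text \<open>By induction on \<open>m < k\<close> the \<open>m\<close>-th derivative in direction \<open>e\<close>,
extended to the boundary, vanishes on the boundary near \<open>p\<close>. Given this below
\<open>m\<close>, Taylor expansion along \<open>e\<close> from the nearby boundary gives \<open>G x y =
A \<rho>^m + o(\<rho>^m)\<close>, and the blow-up argument gives \<open>A = 0\<close>. At order
\<open>k\<close> the expansion bounds \<open>G x\<close> by a multiple of \<open>\<rho>^k\<close>.\<close>

lemma green_decay_at_boundary:
  fixes G :: "real ^ 'n \<Rightarrow> real ^ 'n \<Rightarrow> real"
  assumes G: "green_function k \<theta> U G" and \<theta>: "0 < \<theta>" "\<theta> \<le> 1" and U: "open U" "bounded U" "x \<in> U"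
    and ch: "chart (2 * k) \<theta> U p s e \<rho>" and p: "p \<in> frontier U" and xs: "x \<notin> ball p s" and k: "k \<ge> 1"
  shows "\<exists>d>0. \<exists>C. \<forall>y\<in>U \<inter> ball p d. \<bar>G x y\<bar> \<le> C * norm (y - p) ^ k"
proof -
  have \<rho>: "s > 0" "norm e = 1" "\<And>y t. \<rho> (y + t *\<^sub>R e) = \<rho> y + t" "\<And>y. y \<in> ball p s \<Longrightarrow> y \<in> U \<longleftrightarrow> \<rho> y > 0"
    and H: "Hm \<theta> (2 * k) \<rho>"
    using ch unfolding chart_def by auto
  have C\<rho>: "Cm (2 * k) UNIV \<rho>" by (rule Hm_imp_Cm[OF H])
  have d\<rho>: "\<rho> differentiable (at y)" for y by (rule Cm_differentiable[OF C\<rho>]) (use k in auto)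
  have cont\<rho>: "isCont \<rho> y" for y
    using Cm_continuous[OF C\<rho>] by (simp add: continuous_on_eq_continuous_at)
  define S where "S = U - {x}"
  have oS: "open S" using U by (auto simp: S_def)
  have CS: "Cm (2 * k) S (G x)" unfolding S_def by (rule green_partials_extend(1)[OF G U(1,3)])
  have "\<forall>j. \<exists>E. j \<le> 2 * k \<longrightarrow> continuous_on (closure U - {x}) E \<and> (\<forall>y\<in>S. E y = (ddir e ^^ j) (G x) y)"
    using green_partials_extend(2)[OF G U(1,3)] unfolding S_def by blast
  then obtain E where E: "\<And>j. j \<le> 2 * k \<Longrightarrow> continuous_on (closure U - {x}) (E j)"
    "\<And>j y. j \<le> 2 * k \<Longrightarrow> y \<in> S \<Longrightarrow> E j y = (ddir e ^^ j) (G x) y" by metis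
  \<comment> \<open>the hypothesis \<open>van\<close> is needed at all boundary points near \<open>p'\<close>,
     because the expansion starts at the foot \<open>y - \<rho> y e\<close> of \<open>y\<close>,
     which varies\<close>
  have expand: "\<exists>d>0. \<forall>y\<in>U \<inter> ball p' d. \<bar>G x y - (E m p' / fact m) * \<rho> y ^ m\<bar> \<le> \<eta> * \<rho> y ^ m"
    if p': "p' \<in> frontier U" "p' \<in> ball p s" and \<eta>: "\<eta> > 0" and m: "m \<le> k"
      and van: "\<And>i q. i < m \<Longrightarrow> q \<in> frontier U \<Longrightarrow> q \<in> ball p s \<Longrightarrow> E i q = 0" for p' \<eta> m
  proof -
    have \<rho>p': "\<rho> p' = 0" using chart_frontier(1)[OF ch U(1) p'(2)] p'(1) by simp
    have p'T: "p' \<in> closure U - {x}" using p' xs by (auto simp: frontier_def)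
    have "continuous (at p' within closure U - {x}) (E m)"
      using E(1)[of m] m p'T by (simp add: continuous_on_eq_continuous_within)
    then obtain d0 where d0: "d0 > 0" "\<forall>y\<in>closure U - {x}. dist y p' < d0 \<longrightarrow> dist (E m y) (E m p') < \<eta>"
      using \<eta> unfolding continuous_within_eps_delta by blast
    define r where "r = min d0 (s - dist p p')"
    have r: "r > 0" "r \<le> d0" "r \<le> s - dist p p'" using d0 p' by (auto simp: r_def)
    obtain d1 where d1: "d1 > 0" "\<forall>y. dist y p' < d1 \<longrightarrow> dist (\<rho> y) (\<rho> p') < r / 2"
      using cont\<rho>[of p'] r unfolding continuous_at_eps_delta by (metis half_gt_zero)
    define d where "d = min d1 (r / 2)"
    have "\<bar>G x y - (E m p' / fact m) * \<rho> y ^ m\<bar> \<le> \<eta> * \<rho> y ^ m" if y: "y \<in> U \<inter> ball p' d" for y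
    proof -
      have inr: "z \<in> ball p s" "dist z p' < d0" if "dist z p' < r" for z
        using that r dist_triangle[of p z p'] by (auto simp: dist_commute)
      have yd: "dist y p' < d1" "dist y p' < r / 2" using y by (auto simp: d_def dist_commute)
      have ys: "y \<in> ball p s" using inr yd r by auto
      define R where "R = \<rho> y"
      have R: "0 < R" "R < r / 2"
        using y ys \<rho>(4) d1(2) yd \<rho>p' by (auto simp: R_def dist_real_def)
      define y0 where "y0 = y - R *\<^sub>R e"
      have yt: "y = y0 + R *\<^sub>R e" by (simp add: y0_def)
      have near: "dist (y0 + t *\<^sub>R e) p' < r" if "0 \<le> t" "t \<le> R" for t
      proof -
        have "dist (y0 + t *\<^sub>R e) y = \<bar>t - R\<bar>" using \<rho>(2) by (simp add: y0_def dist_norm flip: scaleR_diff_left)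
        then show ?thesis using dist_triangle[of "y0 + t *\<^sub>R e" p' y] that R yd by linarith
      qed
      have \<rho>0: "\<rho> y0 = 0" using \<rho>(3)[of y "- R"] by (simp add: y0_def R_def)
      have y0: "y0 \<in> frontier U" "y0 \<in> ball p s"
        using near[of 0] R inr chart_frontier(1)[OF ch U(1), of y0] \<rho>0 by auto
      have inU: "y0 + t *\<^sub>R e \<in> S" if "0 < t" "t \<le> R" for t
        using near[of t] that inr \<rho>(4) \<rho>(3)[of y0 t] \<rho>0 xs unfolding S_def by fastforce
      have incl: "y0 + t *\<^sub>R e \<in> closure U - {x}" if "0 \<le> t" "t \<le> R" for t
      proof (cases "t = 0")
        case True then show ?thesis using y0 xs by (auto simp: frontier_def)
      next
        case False then show ?thesis using inU[of t] that closure_subset by (auto simp: S_def)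
      qed
      have "\<bar>E 0 (y0 + R *\<^sub>R e) - E m p' * R ^ m / fact m\<bar> \<le> \<eta> * R ^ m / fact m"
      proof (rule taylor_at_zero[OF R(1), where T = "\<lambda>i t. E i (y0 + t *\<^sub>R e)"])
        show "continuous_on {0..R} (\<lambda>t. E i (y0 + t *\<^sub>R e))" if "i \<le> m" for i
        proof (rule continuous_on_compose2[OF E(1)])
          show "(\<lambda>t. y0 + t *\<^sub>R e) ` {0..R} \<subseteq> closure U - {x}" by (intro image_subsetI incl) auto
        qed (use that m in \<open>auto intro!: continuous_intros\<close>)
        show "((\<lambda>t. E i (y0 + t *\<^sub>R e)) has_real_derivative E (Suc i) (y0 + t *\<^sub>R e)) (at t)"
          if i: "i < m" and t: "0 < t" "t < R" for i t
        proof -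
          have D: "((\<lambda>t. (ddir e ^^ i) (G x) (y0 + t *\<^sub>R e)) has_real_derivative (ddir e ^^ Suc i) (G x) (y0 + t *\<^sub>R e)) (at t)"
            by (rule DERIV_ddir_pow[OF oS CS]) (use i m k inU[of t] t in auto)
          have "\<forall>\<^sub>F u in nhds t. E i (y0 + u *\<^sub>R e) = (ddir e ^^ i) (G x) (y0 + u *\<^sub>R e)"
            using eventually_nhds_in_open[of "{0<..<R}" t] t i m inU
            by (auto elim!: eventually_mono intro!: E(2))
          from DERIV_cong_ev[OF refl this refl] D E(2)[of "Suc i" "y0 + t *\<^sub>R e"] inU[of t] t i m
          show ?thesis by simp
        qed
        show "E i (y0 + 0 *\<^sub>R e) = 0" if "i < m" for i using van[OF that] y0 by simp
        show "\<bar>E m (y0 + t *\<^sub>R e) - E m p'\<bar> \<le> \<eta>" if "0 < t" "t \<le> R" for t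
          using d0(2) incl[of t] near[of t] r that by (auto simp: dist_real_def less_imp_le)
      qed (use R in auto)
      moreover have "E 0 (y0 + R *\<^sub>R e) = G x y" using E(2)[of 0] inU[of R] R by (simp add: yt)
      moreover have "\<eta> * R ^ m / fact m \<le> \<eta> * R ^ m"
        using \<eta> R by (intro divide_le_eq[THEN iffD2]) (auto intro!: mult_left_le simp: fact_ge_1)
      ultimately show ?thesis by (simp add: R_def)
    qed
    moreover have "d > 0" using d1 r by (simp add: d_def)
    ultimately show ?thesis by blast
  qed
  have van: "E i q = 0" if "i < m" "m \<le> k" "q \<in> frontier U" "q \<in> ball p s" for i m q
    using that
  proof (induction m arbitrary: i q)
    case 0 then show ?case by simp
  next
    case (Suc m)
    show ?case
    proof (cases "i < m")
      case True then show ?thesis using Suc by simp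
    next
      case False
      then have i: "i = m" using Suc.prems by simp
      have m: "m < k" using Suc.prems by simp
      have \<rho>q: "\<rho> q = 0" using chart_frontier(1)[OF ch U(1) Suc.prems(4)] Suc.prems(3) by simp
      define s' where "s' = s - dist p q"
      have s': "s' > 0" using Suc.prems(4) by (simp add: s'_def)
      have sub: "z \<in> ball p s" if "dist q z < s'" for z
        using that dist_triangle[of p z q] by (simp add: s'_def)
      define \<nu> where "\<nu> = (\<chi> i. partial i \<rho> q)"
      have \<nu>: "ddir z \<rho> q = z \<bullet> \<nu>" for z by (simp add: ddir_def \<nu>_def inner_vec_def)
      have "ddir e \<rho> q = 1"
      proof -
        have "((\<lambda>t. \<rho> (q + t *\<^sub>R e)) has_real_derivative ddir e \<rho> q) (at 0)" using DERIV_along[of \<rho> q 0 e] d\<rho> by simp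
        moreover have "((\<lambda>t. \<rho> (q + t *\<^sub>R e)) has_real_derivative 1) (at 0)"
          unfolding \<rho>(3) by (auto intro!: derivative_eq_intros)
        ultimately show ?thesis by (rule DERIV_unique)
      qed
      then have \<nu>0: "\<nu> \<noteq> 0" using \<nu>[of e] by auto
      \<comment> \<open>\<open>\<alpha> \<ge> k\<close> since \<open>m < k\<close>, so the test function has zero
         Dirichlet data of order \<open>k\<close>\<close>
      define \<alpha> where "\<alpha> = 2 * k - 1 - m"
      have test: "set_integrable lborel U (\<lambda>y. G x y * (neg_laplacian ^^ k) (\<lambda>y. \<rho> y ^ \<alpha> * bump (2 * k + 4) ((1 / \<delta>) *\<^sub>R (y - q))) y) \<and>
        (LINT y:U|lborel. G x y * (neg_laplacian ^^ k) (\<lambda>y. \<rho> y ^ \<alpha> * bump (2 * k + 4) ((1 / \<delta>) *\<^sub>R (y - q))) y) = 0"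
        if \<delta>: "0 < \<delta>" "\<delta> < s'" for \<delta>
      proof -
        define b where "b y = bump (2 * k + 4) ((1 / \<delta>) *\<^sub>R (y - q))" for y
        have b_eq: "b = (\<lambda>y. bump (2 * k + 4) ((- (1 / \<delta>)) *\<^sub>R q + (1 / \<delta>) *\<^sub>R y))"
          unfolding b_def by (simp add: algebra_simps)
        have Cb: "Cm (2 * k + 3) UNIV b"
          using Cm_affine[OF open_UNIV Cm_bump[of "2 * k + 3" "2 * k + 4"], of "(- (1 / \<delta>)) *\<^sub>R q" "1 / \<delta>"]
          unfolding b_eq by simp
        have Hb: "Hm \<theta> (2 * k) b"
          by (rule Cm_imp_Hm[OF \<theta>]) (rule Cm_mono[OF _ Cb], simp)
        have b0: "b y = 0" if "\<delta> \<le> dist q y" for y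
          unfolding b_def using that \<delta> by (intro bump_outside) (simp add: dist_norm norm_minus_commute pos_le_divide_eq)
        let ?w = "\<lambda>y. \<rho> y ^ \<alpha> * b y"
        have Hw: "Hm \<theta> (2 * k) ?w" by (intro Hm_mult[OF \<theta>] Hm_power[OF \<theta>] H Hb)
        have bc: "(ddir v ^^ j) ?w z = 0" if z: "z \<in> frontier U" and j: "j < k" for z v j
        proof (cases "dist q z < s'")
          case True
          then have "\<rho> z = 0" using chart_frontier(1)[OF ch U(1) sub[OF True]] z by simp
          moreover have "j \<le> \<alpha>" using j m by (simp add: \<alpha>_def)
          then obtain c where "(ddir v ^^ j) ?w = (\<lambda>y. \<rho> y ^ (\<alpha> - j) * c y)"
            using ddir_pow_vanish[OF C\<rho> Cm_mono[OF _ Cb, of "2 * k"], of j \<alpha> v] j by auto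
          moreover have "\<alpha> - j > 0" using j m by (simp add: \<alpha>_def)
          ultimately show ?thesis by simp
        next
          case False
          then have z: "z \<in> - cball q \<delta>" using \<delta> by auto
          show ?thesis by (rule ddir_pow_eq_0[OF _ _ z]) (use b0 in auto)
        qed
        have xc: "x \<in> closure U" using U closure_subset by blast
        have "dist q x \<ge> s'" using xs sub[of x] by force
        then have "?w x = 0" using b0[of x] \<delta> by simp
        then show ?thesis using green_function_test[OF G \<theta> U(2) Hw bc xc] unfolding b_def by simp
      qed
      have "E m q / fact m = 0"
      proof (rule blowup_coefficient_zero[OF U(1) s' C\<rho> \<rho>q \<nu> \<nu>0 _ m])
        show "z \<in> U \<longleftrightarrow> \<rho> z > 0" if "z \<in> ball q s'" for z using \<rho>(4) sub that by auto
        show "\<exists>d>0. \<forall>y\<in>U \<inter> ball q d. \<bar>G x y - E m q / fact m * \<rho> y ^ m\<bar> \<le> \<eta> * \<rho> y ^ m" if "\<eta> > 0" for \<eta>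
          by (rule expand[OF Suc.prems(3,4) that]) (use Suc m in auto)
      qed (use test in \<open>simp add: \<alpha>_def\<close>)
      then show ?thesis by (simp add: i)
    qed
  qed
  obtain d where d: "d > 0" "\<forall>y\<in>U \<inter> ball p d. \<bar>G x y - (E k p / fact k) * \<rho> y ^ k\<bar> \<le> 1 * \<rho> y ^ k"
    using expand[OF p _ zero_less_one, of k] van[of _ k] \<rho>(1) by auto
  have \<rho>p: "\<rho> p = 0" using chart_frontier(1)[OF ch U(1), of p] p \<rho>(1) by simp
  have "\<exists>d2>0. \<exists>L\<ge>0. \<forall>y\<in>ball p d2. \<bar>\<rho> y\<bar> \<le> L * norm (y - p)"
  proof -
    have D: "(\<rho> has_derivative (\<lambda>v. ddir v \<rho> p)) (at p)" by (rule has_derivative_ddir[OF d\<rho>])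
    obtain L where L: "\<And>v. norm (ddir v \<rho> p) \<le> norm v * L"
      using bounded_linear.bounded[OF has_derivative_bounded_linear[OF D]] by blast
    obtain d2 where d2: "d2 > 0" "\<forall>y. norm (y - p) < d2 \<longrightarrow> norm (\<rho> y - \<rho> p - ddir (y - p) \<rho> p) \<le> 1 * norm (y - p)"
      using D unfolding has_derivative_at_alt by (metis zero_less_one)
    have "\<bar>\<rho> y\<bar> \<le> (\<bar>L\<bar> + 1) * norm (y - p)" if "y \<in> ball p d2" for y
    proof -
      have "\<bar>\<rho> y - ddir (y - p) \<rho> p\<bar> \<le> norm (y - p)"
        using d2(2)[rule_format, of y] that \<rho>p by (simp add: dist_norm norm_minus_commute)
      moreover have "\<bar>ddir (y - p) \<rho> p\<bar> \<le> norm (y - p) * \<bar>L\<bar>"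
      proof -
        have "norm (y - p) * L \<le> norm (y - p) * \<bar>L\<bar>" by (rule mult_left_mono) auto
        from order_trans[OF L this] show ?thesis by simp
      qed
      ultimately show ?thesis by (simp add: algebra_simps)
    qed
    then have "\<forall>y\<in>ball p d2. \<bar>\<rho> y\<bar> \<le> (\<bar>L\<bar> + 1) * norm (y - p)" by blast
    moreover have "\<bar>L\<bar> + 1 \<ge> 0" by simp
    ultimately show ?thesis using d2(1) by blast
  qed
  then obtain d2 L where L: "d2 > 0" "L \<ge> 0" "\<forall>y\<in>ball p d2. \<bar>\<rho> y\<bar> \<le> L * norm (y - p)" by blast
  define d3 where "d3 = min s (min d d2)"
  have "\<bar>G x y\<bar> \<le> ((\<bar>E k p / fact k\<bar> + 1) * L ^ k) * norm (y - p) ^ k" if y: "y \<in> U \<inter> ball p d3" for y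
  proof -
    have yb: "y \<in> U" "y \<in> ball p s" "y \<in> ball p d" "y \<in> ball p d2" using y by (auto simp: d3_def)
    have pos: "\<rho> y > 0" using \<rho>(4) yb by simp
    have "\<bar>G x y - (E k p / fact k) * \<rho> y ^ k\<bar> \<le> \<rho> y ^ k" using d(2) yb by simp
    then have "\<bar>G x y\<bar> \<le> \<bar>(E k p / fact k) * \<rho> y ^ k\<bar> + \<rho> y ^ k" by linarith
    also have "\<dots> = (\<bar>E k p / fact k\<bar> + 1) * \<rho> y ^ k" using pos by (simp add: abs_mult algebra_simps)
    also have "\<dots> \<le> (\<bar>E k p / fact k\<bar> + 1) * (L * norm (y - p)) ^ k"
    proof -
      have "\<rho> y \<le> L * norm (y - p)" using bspec[OF L(3) yb(4)] pos by simp
      then show ?thesis using pos by (intro mult_left_mono power_mono) auto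
    qed
    finally show ?thesis by (simp only: power_mult_distrib mult.assoc)
  qed
  moreover have "d3 > 0" using d(1) L(1) \<rho>(1) by (simp add: d3_def)
  ultimately show ?thesis by blast
qed

text \<open>The decay of order \<open>k\<close> does not refer to the direction of the chart any more, so it kills
the derivatives of lower order along every ray that enters the domain, tangential or not.\<close>

lemma green_jets_vanish_along_ray:
  fixes G :: "real ^ 'n \<Rightarrow> real ^ 'n \<Rightarrow> real"
  assumes G: "green_function k \<theta> U G" and \<theta>: "0 < \<theta>" "\<theta> \<le> 1" and U: "open U" "bounded U" "x \<in> U"
    and ch: "chart (2 * k) \<theta> U p s e \<rho>" and p: "p \<in> frontier U" and xs: "x \<notin> ball p s" and k: "k \<ge> 1"
    and v: "norm v = 1" and ray: "R > 0" "\<And>t. 0 < t \<Longrightarrow> t \<le> R \<Longrightarrow> p + t *\<^sub>R v \<in> U" and j: "j < k"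
  shows "((\<lambda>t. (ddir v ^^ j) (G x) (p + t *\<^sub>R v)) \<longlongrightarrow> 0) (at_right 0)"
proof -
  obtain d C where dC: "d > 0" "\<forall>y\<in>U \<inter> ball p d. \<bar>G x y\<bar> \<le> C * norm (y - p) ^ k"
    using green_decay_at_boundary[OF G \<theta> U ch p xs k] by blast
  have s: "s > 0" using ch by (simp add: chart_def)
  define S where "S = U - {x}"
  have oS: "open S" using U by (auto simp: S_def)
  have CS: "Cm (2 * k) S (G x)" unfolding S_def by (rule green_partials_extend(1)[OF G U(1,3)])
  have "\<forall>j. \<exists>E. j \<le> 2 * k \<longrightarrow> continuous_on (closure U - {x}) E \<and> (\<forall>y\<in>S. E y = (ddir v ^^ j) (G x) y)"
    using green_partials_extend(2)[OF G U(1,3)] unfolding S_def by blast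
  then obtain E where E: "\<And>j. j \<le> 2 * k \<Longrightarrow> continuous_on (closure U - {x}) (E j)"
    "\<And>j y. j \<le> 2 * k \<Longrightarrow> y \<in> S \<Longrightarrow> E j y = (ddir v ^^ j) (G x) y" by metis
  define r where "r = min R (min (d / 2) (s / 2))"
  have r: "0 < r" "r \<le> R" "r < d" "r < s" using ray dC s by (auto simp: r_def)
  have inS: "p + t *\<^sub>R v \<in> S" if "0 < t" "t \<le> r" for t
  proof -
    have "p + t *\<^sub>R v \<in> ball p s" using that r v by (simp add: dist_norm)
    then show ?thesis using ray(2)[of t] that r xs by (auto simp: S_def)
  qed
  have incl: "p + t *\<^sub>R v \<in> closure U - {x}" if "0 \<le> t" "t \<le> r" for t
  proof (cases "t = 0")
    case True then show ?thesis using p xs s by (auto simp: frontier_def)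
  next
    case False then show ?thesis using inS[of t] that closure_subset by (auto simp: S_def)
  qed
  have cont: "continuous_on {0..r} (\<lambda>t. E i (p + t *\<^sub>R v))" if "i \<le> 2 * k" for i
  proof (rule continuous_on_compose2[OF E(1)[OF that]])
    show "(\<lambda>t. p + t *\<^sub>R v) ` {0..r} \<subseteq> closure U - {x}" by (intro image_subsetI incl) auto
  qed (auto intro!: continuous_intros)
  have E0: "E j (p + 0 *\<^sub>R v) = 0"
  proof (rule jets_vanish_of_decay[OF r(1), where T = "\<lambda>i t. E i (p + t *\<^sub>R v)" and k = k and C = C])
    show "((\<lambda>t. E i (p + t *\<^sub>R v)) has_real_derivative E (Suc i) (p + t *\<^sub>R v)) (at t)"
      if i: "Suc i < k" and t: "0 < t" "t < r" for i t
    proof -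
      have D: "((\<lambda>t. (ddir v ^^ i) (G x) (p + t *\<^sub>R v)) has_real_derivative (ddir v ^^ Suc i) (G x) (p + t *\<^sub>R v)) (at t)"
        by (rule DERIV_ddir_pow[OF oS CS]) (use i inS[of t] t in auto)
      have "\<forall>\<^sub>F u in nhds t. E i (p + u *\<^sub>R v) = (ddir v ^^ i) (G x) (p + u *\<^sub>R v)"
        using eventually_nhds_in_open[of "{0<..<r}" t] t i inS
        by (auto elim!: eventually_mono intro!: E(2))
      from DERIV_cong_ev[OF refl this refl] D E(2)[of "Suc i" "p + t *\<^sub>R v"] inS[of t] t i
      show ?thesis by simp
    qed
    show "\<bar>E 0 (p + t *\<^sub>R v)\<bar> \<le> C * t ^ k" if t: "0 < t" "t \<le> r" for t
    proof -
      have "p + t *\<^sub>R v \<in> U \<inter> ball p d" using inS[OF t] t r v by (auto simp: S_def dist_norm)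
      from dC(2)[rule_format, OF this] have "\<bar>G x (p + t *\<^sub>R v)\<bar> \<le> C * norm (t *\<^sub>R v) ^ k" by simp
      then show ?thesis using E(2)[of 0] inS[OF t] t v by simp
    qed
  qed (use cont j in auto)
  have "((\<lambda>t. E j (p + t *\<^sub>R v)) \<longlongrightarrow> E j (p + 0 *\<^sub>R v)) (at 0 within {0..r})"
  proof -
    have c: "continuous_on {0..r} (\<lambda>t. E j (p + t *\<^sub>R v))" by (rule cont) (use j in simp)
    show ?thesis by (rule c[unfolded continuous_on_def, rule_format]) (use r in simp)
  qed
  then have "((\<lambda>t. E j (p + t *\<^sub>R v)) \<longlongrightarrow> 0) (at_right 0)"
    using E0 at_within_Icc_at_right[OF r(1)] by simp
  moreover have "\<forall>\<^sub>F t in at_right 0. E j (p + t *\<^sub>R v) = (ddir v ^^ j) (G x) (p + t *\<^sub>R v)"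
    unfolding eventually_at_right_field using r(1) inS j by (intro exI[of _ r]) (auto intro!: E(2))
  ultimately show ?thesis by (rule Lim_transform_eventually)
qed

section \<open>Taylor polynomials and two-point Hermite data\<close>

text \<open>The homogeneous Taylor term of degree \<open>m\<close>, that is, the sum of \<open>a js * (product of z
$ i over i in js) / m!\<close> over all lists \<open>js\<close> of length \<open>m\<close>. The
coefficients are indexed by lists, as iterated partials are; the recursion is Euler's identity for
homogeneous functions, and it avoids multi-indices.\<close>

primrec taylor_term :: "nat \<Rightarrow> ('n list \<Rightarrow> real) \<Rightarrow> real ^ 'n \<Rightarrow> real" where
  "taylor_term 0 a z = a []"
| "taylor_term (Suc m) a z = (1 / real (Suc m)) * (\<Sum>i\<in>UNIV. z $ i * taylor_term m (\<lambda>js. a (js @ [i])) z)"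

lemma Cm_taylor_term: "Cm l UNIV (taylor_term m a)"
proof (induction m arbitrary: a)
  case 0
  have "taylor_term 0 a = (\<lambda>_. a [])" by auto
  then show ?case by (simp add: Cm_const)
next
  case (Suc m)
  have "taylor_term (Suc m) a = (\<lambda>z. (1 / real (Suc m)) * (\<Sum>i\<in>UNIV. z $ i * taylor_term m (\<lambda>js. a (js @ [i])) z))" by auto
  moreover have "Cm l UNIV (\<lambda>z. (1 / real (Suc m)) * (\<Sum>i\<in>UNIV. z $ i * taylor_term m (\<lambda>js. a (js @ [i])) z))"
    by (intro Cm_cmult Cm_sum Cm_mult Cm_component Suc.IH) auto
  ultimately show ?case by simp
qed

lemma differentiable_taylor_term: "taylor_term m a differentiable (at z)"
  by (rule Cm_differentiable[OF Cm_taylor_term[of 1]]) auto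

text \<open>Differentiating the recursion gives the term of degree \<open>m\<close> once from the factor \<open>z $
j\<close> and \<open>m\<close> times, by Euler's identity, from the others; this cancels the
denominator.\<close>

lemma partial_taylor_term:
  assumes "\<And>js js'. mset js = mset js' \<Longrightarrow> a js = a js'"
  shows "partial j (taylor_term (Suc m) a) z = taylor_term m (\<lambda>js. a (js @ [j])) z"
  using assms
proof (induction m arbitrary: a)
  case 0
  have "partial j (taylor_term (Suc 0) a) z = partial j (\<lambda>z. \<Sum>i\<in>UNIV. a [i] * z $ i) z"
    by (rule arg_cong[where f = "\<lambda>f. partial j f z"]) (auto simp: mult.commute)
  also have "\<dots> = (\<Sum>i\<in>UNIV. a [i] * partial j (\<lambda>z. z $ i) z)"
    by (rule partial_sum[OF open_UNIV]) (auto intro: Cm_component)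
  finally show ?case by (simp add: partial_component if_distrib cong: if_cong del: taylor_term.simps(2))
next
  case (Suc m)
  let ?a = "\<lambda>i js. a (js @ [i])"
  have dc: "(\<lambda>x. x $ i) differentiable (at (x :: real ^ 'a))" for i x
    using bounded_linear_imp_differentiable[OF bounded_linear_vec_nth] by blast
  have sym: "?a i js = ?a i js'" if "mset js = mset js'" for i js js'
    by (rule Suc.prems) (use that in simp)
  have sw: "?a i (js @ [j]) = ?a j (js @ [i])" for i js
    by (rule Suc.prems) simp
  have "partial j (taylor_term (Suc (Suc m)) a) z = partial j (\<lambda>z. \<Sum>i\<in>UNIV. (1 / real (Suc (Suc m))) * (z $ i * taylor_term (Suc m) (?a i) z)) z"
    by (rule arg_cong[where f = "\<lambda>f. partial j f z"]) (simp only: taylor_term.simps(2)[of "Suc m"] sum_distrib_left fun_eq_iff, simp)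
  also have "\<dots> = (\<Sum>i\<in>UNIV. (1 / real (Suc (Suc m))) * partial j (\<lambda>z. z $ i * taylor_term (Suc m) (?a i) z) z)"
    by (rule partial_sum[OF open_UNIV]) (intro Cm_mult Cm_component Cm_taylor_term | simp)+
  also have "\<dots> = (\<Sum>i\<in>UNIV. (1 / real (Suc (Suc m))) * ((if i = j then taylor_term (Suc m) (?a j) z else 0) + z $ i * taylor_term m (\<lambda>js. ?a j (js @ [i])) z))"
  proof (rule sum.cong[OF refl])
    fix i
    have "partial j (\<lambda>z. z $ i * taylor_term (Suc m) (?a i) z) z = partial j (\<lambda>z. z $ i) z * taylor_term (Suc m) (?a i) z + z $ i * partial j (taylor_term (Suc m) (?a i)) z"
      by (rule partial_mult[OF dc differentiable_taylor_term])
    also have "partial j (taylor_term (Suc m) (?a i)) z = taylor_term m (\<lambda>js. ?a i (js @ [j])) z"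
      by (rule Suc.IH) (rule sym)
    also have "(\<lambda>js. ?a i (js @ [j])) = (\<lambda>js. ?a j (js @ [i]))" using sw by blast
    finally show "(1 / real (Suc (Suc m))) * partial j (\<lambda>z. z $ i * taylor_term (Suc m) (?a i) z) z
      = (1 / real (Suc (Suc m))) * ((if i = j then taylor_term (Suc m) (?a j) z else 0) + z $ i * taylor_term m (\<lambda>js. ?a j (js @ [i])) z)"
      by (auto simp: partial_component simp del: taylor_term.simps)
  qed
  also have "\<dots> = (1 / real (Suc (Suc m))) * (taylor_term (Suc m) (?a j) z + (\<Sum>i\<in>UNIV. z $ i * taylor_term m (\<lambda>js. ?a j (js @ [i])) z))"
    by (simp only: sum_distrib_left[symmetric] sum.distrib) (simp del: taylor_term.simps)
  also have "(\<Sum>i\<in>UNIV. z $ i * taylor_term m (\<lambda>js. ?a j (js @ [i])) z) = real (Suc m) * taylor_term (Suc m) (?a j) z"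
    by (simp del: of_nat_Suc)
  also have "(1 / real (Suc (Suc m))) * (taylor_term (Suc m) (?a j) z + real (Suc m) * taylor_term (Suc m) (?a j) z) = taylor_term (Suc m) (?a j) z"
  proof -
    have "(1 / (1 + c)) * (X + c * X) = X" if "c \<ge> 0" for c X :: real
      using that by (simp add: field_simps)
    from this[of "real (Suc m)"] show ?thesis by (simp del: taylor_term.simps)
  qed
  finally show ?case .
qed

definition taylor_poly :: "nat \<Rightarrow> ('n list \<Rightarrow> real) \<Rightarrow> real ^ 'n \<Rightarrow> real ^ 'n \<Rightarrow> real" where
  "taylor_poly r a z0 z = (\<Sum>m<r. taylor_term m a (z - z0))"

lemma partial_taylor_poly:
  assumes "\<And>js js'. mset js = mset js' \<Longrightarrow> a js = a js'"
  shows "partial j (taylor_poly r a z0) = taylor_poly (r - 1) (\<lambda>js. a (js @ [j])) z0"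
proof
  fix z
  have sh: "partial j (\<lambda>z. taylor_term m a (z - z0)) z = partial j (taylor_term m a) (z - z0)" for m
    using partial_affine[where p = "- z0" and \<delta> = 1 and z = z and i = j, OF differentiable_taylor_term[of m a]] by simp
  have C: "Cm 1 UNIV (\<lambda>z. taylor_term m a (z - z0))" for m
    using Cm_affine[OF open_UNIV Cm_taylor_term[of 1 m a], of "- z0" 1] by simp
  have "partial j (\<lambda>z. \<Sum>m<r. 1 * taylor_term m a (z - z0)) z = (\<Sum>m<r. 1 * partial j (\<lambda>z. taylor_term m a (z - z0)) z)"
    by (rule partial_sum[OF open_UNIV]) (rule C | simp)+
  then have "partial j (taylor_poly r a z0) z = (\<Sum>m<r. partial j (taylor_term m a) (z - z0))"
    by (simp add: taylor_poly_def[abs_def] sh)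
  also have "\<dots> = taylor_poly (r - 1) (\<lambda>js. a (js @ [j])) z0 z"
  proof (cases r)
    case 0 then show ?thesis by (simp add: taylor_poly_def)
  next
    case (Suc r')
    have "partial j (taylor_term 0 a) y = 0" for y
    proof -
      have "taylor_term 0 a = (\<lambda>_. a [])" by auto
      then show ?thesis by simp
    qed
    then show ?thesis unfolding Suc sum.lessThan_Suc_shift
      by (simp add: taylor_poly_def partial_taylor_term[OF assms] del: taylor_term.simps)
  qed
  finally show "partial j (taylor_poly r a z0) z = taylor_poly (r - 1) (\<lambda>js. a (js @ [j])) z0 z" .
qed

lemma Cm_taylor_poly: "Cm l UNIV (taylor_poly r a z0)"
  unfolding taylor_poly_def[abs_def]
proof (rule Cm_sum)
  show "Cm l UNIV (\<lambda>z. taylor_term m a (z - z0))" for m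
    using Cm_affine[OF open_UNIV Cm_taylor_term[of l m a], of "- z0" 1] by simp
qed auto

lemma partials_taylor_poly:
  assumes "\<And>js js'. mset js = mset js' \<Longrightarrow> a js = a js'"
  shows "partials js (taylor_poly r a z0) = taylor_poly (r - length js) (\<lambda>js'. a (js' @ js)) z0"
proof (induction js)
  case Nil then show ?case by (simp add: partials_Nil)
next
  case (Cons i js)
  have "partials (i # js) (taylor_poly r a z0) = partial i (taylor_poly (r - length js) (\<lambda>js'. a (js' @ js)) z0)"
    by (simp add: partials_Cons Cons.IH)
  also have "\<dots> = taylor_poly (r - length js - 1) (\<lambda>js'. a ((js' @ [i]) @ js)) z0"
    by (rule partial_taylor_poly) (rule assms, simp)
  finally show ?case by simp
qed

lemma taylor_poly_center: "taylor_poly r a z0 z0 = (if r = 0 then 0 else a [])"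
proof (cases r)
  case (Suc r')
  have "taylor_poly r a z0 z0 = taylor_term 0 a 0 + (\<Sum>m<r'. taylor_term (Suc m) a 0)"
    unfolding taylor_poly_def Suc sum.lessThan_Suc_shift by (simp del: taylor_term.simps)
  also have "\<dots> = a []" by simp
  finally show ?thesis by (simp add: Suc)
qed (simp add: taylor_poly_def)

lemma taylor_term_on_line: "\<exists>p. degree p \<le> m \<and> (\<forall>t. poly p t = taylor_term m a (w0 + t *\<^sub>R w1))"
proof (induction m arbitrary: a)
  case 0 then show ?case by (intro exI[of _ "[:a []:]"]) simp
next
  case (Suc m)
  have "\<forall>i. \<exists>p. degree p \<le> m \<and> (\<forall>t. poly p t = taylor_term m (\<lambda>js. a (js @ [i])) (w0 + t *\<^sub>R w1))" using Suc.IH by blast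
  then obtain p where p: "\<And>i. degree (p i) \<le> m" "\<And>i t. poly (p i) t = taylor_term m (\<lambda>js. a (js @ [i])) (w0 + t *\<^sub>R w1)" by metis
  define q where "q = smult (1 / real (Suc m)) (\<Sum>i\<in>UNIV. [:w0 $ i, w1 $ i:] * p i)"
  have "degree ([:w0 $ i, w1 $ i:] * p i) \<le> Suc m" for i
  proof -
    have "degree ([:w0 $ i, w1 $ i:] * p i) \<le> degree [:w0 $ i, w1 $ i:] + degree (p i)" by (rule degree_mult_le)
    also have "\<dots> \<le> 1 + m" by (intro add_mono p) simp
    finally show ?thesis by simp
  qed
  then have "degree q \<le> Suc m" unfolding q_def
    by (intro order_trans[OF degree_smult_le] degree_sum_le) auto
  moreover have "poly q t = taylor_term (Suc m) a (w0 + t *\<^sub>R w1)" for t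
    by (simp add: q_def poly_sum p(2) algebra_simps del: of_nat_Suc)
  ultimately show ?case by blast
qed

lemma taylor_poly_on_line:
  "\<exists>p. (\<forall>i\<ge>r. coeff p i = 0) \<and> (\<forall>t. poly p t = taylor_poly r a z0 (w0 + t *\<^sub>R w1))"
proof -
  have "\<forall>m. \<exists>p. degree p \<le> m \<and> (\<forall>t. poly p t = taylor_term m a ((w0 - z0) + t *\<^sub>R w1))" using taylor_term_on_line by blast
  then obtain p where p: "\<And>m. degree (p m) \<le> m" "\<And>m t. poly (p m) t = taylor_term m a ((w0 - z0) + t *\<^sub>R w1)" by metis
  define q where "q = (\<Sum>m<r. p m)"
  have "coeff q i = 0" if "i \<ge> r" for i
    unfolding q_def coeff_sum
  proof (rule sum.neutral, rule ballI)
    fix m assume "m \<in> {..<r}"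
    then have "degree (p m) < i" using p(1)[of m] that by auto
    then show "coeff (p m) i = 0" by (rule coeff_eq_0)
  qed
  moreover have "poly q t = taylor_poly r a z0 (w0 + t *\<^sub>R w1)" for t
    by (simp add: q_def poly_sum p(2) taylor_poly_def algebra_simps)
  ultimately show ?thesis by blast
qed

lemma poly_derivs_eq_ddir:
  fixes P :: "real ^ 'n \<Rightarrow> real"
  assumes "\<And>l. Cm l UNIV P" "\<And>t. poly p t = P (w0 + t *\<^sub>R w1)"
  shows "poly ((pderiv ^^ j) p) t = (ddir w1 ^^ j) P (w0 + t *\<^sub>R w1)"
proof (induction j arbitrary: t)
  case 0 then show ?case using assms(2) by simp
next
  case (Suc j)
  have 1: "((\<lambda>t. (ddir w1 ^^ j) P (w0 + t *\<^sub>R w1)) has_real_derivative (ddir w1 ^^ Suc j) P (w0 + t *\<^sub>R w1)) (at t)"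
    by (rule DERIV_ddir_pow[OF open_UNIV assms(1)[of "Suc j"]]) auto
  have 2: "(poly ((pderiv ^^ j) p) has_real_derivative poly (pderiv ((pderiv ^^ j) p)) t) (at t)"
    by (rule poly_DERIV)
  have "poly ((pderiv ^^ j) p) = (\<lambda>t. (ddir w1 ^^ j) P (w0 + t *\<^sub>R w1))" using Suc.IH by blast
  then show ?case using DERIV_unique[OF 2, of "(ddir w1 ^^ Suc j) P (w0 + t *\<^sub>R w1)"] 1 by simp
qed

lemma pderiv_pow_pCons:
  "(pderiv ^^ Suc j) (pCons a q) = smult (real (Suc j)) ((pderiv ^^ j) q) + pCons 0 ((pderiv ^^ Suc j) q)"
proof (induction j)
  case 0 then show ?case by (simp add: pderiv_pCons)
next
  case (Suc j)
  have "(pderiv ^^ Suc (Suc j)) (pCons a q) = pderiv (smult (real (Suc j)) ((pderiv ^^ j) q) + pCons 0 ((pderiv ^^ Suc j) q))"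
    using Suc.IH by simp
  also have "\<dots> = smult (real (Suc j)) ((pderiv ^^ Suc j) q) + ((pderiv ^^ Suc j) q + pCons 0 ((pderiv ^^ Suc (Suc j)) q))"
    by (simp add: pderiv_add pderiv_smult pderiv_pCons)
  also have "\<dots> = smult (real (Suc (Suc j))) ((pderiv ^^ Suc j) q) + pCons 0 ((pderiv ^^ Suc (Suc j)) q)"
  proof -
    have "smult (real (Suc (Suc j))) X = smult (real (Suc j)) X + X" for X :: "real poly"
    proof -
      have "real (Suc (Suc j)) = real (Suc j) + 1" by simp
      then show ?thesis by (simp only: smult_add_left smult_1_left)
    qed
    then show ?thesis by (simp only: add.assoc)
  qed
  finally show ?case .
qed

text \<open>A polynomial of degree less than \<open>m + l\<close> is controlled by \<open>m\<close> coefficients at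
\<open>0\<close> and \<open>l\<close> derivatives at \<open>1\<close>, with a constant that does not
depend on it. The induction needs no interpolation formula: a coefficient at \<open>0\<close> is split
off as \<open>p = a + t q\<close>, and when none is left, \<open>p\<close> is recovered from its
derivative by integrating from \<open>1\<close>.\<close>

lemma hermite_bound:
  fixes T :: real
  assumes "T \<ge> 1"
  shows "\<exists>C\<ge>0. \<forall>p \<delta>. (\<forall>i\<ge>m + l. coeff p i = 0) \<longrightarrow> (\<forall>j<m. \<bar>coeff p j\<bar> \<le> \<delta>) \<longrightarrow>
     (\<forall>j<l. \<bar>poly ((pderiv ^^ j) p) 1\<bar> \<le> \<delta>) \<longrightarrow> \<delta> \<ge> 0 \<longrightarrow> (\<forall>t. \<bar>t\<bar> \<le> T \<longrightarrow> \<bar>poly p t\<bar> \<le> C * \<delta>)"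
proof (induction m)
  case 0
  show ?case
  proof (induction l)
    case 0
    have z: "poly p t = 0" if "\<forall>i\<ge>0 + 0. coeff p i = 0" for p :: "real poly" and t
    proof -
      have "p = 0" using that by (simp add: poly_eq_iff)
      then show ?thesis by simp
    qed
    show ?case by (rule exI[of _ 0]) (simp add: z)
  next
    case (Suc l)
    then obtain C where C: "C \<ge> 0" "\<And>p \<delta> t. \<lbrakk>\<forall>i\<ge>0 + l. coeff p i = 0; \<forall>j<l. \<bar>poly ((pderiv ^^ j) p) 1\<bar> \<le> \<delta>; \<delta> \<ge> 0; \<bar>t\<bar> \<le> T\<rbrakk> \<Longrightarrow> \<bar>poly p t\<bar> \<le> C * \<delta>"
      by auto
    have "\<bar>poly p t\<bar> \<le> (1 + C * (2 * T)) * \<delta>"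
      if p: "\<forall>i\<ge>0 + Suc l. coeff p i = 0" "\<forall>j<Suc l. \<bar>poly ((pderiv ^^ j) p) 1\<bar> \<le> \<delta>" "\<delta> \<ge> 0" "\<bar>t\<bar> \<le> T" for p \<delta> t
    proof -
      have b: "\<bar>poly (pderiv p) u\<bar> \<le> C * \<delta>" if "\<bar>u\<bar> \<le> T" for u
      proof (rule C(2)[OF _ _ p(3) that])
        show "\<forall>i\<ge>0 + l. coeff (pderiv p) i = 0" using p(1) by (simp add: coeff_pderiv)
        show "\<forall>j<l. \<bar>poly ((pderiv ^^ j) (pderiv p)) 1\<bar> \<le> \<delta>"
        proof (intro allI impI)
          fix j assume "j < l"
          then show "\<bar>poly ((pderiv ^^ j) (pderiv p)) 1\<bar> \<le> \<delta>"
            using p(2)[rule_format, of "Suc j"] by (simp only: funpow_Suc_right comp_def)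
        qed
      qed
      have "norm (poly p t - poly p 1) \<le> (C * \<delta>) * norm (t - 1)"
      proof (rule field_differentiable_bound[of "{-T..T}" "poly p" "poly (pderiv p)"])
        show "(poly p has_field_derivative poly (pderiv p) z) (at z within {- T..T})" for z
          by (rule has_field_derivative_at_within[OF poly_DERIV])
        show "norm (poly (pderiv p) z) \<le> C * \<delta>" if "z \<in> {- T..T}" for z using b[of z] that by auto
      qed (use p(4) assms in auto)
      also have "\<dots> \<le> (C * \<delta>) * (2 * T)"
        using p(3,4) C(1) assms by (intro mult_left_mono) auto
      finally have "\<bar>poly p t\<bar> \<le> \<bar>poly p 1\<bar> + (C * \<delta>) * (2 * T)" by simp
      moreover have "\<bar>poly p 1\<bar> \<le> \<delta>" using p(2)[rule_format, of 0] by simp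
      ultimately show ?thesis by (simp add: algebra_simps)
    qed
    moreover have "1 + C * (2 * T) \<ge> 0" using C(1) assms by simp
    ultimately show ?case by blast
  qed
next
  case (Suc m)
  then obtain C where C: "C \<ge> 0" "\<And>p \<delta> t. \<lbrakk>\<forall>i\<ge>m + l. coeff p i = 0; \<forall>j<m. \<bar>coeff p j\<bar> \<le> \<delta>; \<forall>j<l. \<bar>poly ((pderiv ^^ j) p) 1\<bar> \<le> \<delta>; \<delta> \<ge> 0; \<bar>t\<bar> \<le> T\<rbrakk> \<Longrightarrow> \<bar>poly p t\<bar> \<le> C * \<delta>"
    by blast
  have "\<bar>poly p t\<bar> \<le> (1 + T * (C * fact (l + 2))) * \<delta>"
    if p: "\<forall>i\<ge>Suc m + l. coeff p i = 0" "\<forall>j<Suc m. \<bar>coeff p j\<bar> \<le> \<delta>" "\<forall>j<l. \<bar>poly ((pderiv ^^ j) p) 1\<bar> \<le> \<delta>" "\<delta> \<ge> 0" "\<bar>t\<bar> \<le> T" for p \<delta> t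
  proof -
    obtain a q where pq: "p = pCons a q" by (cases p) auto
    have a: "\<bar>a\<bar> \<le> \<delta>" using p(2)[rule_format, of 0] pq by simp
    \<comment> \<open>Leibniz: the derivatives of \<open>q\<close> at \<open>1\<close> follow from those of
       \<open>t q\<close> by \<open>(t q)^(j+1) = (j+1) q^(j) + q^(j+1)\<close> at \<open>t =
       1\<close>; the factorial absorbs the growth\<close>
    have q1: "\<bar>poly ((pderiv ^^ j) q) 1\<bar> \<le> fact (j + 2) * \<delta>" if "j < l" for j
      using that
    proof (induction j)
      case 0
      then have "\<bar>a + poly q 1\<bar> \<le> \<delta>" using p(3)[rule_format, of 0] pq by simp
      then show ?case using a by (simp add: numeral_2_eq_2)
    next
      case (Suc j)
      have "\<bar>poly ((pderiv ^^ Suc j) p) 1\<bar> \<le> \<delta>" using p(3) Suc.prems by blast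
      then have "\<bar>real (Suc j) * poly ((pderiv ^^ j) q) 1 + poly ((pderiv ^^ Suc j) q) 1\<bar> \<le> \<delta>"
        unfolding pq pderiv_pow_pCons by simp
      moreover have "\<bar>real (Suc j) * poly ((pderiv ^^ j) q) 1\<bar> \<le> real (Suc j) * (fact (j + 2) * \<delta>)"
        unfolding abs_mult using Suc by (intro mult_mono) auto
      ultimately have "\<bar>poly ((pderiv ^^ Suc j) q) 1\<bar> \<le> \<delta> + real (Suc j) * (fact (j + 2) * \<delta>)" by linarith
      also have "\<dots> \<le> fact (j + 2) * \<delta> + real (Suc j) * (fact (j + 2) * \<delta>)"
        using p(4) mult_right_mono[OF fact_ge_1, of \<delta> "j + 2"] by simp
      also have "\<dots> \<le> real (j + 3) * (fact (j + 2) * \<delta>)" using p(4) by (simp add: distrib_right)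
      also have "\<dots> = fact (Suc j + 2) * \<delta>" by (simp add: algebra_simps)
      finally show ?case .
    qed
    have "\<bar>poly q t\<bar> \<le> C * (fact (l + 2) * \<delta>)"
    proof (rule C(2))
      show "\<forall>i\<ge>m + l. coeff q i = 0"
      proof (intro allI impI)
        fix i assume "i \<ge> m + l"
        then show "coeff q i = 0" using p(1)[rule_format, of "Suc i"] pq by simp
      qed
      have f1: "\<delta> \<le> fact (l + 2) * \<delta>" using p(4) mult_right_mono[OF fact_ge_1, of \<delta> "l + 2"] by simp
      show "\<forall>j<m. \<bar>coeff q j\<bar> \<le> fact (l + 2) * \<delta>"
      proof (intro allI impI)
        fix j assume "j < m"
        then show "\<bar>coeff q j\<bar> \<le> fact (l + 2) * \<delta>" using p(2)[rule_format, of "Suc j"] pq f1 by simp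
      qed
      show "\<forall>j<l. \<bar>poly ((pderiv ^^ j) q) 1\<bar> \<le> fact (l + 2) * \<delta>"
      proof (intro allI impI)
        fix j assume "j < l"
        then have "fact (j + 2) * \<delta> \<le> fact (l + 2) * \<delta>" using p(4) by (intro mult_right_mono fact_mono) auto
        then show "\<bar>poly ((pderiv ^^ j) q) 1\<bar> \<le> fact (l + 2) * \<delta>" using q1[OF \<open>j < l\<close>] by linarith
      qed
    qed (use p in auto)
    then have "\<bar>t * poly q t\<bar> \<le> T * (C * (fact (l + 2) * \<delta>))"
      unfolding abs_mult using p(5) assms by (intro mult_mono) auto
    then have "\<bar>poly p t\<bar> \<le> \<delta> + T * (C * (fact (l + 2) * \<delta>))" using a unfolding pq poly_pCons by linarith
    then show ?thesis by (simp add: distrib_right mult.assoc del: fact_Suc)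
  qed
  moreover have "1 + T * (C * fact (l + 2)) \<ge> 0" using C(1) assms by simp
  ultimately show ?case by blast
qed

lemma coeff_eq_deriv: "coeff p j = poly ((pderiv ^^ j) p) 0 / fact j" for p :: "real poly"
proof (induction j arbitrary: p)
  case 0 then show ?case by (simp add: poly_0_coeff_0)
next
  case (Suc j)
  have "poly ((pderiv ^^ Suc j) p) 0 / fact j = coeff (pderiv p) j"
    using Suc.IH[of "pderiv p"] by (simp add: funpow_Suc_right del: funpow.simps)
  also have "\<dots> = real (Suc j) * coeff p (Suc j)" by (simp add: coeff_pderiv)
  finally have "poly ((pderiv ^^ Suc j) p) 0 = real (Suc j) * coeff p (Suc j) * fact j"
    by (simp add: divide_eq_eq del: of_nat_Suc funpow.simps)
  then show ?case by (simp add: fact_Suc del: of_nat_Suc funpow.simps)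
qed

lemma ddir_pow_scaleR:
  assumes "open S"
  shows "\<lbrakk>Cm j S f; x \<in> S\<rbrakk> \<Longrightarrow> (ddir (c *\<^sub>R v) ^^ j) f x = c ^ j * (ddir v ^^ j) f x"
proof (induction j arbitrary: x)
  case 0 then show ?case by simp
next
  case (Suc j)
  have C: "Cm j S f" by (rule Cm_mono[OF _ Suc.prems(1)]) simp
  have "Cm 1 S ((ddir v ^^ j) f)"
    by (rule Cm_ddir_pow[OF assms]) (use Suc.prems(1) in simp)
  then have d: "(ddir v ^^ j) f differentiable (at x)" using Suc.prems(2) by (intro Cm_differentiable[of 1 S]) auto
  have "(ddir (c *\<^sub>R v) ^^ Suc j) f x = ddir (c *\<^sub>R v) (\<lambda>x. c ^ j * (ddir v ^^ j) f x) x"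
    by (simp, rule ddir_cong_open[OF assms Suc.prems(2)], rule Suc.IH[OF C])
  also have "\<dots> = c * (c ^ j * ddir v ((ddir v ^^ j) f) x)"
    by (simp add: ddir_scaleR ddir_cmult[OF d])
  finally show ?case by simp
qed

section \<open>Control of a function by its derivatives of top order\<close>

text \<open>In dimension at least three, any two points of a sphere are joined through a third one orthogonal to
both. This keeps the paths below inside an annulus.\<close>

lemma exists_orthogonal_unit:
  fixes v0 v :: "real ^ 'n"
  assumes "CARD('n) \<ge> 3"
  obtains v1 where "norm v1 = 1" "v1 \<bullet> v0 = 0" "v1 \<bullet> v = 0"
proof -
  have "dim {v0, v} \<le> card {v0, v}" by (rule dim_le_card') simp
  also have "\<dots> \<le> 2" by (simp add: card_insert_if)
  finally have "dim {v0, v} < DIM(real ^ 'n)" using assms by simp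
  then obtain x where x: "x \<noteq> 0" "\<And>y. y \<in> span {v0, v} \<Longrightarrow> orthogonal x y"
    using orthogonal_to_subspace_exists[of "{v0, v}"] by blast
  have "x \<bullet> v0 = 0" "x \<bullet> v = 0" using x(2)[of v0] x(2)[of v] by (auto simp: orthogonal_def span_base)
  then show ?thesis using that[of "(1 / norm x) *\<^sub>R x"] x(1) by simp
qed

lemma segment_between_orthogonal:
  fixes v w :: "real ^ 'n"
  assumes "norm v = 1" "norm w = 1" "v \<bullet> w = 0" "s > 0" "z \<in> closed_segment (s *\<^sub>R v) (s *\<^sub>R w)"
  shows "s / sqrt 2 \<le> norm z" "norm z \<le> s"
proof -
  obtain t where t: "0 \<le> t" "t \<le> 1" "z = (1 - t) *\<^sub>R (s *\<^sub>R v) + t *\<^sub>R (s *\<^sub>R w)"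
    using assms(5) by (auto simp: in_segment)
  have vv: "v \<bullet> v = 1" "w \<bullet> w = 1" using assms(1,2) by (auto simp: norm_eq_1)
  have n: "(norm z)\<^sup>2 = s\<^sup>2 * ((1 - t)\<^sup>2 + t\<^sup>2)"
    unfolding power2_norm_eq_inner t(3) using vv assms(3)
    by (simp add: inner_add_left inner_add_right inner_commute[of w v] power2_eq_square algebra_simps)
  have "(1 - t)\<^sup>2 + t\<^sup>2 \<ge> 1 / 2"
  proof -
    have "(1 - t)\<^sup>2 + t\<^sup>2 = 1 / 2 + 2 * (t - 1 / 2)\<^sup>2" by (simp add: power2_eq_square algebra_simps)
    then show ?thesis by simp
  qed
  then have "(s / sqrt 2)\<^sup>2 \<le> (norm z)\<^sup>2"
    unfolding n using mult_left_mono[of "1 / 2" "(1 - t)\<^sup>2 + t\<^sup>2" "s\<^sup>2"] by (simp add: power_divide)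
  then show "s / sqrt 2 \<le> norm z" by (rule power2_le_imp_le) simp
  have "(1 - t)\<^sup>2 + t\<^sup>2 \<le> (1 - t) + t"
    using t by (intro add_mono) (auto simp: power2_eq_square mult_left_le)
  then have "(norm z)\<^sup>2 \<le> s\<^sup>2"
    unfolding n using mult_left_mono[of "(1 - t)\<^sup>2 + t\<^sup>2" 1 "s\<^sup>2"] by simp
  then show "norm z \<le> s" by (rule power2_le_imp_le) (use assms in simp)
qed

text \<open>On every ray from the origin there is a point \<open>\<beta> v\<close>, at distance between
\<open>\<beta>0\<close> and \<open>L\<close>, from which the ray enters \<open>D\<close> and where the
derivatives of order less than \<open>k\<close> along the ray tend to zero. Around a hole the ray enters
outwards, \<open>u = v\<close>; at an outer boundary it enters inwards, \<open>u = - v\<close>.\<close>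

definition vanishing_ends :: "nat \<Rightarrow> (real ^ 'n) set \<Rightarrow> real \<Rightarrow> real \<Rightarrow> (real ^ 'n \<Rightarrow> real) \<Rightarrow> bool" where
  "vanishing_ends k D \<beta>0 L f \<longleftrightarrow>
     (\<forall>v. norm v = 1 \<longrightarrow> (\<exists>\<beta> u. \<beta>0 \<le> \<beta> \<and> \<beta> \<le> L \<and> (u = v \<or> u = - v) \<and>
        (\<exists>t0>0. \<forall>t. 0 < t \<longrightarrow> t < t0 \<longrightarrow> \<beta> *\<^sub>R v + t *\<^sub>R u \<in> D) \<and>
        (\<forall>j<k. ((\<lambda>t. (ddir u ^^ j) f (\<beta> *\<^sub>R v + t *\<^sub>R u)) \<longlongrightarrow> 0) (at_right 0))))"

text \<open>The set \<open>D\<close> is an annulus with radial pieces attached. Let \<open>P\<close> be the Taylor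
polynomial of \<open>f\<close> of degree less than \<open>r\<close> at a base point. Since
\<open>D\<close> is connected by paths of bounded length, \<open>f - P\<close> and its derivatives up to
order \<open>r\<close> are \<open>O(\<delta>)\<close> on \<open>D\<close>. At the two ends of a line
through the origin the derivatives of \<open>f\<close> along it tend to zero, so those of
\<open>P\<close> are \<open>O(\<delta>)\<close>. On this line \<open>P\<close> has degree less than
\<open>2k\<close>, so the two-point bound gives \<open>P = O(\<delta>)\<close> there. The segment
between the two ends may leave \<open>D\<close>, since only \<open>P\<close> is followed along it.\<close>

lemma jets_bound:
  fixes D :: "(real ^ 'n) set"
  assumes n: "CARD('n) \<ge> 3" and r: "r \<le> 2 * k" and s: "s > 0" and \<beta>0: "\<beta>0 > 0" and DL: "D \<subseteq> cball 0 L"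
    and ann: "\<And>z. s / sqrt 2 \<le> norm z \<Longrightarrow> norm z \<le> s \<Longrightarrow> z \<in> D"
    and star: "\<And>z. z \<in> D \<Longrightarrow> z \<noteq> 0 \<and> closed_segment ((s / norm z) *\<^sub>R z) z \<subseteq> D"
  shows "\<exists>C\<ge>0. \<forall>f \<delta> S. open S \<longrightarrow> D \<subseteq> S \<longrightarrow> Cm r S f \<longrightarrow> \<delta> \<ge> 0 \<longrightarrow>
     (\<forall>z\<in>D. \<forall>js. length js = r \<longrightarrow> \<bar>partials js f z\<bar> \<le> \<delta>) \<longrightarrow>
     vanishing_ends k D \<beta>0 L f \<longrightarrow> (\<forall>z\<in>D. \<bar>f z\<bar> \<le> C * \<delta>)"
proof -
  define v0 where "v0 = axis (undefined :: 'n) (1 :: real)"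
  have v0: "norm v0 = 1" by (simp add: v0_def)
  define z0 where "z0 = s *\<^sub>R v0"
  have sD: "s *\<^sub>R v \<in> D" if "norm v = 1" for v
    using s that by (intro ann) (auto simp: divide_le_eq mult_left_le)
  have z0: "z0 \<in> D" unfolding z0_def by (rule sD[OF v0])
  have L0: "L > 0" using DL z0 s v0 by (auto simp: z0_def)
  \<comment> \<open>Lowering the order of a derivative by one costs a path of three segments, each of length at
     most \<open>2 L\<close>.\<close>
  define Q where "Q = 6 * real CARD('n) * L + 1"
  have Q1: "Q \<ge> 1" using L0 by (simp add: Q_def)
  \<comment> \<open>The line is parametrised so that its two ends are at \<open>0\<close> and \<open>1\<close>; as
     they are at least \<open>2 \<beta>0\<close> apart, the points of \<open>D\<close> have
     parameters in \<open>[-T, T]\<close>.\<close>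
  define T where "T = 1 + L / \<beta>0"
  have T1: "T \<ge> 1" using L0 \<beta>0 by (simp add: T_def)
  obtain CH where CH: "CH \<ge> 0" "\<And>p \<delta> t. \<lbrakk>\<forall>i\<ge>k + k. coeff p i = 0; \<forall>j<k. \<bar>coeff p j\<bar> \<le> \<delta>;
     \<forall>j<k. \<bar>poly ((pderiv ^^ j) p) 1\<bar> \<le> \<delta>; \<delta> \<ge> 0; \<bar>t\<bar> \<le> T\<rbrakk> \<Longrightarrow> \<bar>poly p t\<bar> \<le> CH * \<delta>"
    using hermite_bound[OF T1, of k k] by blast
  define N where "N = (2 * L + 1) ^ k * (real CARD('n) ^ k * Q ^ r)"
  have N0: "N \<ge> 0" using L0 Q1 by (simp add: N_def)
  have main: "\<bar>f z\<bar> \<le> (CH * N + Q ^ r) * \<delta>"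
    if S: "open S" "D \<subseteq> S" and f: "Cm r S f" and \<delta>: "\<delta> \<ge> 0"
      and bd: "\<forall>z\<in>D. \<forall>js. length js = r \<longrightarrow> \<bar>partials js f z\<bar> \<le> \<delta>"
      and ends: "vanishing_ends k D \<beta>0 L f"
      and z: "z \<in> D" for f \<delta> S z
  proof -
    define a where "a js = (if length js < r then partials js f z0 else 0)" for js
    have a_sym: "a js = a js'" if "mset js = mset js'" for js js'
    proof -
      have "length js = length js'" using that by (metis size_mset)
      moreover have "partials js f z0 = partials js' f z0" if "length js < r"
        by (rule partials_mset_eq[OF S(1) \<open>mset js = mset js'\<close> Cm_mono[OF _ f]]) (use that z0 S in auto)
      ultimately show ?thesis by (simp add: a_def)
    qed
    have ptp: "partials js (taylor_poly r a z0) = taylor_poly (r - length js) (\<lambda>js'. a (js' @ js)) z0" for js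
      by (rule partials_taylor_poly) (rule a_sym)
    define P where "P = taylor_poly r a z0"
    have CP: "Cm l UNIV P" for l unfolding P_def by (rule Cm_taylor_poly)
    define h where "h y = f y - P y" for y
    have Ch: "Cm r S h" unfolding h_def by (rule Cm_diff[OF S(1) f Cm_subset[OF CP]]) simp
    have dh: "partials js h y = partials js f y - partials js P y" if "length js \<le> r" "y \<in> S" for js y
      using that
    proof (induction js arbitrary: y)
      case Nil then show ?case by (simp add: partials_Nil h_def)
    next
      case (Cons i js)
      have "partials (i # js) h y = partial i (\<lambda>y. partials js f y + (-1) * partials js P y) y"
        unfolding partials_Cons by (rule partial_cong_open[OF S(1) Cons.prems(2)]) (use Cons in simp)
      also have "\<dots> = partial i (partials js f) y + (-1) * partial i (partials js P) y"
      proof -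
        have d1: "partials js f differentiable (at y)"
          using Cons.prems by (intro Cm_differentiable[OF Cm_partials[of js 1 S]] Cm_mono[OF _ f]) auto
        have d2: "partials js P differentiable (at y)"
          by (rule Cm_differentiable[OF Cm_partials[of js 1 UNIV, OF CP]]) auto
        show ?thesis
          using partial_add[OF d1 differentiable_mult[OF differentiable_const d2], of i "-1"] partial_cmult[OF d2, of i "-1"] by simp
      qed
      finally show ?case by (simp add: partials_Cons)
    qed
    have h0: "partials js h z0 = 0" if "length js < r" for js
    proof -
      have "partials js P z0 = a js"
        using that unfolding P_def ptp taylor_poly_center by simp
      then show ?thesis using dh[of js z0] that z0 S by (auto simp: a_def)
    qed
    have hr: "\<bar>partials js h y\<bar> \<le> \<delta>" if "length js = r" "y \<in> D" for js y
    proof -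
      have "partials js P y = 0" unfolding P_def ptp by (simp add: that taylor_poly_def)
      then show ?thesis using dh[of js y] that S bd by auto
    qed
    \<comment> \<open>downward induction on the order: below order \<open>r\<close> all derivatives vanish at
       \<open>z0\<close>\<close>
    have hb: "\<bar>partials js h y\<bar> \<le> Q ^ m * \<delta>" if "m \<le> r" "length js = r - m" "y \<in> D" for m js y
      using that
    proof (induction m arbitrary: js y)
      case 0 then show ?case using hr by simp
    next
      case (Suc m)
      let ?F = "partials js h"
      have dF: "?F differentiable (at w)" if "w \<in> D" for w
        using Suc.prems that S by (intro Cm_differentiable[OF Cm_partials[of js 1 S]] Cm_mono[OF _ Ch]) auto
      have bF: "\<bar>partial i ?F w\<bar> \<le> Q ^ m * \<delta>" if "w \<in> D" for i w
        using Suc.IH[of "i # js" w] Suc.prems that by (simp add: partials_Cons)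
      have step: "\<bar>?F b\<bar> \<le> \<bar>?F a\<bar> + real CARD('n) * (Q ^ m * \<delta>) * (2 * L)" if seg: "closed_segment a b \<subseteq> D" for a b
      proof -
        have "\<bar>?F b - ?F a\<bar> \<le> real CARD('n) * (Q ^ m * \<delta>) * dist a b"
          by (rule mean_value_partials) (use seg dF bF in blast)+
        also have "\<dots> \<le> real CARD('n) * (Q ^ m * \<delta>) * (2 * L)"
        proof (rule mult_left_mono)
          have "a \<in> D" "b \<in> D" using seg by auto
          then have "norm a \<le> L" "norm b \<le> L" using DL by auto
          then show "dist a b \<le> 2 * L" using norm_triangle_ineq4[of a b] by (simp add: dist_norm)
        qed (use Q1 \<delta> in auto)
        finally show ?thesis by linarith
      qed
      define v where "v = (1 / norm y) *\<^sub>R y"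
      have y0: "y \<noteq> 0" using star Suc.prems by blast
      have v: "norm v = 1" using y0 by (simp add: v_def)
      obtain v1 where v1: "norm v1 = 1" "v1 \<bullet> v0 = 0" "v1 \<bullet> v = 0" using exists_orthogonal_unit[OF n] by blast
      have s1: "closed_segment z0 (s *\<^sub>R v1) \<subseteq> D"
        unfolding z0_def using segment_between_orthogonal[OF v0 v1(1) _ s] v1(2) by (auto intro!: ann simp: inner_commute)
      have s2: "closed_segment (s *\<^sub>R v1) (s *\<^sub>R v) \<subseteq> D"
        using segment_between_orthogonal[OF v1(1) v v1(3) s] by (auto intro!: ann)
      have s3: "closed_segment (s *\<^sub>R v) y \<subseteq> D"
        using star[OF Suc.prems(3)] by (simp add: v_def)
      have "?F z0 = 0" using h0 Suc.prems by simp
      then have "\<bar>?F y\<bar> \<le> 3 * (real CARD('n) * (Q ^ m * \<delta>) * (2 * L))"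
        using step[OF s1] step[OF s2] step[OF s3] by linarith
      also have "\<dots> = (Q - 1) * (Q ^ m * \<delta>)" by (simp add: Q_def)
      also have "\<dots> \<le> Q ^ Suc m * \<delta>" using \<delta> Q1 by (simp add: algebra_simps)
      finally show ?case .
    qed
    have hball: "\<bar>partials js h y\<bar> \<le> Q ^ r * \<delta>" if "length js \<le> r" "y \<in> D" for js y
    proof -
      have "\<bar>partials js h y\<bar> \<le> Q ^ (r - length js) * \<delta>" using hb[of "r - length js" js y] that by simp
      also have "\<dots> \<le> Q ^ r * \<delta>" using Q1 \<delta> by (intro mult_right_mono power_increasing) auto
      finally show ?thesis .
    qed
    \<comment> \<open>the factor \<open>c\<close> allows for the parametrisation of the line, whose speed is at
       most \<open>2 L\<close>\<close>
    have jets: "\<exists>\<beta>. \<beta>0 \<le> \<beta> \<and> \<beta> \<le> L \<and> (\<forall>j<min k r. \<forall>c. \<bar>c\<bar> \<le> 2 * L \<longrightarrow> \<bar>(ddir (c *\<^sub>R v) ^^ j) P (\<beta> *\<^sub>R v)\<bar> \<le> N * \<delta>)" if v: "norm v = 1" for v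
    proof -
      obtain \<beta> u t0 where \<beta>: "\<beta>0 \<le> \<beta>" "\<beta> \<le> L" and u: "u = v \<or> u = - v" and t0: "t0 > 0" "\<And>t. 0 < t \<Longrightarrow> t < t0 \<Longrightarrow> \<beta> *\<^sub>R v + t *\<^sub>R u \<in> D"
        and lim: "\<And>j. j < k \<Longrightarrow> ((\<lambda>t. (ddir u ^^ j) f (\<beta> *\<^sub>R v + t *\<^sub>R u)) \<longlongrightarrow> 0) (at_right 0)"
        using ends v unfolding vanishing_ends_def by blast
      have ui: "\<bar>u $ i\<bar> \<le> 1" for i using component_le_norm_cart[of u i] u v by auto
      have J: "\<bar>(ddir u ^^ j) P (\<beta> *\<^sub>R v)\<bar> \<le> real CARD('n) ^ k * (Q ^ r * \<delta>)" if j: "j < min k r" for j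
      proof -
        have jr: "j < r" "j < k" using j by auto
        have nk: "real CARD('n) ^ j * (Q ^ r * \<delta>) \<le> real CARD('n) ^ k * (Q ^ r * \<delta>)"
          using jr \<delta> Q1 n by (intro mult_right_mono power_increasing) auto
        have hj: "\<bar>(ddir u ^^ j) h y\<bar> \<le> real CARD('n) ^ k * (Q ^ r * \<delta>)" if y: "y \<in> D" for y
        proof -
          have "\<bar>(ddir u ^^ j) (partials [] h) y\<bar> \<le> real CARD('n) ^ j * (Q ^ r * \<delta>)"
          proof (rule ddir_pow_bound[OF S(1) _ ui])
            show "y \<in> S" using y S by blast
            show "Cm (j + length []) S h" by (rule Cm_mono[OF _ Ch]) (use jr in simp)
            show "\<bar>partials (js @ []) h y\<bar> \<le> Q ^ r * \<delta>" if "length js = j" for js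
              using hball[of js y] that y jr by simp
          qed
          then show ?thesis using nk by (simp add: partials_Nil)
        qed
        have sp: "(ddir u ^^ j) P y = (ddir u ^^ j) f y - (ddir u ^^ j) h y" if y: "y \<in> S" for y
        proof -
          have "(ddir u ^^ j) (\<lambda>y. P y + h y) y = (ddir u ^^ j) P y + (ddir u ^^ j) h y"
            by (rule ddir_pow_add[OF S(1) Cm_subset[OF CP] _ y]) (use jr in \<open>auto intro!: Cm_mono[OF _ Ch]\<close>)
          then show ?thesis by (simp add: h_def)
        qed
        let ?q = "\<lambda>t. \<beta> *\<^sub>R v + t *\<^sub>R u"
        have "((\<lambda>t. \<bar>(ddir u ^^ j) P (?q t) - (ddir u ^^ j) f (?q t)\<bar>) \<longlongrightarrow> \<bar>(ddir u ^^ j) P (\<beta> *\<^sub>R v) - 0\<bar>) (at_right 0)"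
        proof (intro tendsto_rabs tendsto_diff lim jr)
          have cP: "isCont ((ddir u ^^ j) P) (\<beta> *\<^sub>R v)"
            using Cm_continuous[OF Cm_ddir_pow[OF open_UNIV, of j 0 P u]] CP[of "j + 0"]
            by (simp add: continuous_on_eq_continuous_at)
          have "(?q \<longlongrightarrow> \<beta> *\<^sub>R v + 0 *\<^sub>R u) (at_right 0)" by (intro tendsto_intros)
          then have "(?q \<longlongrightarrow> \<beta> *\<^sub>R v) (at_right 0)" by simp
          from isCont_tendsto_compose[OF cP this]
          show "((\<lambda>t. (ddir u ^^ j) P (?q t)) \<longlongrightarrow> (ddir u ^^ j) P (\<beta> *\<^sub>R v)) (at_right 0)" .
        qed
        moreover have "\<forall>\<^sub>F t in at_right 0. \<bar>(ddir u ^^ j) P (?q t) - (ddir u ^^ j) f (?q t)\<bar> \<le> real CARD('n) ^ k * (Q ^ r * \<delta>)"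
          unfolding eventually_at_right_field
        proof (intro exI[of _ t0] conjI allI impI t0(1))
          fix t :: real assume "0 < t" "t < t0"
          then have "?q t \<in> D" by (rule t0(2))
          then show "\<bar>(ddir u ^^ j) P (?q t) - (ddir u ^^ j) f (?q t)\<bar> \<le> real CARD('n) ^ k * (Q ^ r * \<delta>)"
            using sp[of "?q t"] hj[of "?q t"] S by auto
        qed
        ultimately have "\<bar>(ddir u ^^ j) P (\<beta> *\<^sub>R v) - 0\<bar> \<le> real CARD('n) ^ k * (Q ^ r * \<delta>)"
          by (rule tendsto_upperbound) simp
        then show ?thesis by simp
      qed
      have "\<bar>(ddir (c *\<^sub>R v) ^^ j) P (\<beta> *\<^sub>R v)\<bar> \<le> N * \<delta>" if j: "j < min k r" and c: "\<bar>c\<bar> \<le> 2 * L" for j c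
      proof -
        obtain c' where c': "c *\<^sub>R v = c' *\<^sub>R u" "\<bar>c'\<bar> \<le> 2 * L"
          using u c by (metis abs_minus_cancel scaleR_minus_left scaleR_minus_right minus_minus)
        have "\<bar>(ddir (c *\<^sub>R v) ^^ j) P (\<beta> *\<^sub>R v)\<bar> = \<bar>c'\<bar> ^ j * \<bar>(ddir u ^^ j) P (\<beta> *\<^sub>R v)\<bar>"
          unfolding c'(1) by (subst ddir_pow_scaleR[OF open_UNIV CP]) (auto simp: abs_mult power_abs)
        also have "\<dots> \<le> (2 * L + 1) ^ k * (real CARD('n) ^ k * (Q ^ r * \<delta>))"
        proof (rule mult_mono[OF _ J[OF j]])
          have "\<bar>c'\<bar> ^ j \<le> (2 * L + 1) ^ j" using c' by (intro power_mono) auto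
          also have "\<dots> \<le> (2 * L + 1) ^ k" using j L0 by (intro power_increasing) auto
          finally show "\<bar>c'\<bar> ^ j \<le> (2 * L + 1) ^ k" .
        qed (use L0 in auto)
        also have "\<dots> = N * \<delta>" by (simp add: N_def mult.assoc)
        finally show ?thesis .
      qed
      then show ?thesis using \<beta> by blast
    qed
    define v where "v = (1 / norm z) *\<^sub>R z"
    have zn: "z \<noteq> 0" using star z by blast
    have v: "norm v = 1" using zn by (simp add: v_def)
    have zv: "z = norm z *\<^sub>R v" using zn by (simp add: v_def)
    obtain \<beta>1 where \<beta>1: "\<beta>0 \<le> \<beta>1" "\<beta>1 \<le> L"
      "\<And>j c. j < min k r \<Longrightarrow> \<bar>c\<bar> \<le> 2 * L \<Longrightarrow> \<bar>(ddir (c *\<^sub>R v) ^^ j) P (\<beta>1 *\<^sub>R v)\<bar> \<le> N * \<delta>" using jets[OF v] by blast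
    obtain \<beta>2 where \<beta>2: "\<beta>0 \<le> \<beta>2" "\<beta>2 \<le> L"
      "\<And>j c. j < min k r \<Longrightarrow> \<bar>c\<bar> \<le> 2 * L \<Longrightarrow> \<bar>(ddir (c *\<^sub>R (- v)) ^^ j) P (\<beta>2 *\<^sub>R (- v))\<bar> \<le> N * \<delta>"
      using jets[of "- v"] v by auto
    define \<Lambda> where "\<Lambda> = \<beta>1 + \<beta>2"
    have \<Lambda>: "\<Lambda> \<ge> 2 * \<beta>0" "\<Lambda> \<le> 2 * L" using \<beta>1 \<beta>2 by (auto simp: \<Lambda>_def)
    define w1 where "w1 = (- \<Lambda>) *\<^sub>R v"
    obtain p where p: "\<And>i. i \<ge> r \<Longrightarrow> coeff p i = 0" "\<And>t. poly p t = P (\<beta>1 *\<^sub>R v + t *\<^sub>R w1)"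
      using taylor_poly_on_line[of r a z0 "\<beta>1 *\<^sub>R v" w1] unfolding P_def by blast
    have D: "poly ((pderiv ^^ j) p) t = (ddir w1 ^^ j) P (\<beta>1 *\<^sub>R v + t *\<^sub>R w1)" for j t
      by (rule poly_derivs_eq_ddir[OF CP p(2)])
    have high: "(pderiv ^^ j) p = 0" if "j \<ge> r" for j
    proof -
      have c: "coeff ((pderiv ^^ j) p) i = 0" if "i + j \<ge> r" for i j
        using that
      proof (induction j arbitrary: i)
        case 0 then show ?case using p(1) by simp
      next
        case (Suc j) then show ?case by (simp add: coeff_pderiv)
      qed
      show ?thesis by (intro poly_eqI) (use c that in simp)
    qed
    have d0: "\<bar>poly ((pderiv ^^ j) p) 0\<bar> \<le> N * \<delta>" if "j < k" for j
    proof (cases "j < r")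
      case True
      then show ?thesis using \<beta>1(3)[of j "- \<Lambda>"] that \<Lambda> \<beta>0 unfolding D w1_def by simp
    next
      case False then show ?thesis using high N0 \<delta> by simp
    qed
    have d1: "\<bar>poly ((pderiv ^^ j) p) 1\<bar> \<le> N * \<delta>" if "j < k" for j
    proof (cases "j < r")
      case True
      have e: "\<beta>1 *\<^sub>R v + 1 *\<^sub>R w1 = \<beta>2 *\<^sub>R (- v)" "w1 = \<Lambda> *\<^sub>R (- v)"
        by (simp_all add: w1_def \<Lambda>_def algebra_simps)
      show ?thesis using \<beta>2(3)[of j \<Lambda>] True that \<Lambda> \<beta>0 unfolding D e(1) unfolding e(2) by simp
    next
      case False then show ?thesis using high N0 \<delta> by simp
    qed
    define t where "t = (\<beta>1 - norm z) / \<Lambda>"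
    have \<Lambda>0: "\<Lambda> > 0" using \<Lambda> \<beta>0 by linarith
    have zt: "\<beta>1 *\<^sub>R v + t *\<^sub>R w1 = z"
    proof -
      have "\<beta>1 *\<^sub>R v + t *\<^sub>R w1 = (\<beta>1 - t * \<Lambda>) *\<^sub>R v" by (simp add: w1_def algebra_simps)
      also have "\<beta>1 - t * \<Lambda> = norm z" using \<Lambda>0 by (simp add: t_def)
      finally show ?thesis using zv by simp
    qed
    have "\<bar>t\<bar> \<le> L / \<beta>0"
    proof -
      have "norm z \<le> L" using DL z by auto
      then have "\<bar>\<beta>1 - norm z\<bar> \<le> L" using \<beta>1 \<beta>0 norm_ge_zero[of z] by linarith
      moreover have "\<beta>0 \<le> \<Lambda>" using \<Lambda> \<beta>0 by linarith
      ultimately show ?thesis unfolding t_def abs_divide using \<Lambda>0 \<beta>0 L0 by (intro frac_le) auto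
    qed
    then have tT: "\<bar>t\<bar> \<le> T" by (simp add: T_def)
    have "\<bar>poly p t\<bar> \<le> CH * (N * \<delta>)"
    proof (rule CH(2)[OF _ _ _ _ tT])
      show "\<forall>i\<ge>k + k. coeff p i = 0" using p(1) r by simp
      show "\<forall>j<k. \<bar>coeff p j\<bar> \<le> N * \<delta>"
      proof (intro allI impI)
        fix j assume j: "j < k"
        have "\<bar>coeff p j\<bar> = \<bar>poly ((pderiv ^^ j) p) 0\<bar> / fact j" by (simp add: coeff_eq_deriv)
        also have "\<dots> \<le> \<bar>poly ((pderiv ^^ j) p) 0\<bar> / 1" by (rule divide_left_mono) (auto simp: fact_ge_1)
        finally show "\<bar>coeff p j\<bar> \<le> N * \<delta>" using d0[OF j] by simp
      qed
    qed (use d1 N0 \<delta> in auto)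
    then have "\<bar>P z\<bar> \<le> CH * (N * \<delta>)" using p(2)[of t] zt by simp
    moreover have "\<bar>h z\<bar> \<le> Q ^ r * \<delta>" using hball[of "[]" z] z by (simp add: partials_Nil)
    moreover have "f z = P z + h z" by (simp add: h_def)
    ultimately have "\<bar>f z\<bar> \<le> CH * (N * \<delta>) + Q ^ r * \<delta>" by linarith
    then show ?thesis by (simp add: algebra_simps)
  qed
  show ?thesis
  proof (rule exI[of _ "CH * N + Q ^ r"], rule conjI)
    show "CH * N + Q ^ r \<ge> 0" using CH(1) N0 Q1 by simp
  qed (intro allI impI ballI, rule main)
qed

section \<open>The Green function near the hole\<close>

lemma ddir_pow_affine:
  assumes "open S"
  shows "\<lbrakk>Cm j S f; p + \<delta> *\<^sub>R z \<in> S\<rbrakk> \<Longrightarrow>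
     (ddir v ^^ j) (\<lambda>z. f (p + \<delta> *\<^sub>R z)) z = \<delta> ^ j * (ddir v ^^ j) f (p + \<delta> *\<^sub>R z)"
proof (induction j arbitrary: z)
  case 0 then show ?case by simp
next
  case (Suc j)
  let ?S = "{z. p + \<delta> *\<^sub>R z \<in> S}"
  have o: "open ?S" by (rule open_affine_vimage[OF assms])
  have zS: "z \<in> ?S" using Suc.prems by simp
  have c: "Cm j S f" by (rule Cm_mono[OF _ Suc.prems(1)]) simp
  have "Cm 1 S ((ddir v ^^ j) f)" by (rule Cm_ddir_pow[OF assms]) (use Suc.prems in simp)
  then have d: "(ddir v ^^ j) f differentiable (at (p + \<delta> *\<^sub>R z))"
    by (rule Cm_differentiable) (use Suc.prems in auto)
  have D: "((\<lambda>z. (ddir v ^^ j) f (p + \<delta> *\<^sub>R z)) has_derivative (\<lambda>w. ddir (\<delta> *\<^sub>R w) ((ddir v ^^ j) f) (p + \<delta> *\<^sub>R z))) (at z)"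
    by (rule differentiable_affine[OF d])
  have "(ddir v ^^ Suc j) (\<lambda>z. f (p + \<delta> *\<^sub>R z)) z = ddir v (\<lambda>z. \<delta> ^ j * (ddir v ^^ j) f (p + \<delta> *\<^sub>R z)) z"
    by (simp, rule ddir_cong_open[OF o zS]) (use Suc.IH[OF c] in auto)
  also have "\<dots> = \<delta> ^ j * ddir v (\<lambda>z. (ddir v ^^ j) f (p + \<delta> *\<^sub>R z)) z"
    by (rule ddir_cmult) (use D in \<open>auto simp: differentiable_def\<close>)
  also have "ddir v (\<lambda>z. (ddir v ^^ j) f (p + \<delta> *\<^sub>R z)) z = \<delta> * ddir v ((ddir v ^^ j) f) (p + \<delta> *\<^sub>R z)"
    unfolding ddir_def[of v "\<lambda>z. (ddir v ^^ j) f (p + \<delta> *\<^sub>R z)"] partial_affine[OF d]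
    by (simp add: ddir_def sum_distrib_left algebra_simps)
  finally show ?case by simp
qed

lemma chart_of_holder_boundary:
  assumes "holder_boundary m \<theta> U" "p \<in> frontier U" "0 < \<theta>" "\<theta> \<le> 1"
  obtains s e \<rho> where "chart m \<theta> U p s e \<rho>"
proof -
  from assms(1)[unfolded holder_boundary_def, rule_format, OF assms(2)]
  obtain s e \<phi> where h: "s > 0" "norm e = 1" "\<And>x t. \<phi> (x + t *\<^sub>R e) = \<phi> x" "C_holder m \<theta> UNIV \<phi>"
    "U \<inter> ball p s = {x \<in> ball p s. x \<bullet> e > \<phi> x}"
    by blast
  define \<rho> where "\<rho> x = x \<bullet> e + (-1) * \<phi> x" for x
  have "Hm \<theta> m \<rho>" unfolding \<rho>_def
    by (rule Hm_add[OF assms(3,4) Cm_imp_Hm[OF assms(3,4) Cm_inner[OF open_UNIV]]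
          Hm_cmult[OF assms(3,4) C_holder_UNIV_imp_Hm[OF assms(3,4) h(4)]]])
  moreover have "\<rho> (y + t *\<^sub>R e) = \<rho> y + t" for y t
  proof -
    have "e \<bullet> e = 1" using h(2) by (simp add: norm_eq_1)
    then show ?thesis by (simp add: \<rho>_def h(3) inner_add_left)
  qed
  moreover have "y \<in> U \<longleftrightarrow> \<rho> y > 0" if "y \<in> ball p s" for y
    using h(5) that by (auto simp: \<rho>_def set_eq_iff)
  ultimately have "chart m \<theta> U p s e \<rho>" using h(1,2) by (simp add: chart_def)
  then show ?thesis by (rule that)
qed

lemma perforated_iff:
  assumes "\<epsilon> > 0"
  shows "y \<in> perforated \<Omega> x0 \<omega> \<epsilon> \<longleftrightarrow> y \<in> \<Omega> \<and> (1 / \<epsilon>) *\<^sub>R (y - x0) \<notin> closure \<omega>"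
proof -
  have "(\<lambda>z. x0 + \<epsilon> *\<^sub>R z) ` \<omega> = (\<lambda>x. x0 + x) ` ((*\<^sub>R) \<epsilon> ` \<omega>)" by auto
  then have "closure ((\<lambda>z. x0 + \<epsilon> *\<^sub>R z) ` \<omega>) = (\<lambda>x. x0 + x) ` ((*\<^sub>R) \<epsilon> ` closure \<omega>)"
    by (simp only: closure_translation closure_scaleR)
  also have "\<dots> = (\<lambda>z. x0 + \<epsilon> *\<^sub>R z) ` closure \<omega>" by (simp only: image_image)
  finally have "closure ((\<lambda>z. x0 + \<epsilon> *\<^sub>R z) ` \<omega>) = (\<lambda>z. x0 + \<epsilon> *\<^sub>R z) ` closure \<omega>" .
  moreover have "y \<in> (\<lambda>z. x0 + \<epsilon> *\<^sub>R z) ` closure \<omega> \<longleftrightarrow> (1 / \<epsilon>) *\<^sub>R (y - x0) \<in> closure \<omega>"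
  proof
    assume "(1 / \<epsilon>) *\<^sub>R (y - x0) \<in> closure \<omega>"
    then show "y \<in> (\<lambda>z. x0 + \<epsilon> *\<^sub>R z) ` closure \<omega>"
      using assms by (intro image_eqI[of _ _ "(1 / \<epsilon>) *\<^sub>R (y - x0)"]) auto
  qed (use assms in auto)
  ultimately show ?thesis by (simp add: perforated_def)
qed

lemma open_perforated: "open \<Omega> \<Longrightarrow> open (perforated \<Omega> x0 \<omega> \<epsilon>)"
  unfolding perforated_def by (intro open_Diff) auto

text \<open>Seen from outside, the boundary of the scaled hole has the defining function \<open>- \<epsilon> \<rho>
((y - x0) / \<epsilon>)\<close>, so that its speed along \<open>- e\<close> is again one.\<close>

lemma chart_hole:
  assumes ch: "chart m \<theta> \<omega> p s e \<rho>" and \<omega>: "open \<omega>" and \<epsilon>: "\<epsilon> > 0" and \<theta>: "0 < \<theta>" "\<theta> \<le> 1"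
    and s': "0 < s'" "s' \<le> \<epsilon> * s" "ball (x0 + \<epsilon> *\<^sub>R p) s' \<subseteq> \<Omega>"
  shows "chart m \<theta> (perforated \<Omega> x0 \<omega> \<epsilon>) (x0 + \<epsilon> *\<^sub>R p) s' (- e) (\<lambda>y. (- \<epsilon>) * \<rho> ((- (1 / \<epsilon>)) *\<^sub>R x0 + (1 / \<epsilon>) *\<^sub>R y))"
proof -
  have \<rho>: "s > 0" "norm e = 1" "\<And>y t. \<rho> (y + t *\<^sub>R e) = \<rho> y + t" and H: "Hm \<theta> m \<rho>"
    using ch unfolding chart_def by auto
  have z: "(- (1 / \<epsilon>)) *\<^sub>R x0 + (1 / \<epsilon>) *\<^sub>R y = (1 / \<epsilon>) *\<^sub>R (y - x0)" for y
    by (simp add: scaleR_diff_right)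
  have sh: "(- \<epsilon>) * \<rho> ((1 / \<epsilon>) *\<^sub>R (y + t *\<^sub>R (- e) - x0)) = (- \<epsilon>) * \<rho> ((1 / \<epsilon>) *\<^sub>R (y - x0)) + t" for y t
  proof -
    have "(1 / \<epsilon>) *\<^sub>R (y + t *\<^sub>R (- e) - x0) = (1 / \<epsilon>) *\<^sub>R (y - x0) + (- (t / \<epsilon>)) *\<^sub>R e"
      by (simp add: algebra_simps)
    then have "\<rho> ((1 / \<epsilon>) *\<^sub>R (y + t *\<^sub>R (- e) - x0)) = \<rho> ((1 / \<epsilon>) *\<^sub>R (y - x0)) + (- (t / \<epsilon>))"
      by (simp only: \<rho>(3))
    then show ?thesis using \<epsilon> by (simp only: distrib_left) simp
  qed
  have mem: "y \<in> perforated \<Omega> x0 \<omega> \<epsilon> \<longleftrightarrow> (- \<epsilon>) * \<rho> ((1 / \<epsilon>) *\<^sub>R (y - x0)) > 0" if y: "y \<in> ball (x0 + \<epsilon> *\<^sub>R p) s'" for y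
  proof -
    have "p - (1 / \<epsilon>) *\<^sub>R (y - x0) = (1 / \<epsilon>) *\<^sub>R ((x0 + \<epsilon> *\<^sub>R p) - y)"
      using \<epsilon> by (simp add: algebra_simps)
    then have "dist p ((1 / \<epsilon>) *\<^sub>R (y - x0)) = dist (x0 + \<epsilon> *\<^sub>R p) y / \<epsilon>"
      using \<epsilon> by (simp add: dist_norm)
    also have "\<dots> < s" using y s' \<epsilon> by (simp add: pos_divide_less_eq mult.commute)
    finally have b: "(1 / \<epsilon>) *\<^sub>R (y - x0) \<in> ball p s" by simp
    show ?thesis
      using perforated_iff[OF \<epsilon>, of y \<Omega> x0 \<omega>] s'(3) y chart_frontier(2)[OF ch \<omega> b] \<epsilon>
      by (auto simp: mult_less_0_iff)
  qed
  show ?thesis unfolding chart_def z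
    using s'(1) \<rho>(2) sh mem Hm_cmult[OF \<theta> Hm_affine[OF \<theta> H, of "(- (1 / \<epsilon>)) *\<^sub>R x0" "1 / \<epsilon>"], of "- \<epsilon>"]
    unfolding z by simp
qed

text \<open>In the variable \<open>z = (y - x0) / \<epsilon>\<close> the hole is \<open>\<omega>\<close> itself, so
one set \<open>D\<close> and one constant serve all \<open>\<epsilon>\<close>, and rescaling the
derivatives of order \<open>r\<close> produces the factor \<open>\<epsilon>^r\<close>. The set
\<open>D\<close> consists of the points from which the outward ray misses the hole; such rays start
where they leave the closure of \<open>\<omega>\<close> for the last time. The radius \<open>4 R\<close>
leaves room for the annulus of \<open>jets_bound\<close> beyond the hole.\<close>

lemma inner_green_bound:
  fixes \<omega> :: "(real ^ 'n) set"
  assumes n: "CARD('n) \<ge> 3" and k: "k \<ge> 1" and r: "r \<le> 2 * k" and \<theta>: "0 < \<theta>" "\<theta> \<le> 1"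
    and \<omega>: "open \<omega>" "0 \<in> \<omega>" "holder_boundary (2 * k) \<theta> \<omega>" and R: "closure \<omega> \<subseteq> ball 0 R"
  shows "\<exists>C\<ge>0. \<forall>\<Omega> x0 \<epsilon> G x \<delta>. open \<Omega> \<longrightarrow> bounded \<Omega> \<longrightarrow> \<epsilon> > 0 \<longrightarrow> cball x0 (4 * R * \<epsilon>) \<subseteq> \<Omega> \<longrightarrow>
     green_function k \<theta> (perforated \<Omega> x0 \<omega> \<epsilon>) G \<longrightarrow> x \<in> perforated \<Omega> x0 \<omega> \<epsilon> \<longrightarrow> dist x0 x > 4 * R * \<epsilon> \<longrightarrow> \<delta> \<ge> 0 \<longrightarrow>
     (\<forall>y\<in>perforated \<Omega> x0 \<omega> \<epsilon>. dist x0 y \<le> 4 * R * \<epsilon> \<longrightarrow> (\<forall>js. length js = r \<longrightarrow> \<bar>partials js (G x) y\<bar> \<le> \<delta>)) \<longrightarrow>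
     (\<forall>y. R * \<epsilon> \<le> dist x0 y \<longrightarrow> dist x0 y \<le> 4 * R * \<epsilon> \<longrightarrow> \<bar>G x y\<bar> \<le> C * (\<epsilon> ^ r * \<delta>))"
proof -
  have cl0: "0 \<in> closure \<omega>" using \<omega>(2) closure_subset by blast
  have R0: "R > 0" using R cl0 by auto
  have clR: "norm z < R" if "z \<in> closure \<omega>" for z using R that by auto
  obtain b where b: "b > 0" "ball 0 b \<subseteq> \<omega>" using \<omega>(1,2) openE by blast
  define D where "D = {z. norm z \<le> 4 * R \<and> (\<forall>t\<ge>1. t *\<^sub>R z \<notin> closure \<omega>)}"
  have far: "z \<in> D" if "R \<le> norm z" "norm z \<le> 4 * R" for z
  proof -
    have "t *\<^sub>R z \<notin> closure \<omega>" if "t \<ge> 1" for t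
    proof
      assume "t *\<^sub>R z \<in> closure \<omega>"
      then have "t * norm z < R" using clR[of "t *\<^sub>R z"] that by simp
      moreover have "norm z \<le> t * norm z" using that mult_right_mono[of 1 t "norm z"] by simp
      ultimately show False using \<open>R \<le> norm z\<close> by linarith
    qed
    then show ?thesis using that by (simp add: D_def)
  qed
  have "\<exists>C\<ge>0. \<forall>f \<delta> S. open S \<longrightarrow> D \<subseteq> S \<longrightarrow> Cm r S f \<longrightarrow> \<delta> \<ge> 0 \<longrightarrow>
     (\<forall>z\<in>D. \<forall>js. length js = r \<longrightarrow> \<bar>partials js f z\<bar> \<le> \<delta>) \<longrightarrow>
     vanishing_ends k D (b / 2) (4 * R) f \<longrightarrow>
     (\<forall>z\<in>D. \<bar>f z\<bar> \<le> C * \<delta>)"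
  proof (rule jets_bound[OF n r, where s = "4 * R"])
    show "D \<subseteq> cball 0 (4 * R)" by (auto simp: D_def)
    show "z \<in> D" if "4 * R / sqrt 2 \<le> norm z" "norm z \<le> 4 * R" for z
    proof (rule far[OF _ that(2)])
      have "sqrt 2 \<le> 4" by (rule real_le_lsqrt) auto
      then have "R \<le> 4 * R / sqrt 2" using R0 by (simp add: pos_le_divide_eq)
      then show "R \<le> norm z" using that by linarith
    qed
    show "z \<noteq> 0 \<and> closed_segment ((4 * R / norm z) *\<^sub>R z) z \<subseteq> D" if z: "z \<in> D" for z
    proof
      show z0: "z \<noteq> 0" using z cl0 unfolding D_def by auto
      have zn: "norm z \<le> 4 * R" "norm z > 0" using z z0 by (auto simp: D_def)
      show "closed_segment ((4 * R / norm z) *\<^sub>R z) z \<subseteq> D"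
      proof
        fix w assume "w \<in> closed_segment ((4 * R / norm z) *\<^sub>R z) z"
        then obtain t where t: "0 \<le> t" "t \<le> 1" "w = (1 - t) *\<^sub>R ((4 * R / norm z) *\<^sub>R z) + t *\<^sub>R z"
          by (auto simp: in_segment)
        define \<tau> where "\<tau> = (1 - t) * (4 * R / norm z) + t"
        have w: "w = \<tau> *\<^sub>R z" by (simp add: t(3) \<tau>_def scaleR_add_left)
        define q where "q = 4 * R / norm z"
        have q: "q \<ge> 1" using zn by (simp add: q_def)
        have \<tau>q: "\<tau> = (1 - t) * q + t" by (simp add: \<tau>_def q_def)
        have \<tau>1: "\<tau> \<ge> 1"
          using mult_left_mono[OF q, of "1 - t"] t by (simp add: \<tau>q)
        have \<tau>2: "\<tau> \<le> 4 * R / norm z"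
        proof -
          have "t * 1 \<le> t * q" by (rule mult_left_mono[OF q t(1)])
          moreover have "(1 - t) * q + t * q = q" by (simp add: algebra_simps)
          ultimately have "\<tau> \<le> q" unfolding \<tau>q by linarith
          then show ?thesis by (simp add: q_def)
        qed
        have "norm w \<le> 4 * R" using \<tau>1 \<tau>2 zn by (simp add: w pos_le_divide_eq)
        moreover have "u *\<^sub>R w \<notin> closure \<omega>" if "u \<ge> 1" for u
        proof -
          have "u * \<tau> \<ge> 1" using that \<tau>1 mult_mono[of 1 u 1 \<tau>] by simp
          then show ?thesis using z by (simp add: D_def w)
        qed
        ultimately show "w \<in> D" by (simp add: D_def)
      qed
    qed
  qed (use R0 b in auto)
  then obtain C where C: "C \<ge> 0" "\<forall>f \<delta> S. open S \<longrightarrow> D \<subseteq> S \<longrightarrow> Cm r S f \<longrightarrow> \<delta> \<ge> 0 \<longrightarrow>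
     (\<forall>z\<in>D. \<forall>js. length js = r \<longrightarrow> \<bar>partials js f z\<bar> \<le> \<delta>) \<longrightarrow>
     vanishing_ends k D (b / 2) (4 * R) f \<longrightarrow> (\<forall>z\<in>D. \<bar>f z\<bar> \<le> C * \<delta>)"
    by (elim exE conjE) (rule that)
  have main: "\<bar>G x y\<bar> \<le> C * (\<epsilon> ^ r * \<delta>)"
    if \<Omega>: "open \<Omega>" "bounded \<Omega>" and \<epsilon>: "\<epsilon> > 0" and cb: "cball x0 (4 * R * \<epsilon>) \<subseteq> \<Omega>"
      and G: "green_function k \<theta> (perforated \<Omega> x0 \<omega> \<epsilon>) G" and x: "x \<in> perforated \<Omega> x0 \<omega> \<epsilon>" "dist x0 x > 4 * R * \<epsilon>"
      and \<delta>: "\<delta> \<ge> 0"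
      and bd: "\<forall>y\<in>perforated \<Omega> x0 \<omega> \<epsilon>. dist x0 y \<le> 4 * R * \<epsilon> \<longrightarrow> (\<forall>js. length js = r \<longrightarrow> \<bar>partials js (G x) y\<bar> \<le> \<delta>)"
      and y: "R * \<epsilon> \<le> dist x0 y" "dist x0 y \<le> 4 * R * \<epsilon>" for \<Omega> x0 \<epsilon> G x \<delta> y
  proof -
    define U where "U = perforated \<Omega> x0 \<omega> \<epsilon>"
    have oU: "open U" unfolding U_def by (rule open_perforated[OF \<Omega>(1)])
    have bU: "bounded U" unfolding U_def perforated_def by (rule bounded_subset[OF \<Omega>(2)]) auto
    have GU: "green_function k \<theta> U G" and xU: "x \<in> U" using G x by (auto simp: U_def)
    define S where "S = U - {x}"
    have oS: "open S" using oU by (auto simp: S_def)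
    have CS: "Cm (2 * k) S (G x)" unfolding S_def by (rule green_partials_extend(1)[OF GU oU xU])
    let ?f = "\<lambda>z. G x (x0 + \<epsilon> *\<^sub>R z)"
    let ?S = "{z. x0 + \<epsilon> *\<^sub>R z \<in> S}"
    have dz: "dist x0 (x0 + \<epsilon> *\<^sub>R z) = \<epsilon> * norm z" for z using \<epsilon> by (simp add: dist_norm)
    have DS: "x0 + \<epsilon> *\<^sub>R z \<in> S" "dist x0 (x0 + \<epsilon> *\<^sub>R z) \<le> 4 * R * \<epsilon>" if z: "z \<in> D" for z
    proof -
      have nz: "norm z \<le> 4 * R" and zc: "z \<notin> closure \<omega>" using z unfolding D_def by (force dest: spec[of _ 1])+
      show d: "dist x0 (x0 + \<epsilon> *\<^sub>R z) \<le> 4 * R * \<epsilon>" unfolding dz using nz \<epsilon> by (simp add: mult.commute)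
      then have "x0 + \<epsilon> *\<^sub>R z \<in> \<Omega>" using cb by (auto simp: subset_iff)
      then have "x0 + \<epsilon> *\<^sub>R z \<in> U" unfolding U_def perforated_iff[OF \<epsilon>] using zc \<epsilon> by simp
      then show "x0 + \<epsilon> *\<^sub>R z \<in> S" using d x(2) by (auto simp: S_def)
    qed
    have Cf: "Cm r ?S ?f" by (rule Cm_affine[OF oS Cm_mono[OF r CS]])
    have pf: "\<forall>z\<in>D. \<forall>js. length js = r \<longrightarrow> \<bar>partials js ?f z\<bar> \<le> \<epsilon> ^ r * \<delta>"
    proof (intro ballI allI impI)
      fix z and js :: "'n list" assume z: "z \<in> D" and js: "length js = r"
      have "partials js ?f z = \<epsilon> ^ length js * partials js (G x) (x0 + \<epsilon> *\<^sub>R z)"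
        by (rule partials_affine[OF oS _ DS(1)[OF z]]) (use Cm_mono[OF r CS] js in simp)
      then have "\<bar>partials js ?f z\<bar> = \<epsilon> ^ r * \<bar>partials js (G x) (x0 + \<epsilon> *\<^sub>R z)\<bar>"
        using \<epsilon> js by (simp add: abs_mult)
      also have "\<dots> \<le> \<epsilon> ^ r * \<delta>"
        using bd DS[OF z] js \<epsilon> by (intro mult_left_mono) (auto simp: S_def U_def)
      finally show "\<bar>partials js ?f z\<bar> \<le> \<epsilon> ^ r * \<delta>" .
    qed
    have ends: "\<exists>\<beta> u. b / 2 \<le> \<beta> \<and> \<beta> \<le> 4 * R \<and> (u = v \<or> u = - v) \<and>
        (\<exists>t0>0. \<forall>t. 0 < t \<longrightarrow> t < t0 \<longrightarrow> \<beta> *\<^sub>R v + t *\<^sub>R u \<in> D) \<and>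
        (\<forall>j<k. ((\<lambda>t. (ddir u ^^ j) ?f (\<beta> *\<^sub>R v + t *\<^sub>R u)) \<longlongrightarrow> 0) (at_right 0))" if v: "norm v = 1" for v
    proof -
      \<comment> \<open>\<open>\<beta>\<close> is the last parameter at which the ray meets the closure of the
         hole\<close>
      define A where "A = {0..R} \<inter> (\<lambda>t. t *\<^sub>R v) -` closure \<omega>"
      have "compact A" unfolding A_def
        by (intro compact_Int_closed closed_vimage) (auto intro!: continuous_intros)
      moreover have "0 \<in> A" using cl0 R0 by (simp add: A_def)
      ultimately obtain \<beta> where \<beta>: "\<beta> \<in> A" "\<And>t. t \<in> A \<Longrightarrow> t \<le> \<beta>" using compact_attains_sup[of A] by auto
      have \<beta>R: "\<beta> < R" "0 \<le> \<beta>" using \<beta>(1) clR[of "\<beta> *\<^sub>R v"] v by (auto simp: A_def)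
      have inA: "t \<in> A" if "0 \<le> t" "t *\<^sub>R v \<in> closure \<omega>" for t
        using clR[OF that(2)] that v by (simp add: A_def)
      have beyond: "t *\<^sub>R v \<notin> closure \<omega>" if "t > \<beta>" for t
        using inA[of t] \<beta>(2)[of t] that \<beta>R by auto
      have b2: "b / 2 \<le> \<beta>"
      proof (rule \<beta>(2)[OF inA])
        have "(b / 2) *\<^sub>R v \<in> ball 0 b" using b(1) v by simp
        then show "(b / 2) *\<^sub>R v \<in> closure \<omega>" using b(2) closure_subset by blast
      qed (use b in simp)
      have fr: "\<beta> *\<^sub>R v \<in> frontier \<omega>"
      proof -
        have "\<beta> *\<^sub>R v \<notin> \<omega>"
        proof
          assume "\<beta> *\<^sub>R v \<in> \<omega>"
          then obtain e where e: "e > 0" "ball (\<beta> *\<^sub>R v) e \<subseteq> \<omega>" using \<omega>(1) openE by blast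
          have "(\<beta> + e / 2) *\<^sub>R v \<in> ball (\<beta> *\<^sub>R v) e" using e(1) v by (simp add: dist_norm scaleR_add_left)
          then have "(\<beta> + e / 2) *\<^sub>R v \<in> closure \<omega>" using e(2) closure_subset by blast
          then show False using beyond[of "\<beta> + e / 2"] e(1) by simp
        qed
        then show ?thesis using \<beta>(1) \<omega>(1) by (simp add: A_def frontier_def interior_open)
      qed
      obtain s e \<rho> where ch: "chart (2 * k) \<theta> \<omega> (\<beta> *\<^sub>R v) s e \<rho>"
        using chart_of_holder_boundary[OF \<omega>(3) fr \<theta>] by blast
      have s0: "s > 0" using ch by (simp add: chart_def)
      define p where "p = x0 + \<epsilon> *\<^sub>R (\<beta> *\<^sub>R v)"
      have dp: "dist x0 p < R * \<epsilon>" unfolding p_def dz using \<beta>R v \<epsilon> by (simp add: mult.commute)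
      define s' where "s' = min (\<epsilon> * s) (3 * R * \<epsilon>)"
      have s': "s' > 0" "s' \<le> \<epsilon> * s" "s' \<le> 3 * R * \<epsilon>" using s0 R0 \<epsilon> by (auto simp: s'_def)
      have bs: "dist x0 y < 4 * R * \<epsilon>" if "y \<in> ball p s'" for y
        using dist_triangle[of x0 y p] that dp s'(3) by simp
      have bs\<Omega>: "ball p s' \<subseteq> \<Omega>" using bs cb by fastforce
      define \<rho>' where "\<rho>' y = (- \<epsilon>) * \<rho> ((- (1 / \<epsilon>)) *\<^sub>R x0 + (1 / \<epsilon>) *\<^sub>R y)" for y
      have ch': "chart (2 * k) \<theta> U p s' (- e) \<rho>'"
        unfolding U_def p_def \<rho>'_def
        by (rule chart_hole[OF ch \<omega>(1) \<epsilon> \<theta> s'(1,2)]) (use bs\<Omega> in \<open>simp add: p_def\<close>)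
      have pU: "p \<in> frontier U"
      proof -
        have "\<rho> (\<beta> *\<^sub>R v) = 0" using chart_frontier(1)[OF ch \<omega>(1), of "\<beta> *\<^sub>R v"] fr s0 by simp
        moreover have "(- (1 / \<epsilon>)) *\<^sub>R x0 + (1 / \<epsilon>) *\<^sub>R p = \<beta> *\<^sub>R v" using \<epsilon> by (simp add: p_def algebra_simps)
        ultimately have "\<rho>' p = 0" by (simp add: \<rho>'_def)
        then show ?thesis using chart_frontier(1)[OF ch' oU, of p] s'(1) by simp
      qed
      have xs: "x \<notin> ball p s'" using bs[of x] x(2) by auto
      have inD: "\<beta> *\<^sub>R v + t *\<^sub>R v \<in> D" if t: "0 < t" "t \<le> R" for t
      proof -
        have e: "\<beta> *\<^sub>R v + t *\<^sub>R v = (\<beta> + t) *\<^sub>R v" by (simp add: scaleR_add_left)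
        have "norm ((\<beta> + t) *\<^sub>R v) \<le> 4 * R" using v \<beta>R t by simp
        moreover have "u *\<^sub>R ((\<beta> + t) *\<^sub>R v) \<notin> closure \<omega>" if "u \<ge> 1" for u
        proof -
          have "u * (\<beta> + t) \<ge> 1 * (\<beta> + t)" using that t \<beta>R by (intro mult_right_mono) auto
          then show ?thesis using beyond[of "u * (\<beta> + t)"] t by simp
        qed
        ultimately show ?thesis unfolding e D_def by blast
      qed
      have lim: "((\<lambda>t. (ddir v ^^ j) ?f (\<beta> *\<^sub>R v + t *\<^sub>R v)) \<longlongrightarrow> 0) (at_right 0)" if j: "j < k" for j
      proof -
        have pt: "p + (\<epsilon> * t) *\<^sub>R v = x0 + \<epsilon> *\<^sub>R (\<beta> *\<^sub>R v + t *\<^sub>R v)" for t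
          by (simp add: p_def scaleR_add_right)
        have "((\<lambda>t. (ddir v ^^ j) (G x) (p + t *\<^sub>R v)) \<longlongrightarrow> 0) (at_right 0)"
        proof (rule green_jets_vanish_along_ray[OF GU \<theta> oU bU xU ch' pU xs k v _ _ j])
          show "0 < R * \<epsilon>" using R0 \<epsilon> by simp
          show "p + t *\<^sub>R v \<in> U" if t: "0 < t" "t \<le> R * \<epsilon>" for t
          proof -
            have "0 < t / \<epsilon>" "t / \<epsilon> \<le> R" using t \<epsilon> by (auto simp: pos_divide_le_eq)
            from DS(1)[OF inD[OF this]] pt[of "t / \<epsilon>"] \<epsilon> show ?thesis by (simp add: S_def)
          qed
        qed
        moreover have "filterlim (\<lambda>t. \<epsilon> * t) (at_right 0) (at_right 0)"
          unfolding filterlim_at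
        proof
          have "((\<lambda>t. \<epsilon> * t) \<longlongrightarrow> \<epsilon> * 0) (at_right 0)" by (intro tendsto_intros)
          then show "((\<lambda>t. \<epsilon> * t) \<longlongrightarrow> 0) (at_right 0)" by simp
          show "\<forall>\<^sub>F t in at_right 0. \<epsilon> * t \<in> {0<..} \<and> \<epsilon> * t \<noteq> 0"
            unfolding eventually_at_right_field using \<epsilon> by (intro exI[of _ 1]) auto
        qed
        ultimately have "((\<lambda>t. (ddir v ^^ j) (G x) (p + (\<epsilon> * t) *\<^sub>R v)) \<longlongrightarrow> 0) (at_right 0)"
          by (rule filterlim_compose)
        then have "((\<lambda>t. \<epsilon> ^ j * (ddir v ^^ j) (G x) (p + (\<epsilon> * t) *\<^sub>R v)) \<longlongrightarrow> \<epsilon> ^ j * 0) (at_right 0)"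
          by (rule tendsto_mult_left)
        moreover have "\<forall>\<^sub>F t in at_right 0. \<epsilon> ^ j * (ddir v ^^ j) (G x) (p + (\<epsilon> * t) *\<^sub>R v) = (ddir v ^^ j) ?f (\<beta> *\<^sub>R v + t *\<^sub>R v)"
          unfolding eventually_at_right_field
        proof (intro exI[of _ R] conjI allI impI R0)
          fix t assume t: "0 < t" "t < R"
          show "\<epsilon> ^ j * (ddir v ^^ j) (G x) (p + (\<epsilon> * t) *\<^sub>R v) = (ddir v ^^ j) ?f (\<beta> *\<^sub>R v + t *\<^sub>R v)"
            unfolding pt
            by (rule ddir_pow_affine[OF oS Cm_mono[OF _ CS], symmetric]) (use j DS(1)[OF inD] t in auto)
        qed
        ultimately show ?thesis using Lim_transform_eventually by fastforce
      qed
      show ?thesis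
        by (rule exI[of _ \<beta>], rule exI[of _ v])
           (use b2 \<beta>R R0 inD lim in \<open>auto intro!: exI[of _ R]\<close>)
    qed
    then have ve: "vanishing_ends k D (b / 2) (4 * R) ?f" unfolding vanishing_ends_def by blast
    define z where "z = (1 / \<epsilon>) *\<^sub>R (y - x0)"
    have yz: "y = x0 + \<epsilon> *\<^sub>R z" using \<epsilon> by (simp add: z_def)
    have "z \<in> D"
      using y \<epsilon> unfolding yz dz by (intro far) (auto simp: mult.commute)
    then have "\<bar>?f z\<bar> \<le> C * (\<epsilon> ^ r * \<delta>)"
      by (intro C(2)[rule_format, OF open_affine_vimage[OF oS] _ Cf _ _ ve]) (use pf DS \<epsilon> \<delta> in auto)
    then show ?thesis by (simp add: yz)
  qed
  show ?thesis
    by (rule exI[of _ C], rule conjI[OF C(1)], intro allI impI, rule main)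
qed

section \<open>The Green function near the outer boundary\<close>

text \<open>Here \<open>D\<close> consists of the points that are visible from \<open>x0\<close> in
\<open>\<Omega>\<close>, away from the set \<open>K\<close> that is removed near \<open>x0\<close>.
Every ray ends where it first leaves \<open>\<Omega>\<close>. The set \<open>D\<close>, and hence the
constant, does not depend on \<open>K\<close>.\<close>

lemma outer_green_bound:
  fixes \<Omega> :: "(real ^ 'n) set"
  assumes n: "CARD('n) \<ge> 3" and k: "k \<ge> 1" and r: "r \<le> 2 * k" and \<theta>: "0 < \<theta>" "\<theta> \<le> 1"
    and \<Omega>: "open \<Omega>" "bounded \<Omega>" "holder_boundary (2 * k) \<theta> \<Omega>" and c: "c > 0" "ball x0 (2 * c) \<subseteq> \<Omega>"
  shows "\<exists>C\<ge>0. \<forall>K G x \<delta>. closed K \<longrightarrow> K \<subseteq> ball x0 (c / 2) \<longrightarrow> green_function k \<theta> (\<Omega> - K) G \<longrightarrow>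
     x \<in> \<Omega> - K \<longrightarrow> dist x0 x < c / 2 \<longrightarrow> \<delta> \<ge> 0 \<longrightarrow>
     (\<forall>y\<in>\<Omega> - K. dist x0 y \<ge> c / 2 \<longrightarrow> (\<forall>js. length js = r \<longrightarrow> \<bar>partials js (G x) y\<bar> \<le> \<delta>)) \<longrightarrow>
     (\<forall>y. c \<le> dist x0 y \<longrightarrow> dist x0 y \<le> sqrt 2 * c \<longrightarrow> \<bar>G x y\<bar> \<le> C * \<delta>)"
proof -
  obtain L where L: "L > 0" "\<Omega> \<subseteq> ball x0 L" using bounded_subset_ballD[OF \<Omega>(2)] by blast
  have x0c: "x0 \<in> ball x0 (2 * c)" using c by simp
  have sq: "1 < sqrt (2 :: real)" "sqrt (2 :: real) < 2" by (auto intro: real_less_lsqrt)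
  have sc: "c < sqrt 2 * c" "sqrt 2 * c < 2 * c" using sq c by auto
  define D where "D = {z. c / 2 \<le> norm z \<and> (\<forall>t. 0 \<le> t \<longrightarrow> t \<le> 1 \<longrightarrow> x0 + t *\<^sub>R z \<in> \<Omega>)}"
  have near: "x0 + t *\<^sub>R z \<in> \<Omega>" if "0 \<le> t" "t \<le> 1" "norm z < 2 * c" for t z
  proof -
    have "norm (t *\<^sub>R z) \<le> norm z" using that by (simp add: mult_left_le_one_le)
    then have "x0 + t *\<^sub>R z \<in> ball x0 (2 * c)" using that by (simp add: dist_norm)
    then show ?thesis using c by blast
  qed
  have DL: "D \<subseteq> cball 0 L"
  proof
    fix z assume "z \<in> D"
    then have "x0 + 1 *\<^sub>R z \<in> \<Omega>" unfolding D_def by (elim CollectE conjE allE[of _ 1]) simp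
    then have "dist x0 (x0 + z) < L" using L(2) by auto
    then show "z \<in> cball 0 L" by (simp add: dist_norm)
  qed
  have far: "z \<in> D" if "c \<le> norm z" "norm z \<le> sqrt 2 * c" for z
    using near[of _ z] that sc c unfolding D_def by auto
  have "\<exists>C\<ge>0. \<forall>f \<delta> S. open S \<longrightarrow> D \<subseteq> S \<longrightarrow> Cm r S f \<longrightarrow> \<delta> \<ge> 0 \<longrightarrow>
     (\<forall>z\<in>D. \<forall>js. length js = r \<longrightarrow> \<bar>partials js f z\<bar> \<le> \<delta>) \<longrightarrow>
     vanishing_ends k D c L f \<longrightarrow> (\<forall>z\<in>D. \<bar>f z\<bar> \<le> C * \<delta>)"
  proof (rule jets_bound[OF n r, where s = "sqrt 2 * c"])
    show "0 < sqrt 2 * c" using sc c by linarith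
    show "z \<in> D" if "sqrt 2 * c / sqrt 2 \<le> norm z" "norm z \<le> sqrt 2 * c" for z
      using that by (intro far) auto
    show "z \<noteq> 0 \<and> closed_segment ((sqrt 2 * c / norm z) *\<^sub>R z) z \<subseteq> D" if z: "z \<in> D" for z
    proof
      have zn: "norm z \<ge> c / 2" "\<And>t. 0 \<le> t \<Longrightarrow> t \<le> 1 \<Longrightarrow> x0 + t *\<^sub>R z \<in> \<Omega>" using z by (auto simp: D_def)
      show z0: "z \<noteq> 0" using zn c by auto
      have np: "norm z > 0" using z0 by simp
      show "closed_segment ((sqrt 2 * c / norm z) *\<^sub>R z) z \<subseteq> D"
      proof
        fix w assume "w \<in> closed_segment ((sqrt 2 * c / norm z) *\<^sub>R z) z"
        then obtain t where t: "0 \<le> t" "t \<le> 1" "w = (1 - t) *\<^sub>R ((sqrt 2 * c / norm z) *\<^sub>R z) + t *\<^sub>R z"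
          by (auto simp: in_segment)
        define \<tau> where "\<tau> = (1 - t) * (sqrt 2 * c / norm z) + t"
        have w: "w = \<tau> *\<^sub>R z" by (simp add: t(3) \<tau>_def scaleR_add_left)
        have \<tau>n: "\<tau> * norm z = (1 - t) * (sqrt 2 * c) + t * norm z" using np by (simp add: \<tau>_def distrib_right)
        have \<tau>0: "\<tau> \<ge> 0" using t np c by (simp add: \<tau>_def)
        have lower: "norm w \<ge> c / 2"
        proof -
          have "c / 2 \<le> sqrt 2 * c" using sc(1) c(1) by linarith
          then have "(1 - t) * (c / 2) \<le> (1 - t) * (sqrt 2 * c)" by (rule mult_left_mono) (use t in simp)
          moreover have "t * (c / 2) \<le> t * norm z" using t zn by (intro mult_left_mono) auto
          moreover have "(1 - t) * (c / 2) + t * (c / 2) = c / 2" unfolding distrib_right[symmetric] by simp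
          moreover have "norm w = \<tau> * norm z" using \<tau>0 by (simp add: w)
          ultimately show ?thesis unfolding \<tau>n by linarith
        qed
        have "x0 + u *\<^sub>R w \<in> \<Omega>" if u: "0 \<le> u" "u \<le> 1" for u
        proof (cases "\<tau> \<le> 1")
          case True
          have "0 \<le> u * \<tau>" "u * \<tau> \<le> 1" using u \<tau>0 True mult_mono[of u 1 \<tau> 1] by auto
          then show ?thesis using zn(2)[of "u * \<tau>"] by (simp add: w)
        next
          case False
          have "norm z \<le> sqrt 2 * c"
          proof (rule ccontr)
            assume "\<not> norm z \<le> sqrt 2 * c"
            then have "sqrt 2 * c / norm z \<le> 1" using np by simp
            then have "(1 - t) * (sqrt 2 * c / norm z) \<le> (1 - t) * 1" using t by (intro mult_left_mono) auto
            then show False using False by (simp add: \<tau>_def)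
          qed
          then have "t * norm z \<le> t * (sqrt 2 * c)" using t by (intro mult_left_mono) auto
          moreover have "(1 - t) * (sqrt 2 * c) + t * (sqrt 2 * c) = sqrt 2 * c" by (simp add: algebra_simps)
          moreover have "norm w = \<tau> * norm z" using \<tau>0 by (simp add: w)
          ultimately have "norm w < 2 * c" unfolding \<tau>n using sc by linarith
          then show ?thesis using near u by blast
        qed
        then show "w \<in> D" using lower by (simp add: D_def)
      qed
    qed
  qed (use c DL in auto)
  then obtain C where C: "C \<ge> 0" "\<forall>f \<delta> S. open S \<longrightarrow> D \<subseteq> S \<longrightarrow> Cm r S f \<longrightarrow> \<delta> \<ge> 0 \<longrightarrow>
     (\<forall>z\<in>D. \<forall>js. length js = r \<longrightarrow> \<bar>partials js f z\<bar> \<le> \<delta>) \<longrightarrow>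
     vanishing_ends k D c L f \<longrightarrow> (\<forall>z\<in>D. \<bar>f z\<bar> \<le> C * \<delta>)"
    by (elim exE conjE) (rule that)
  have main: "\<bar>G x y\<bar> \<le> C * \<delta>"
    if K: "closed K" "K \<subseteq> ball x0 (c / 2)" and G: "green_function k \<theta> (\<Omega> - K) G"
      and x: "x \<in> \<Omega> - K" "dist x0 x < c / 2" and \<delta>: "\<delta> \<ge> 0"
      and bd: "\<forall>y\<in>\<Omega> - K. dist x0 y \<ge> c / 2 \<longrightarrow> (\<forall>js. length js = r \<longrightarrow> \<bar>partials js (G x) y\<bar> \<le> \<delta>)"
      and y: "c \<le> dist x0 y" "dist x0 y \<le> sqrt 2 * c" for K G x \<delta> y
  proof -
    define U where "U = \<Omega> - K"
    have oU: "open U" unfolding U_def using \<Omega>(1) K(1) by (rule open_Diff)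
    have bU: "bounded U" unfolding U_def by (rule bounded_subset[OF \<Omega>(2)]) auto
    have GU: "green_function k \<theta> U G" and xU: "x \<in> U" using G x by (auto simp: U_def)
    define S where "S = U - {x}"
    have oS: "open S" using oU by (auto simp: S_def)
    have CS: "Cm (2 * k) S (G x)" unfolding S_def by (rule green_partials_extend(1)[OF GU oU xU])
    let ?f = "\<lambda>z. G x (x0 + 1 *\<^sub>R z)"
    let ?S = "{z. x0 + 1 *\<^sub>R z \<in> S}"
    have inS: "x0 + z \<in> S" if "x0 + z \<in> \<Omega>" "norm z \<ge> c / 2" for z
    proof -
      have "dist x0 (x0 + z) \<ge> c / 2" using that by (simp add: dist_norm)
      then show ?thesis using that K(2) x(2) by (auto simp: S_def U_def)
    qed
    have DS: "x0 + z \<in> S" "c / 2 \<le> norm z" if z: "z \<in> D" for z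
    proof -
      have "x0 + 1 *\<^sub>R z \<in> \<Omega>" using z unfolding D_def by (elim CollectE conjE allE[of _ 1]) simp
      moreover show "c / 2 \<le> norm z" using z by (simp add: D_def)
      ultimately show "x0 + z \<in> S" using inS[of z] by simp
    qed
    have Cf: "Cm r ?S ?f" by (rule Cm_affine[OF oS Cm_mono[OF r CS]])
    have pf: "\<forall>z\<in>D. \<forall>js. length js = r \<longrightarrow> \<bar>partials js ?f z\<bar> \<le> \<delta>"
    proof (intro ballI allI impI)
      fix z and js :: "'n list" assume z: "z \<in> D" and js: "length js = r"
      have "partials js ?f z = 1 ^ length js * partials js (G x) (x0 + 1 *\<^sub>R z)"
        by (rule partials_affine[OF oS]) (use Cm_mono[OF r CS] js DS(1)[OF z] in simp_all)
      then show "\<bar>partials js ?f z\<bar> \<le> \<delta>"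
        using bd DS[OF z] js by (simp add: S_def U_def dist_norm)
    qed
    have "\<exists>\<beta> u. c \<le> \<beta> \<and> \<beta> \<le> L \<and> (u = v \<or> u = - v) \<and>
        (\<exists>t0>0. \<forall>t. 0 < t \<longrightarrow> t < t0 \<longrightarrow> \<beta> *\<^sub>R v + t *\<^sub>R u \<in> D) \<and>
        (\<forall>j<k. ((\<lambda>t. (ddir u ^^ j) ?f (\<beta> *\<^sub>R v + t *\<^sub>R u)) \<longlongrightarrow> 0) (at_right 0))" if v: "norm v = 1" for v
    proof -
      \<comment> \<open>\<open>\<beta>\<close> is the first parameter at which the ray leaves
         \<open>\<Omega>\<close>\<close>
      define A where "A = {0..L} \<inter> (\<lambda>t. x0 + t *\<^sub>R v) -` (- \<Omega>)"
      have "compact A" unfolding A_def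
        by (intro compact_Int_closed closed_vimage) (use \<Omega>(1) in \<open>auto intro!: continuous_intros\<close>)
      moreover have "L \<in> A"
      proof -
        have "x0 + L *\<^sub>R v \<notin> ball x0 L" using L(1) v by (simp add: dist_norm)
        then show ?thesis using L by (auto simp: A_def)
      qed
      ultimately obtain \<beta> where \<beta>: "\<beta> \<in> A" "\<And>t. t \<in> A \<Longrightarrow> \<beta> \<le> t" using compact_attains_inf[of A] by auto
      have \<beta>L: "0 \<le> \<beta>" "\<beta> \<le> L" "x0 + \<beta> *\<^sub>R v \<notin> \<Omega>" using \<beta>(1) by (auto simp: A_def)
      have before: "x0 + t *\<^sub>R v \<in> \<Omega>" if "0 \<le> t" "t < \<beta>" for t
        using \<beta>(2)[of t] that \<beta>L by (force simp: A_def)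
      have \<beta>c: "2 * c \<le> \<beta>"
      proof (rule ccontr)
        assume "\<not> 2 * c \<le> \<beta>"
        then have "x0 + \<beta> *\<^sub>R v \<in> ball x0 (2 * c)" using \<beta>L v by (simp add: dist_norm)
        then show False using \<beta>L c by blast
      qed
      define p where "p = x0 + \<beta> *\<^sub>R v"
      have pv: "p + t *\<^sub>R (- v) = x0 + (\<beta> - t) *\<^sub>R v" for t by (simp add: p_def algebra_simps)
      have pfr: "p \<in> frontier \<Omega>"
      proof -
        have "p \<in> closure \<Omega>" unfolding closure_approachable
        proof (intro allI impI)
          fix e :: real assume e: "e > 0"
          define t where "t = min (e / 2) (\<beta> / 2)"
          have t: "0 < t" "t < e" "t < \<beta>" using e \<beta>c c by (auto simp: t_def)
          have "x0 + (\<beta> - t) *\<^sub>R v \<in> \<Omega>" using before[of "\<beta> - t"] t by simp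
          moreover have "dist (x0 + (\<beta> - t) *\<^sub>R v) p < e" unfolding pv[symmetric] using t v by (simp add: dist_norm)
          ultimately show "\<exists>y\<in>\<Omega>. dist y p < e" by blast
        qed
        then show ?thesis using \<beta>L \<Omega>(1) by (simp add: frontier_def interior_open p_def)
      qed
      obtain s e \<rho> where ch: "chart (2 * k) \<theta> \<Omega> p s e \<rho>"
        using chart_of_holder_boundary[OF \<Omega>(3) pfr \<theta>] by blast
      have s0: "s > 0" using ch by (simp add: chart_def)
      define s' where "s' = min s c"
      have s': "s' > 0" "s' \<le> s" "s' \<le> c" using s0 c by (auto simp: s'_def)
      have bs: "dist x0 y > c / 2" if "y \<in> ball p s'" for y
      proof -
        have "dist x0 p = \<beta>" using v \<beta>L by (simp add: p_def dist_norm)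
        then show ?thesis using dist_triangle[of x0 p y] that s'(3) \<beta>c c by (simp add: dist_commute)
      qed
      have ch': "chart (2 * k) \<theta> U p s' e \<rho>"
      proof -
        have "y \<in> U \<longleftrightarrow> \<rho> y > 0" if y: "y \<in> ball p s'" for y
        proof -
          have "y \<notin> K" using bs[OF y] K(2) by auto
          moreover have "y \<in> ball p s" using y s' by simp
          ultimately show ?thesis using ch unfolding chart_def U_def by blast
        qed
        then show ?thesis using ch s'(1) unfolding chart_def by blast
      qed
      have pU: "p \<in> frontier U"
      proof -
        have "\<rho> p = 0" using chart_frontier(1)[OF ch \<Omega>(1), of p] pfr s0 by simp
        then show ?thesis using chart_frontier(1)[OF ch' oU, of p] s'(1) by simp
      qed
      have xs: "x \<notin> ball p s'" using bs[of x] x(2) by auto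
      have inD: "\<beta> *\<^sub>R v + t *\<^sub>R (- v) \<in> D" if t: "0 < t" "t \<le> c" for t
      proof -
        have e: "\<beta> *\<^sub>R v + t *\<^sub>R (- v) = (\<beta> - t) *\<^sub>R v" by (simp add: algebra_simps)
        have "norm ((\<beta> - t) *\<^sub>R v) \<ge> c / 2" using v \<beta>c t c by simp
        moreover have "x0 + u *\<^sub>R ((\<beta> - t) *\<^sub>R v) \<in> \<Omega>" if u: "0 \<le> u" "u \<le> 1" for u
        proof -
          have "u * (\<beta> - t) \<le> 1 * (\<beta> - t)" using u t \<beta>c c by (intro mult_right_mono) auto
          moreover have "0 \<le> u * (\<beta> - t)" using u t \<beta>c c by (intro mult_nonneg_nonneg) auto
          ultimately show ?thesis using before[of "u * (\<beta> - t)"] t by simp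
        qed
        ultimately show ?thesis unfolding e D_def by blast
      qed
      have lim: "((\<lambda>t. (ddir (- v) ^^ j) ?f (\<beta> *\<^sub>R v + t *\<^sub>R (- v))) \<longlongrightarrow> 0) (at_right 0)" if j: "j < k" for j
      proof -
        have pt: "x0 + 1 *\<^sub>R (\<beta> *\<^sub>R v + t *\<^sub>R (- v)) = p + t *\<^sub>R (- v)" for t
          by (simp add: p_def)
        have "((\<lambda>t. (ddir (- v) ^^ j) (G x) (p + t *\<^sub>R (- v))) \<longlongrightarrow> 0) (at_right 0)"
        proof (rule green_jets_vanish_along_ray[OF GU \<theta> oU bU xU ch' pU xs k _ c(1) _ j])
          show "norm (- v) = 1" using v by simp
          show "p + t *\<^sub>R (- v) \<in> U" if t: "0 < t" "t \<le> c" for t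
          proof -
            have "x0 + 1 *\<^sub>R (\<beta> *\<^sub>R v + t *\<^sub>R (- v)) \<in> S" using DS(1)[OF inD[OF t]] by simp
            then show ?thesis unfolding pt by (simp add: S_def)
          qed
        qed
        moreover have "\<forall>\<^sub>F t in at_right 0. (ddir (- v) ^^ j) (G x) (p + t *\<^sub>R (- v)) = (ddir (- v) ^^ j) ?f (\<beta> *\<^sub>R v + t *\<^sub>R (- v))"
          unfolding eventually_at_right_field
        proof (intro exI[of _ c] conjI allI impI c(1))
          fix t assume t: "0 < t" "t < c"
          have "(ddir (- v) ^^ j) ?f (\<beta> *\<^sub>R v + t *\<^sub>R (- v)) = 1 ^ j * (ddir (- v) ^^ j) (G x) (x0 + 1 *\<^sub>R (\<beta> *\<^sub>R v + t *\<^sub>R (- v)))"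
            by (rule ddir_pow_affine[OF oS Cm_mono[OF _ CS]]) (use j DS(1)[OF inD, of t] t in auto)
          then show "(ddir (- v) ^^ j) (G x) (p + t *\<^sub>R (- v)) = (ddir (- v) ^^ j) ?f (\<beta> *\<^sub>R v + t *\<^sub>R (- v))"
            unfolding pt by simp
        qed
        ultimately show ?thesis by (rule Lim_transform_eventually)
      qed
      show ?thesis
        by (rule exI[of _ \<beta>], rule exI[of _ "- v"])
           (use \<beta>c \<beta>L c inD lim in \<open>auto intro!: exI[of _ c]\<close>)
    qed
    then have ve: "vanishing_ends k D c L ?f" unfolding vanishing_ends_def by blast
    have "y - x0 \<in> D" using y by (intro far) (auto simp: dist_norm norm_minus_commute)
    then have "\<bar>?f (y - x0)\<bar> \<le> C * \<delta>"
      by (intro C(2)[rule_format, OF open_affine_vimage[OF oS] _ Cf _ _ ve]) (use pf DS \<delta> in auto)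
    then show ?thesis by simp
  qed
  show ?thesis
    by (rule exI[of _ C], rule conjI[OF C(1)], intro allI impI, rule main)
qed

section \<open>The singularity of the Green function against its derivatives\<close>

text \<open>The function \<open>u = W_a - W_c\<close>, with \<open>W_s\<close> the truncated fundamental solution at
scale \<open>s\<close>, vanishes off the annulus \<open>a < |y - x0| < sqrt 2 c\<close>, hence near the
frontier of \<open>U\<close>. At \<open>x\<close> it equals the fundamental solution, as
\<open>W_c\<close> still vanishes there. The image of \<open>W_s\<close> under
\<open>(-\<Delta>)^k\<close> is of size \<open>s^(-n)\<close> on a ball of volume comparable to
\<open>s^n\<close>, so its mass does not depend on \<open>s\<close>.\<close>

lemma test_identity_bound:
  fixes k :: nat
  assumes k: "k \<ge> 1" and n: "CARD('n) > 2 * k" and \<theta>: "0 < \<theta>" "\<theta> \<le> 1"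
  shows "\<exists>Z\<ge>0. \<forall>U (G :: real ^ 'n \<Rightarrow> real ^ 'n \<Rightarrow> real) x0 x a c K1 K2. open U \<longrightarrow> bounded U \<longrightarrow> green_function k \<theta> U G \<longrightarrow>
     x \<in> U \<longrightarrow> a > 0 \<longrightarrow> sqrt 2 * a \<le> dist x0 x \<longrightarrow> dist x0 x \<le> c \<longrightarrow>
     (\<forall>y. y \<notin> U \<longrightarrow> dist x0 y < a \<or> dist x0 y > sqrt 2 * c) \<longrightarrow> K1 \<ge> 0 \<longrightarrow> K2 \<ge> 0 \<longrightarrow>
     (\<forall>y. a \<le> dist x0 y \<longrightarrow> dist x0 y \<le> sqrt 2 * a \<longrightarrow> \<bar>G x y\<bar> \<le> K1) \<longrightarrow>
     (\<forall>y. c \<le> dist x0 y \<longrightarrow> dist x0 y \<le> sqrt 2 * c \<longrightarrow> \<bar>G x y\<bar> \<le> K2) \<longrightarrow>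
     (1 / dist x0 x) ^ (CARD('n) - 2 * k) \<le> Z * (K1 + K2)"
proof -
  define \<nu> where "\<nu> = CARD('n) - 2 * k"
  have \<nu>n: "\<nu> + 2 * k = CARD('n)" using n by (simp add: \<nu>_def)
  obtain V :: "real ^ 'n \<Rightarrow> real" where CV: "Cm (2 * k + 1) UNIV V" and V0: "\<And>z. norm z \<le> 1 \<Longrightarrow> V z = 0"
    and Vout: "\<And>z. norm z \<ge> sqrt 2 \<Longrightarrow> V z = norm z powr (2 * real k - real CARD('n))"
    and NV: "\<And>z. norm z < 1 \<or> norm z > sqrt 2 \<Longrightarrow> (neg_laplacian ^^ k) V z = 0"
    using truncated_fundamental_solution[OF k, of "2 * k + 1"] by metis
  define F where "F = (neg_laplacian ^^ k) V"
  have "Cm 1 UNIV F" unfolding F_def by (rule Cm_neg_laplacian_pow[OF open_UNIV CV])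
  then obtain KF where KF: "KF \<ge> 0" "\<And>z. z \<in> cball 0 (sqrt 2) \<Longrightarrow> \<bar>F z\<bar> \<le> KF"
    using continuous_bounded_cball[OF Cm_continuous] by blast
  have Fb: "\<bar>F z\<bar> \<le> KF" for z
  proof (cases "z \<in> cball 0 (sqrt 2)")
    case False
    then have "F z = 0" unfolding F_def by (intro NV) auto
    then show ?thesis using KF by simp
  qed (rule KF)
  define Z where "Z = KF * (unit_ball_vol (real CARD('n)) * sqrt 2 ^ CARD('n))"
  have Z0: "Z \<ge> 0" using KF by (simp add: Z_def)
  have sq: "1 < sqrt (2 :: real)" by auto
  have main: "(1 / dist x0 x) ^ \<nu> \<le> Z * (K1 + K2)"
    if U: "open U" "bounded U" and G: "green_function k \<theta> U G" and x: "x \<in> U"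
      and a: "a > 0" "sqrt 2 * a \<le> dist x0 x" "dist x0 x \<le> c"
      and off: "\<forall>y. y \<notin> U \<longrightarrow> dist x0 y < a \<or> dist x0 y > sqrt 2 * c" and K: "K1 \<ge> 0" "K2 \<ge> 0"
      and b1: "\<forall>y. a \<le> dist x0 y \<longrightarrow> dist x0 y \<le> sqrt 2 * a \<longrightarrow> \<bar>G x y\<bar> \<le> K1"
      and b2: "\<forall>y. c \<le> dist x0 y \<longrightarrow> dist x0 y \<le> sqrt 2 * c \<longrightarrow> \<bar>G x y\<bar> \<le> K2"
    for U x0 x a c K1 K2 and G :: "real ^ 'n \<Rightarrow> real ^ 'n \<Rightarrow> real"
  proof -
    have sa: "a < sqrt 2 * a" using sq a(1) by simp
    have c: "c > 0" "a \<le> c" using a sa by linarith+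
    define W where "W s y = (1 / s) ^ \<nu> * V ((- (1 / s)) *\<^sub>R x0 + (1 / s) *\<^sub>R y)" for s y
    have z: "(- (1 / s)) *\<^sub>R x0 + (1 / s) *\<^sub>R y = (1 / s) *\<^sub>R (y - x0)" for s :: real and y :: "real ^ 'n"
      by (simp add: scaleR_diff_right)
    have nz: "norm ((1 / s) *\<^sub>R (y - x0)) = dist x0 y / s" if "s > 0" for s y
      using that by (simp add: dist_norm norm_minus_commute)
    have CVs: "Cm (2 * k + 1) UNIV (\<lambda>y. V ((- (1 / s)) *\<^sub>R x0 + (1 / s) *\<^sub>R y))" for s
      using Cm_affine[OF open_UNIV CV, of "(- (1 / s)) *\<^sub>R x0" "1 / s"] by simp
    have CW: "Cm (2 * k + 1) UNIV (W s)" for s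
      unfolding W_def[abs_def] by (rule Cm_cmult[OF open_UNIV CVs])
    have W0: "W s y = 0" if "s > 0" "dist x0 y \<le> s" for s y
    proof -
      have "norm ((1 / s) *\<^sub>R (y - x0)) \<le> 1" unfolding nz[OF that(1)] using that by simp
      then show ?thesis unfolding W_def z by (subst V0) simp_all
    qed
    have Wout: "W s y = (1 / dist x0 y) ^ \<nu>" if s: "s > 0" "sqrt 2 * s \<le> dist x0 y" for s y
    proof -
      let ?d = "dist x0 y / s"
      have d: "?d \<ge> sqrt 2" using s by (simp add: pos_le_divide_eq)
      then have d0: "?d > 0" using sq by linarith
      have dp: "dist x0 y > 0" using d0 s by (simp add: zero_less_divide_iff)
      have "V ((1 / s) *\<^sub>R (y - x0)) = ?d powr (- real \<nu>)"
      proof -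
        have "V ((1 / s) *\<^sub>R (y - x0)) = norm ((1 / s) *\<^sub>R (y - x0)) powr (2 * real k - real CARD('n))"
          by (rule Vout) (simp only: nz[OF s(1)] d)
        moreover have "2 * real k - real CARD('n) = - real \<nu>" using arg_cong[OF \<nu>n, of real] by simp
        ultimately show ?thesis by (simp only: nz[OF s(1)])
      qed
      also have "\<dots> = (1 / ?d) ^ \<nu>"
      proof -
        have "t powr (- real \<nu>) = (1 / t) ^ \<nu>" if "t > 0" for t
          using that by (simp add: powr_minus powr_realpow power_one_over inverse_eq_divide)
        from this[OF d0] show ?thesis .
      qed
      finally have "W s y = (1 / s) ^ \<nu> * (1 / ?d) ^ \<nu>" unfolding W_def z by simp
      also have "\<dots> = (1 / s * (1 / ?d)) ^ \<nu>" by (rule power_mult_distrib[symmetric])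
      also have "1 / s * (1 / ?d) = 1 / dist x0 y" using s dp by simp
      finally show ?thesis .
    qed
    have NW: "(neg_laplacian ^^ k) (W s) y = (1 / s) ^ CARD('n) * F ((1 / s) *\<^sub>R (y - x0))" for s y
    proof -
      have "(neg_laplacian ^^ k) (W s) y = (1 / s) ^ \<nu> * (neg_laplacian ^^ k) (\<lambda>y. V ((- (1 / s)) *\<^sub>R x0 + (1 / s) *\<^sub>R y)) y"
        unfolding W_def[abs_def] by (rule neg_laplacian_pow_cmult[OF open_UNIV Cm_mono[OF _ CVs]]) auto
      also have "(neg_laplacian ^^ k) (\<lambda>y. V ((- (1 / s)) *\<^sub>R x0 + (1 / s) *\<^sub>R y)) y = (1 / s) ^ (2 * k) * F ((- (1 / s)) *\<^sub>R x0 + (1 / s) *\<^sub>R y)"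
        unfolding F_def by (rule neg_laplacian_pow_affine[OF open_UNIV Cm_mono[OF _ CV]]) auto
      finally show ?thesis unfolding z \<nu>n[symmetric] power_add by (simp only: mult.assoc)
    qed
    define u where "u y = W a y + (-1) * W c y" for y
    have Cu: "Cm (2 * k + 1) UNIV u" unfolding u_def by (intro Cm_add Cm_cmult CW open_UNIV)
    have Hu: "Hm \<theta> (2 * k) u" by (rule Cm_imp_Hm[OF \<theta>]) (use Cu in simp)
    have Nu: "(neg_laplacian ^^ k) u y = (1 / a) ^ CARD('n) * F ((1 / a) *\<^sub>R (y - x0)) - (1 / c) ^ CARD('n) * F ((1 / c) *\<^sub>R (y - x0))" for y
    proof -
      have C1: "Cm (2 * k) UNIV (W s)" for s by (rule Cm_mono[OF _ CW]) simp
      have "(neg_laplacian ^^ k) u y = (neg_laplacian ^^ k) (W a) y + (neg_laplacian ^^ k) (\<lambda>y. (-1) * W c y) y"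
        unfolding u_def[abs_def] by (rule neg_laplacian_pow_add[OF open_UNIV C1 Cm_cmult[OF open_UNIV C1]]) simp
      also have "(neg_laplacian ^^ k) (\<lambda>y. (-1) * W c y) y = (-1) * (neg_laplacian ^^ k) (W c) y"
        by (rule neg_laplacian_pow_cmult[OF open_UNIV C1]) simp
      finally show ?thesis by (simp add: NW)
    qed
    have u0: "u y = 0" if "dist x0 y < a \<or> dist x0 y > sqrt 2 * c" for y
    proof (cases "dist x0 y < a")
      case True then show ?thesis using a c by (simp add: u_def W0)
    next
      case False
      then have d: "sqrt 2 * c < dist x0 y" using that by simp
      have ac: "sqrt 2 * a \<le> sqrt 2 * c" using c by simp
      have "sqrt 2 * a \<le> dist x0 y" "sqrt 2 * c \<le> dist x0 y" using d ac by linarith+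
      then show ?thesis using Wout[OF a(1)] Wout[OF c(1)] by (simp add: u_def)
    qed
    have bc: "(ddir v ^^ j) u y = 0" if y: "y \<in> frontier U" for y v j
    proof -
      have "y \<notin> U" using y U(1) by (simp add: frontier_def interior_open)
      then have "y \<in> ball x0 a \<union> - cball x0 (sqrt 2 * c)" using off by auto
      then show ?thesis by (rule ddir_pow_eq_0[rotated 2]) (auto intro!: u0)
    qed
    have xc: "x \<in> closure U" using x closure_subset by blast
    have ux: "u x = (1 / dist x0 x) ^ \<nu>" using W0[OF c(1) a(3)] Wout[OF a(1,2)] by (simp add: u_def)
    let ?f = "\<lambda>y. indicator U y * (G x y * (neg_laplacian ^^ k) u y)"
    have int: "integrable lborel ?f"
      using green_function_test(1)[OF G \<theta> U(2) Hu bc xc] by (simp add: set_integrable_def)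
    have uint: "u x = (LINT y|lborel. ?f y)"
      using green_function_test(2)[OF G \<theta> U(2) Hu bc xc] by (simp add: set_lebesgue_integral_def)
    define g where "g y = indicator (cball x0 (sqrt 2 * a)) y * (K1 * ((1 / a) ^ CARD('n) * KF))
       + indicator (cball x0 (sqrt 2 * c)) y * (K2 * ((1 / c) ^ CARD('n) * KF))" for y
    have fin: "emeasure lborel (cball x0 s) < \<infinity>" for s by (rule emeasure_bounded_finite) simp
    have ig: "integrable lborel g" unfolding g_def
      by (intro Bochner_Integration.integrable_add integrable_mult_left integrable_real_indicator) (use fin in auto)
    have piece: "\<bar>G x y * ((1 / s) ^ CARD('n) * F ((1 / s) *\<^sub>R (y - x0)))\<bar> \<le> indicator (cball x0 (sqrt 2 * s)) y * (K * ((1 / s) ^ CARD('n) * KF))"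
      if s: "s > 0" and K: "K \<ge> 0" and b: "\<forall>y. s \<le> dist x0 y \<longrightarrow> dist x0 y \<le> sqrt 2 * s \<longrightarrow> \<bar>G x y\<bar> \<le> K" for s K y
    proof (cases "s \<le> dist x0 y \<and> dist x0 y \<le> sqrt 2 * s")
      case True
      have "\<bar>G x y * ((1 / s) ^ CARD('n) * F ((1 / s) *\<^sub>R (y - x0)))\<bar> = \<bar>G x y\<bar> * ((1 / s) ^ CARD('n) * \<bar>F ((1 / s) *\<^sub>R (y - x0))\<bar>)"
        using s by (simp add: abs_mult)
      also have "\<dots> \<le> K * ((1 / s) ^ CARD('n) * KF)"
        using True b s K by (intro mult_mono mult_left_mono Fb) auto
      finally show ?thesis using True by simp
    next
      case False
      then have "dist x0 y / s < 1 \<or> dist x0 y / s > sqrt 2" using s by (auto simp: pos_less_divide_eq)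
      then have "F ((1 / s) *\<^sub>R (y - x0)) = 0" unfolding F_def by (intro NV) (simp only: nz[OF s])
      then show ?thesis using s K KF by simp
    qed
    have fg: "norm (?f y) \<le> g y" for y
    proof -
      have "norm (?f y) \<le> \<bar>G x y * (neg_laplacian ^^ k) u y\<bar>" by (simp add: indicator_def)
      also have "\<dots> \<le> \<bar>G x y * ((1 / a) ^ CARD('n) * F ((1 / a) *\<^sub>R (y - x0)))\<bar> + \<bar>G x y * ((1 / c) ^ CARD('n) * F ((1 / c) *\<^sub>R (y - x0)))\<bar>"
        unfolding Nu right_diff_distrib by (rule abs_triangle_ineq4)
      also have "\<dots> \<le> g y" unfolding g_def
        by (rule add_mono[OF piece[OF a(1) K(1) b1] piece[OF c(1) K(2) b2]])
      finally show ?thesis .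
    qed
    have vol: "(LINT y|lborel. indicator (cball x0 (sqrt 2 * s)) y * (K * ((1 / s) ^ CARD('n) * KF))) = Z * K" if "s > 0" for s K
    proof -
      have "(LINT y|lborel. indicator (cball x0 (sqrt 2 * s)) y * (K * ((1 / s) ^ CARD('n) * KF)))
         = measure lborel (cball x0 (sqrt 2 * s)) * (K * ((1 / s) ^ CARD('n) * KF))" by simp
      also have "measure lborel (cball x0 (sqrt 2 * s)) = unit_ball_vol (real CARD('n)) * (sqrt 2 * s) ^ CARD('n)"
        using content_cball[of "sqrt 2 * s" x0] that by simp
      also have "(unit_ball_vol (real CARD('n)) * (sqrt 2 * s) ^ CARD('n)) * (K * ((1 / s) ^ CARD('n) * KF))
        = KF * (unit_ball_vol (real CARD('n)) * sqrt 2 ^ CARD('n)) * K * (s * (1 / s)) ^ CARD('n)"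
        by (simp only: power_mult_distrib mult_ac)
      finally show ?thesis using that by (simp add: Z_def)
    qed
    have "(1 / dist x0 x) ^ \<nu> \<le> norm (LINT y|lborel. ?f y)" using uint ux by simp
    also have "\<dots> \<le> (LINT y|lborel. norm (?f y))" by (rule integral_norm_bound)
    also have "\<dots> \<le> (LINT y|lborel. g y)" by (rule integral_mono[OF integrable_norm[OF int] ig fg])
    also have "\<dots> = (LINT y|lborel. indicator (cball x0 (sqrt 2 * a)) y * (K1 * ((1 / a) ^ CARD('n) * KF)))
       + (LINT y|lborel. indicator (cball x0 (sqrt 2 * c)) y * (K2 * ((1 / c) ^ CARD('n) * KF)))"
      unfolding g_def
      by (intro Bochner_Integration.integral_add integrable_mult_left integrable_real_indicator) (use fin in auto)
    also have "\<dots> = Z * (K1 + K2)" unfolding vol[OF a(1)] vol[OF c(1)] by (simp add: distrib_left)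
    finally show ?thesis .
  qed
  show ?thesis unfolding \<nu>_def[symmetric]
    by (rule exI[of _ Z], rule conjI[OF Z0], intro allI impI, rule main)
qed

theorem proposition1:
  fixes k r :: nat and \<theta> q :: real
    and \<Omega> \<omega> :: "(real ^ 'n) set" and x0 :: "real ^ 'n"
    and G :: "real \<Rightarrow> real ^ 'n \<Rightarrow> real ^ 'n \<Rightarrow> real"
  assumes "2 * k \<ge> 2" and "CARD('n) > 2 * k"
    and "0 < \<theta>" and "\<theta> < 1"
    and "holder_domain (2 * k) \<theta> \<Omega>" and "x0 \<in> \<Omega>"
    and "holder_domain (2 * k) \<theta> \<omega>" and "0 \<in> \<omega>"
    and "0 < q" and "q < 1"
    and "\<And>\<epsilon>. \<epsilon> \<in> {0 <..< q * infdist x0 (frontier \<Omega>) / diameter \<omega>} \<Longrightarrow>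
           green_function k \<theta> (perforated \<Omega> x0 \<omega> \<epsilon>) (G \<epsilon>)"
    and "1 \<le> r" and "r \<le> 2 * k"
  shows "(SUP \<epsilon> \<in> {0 <..< q * infdist x0 (frontier \<Omega>) / diameter \<omega>}.
           SUP (x, y) \<in> {(x, y). x \<in> perforated \<Omega> x0 \<omega> \<epsilon> \<and> y \<in> perforated \<Omega> x0 \<omega> \<epsilon> \<and> x \<noteq> y}.
             ereal (norm (x - y) ^ (CARD('n) - 2 * k + r) * norm_nabla r (G \<epsilon> x) y)) = \<infinity>"
    (is "?S = \<infinity>")
proof (rule ccontr)
  assume "?S \<noteq> \<infinity>"
  define \<nu> where "\<nu> = CARD('n) - 2 * k"
  define N where "N = \<nu> + r"
  define \<epsilon>0 where "\<epsilon>0 = q * infdist x0 (frontier \<Omega>) / diameter \<omega>"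
  have k: "k \<ge> 1" and n: "CARD('n) \<ge> 3" using assms(1,2) by auto
  have \<nu>: "\<nu> \<ge> 1" using assms(2) by (simp add: \<nu>_def)
  have \<theta>: "0 < \<theta>" "\<theta> \<le> 1" using assms(3,4) by auto
  have \<Omega>: "open \<Omega>" "bounded \<Omega>" "holder_boundary (2 * k) \<theta> \<Omega>" using assms(5) by (auto simp: holder_domain_def)
  have \<omega>: "open \<omega>" "bounded \<omega>" "holder_boundary (2 * k) \<theta> \<omega>" using assms(7) by (auto simp: holder_domain_def)
  have \<epsilon>0: "\<epsilon>0 > 0"
  proof -
    have "\<Omega> \<noteq> UNIV" using \<Omega>(2) not_bounded_UNIV by blast
    then have "frontier \<Omega> \<noteq> {}" using assms(6) frontier_eq_empty by blast
    moreover have "x0 \<notin> frontier \<Omega>" using assms(6) \<Omega>(1) by (simp add: frontier_def interior_open)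
    ultimately have "infdist x0 (frontier \<Omega>) > 0"
      using infdist_pos_not_in_closed[OF frontier_closed] by blast
    moreover have "diameter \<omega> > 0"
    proof -
      obtain b where b: "b > 0" "ball 0 b \<subseteq> \<omega>" using \<omega>(1) assms(8) openE by blast
      define w where "w = (b / 2) *\<^sub>R axis (undefined :: 'n) (1 :: real)"
      have "w \<in> \<omega>" using b by (auto simp: w_def)
      from diameter_bounded_bound[OF \<omega>(2) this assms(8)] show ?thesis using b(1) by (simp add: w_def dist_norm)
    qed
    ultimately show ?thesis using assms(9) by (simp add: \<epsilon>0_def)
  qed
  \<comment> \<open>a real bound; it is replaced by its absolute value, as the sign of the supremum is not known\<close>
  obtain B0 where B0: "?S < ereal B0"
    using \<open>?S \<noteq> \<infinity>\<close> less_PInf_Ex_of_nat by blast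
  define B where "B = \<bar>B0\<bar>"
  have B: "norm (x - y) ^ N * norm_nabla r (G \<epsilon> x) y \<le> B"
    if "0 < \<epsilon>" "\<epsilon> < \<epsilon>0" "x \<in> perforated \<Omega> x0 \<omega> \<epsilon>" "y \<in> perforated \<Omega> x0 \<omega> \<epsilon>" "x \<noteq> y" for \<epsilon> x y
  proof -
    have "ereal (norm (x - y) ^ N * norm_nabla r (G \<epsilon> x) y) \<le> ?S"
      unfolding N_def \<nu>_def
      by (rule SUP_upper2[of \<epsilon>]) (use that in \<open>auto simp: \<epsilon>0_def intro!: SUP_upper2[of "(x, y)"]\<close>)
    also have "\<dots> \<le> ereal B" using B0 by (simp add: B_def less_imp_le order_trans[OF less_imp_le[OF B0]])
    finally show ?thesis by simp
  qed
  have B_nn: "B \<ge> 0" by (simp add: B_def)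
  obtain d0 where d0: "d0 > 0" "ball x0 d0 \<subseteq> \<Omega>" using \<Omega>(1) assms(6) openE by blast
  define c where "c = d0 / 2"
  have c: "c > 0" "ball x0 (2 * c) \<subseteq> \<Omega>" using d0 by (simp_all add: c_def)
  have "bounded (closure \<omega>)" using \<omega>(2) by (rule bounded_closure)
  then obtain R where R: "R > 0" "closure \<omega> \<subseteq> ball 0 R" using bounded_subset_ballD by blast
  obtain Cin where Cin: "Cin \<ge> 0" "\<forall>\<Omega> x0 \<epsilon> G x \<delta>. open \<Omega> \<longrightarrow> bounded \<Omega> \<longrightarrow> \<epsilon> > 0 \<longrightarrow> cball x0 (4 * R * \<epsilon>) \<subseteq> \<Omega> \<longrightarrow>
     green_function k \<theta> (perforated \<Omega> x0 \<omega> \<epsilon>) G \<longrightarrow> x \<in> perforated \<Omega> x0 \<omega> \<epsilon> \<longrightarrow> dist x0 x > 4 * R * \<epsilon> \<longrightarrow> \<delta> \<ge> 0 \<longrightarrow>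
     (\<forall>y\<in>perforated \<Omega> x0 \<omega> \<epsilon>. dist x0 y \<le> 4 * R * \<epsilon> \<longrightarrow> (\<forall>js. length js = r \<longrightarrow> \<bar>partials js (G x) y\<bar> \<le> \<delta>)) \<longrightarrow>
     (\<forall>y. R * \<epsilon> \<le> dist x0 y \<longrightarrow> dist x0 y \<le> 4 * R * \<epsilon> \<longrightarrow> \<bar>G x y\<bar> \<le> Cin * (\<epsilon> ^ r * \<delta>))"
    using inner_green_bound[OF n k assms(13) \<theta> \<omega>(1) assms(8) \<omega>(3) R(2)] by (elim exE conjE) (rule that)
  obtain Cout where Cout: "Cout \<ge> 0" "\<forall>K G x \<delta>. closed K \<longrightarrow> K \<subseteq> ball x0 (c / 2) \<longrightarrow> green_function k \<theta> (\<Omega> - K) G \<longrightarrow>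
     x \<in> \<Omega> - K \<longrightarrow> dist x0 x < c / 2 \<longrightarrow> \<delta> \<ge> 0 \<longrightarrow>
     (\<forall>y\<in>\<Omega> - K. dist x0 y \<ge> c / 2 \<longrightarrow> (\<forall>js. length js = r \<longrightarrow> \<bar>partials js (G x) y\<bar> \<le> \<delta>)) \<longrightarrow>
     (\<forall>y. c \<le> dist x0 y \<longrightarrow> dist x0 y \<le> sqrt 2 * c \<longrightarrow> \<bar>G x y\<bar> \<le> Cout * \<delta>)"
    using outer_green_bound[OF n k assms(13) \<theta> \<Omega> c] by (elim exE conjE) (rule that)
  obtain Z where Z: "Z \<ge> 0" "\<forall>U (G :: real ^ 'n \<Rightarrow> real ^ 'n \<Rightarrow> real) x0 x a c K1 K2. open U \<longrightarrow> bounded U \<longrightarrow> green_function k \<theta> U G \<longrightarrow>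
     x \<in> U \<longrightarrow> a > 0 \<longrightarrow> sqrt 2 * a \<le> dist x0 x \<longrightarrow> dist x0 x \<le> c \<longrightarrow>
     (\<forall>y. y \<notin> U \<longrightarrow> dist x0 y < a \<or> dist x0 y > sqrt 2 * c) \<longrightarrow> K1 \<ge> 0 \<longrightarrow> K2 \<ge> 0 \<longrightarrow>
     (\<forall>y. a \<le> dist x0 y \<longrightarrow> dist x0 y \<le> sqrt 2 * a \<longrightarrow> \<bar>G x y\<bar> \<le> K1) \<longrightarrow>
     (\<forall>y. c \<le> dist x0 y \<longrightarrow> dist x0 y \<le> sqrt 2 * c \<longrightarrow> \<bar>G x y\<bar> \<le> K2) \<longrightarrow>
     (1 / dist x0 x) ^ (CARD('n) - 2 * k) \<le> Z * (K1 + K2)"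
    using test_identity_bound[OF k assms(2) \<theta>] by (elim exE conjE) (rule that)
  \<comment> \<open>With \<open>|x - x0| = \<eta> = M \<epsilon>\<close> the inner annulus contributes at most
     \<open>Q M^(-r) \<eta>^(-\<nu>)\<close> and the outer one at most \<open>K3\<close>. The
     choices of \<open>M\<close> and \<open>\<eta>\<close> make each at most a quarter of
     \<open>\<eta>^(-\<nu>)\<close>; \<open>M > 8 R\<close> keeps \<open>x\<close> well outside the
     hole, and \<open>\<eta> \<le> M \<epsilon>0 / 2\<close> makes \<open>\<epsilon> = \<eta> /
     M\<close> admissible.\<close>
  define Q where "Q = Z * (Cin * (B * 2 ^ N))"
  have Q0: "Q \<ge> 0" using Z Cin B_nn by (simp add: Q_def)
  define M where "M = 8 * R + 1 + 4 * Q"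
  have M: "M \<ge> 1" "M > 8 * R" "4 * Q \<le> M" using R(1) Q0 by (auto simp: M_def)
  define K3 where "K3 = Z * (Cout * (B / (c / 4) ^ N))"
  have K30: "K3 \<ge> 0" using Z Cout B_nn c by (simp add: K3_def)
  define \<eta> where "\<eta> = min (min 1 (c / 8)) (min (M * \<epsilon>0 / 2) (1 / (4 * (K3 + 1))))"
  have \<eta>0: "\<eta> > 0" using c M \<epsilon>0 K30 by (simp add: \<eta>_def)
  have \<eta>: "\<eta> \<le> 1" "\<eta> \<le> c / 8" "\<eta> \<le> M * \<epsilon>0 / 2" "\<eta> \<le> 1 / (4 * (K3 + 1))"
    by (simp_all add: \<eta>_def min_le_iff_disj)
  define \<epsilon> where "\<epsilon> = \<eta> / M"
  have M\<epsilon>: "M * \<epsilon> = \<eta>" using M by (simp add: \<epsilon>_def)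
  have \<epsilon>: "\<epsilon> > 0" using \<eta>0 M by (simp add: \<epsilon>_def)
  have \<epsilon>lt: "\<epsilon> < \<epsilon>0"
  proof -
    have "M * \<epsilon> \<le> M * (\<epsilon>0 / 2)" using \<eta>(3) M\<epsilon> by simp
    then have "\<epsilon> \<le> \<epsilon>0 / 2" using M by simp
    then show ?thesis using \<epsilon>0 by simp
  qed
  have R\<epsilon>: "8 * (R * \<epsilon>) < \<eta>"
    using mult_strict_right_mono[OF M(2) \<epsilon>] M\<epsilon> by simp
  have R\<epsilon>0: "R * \<epsilon> > 0" using R(1) \<epsilon> by simp
  define U where "U = perforated \<Omega> x0 \<omega> \<epsilon>"
  have oU: "open U" unfolding U_def by (rule open_perforated[OF \<Omega>(1)])
  have bU: "bounded U" unfolding U_def perforated_def by (rule bounded_subset[OF \<Omega>(2)]) auto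
  have GU: "green_function k \<theta> U (G \<epsilon>)" unfolding U_def using \<epsilon> \<epsilon>lt by (intro assms(11)) (simp add: \<epsilon>0_def)
  have hole: "dist x0 y < R * \<epsilon>" if "(1 / \<epsilon>) *\<^sub>R (y - x0) \<in> closure \<omega>" for y
  proof -
    have "norm ((1 / \<epsilon>) *\<^sub>R (y - x0)) < R" using R(2) that by auto
    then show ?thesis using \<epsilon> by (simp add: dist_norm norm_minus_commute pos_divide_less_eq)
  qed
  define x where "x = x0 + \<eta> *\<^sub>R axis (undefined :: 'n) (1 :: real)"
  have dx: "dist x0 x = \<eta>" using \<eta>0 by (simp add: x_def dist_norm)
  have xU: "x \<in> U"
  proof -
    have "x \<in> ball x0 (2 * c)" using dx \<eta>(2) c by simp
    moreover have "(1 / \<epsilon>) *\<^sub>R (x - x0) \<notin> closure \<omega>" using hole[of x] dx R\<epsilon> R\<epsilon>0 by force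
    ultimately show ?thesis unfolding U_def perforated_iff[OF \<epsilon>] using c(2) by blast
  qed
  have est: "\<bar>partials js (G \<epsilon> x) y\<bar> \<le> B / s ^ N"
    if y: "y \<in> U" and s: "s > 0" "s \<le> dist x y" and js: "length js = r" for y s js
  proof -
    have yx: "x \<noteq> y" using s by auto
    have "Cm r (U - {x}) (G \<epsilon> x)"
      by (rule Cm_mono[OF assms(13) green_partials_extend(1)[OF GU oU xU]])
    then have "\<bar>partials js (G \<epsilon> x) y\<bar> \<le> norm_nabla r (G \<epsilon> x) y"
      by (intro partials_le_norm_nabla[of "U - {x}"]) (use oU y yx js in auto)
    then have "s ^ N * \<bar>partials js (G \<epsilon> x) y\<bar> \<le> norm (x - y) ^ N * norm_nabla r (G \<epsilon> x) y"
      using s by (intro mult_mono power_mono) (auto simp: dist_norm)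
    also have "\<dots> \<le> B" using B[OF \<epsilon> \<epsilon>lt] xU y yx by (simp add: U_def)
    finally show ?thesis using s by (simp add: pos_le_divide_eq mult.commute)
  qed
  \<comment> \<open>\<open>x\<close> has distance at least \<open>\<eta> / 2\<close> from the inner region and at
     least \<open>c / 4\<close> from the outer one\<close>
  define \<delta>1 where "\<delta>1 = B / (\<eta> / 2) ^ N"
  define \<delta>2 where "\<delta>2 = B / (c / 4) ^ N"
  have \<delta>: "\<delta>1 \<ge> 0" "\<delta>2 \<ge> 0" using B_nn \<eta>0 c by (simp_all add: \<delta>1_def \<delta>2_def)
  have b1: "\<bar>G \<epsilon> x y\<bar> \<le> Cin * (\<epsilon> ^ r * \<delta>1)" if "R * \<epsilon> \<le> dist x0 y" "dist x0 y \<le> 4 * R * \<epsilon>" for y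
  proof (rule Cin(2)[rule_format, OF \<Omega>(1,2) \<epsilon> _ GU[unfolded U_def] xU[unfolded U_def] _ \<delta>(1) _ that])
    show "cball x0 (4 * R * \<epsilon>) \<subseteq> \<Omega>"
    proof
      fix w assume "w \<in> cball x0 (4 * R * \<epsilon>)"
      then have "dist x0 w \<le> 4 * (R * \<epsilon>)" by simp
      then have "w \<in> ball x0 (2 * c)" using R\<epsilon> R\<epsilon>0 \<eta>(2) c(1) unfolding mem_ball by linarith
      then show "w \<in> \<Omega>" using c(2) by blast
    qed
    show "dist x0 x > 4 * R * \<epsilon>" using dx R\<epsilon> R\<epsilon>0 by simp
    fix w and js :: "'n list"
    assume w: "w \<in> perforated \<Omega> x0 \<omega> \<epsilon>" "dist x0 w \<le> 4 * R * \<epsilon>" and js: "length js = r"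
    have "\<eta> / 2 \<le> dist x w" using dist_triangle[of x0 x w] dx w(2) R\<epsilon> by (simp add: dist_commute)
    then show "\<bar>partials js (G \<epsilon> x) w\<bar> \<le> \<delta>1"
      unfolding \<delta>1_def by (intro est) (use w js \<eta>0 in \<open>auto simp: U_def\<close>)
  qed
  have b2: "\<bar>G \<epsilon> x y\<bar> \<le> Cout * \<delta>2" if "c \<le> dist x0 y" "dist x0 y \<le> sqrt 2 * c" for y
  proof (rule Cout(2)[rule_format, OF _ _ GU[unfolded U_def perforated_def] xU[unfolded U_def perforated_def] _ \<delta>(2) _ that])
    let ?K = "closure ((\<lambda>z. x0 + \<epsilon> *\<^sub>R z) ` \<omega>)"
    show "closed ?K" by simp
    show "?K \<subseteq> ball x0 (c / 2)"
    proof
      fix w assume "w \<in> ?K"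
      then have "(1 / \<epsilon>) *\<^sub>R (w - x0) \<in> closure \<omega>"
        using perforated_iff[OF \<epsilon>, of w UNIV x0 \<omega>] by (auto simp: perforated_def)
      from hole[OF this] show "w \<in> ball x0 (c / 2)" using R\<epsilon> R\<epsilon>0 \<eta>(2) c(1) unfolding mem_ball by linarith
    qed
    show "dist x0 x < c / 2" using dx \<eta>(2) c(1) by simp
    fix w and js :: "'n list"
    assume w: "w \<in> \<Omega> - ?K" "c / 2 \<le> dist x0 w" and js: "length js = r"
    have "c / 4 \<le> dist x w" using dist_triangle[of x0 w x] dx w(2) \<eta>(2) c(1) by simp
    then show "\<bar>partials js (G \<epsilon> x) w\<bar> \<le> \<delta>2"
      unfolding \<delta>2_def by (intro est) (use w js c in \<open>auto simp: U_def perforated_def\<close>)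
  qed
  have "(1 / dist x0 x) ^ (CARD('n) - 2 * k) \<le> Z * (Cin * (\<epsilon> ^ r * \<delta>1) + Cout * \<delta>2)"
  proof (rule Z(2)[rule_format, OF oU bU GU xU R\<epsilon>0])
    have s2: "sqrt 2 < (2 :: real)" by (auto intro: real_less_lsqrt)
    have sR: "sqrt 2 * (R * \<epsilon>) \<le> 2 * (R * \<epsilon>)" using s2 R\<epsilon>0 by (intro mult_right_mono) auto
    show "sqrt 2 * (R * \<epsilon>) \<le> dist x0 x" using sR R\<epsilon> R\<epsilon>0 dx by linarith
    show "dist x0 x \<le> c" using dx \<eta>(2) c by simp
    show "dist x0 y < R * \<epsilon> \<or> sqrt 2 * c < dist x0 y" if "y \<notin> U" for y
    proof (cases "y \<in> \<Omega>")
      case True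
      then show ?thesis using that hole[of y] unfolding U_def perforated_iff[OF \<epsilon>] by blast
    next
      case False
      then have "y \<notin> ball x0 (2 * c)" using c(2) by blast
      moreover have "sqrt 2 * c < 2 * c" using s2 c by simp
      ultimately show ?thesis by simp
    qed
    show "0 \<le> Cin * (\<epsilon> ^ r * \<delta>1)" "0 \<le> Cout * \<delta>2" using Cin(1) Cout(1) \<delta> \<epsilon> by simp_all
    show "\<bar>G \<epsilon> x y\<bar> \<le> Cin * (\<epsilon> ^ r * \<delta>1)" if "R * \<epsilon> \<le> dist x0 y" "dist x0 y \<le> sqrt 2 * (R * \<epsilon>)" for y
      by (rule b1) (use that sR R\<epsilon>0 in auto)
  qed (rule b2)
  then have fin: "(1 / \<eta>) ^ \<nu> \<le> Z * (Cin * (\<epsilon> ^ r * \<delta>1)) + K3"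
    by (simp add: dx \<nu>_def K3_def \<delta>2_def distrib_left)
  have "\<epsilon> ^ r * \<delta>1 = B * 2 ^ N * (1 / M) ^ r * (1 / \<eta>) ^ \<nu>"
  proof -
    have "\<epsilon> ^ r = \<eta> ^ r * (1 / M) ^ r" by (simp add: \<epsilon>_def power_divide)
    moreover have "\<delta>1 = B * 2 ^ N * ((1 / \<eta>) ^ \<nu> * (1 / \<eta>) ^ r)"
      by (simp add: \<delta>1_def N_def power_divide power_add)
    moreover have "\<eta> ^ r * (1 / \<eta>) ^ r = 1" using \<eta>0 by (simp add: power_divide)
    ultimately show ?thesis by (simp add: mult_ac) 
  qed
  then have "Z * (Cin * (\<epsilon> ^ r * \<delta>1)) = Q * (1 / M) ^ r * (1 / \<eta>) ^ \<nu>" by (simp add: Q_def mult_ac)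
  moreover have "Q * (1 / M) ^ r \<le> 1 / 4"
  proof -
    have "(1 / M) ^ r \<le> (1 / M) ^ 1" using M(1) assms(12) by (intro power_decreasing) auto
    then have "Q * (1 / M) ^ r \<le> Q * (1 / M)" using Q0 by (intro mult_left_mono) auto
    also have "\<dots> \<le> 1 / 4" using M by (simp add: pos_divide_le_eq)
    finally show ?thesis .
  qed
  ultimately have "Z * (Cin * (\<epsilon> ^ r * \<delta>1)) \<le> 1 / 4 * (1 / \<eta>) ^ \<nu>"
    using \<eta>0 by (metis mult_right_mono zero_le_divide_1_iff zero_le_power less_imp_le)
  moreover have "K3 \<le> 1 / 4 * (1 / \<eta>) ^ \<nu>"
  proof -
    have "4 * (K3 + 1) \<le> 1 / \<eta>" using \<eta>(4) \<eta>0 K30 by (simp add: field_simps)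
    moreover have "(1 / \<eta>) ^ 1 \<le> (1 / \<eta>) ^ \<nu>" using \<nu> \<eta>0 \<eta>(1) by (intro power_increasing) auto
    ultimately show ?thesis by simp
  qed
  moreover have "(1 / \<eta>) ^ \<nu> > 0" using \<eta>0 by simp
  ultimately show False using fin by linarith
qed

end
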